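(* Let $f\in C^4(\mathbb R)$ with $c\le f''(u)\le C$ for all $u$ (where $0<c\le C$). Let $u_0\in H^1(\mathbb R)$ with $u_0'\in L^1(\mathbb R)$ and $u_0'(x)\le M<\infty$ for all $x$. For each $\ell>0$ let $u^\ell$ be the constructed dissipative solution of (rB) with initial datum $u_0$. Then there exists $u^0\in L^\infty_{loc}([0,\infty),L^1_{loc}(\mathbb R))$ such that $u^\ell\to u^0$ as $\ell\to0$ in $L^\infty_{loc}([0,\infty),L^p_{loc}(\mathbb R))$ for every $p\in[1,\infty)$, and $u^0$ is the unique entropy solution of the scalar conservation law $u_t+f(u)_x=0$ with $u(0,\cdot)=u_0$.
   Context: For $\ell>0$ let $\mathfrak G(x)=(2\ell)^{-1}e^{-|x|/\ell}$. Equation (rB) is $u_t+[f(u)+\tfrac12\ell^2\mathfrak G*\{f''(u)u_x^2\}]_x=0$. Approximate problem: let $j_\varepsilon$ be a Friedrichs mollifier, $u_0^\varepsilon=u_0*j_\varepsilon$, $\chi_\varepsilon(q)=(q+1/\varepsilon)^2$ if $q\le-1/\varepsilon$ and $\chi_\varepsilon(q)=0$ otherwise, and let $u^{\ell,\varepsilon}\in C(\mathbb R^+,H^3)\cap C^1(\mathbb R^+,H^2)$ be the global smooth solution of $$u_t+\Big[f(u)+\tfrac12\ell^2\mathfrak G*\{f''(u)(u_x^2+\chi_\varepsilon(u_x))\}\Big]_x=0,\qquad u(0)=u_0^\varepsilon.$$ The constructed dissipative solution $u^\ell$ is a limit, along a subsequence $\varepsilon_k\to0$, of $u^{\ell,\varepsilon_k}$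 such that $u^{\ell,\varepsilon_k}\to u^\ell$ locally uniformly on $[0,\infty)\times\mathbb R$ and $u^{\ell,\varepsilon_k}_x\to u^\ell_x$ in $L^2_{loc}((0,\infty)\times\mathbb R)$; such a limit exists and is a weak dissipative solution of (rB) (solving (rB) in $L^2$, satisfying the energy inequality and right continuity in $H^1$), satisfying the Oleinik inequality $u^\ell_x\le 1/(ct/2+1/M)$ and the bound $\|u^\ell_x(t)\|_{L^1}\le\|u_0'\|_{L^1}(cMt/2+1)^{2C/c}$. *)

theory Defs
  imports "HOL-Analysis.Analysis"
begin

definition L2 :: "(real \<Rightarrow> real) \<Rightarrow> bool" where
  "L2 g \<longleftrightarrow> g \<in> borel_measurable lborel \<and> integrable lborel (\<lambda>x. (g x)\<^sup>2)"

definition loc_int :: "(real \<Rightarrow> real) \<Rightarrow> bool" where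
  "loc_int g \<longleftrightarrow> g \<in> borel_measurable lborel \<and> (\<forall>a b. set_integrable lborel {a..b} g)"

definition smooth_test :: "(real \<Rightarrow> real) \<Rightarrow> bool" where
  "smooth_test \<phi> \<longleftrightarrow> (\<forall>k x. ((deriv ^^ k) \<phi>) differentiable (at x)) \<and> bounded {x. \<phi> x \<noteq> 0}"

definition weak_deriv :: "(real \<Rightarrow> real) \<Rightarrow> (real \<Rightarrow> real) \<Rightarrow> bool" where
  "weak_deriv v w \<longleftrightarrow> loc_int v \<and> loc_int w \<and>
     (\<forall>\<phi>. smooth_test \<phi> \<longrightarrow>
        (LINT x|lborel. v x * deriv \<phi> x) = - (LINT x|lborel. w x * \<phi> x))"

definition H_derivs :: "nat \<Rightarrow> (real \<Rightarrow> real) \<Rightarrow> (nat \<Rightarrow> real \<Rightarrow> real) \<Rightarrow> bool" where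
  "H_derivs k v d \<longleftrightarrow> d 0 = v \<and> (\<forall>i<k. weak_deriv (d i) (d (Suc i))) \<and> (\<forall>i\<le>k. L2 (d i))"

definition H_curve :: "nat \<Rightarrow> (real \<Rightarrow> real \<Rightarrow> real) \<Rightarrow> (real \<Rightarrow> nat \<Rightarrow> real \<Rightarrow> real) \<Rightarrow> bool" where
  "H_curve k W D \<longleftrightarrow> (\<forall>t\<ge>0. H_derivs k (W t) (D t)) \<and>
     (\<forall>s\<ge>0. \<forall>i\<le>k. ((\<lambda>t. LINT x|lborel. (D t i x - D s i x)\<^sup>2) \<longlongrightarrow> 0) (at s within {0..}))"

definition conv :: "(real \<Rightarrow> real) \<Rightarrow> (real \<Rightarrow> real) \<Rightarrow> real \<Rightarrow> real" where
  "conv g h x = (LINT y|lborel. g (x - y) * h y)"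

definition C4 :: "(real \<Rightarrow> real) \<Rightarrow> bool" where
  "C4 f \<longleftrightarrow> (\<forall>k<4. \<forall>x. ((deriv ^^ k) f) differentiable (at x)) \<and> continuous_on UNIV ((deriv ^^ 4) f)"

definition Gk :: "real \<Rightarrow> real \<Rightarrow> real" where
  "Gk l x = exp (- \<bar>x\<bar> / l) / (2 * l)"

definition chi :: "real \<Rightarrow> real \<Rightarrow> real" where
  "chi eps q = (if q \<le> - 1 / eps then (q + 1 / eps)\<^sup>2 else 0)"

definition friedrichs :: "(real \<Rightarrow> real) \<Rightarrow> bool" where
  "friedrichs j \<longleftrightarrow> smooth_test j \<and> (\<forall>x. 0 \<le> j x) \<and> (\<forall>x. 1 \<le> \<bar>x\<bar> \<longrightarrow> j x = 0)
     \<and> (LINT x|lborel. j x) = 1"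

definition mollify :: "(real \<Rightarrow> real) \<Rightarrow> real \<Rightarrow> real \<Rightarrow> real" where
  "mollify j eps x = j (x / eps) / eps"

text \<open>U is the global smooth solution of the regularized approximate problem, in
  C([0,\<infinity>),H^3) \<inter> C^1([0,\<infinity>),H^2) with U(0) = w0; D t i is the i-th x-derivative of U t;
  the representative U is jointly continuous on [0,\<infinity>) \<times> \<real>.\<close>
definition approx_solution ::
  "(real \<Rightarrow> real) \<Rightarrow> real \<Rightarrow> real \<Rightarrow> (real \<Rightarrow> real) \<Rightarrow> (real \<Rightarrow> real \<Rightarrow> real)
     \<Rightarrow> (real \<Rightarrow> nat \<Rightarrow> real \<Rightarrow> real) \<Rightarrow> bool" where
  "approx_solution f l eps w0 U D \<longleftrightarrow>
     continuous_on ({0..} \<times> UNIV) (\<lambda>z. U (fst z) (snd z)) \<and>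
     H_curve 3 U D \<and>
     (\<exists>V DV. H_curve 2 V DV \<and>
        (\<forall>s\<ge>0. \<forall>i\<le>2. ((\<lambda>t. LINT x|lborel. ((D t i x - D s i x) / (t - s) - DV s i x)\<^sup>2)
                          \<longlongrightarrow> 0) (at s within {0..})) \<and>
        (\<forall>t\<ge>0. weak_deriv
           (\<lambda>x. f (U t x) + 1/2 * l\<^sup>2 *
                 conv (Gk l) (\<lambda>y. (deriv ^^ 2) f (U t y) * ((D t 1 y)\<^sup>2 + chi eps (D t 1 y))) x)
           (\<lambda>x. - V t x))) \<and>
     (AE x in lborel. U 0 x = w0 x)"

definition constructed_dissipative_solution ::
  "(real \<Rightarrow> real) \<Rightarrow> (real \<Rightarrow> real) \<Rightarrow> real \<Rightarrow> (real \<Rightarrow> real \<Rightarrow> real) \<Rightarrow> bool" where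
  "constructed_dissipative_solution f u0 l v \<longleftrightarrow>
     (\<exists>j epss U D vx. friedrichs j \<and> (\<forall>k. 0 < epss k) \<and> epss \<longlonglongrightarrow> 0 \<and>
        (\<forall>k. approx_solution f l (epss k) (conv u0 (mollify j (epss k))) (U k) (D k)) \<and>
        (\<forall>T a b e. 0 < e \<longrightarrow>
           (\<forall>\<^sub>F k in sequentially. \<forall>t\<in>{0..T}. \<forall>x\<in>{a..b}. \<bar>U k t x - v t x\<bar> < e)) \<and>
        (\<lambda>z. vx (fst z) (snd z)) \<in> borel_measurable lborel \<and>
        (AE t in lborel. 0 < t \<longrightarrow> weak_deriv (v t) (vx t)) \<and>
        (\<forall>a T c d. 0 < a \<longrightarrow>
           (\<forall>\<^sub>F k in sequentially. set_integrable lborel ({a..T} \<times> {c..d})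
               (\<lambda>z. (D k (fst z) 1 (snd z) - vx (fst z) (snd z))\<^sup>2)) \<and>
           ((\<lambda>k. set_lebesgue_integral lborel ({a..T} \<times> {c..d})
               (\<lambda>z. (D k (fst z) 1 (snd z) - vx (fst z) (snd z))\<^sup>2)) \<longlonglongrightarrow> 0)))"

definition Linf_loc_L1_loc :: "(real \<Rightarrow> real \<Rightarrow> real) \<Rightarrow> bool" where
  "Linf_loc_L1_loc w \<longleftrightarrow> (\<lambda>z. w (fst z) (snd z)) \<in> borel_measurable lborel \<and>
     (\<forall>T a b. \<exists>B. AE t in lborel. 0 \<le> t \<and> t \<le> T \<longrightarrow>
        set_integrable lborel {a..b} (w t) \<and> set_lebesgue_integral lborel {a..b} (\<lambda>x. \<bar>w t x\<bar>) \<le> B)"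

definition conv_Linf_loc_Lp_loc :: "real \<Rightarrow> (real \<Rightarrow> real \<Rightarrow> real \<Rightarrow> real) \<Rightarrow> (real \<Rightarrow> real \<Rightarrow> real) \<Rightarrow> bool" where
  "conv_Linf_loc_Lp_loc p u w \<longleftrightarrow>
     (\<forall>T a b e. 0 < e \<longrightarrow> (\<forall>\<^sub>F l in at_right 0. AE t in lborel. 0 \<le> t \<and> t \<le> T \<longrightarrow>
        set_integrable lborel {a..b} (\<lambda>x. \<bar>u l t x - w t x\<bar> powr p) \<and>
        set_lebesgue_integral lborel {a..b} (\<lambda>x. \<bar>u l t x - w t x\<bar> powr p) < e))"

definition pt :: "(real \<times> real \<Rightarrow> real) \<Rightarrow> real \<times> real \<Rightarrow> real" where
  "pt \<phi> z = deriv (\<lambda>s. \<phi> (s, snd z)) (fst z)"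

definition px :: "(real \<times> real \<Rightarrow> real) \<Rightarrow> real \<times> real \<Rightarrow> real" where
  "px \<phi> z = deriv (\<lambda>y. \<phi> (fst z, y)) (snd z)"

definition test2 :: "(real \<times> real \<Rightarrow> real) \<Rightarrow> bool" where
  "test2 \<phi> \<longleftrightarrow> (\<forall>t x. (\<lambda>s. \<phi> (s, x)) differentiable (at t) \<and> (\<lambda>y. \<phi> (t, y)) differentiable (at x))
     \<and> continuous_on UNIV (pt \<phi>) \<and> continuous_on UNIV (px \<phi>) \<and> bounded {z. \<phi> z \<noteq> 0}"

text \<open>Kruzhkov entropy solution of u_t + f(u)_x = 0, u(0) = u0, in the class of
  bounded measurable functions on (0,\<infinity>)\<times>\<real>.\<close>
definition entropy_solution :: "(real \<Rightarrow> real) \<Rightarrow> (real \<Rightarrow> real) \<Rightarrow> (real \<Rightarrow> real \<Rightarrow> real) \<Rightarrow> bool" where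
  "entropy_solution f u0 w \<longleftrightarrow>
     (\<lambda>z. w (fst z) (snd z)) \<in> borel_measurable lborel \<and>
     (\<exists>B. AE z in lborel. 0 < fst z \<longrightarrow> \<bar>w (fst z) (snd z)\<bar> \<le> B) \<and>
     (\<forall>k \<phi>. test2 \<phi> \<and> (\<forall>z. 0 \<le> \<phi> z) \<longrightarrow>
        0 \<le> set_lebesgue_integral lborel ({0<..} \<times> UNIV)
               (\<lambda>z. \<bar>w (fst z) (snd z) - k\<bar> * pt \<phi> z
                    + sgn (w (fst z) (snd z) - k) * (f (w (fst z) (snd z)) - f k) * px \<phi> z)
             + (LINT x|lborel. \<bar>u0 x - k\<bar> * \<phi> (0, x)))"

end

theory Submission
  imports Defs
begin

text \<open>
  The regularised equation is a nonlocal perturbation of the conservation law whose size is governed by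
  \<open>P = (l\<^sup>2/2) Gk l * (f''(U) (U\<^sub>x\<^sup>2 + chi eps U\<^sub>x))\<close>. The one-sided (Oleinik) bound on \<open>U\<^sub>x\<close> makes
  \<open>\<integral> \<bar>U\<^sub>x\<bar>\<close>, hence also \<open>\<bar>U\<bar>\<close>, bounded uniformly in \<open>l\<close> and \<open>eps\<close>, and the time derivative of
  \<open>\<integral> - l U\<^sub>x \<bar>U\<^sub>x\<bar> / (1 + l \<bar>U\<^sub>x\<bar>) dx\<close> shows that the space-time integral of \<open>P\<close> is \<open>O(l)\<close>.
  So approximate solutions satisfy Kruzhkov's inequalities up to \<open>O(sqrt l)\<close>, and doubling of variables
  compares any (approximate) Kruzhkov solution with them: applied to two approximate solutions it
  gives the Cauchy property as \<open>l \<rightarrow> 0\<close>, applied to an entropy solution it gives uniqueness. All estimates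
  are made on the approximate solutions; \<open>u l\<close> only enters as their locally uniform limit.
\<close>

section \<open>Weak derivatives and integration on the line\<close>

text \<open>The obstacle is the size of \<open>P\<close>: its mass is comparable to
  \<open>l^2\<close> times the integral of \<open>U\<^sub>x\<^sup>2\<close>, for which the a priori
  estimates give no bound uniform in \<open>l\<close>; only \<open>\<bar>U\<^sub>x\<bar>\<close> is
  controlled. The density \<open>S\<close> of the functional is made so that
  \<open>S' + 1 = (1 + l \<bar>z\<bar>)^(-2)\<close>: then \<open>z S + z^2\<close> is at most
  \<open>\<bar>z\<bar> / l\<close>, which is linear, and Jensen's inequality with
  \<open>Gk l \<le> 1 / (2 l)\<close> bounds the averaged weight below independently of
  \<open>l\<close>. The order \<open>sqrt l\<close> comes from smoothing the entropy at scale
  \<open>d\<close>: its second derivative, up to \<open>1 / d\<close>, multiplies \<open>P\<close>,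
  so the error is \<open>l / d + d\<close>. That term contains \<open>U\<^sub>x\<close> with a
  nonnegative factor, hence an upper bound of \<open>U\<^sub>x\<close> suffices. Doubling is
  one-sided, the second point being later than the first; so one of the two functions needs no
  continuity. The bounds grow exponentially in time, whereas an entropy solution is to be bounded by
  one constant for all times. Therefore the limit itself is shown to obey a maximum
  principle.\<close>

lemma AE_zero_if_interval_integrals_zero:
  fixes g :: "real \<Rightarrow> real"
  assumes int: "\<And>a b. set_integrable lborel {a..b} g"
    and zero: "\<And>a b. (LBINT x:{a..b}. g x) = 0"
  shows "AE x in lborel. g x = 0"
proof -
  \<comment> \<open>Cut off to a bounded interval the function is integrable, and its vanishing can
    be read off from its integrals over Borel sets.\<close>
  have "AE x in lborel. indicator {-real n..real n} x * g x = 0" for n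
  proof (rule sigma_finite_measure.density_zero[OF lborel.sigma_finite_measure_axioms])
    let ?g = "\<lambda>x. indicator {-real n..real n} x * g x"
    show i: "integrable lborel ?g"
      using int[of "-real n" "real n"] by (simp add: set_integrable_def)
    fix A :: "real set" assume "A \<in> sets lborel"
    \<comment> \<open>Half-lines are stable under intersection and generate the Borel sets, so
      Dynkin's argument carries zero integrals from them to every Borel set. The complement step
      uses the total integral, which after the cut-off is again one over an interval.\<close>
    have "Int_stable (range (\<lambda>a::real. {..a}))"
      by (auto simp: Int_stable_def Int_atMost)
    moreover have "range (\<lambda>a::real. {..a}) \<subseteq> Pow UNIV" by auto
    moreover have "A \<in> sigma_sets UNIV (range (\<lambda>a::real. {..a}))"
      using \<open>A \<in> sets lborel\<close> by (simp add: borel_eq_atMost)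
    ultimately show "(LBINT x:A. ?g x) = 0"
    proof (induct rule: sigma_sets_induct_disjoint)
      case (basic A)
      then obtain a where A: "A = {..a}" by auto
      have "(LBINT x:A. ?g x) = (LBINT x:{-real n..min a (real n)}. g x)"
        unfolding set_lebesgue_integral_def A
        by (intro Bochner_Integration.integral_cong) (auto split: split_indicator)
      then show ?case using zero by simp
    next
      case empty show ?case by (simp add: set_lebesgue_integral_def)
    next
      case (compl A)
      then have "A \<in> sets lborel" by (simp add: borel_eq_atMost)
      have "(LBINT x:UNIV. ?g x) = (LBINT x:{-real n..real n}. g x)"
        unfolding set_lebesgue_integral_def by simp
      then have u: "(LBINT x:UNIV. ?g x) = 0" using zero by simp
      have "set_integrable lborel B ?g" if "B \<in> sets lborel" for B
        unfolding set_integrable_def using i that by (rule integrable_mult_indicator[rotated])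
      then have "(LBINT x:A \<union> (UNIV - A). ?g x) = (LBINT x:A. ?g x) + (LBINT x:UNIV - A. ?g x)"
        using \<open>A \<in> sets lborel\<close> by (intro set_integral_Un) auto
      then show ?case using compl u by simp
    next
      case (union A)
      have m: "A i \<in> sets lborel" for i using union(2) by (auto simp: borel_eq_atMost)
      have "(LBINT x:(\<Union>i. A i). ?g x) = (\<Sum>i. LBINT x:A i. ?g x)"
      proof (rule lebesgue_integral_countable_add)
        show "set_integrable lborel (\<Union>i. A i) ?g"
          unfolding set_integrable_def using i m by (intro integrable_mult_indicator) auto
      qed (use union m in \<open>auto simp: disjoint_family_on_def\<close>)
      then show ?case using union by simp
    qed
  qed
  then have "AE x in lborel. \<forall>n. indicator {-real n..real n} x * g x = 0"
    unfolding AE_all_countable by blast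
  then show ?thesis
  proof eventually_elim
    case (elim x)
    obtain n where "\<bar>x\<bar> \<le> real n" using real_arch_simple by blast
    then show ?case using elim[rule_format, of n] by (auto simp: indicator_def abs_le_iff split: if_splits)
  qed
qed

section \<open>Smooth test functions and functions that vanish against all of them\<close>

lemma smooth_test_deriv:
  assumes "smooth_test \<phi>"
  shows "smooth_test (deriv \<phi>)"
  unfolding smooth_test_def
proof (intro conjI allI)
  fix k x show "(deriv ^^ k) (deriv \<phi>) differentiable at x"
    using assms[unfolded smooth_test_def] by (metis funpow_Suc_right o_apply)
next
  obtain B where B: "\<And>x. \<phi> x \<noteq> 0 \<Longrightarrow> \<bar>x\<bar> \<le> B"
    using assms by (auto simp: smooth_test_def bounded_iff)
  have "deriv \<phi> x = 0" if "\<bar>x\<bar> > B" for x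
  proof -
    have o: "open {x::real. \<bar>x\<bar> > B}" by (intro open_Collect_less continuous_intros)
    have "eventually (\<lambda>y. \<phi> y = 0) (nhds x)"
      using that B o by (auto simp: eventually_nhds intro!: exI[of _ "{x. \<bar>x\<bar> > B}"])
        fastforce
    then have "deriv \<phi> x = deriv (\<lambda>_. 0) x" by (intro deriv_cong_ev) auto
    then show ?thesis by simp
  qed
  then have "\<bar>x\<bar> \<le> B" if "deriv \<phi> x \<noteq> 0" for x using that by force
  then show "bounded {x. deriv \<phi> x \<noteq> 0}" by (auto simp: bounded_iff)
qed

lemma smooth_test_DERIV: "smooth_test \<phi> \<Longrightarrow> (\<phi> has_real_derivative deriv \<phi> x) (at x)"
  unfolding smooth_test_def
  by (metis DERIV_deriv_iff_real_differentiable funpow_0)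

lemma smooth_test_isCont: "smooth_test \<phi> \<Longrightarrow> isCont \<phi> x"
  using smooth_test_DERIV DERIV_isCont by blast

lemma smooth_test_support:
  assumes "smooth_test \<phi>"
  obtains R where "0 < R" "\<And>x. R \<le> \<bar>x\<bar> \<Longrightarrow> \<phi> x = 0"
proof -
  obtain B where B: "\<And>x. \<phi> x \<noteq> 0 \<Longrightarrow> \<bar>x\<bar> \<le> B"
    using assms by (auto simp: smooth_test_def bounded_iff)
  show ?thesis by (rule that[of "max 1 (B + 1)"]) (use B in force)+
qed

lemma integrable_mult_cont_supp:
  fixes v \<phi> :: "real \<Rightarrow> real"
  assumes v: "\<And>a b. set_integrable lborel {a..b} v"
    and c: "\<And>x. isCont \<phi> x" and supp: "\<And>x. R \<le> \<bar>x\<bar> \<Longrightarrow> \<phi> x = 0"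
  shows "integrable lborel (\<lambda>x. v x * \<phi> x)"
proof -
  have "compact (\<phi> ` {-R..R})" using c
    by (intro compact_continuous_image continuous_at_imp_continuous_on) auto
  then obtain B where B: "\<And>x. x \<in> {-R..R} \<Longrightarrow> \<bar>\<phi> x\<bar> \<le> B"
    by (meson compact_imp_bounded bounded_real imageI)
  have [measurable]: "\<phi> \<in> borel_measurable borel"
    using c by (intro borel_measurable_continuous_onI continuous_at_imp_continuous_on) auto
  have [measurable]: "(\<lambda>x. indicator {-R..R} x * v x) \<in> borel_measurable borel"
    using v[of "-R" R] by (simp add: set_integrable_def integrable_iff_bounded)
  have "integrable lborel (\<lambda>x. (indicator {-R..R} x * v x) * \<phi> x)"
  proof (rule Bochner_Integration.integrable_bound)
    show "integrable lborel (\<lambda>x. B * \<bar>indicator {-R..R} x * v x\<bar>)"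
      using v[of "-R" R] by (intro integrable_mult_right integrable_abs) (simp add: set_integrable_def)
    show "AE x in lborel. norm (indicator {-R..R} x * v x * \<phi> x) \<le> norm (B * \<bar>indicator {-R..R} x * v x\<bar>)"
    proof (intro AE_I2)
      fix x show "norm (indicator {-R..R} x * v x * \<phi> x) \<le> norm (B * \<bar>indicator {-R..R} x * v x\<bar>)"
        using B[of x] by (cases "x \<in> {-R..R}") (auto simp: abs_mult mult.commute intro!: mult_right_mono)
    qed
  qed simp
  also have "(\<lambda>x. (indicator {-R..R} x * v x) * \<phi> x) = (\<lambda>x. v x * \<phi> x)"
  proof
    fix x show "(indicator {-R..R} x * v x) * \<phi> x = v x * \<phi> x"
      using supp[of x] by (auto split: split_indicator)
  qed
  finally show ?thesis .
qed

lemma antiderivative_real: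
  fixes g :: "real \<Rightarrow> real"
  assumes "\<And>x. isCont g x"
  obtains G where "\<And>x. (G has_real_derivative g x) (at x)"
proof -
  have "\<exists>G. \<forall>x. -\<infinity> < ereal x \<longrightarrow> ereal x < \<infinity> \<longrightarrow> (G has_vector_derivative g x) (at x)"
    using assms by (intro einterval_antiderivative) auto
  then show ?thesis
    using that by (auto simp: has_real_derivative_iff_has_vector_derivative)
qed

lemma LBINT_FTC:
  fixes g G :: "real \<Rightarrow> real"
  assumes "a \<le> b" "\<And>x. (G has_real_derivative g x) (at x)" "\<And>x. isCont g x"
  shows "(LBINT x:{a..b}. g x) = G b - G a"
  using integral_FTC_Icc_real[of a b G g] assms
  by (simp add: set_lebesgue_integral_def mult.commute)

lemma set_integrable_cont:
  fixes g :: "real \<Rightarrow> real"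
  assumes "\<And>x. isCont g x"
  shows "set_integrable lborel {a..b} g"
  using assms by (intro borel_integrable_atLeastAtMost' continuous_at_imp_continuous_on) auto

lemma smooth_test_integrable: 
  assumes "smooth_test \<phi>" shows "integrable lborel \<phi>"
proof -
  obtain R where R: "\<And>x. R \<le> \<bar>x\<bar> \<Longrightarrow> \<phi> x = 0" using smooth_test_support[OF assms] by metis
  have "integrable lborel (\<lambda>x. 1 * \<phi> x)"
    using R smooth_test_isCont[OF assms] by (intro integrable_mult_cont_supp set_integrable_cont) auto
  then show ?thesis by simp
qed

lemma LINT_eq_LBINT:
  fixes g :: "real \<Rightarrow> real"
  assumes "\<And>x. x \<notin> A \<Longrightarrow> g x = 0"
  shows "(LBINT x. g x) = (LBINT x:A. g x)"
  unfolding set_lebesgue_integral_def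
  by (intro Bochner_Integration.integral_cong) (use assms in \<open>auto split: split_indicator\<close>)

text \<open>The primitive that starts left of the support is zero there; the zero mean is exactly
  what brings it back to zero on the right.\<close>

lemma smooth_test_antideriv:
  assumes \<psi>: "smooth_test \<psi>" and z: "(LBINT x. \<psi> x) = 0"
  obtains \<phi> where "smooth_test \<phi>" "deriv \<phi> = \<psi>"
proof -
  obtain R where R: "0 < R" "\<And>x. R \<le> \<bar>x\<bar> \<Longrightarrow> \<psi> x = 0" using smooth_test_support[OF \<psi>] by metis
  obtain G where G: "\<And>x. (G has_real_derivative \<psi> x) (at x)"
    using antiderivative_real smooth_test_isCont[OF \<psi>] by metis
  define \<phi> where "\<phi> = (\<lambda>x. G x - G (-R))"
  have D: "(\<phi> has_real_derivative \<psi> x) (at x)" for x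
    unfolding \<phi>_def using G by (auto intro!: derivative_eq_intros)
  have d: "deriv \<phi> = \<psi>" using D by (auto intro!: DERIV_imp_deriv)
  have FTC: "(LBINT x:{a..b}. \<psi> x) = \<phi> b - \<phi> a" if "a \<le> b" for a b
    using that by (intro LBINT_FTC D smooth_test_isCont[OF \<psi>])
  have zero: "\<phi> x = 0" if "R \<le> \<bar>x\<bar>" for x
  proof (cases "x \<le> -R")
    case True
    have "(LBINT y:{x..-R}. \<psi> y) = (LBINT y:{x..-R}. 0)"
      using R by (intro set_lebesgue_integral_cong) auto
    then show ?thesis using FTC[OF True] by (simp add: \<phi>_def set_lebesgue_integral_def)
  next
    case False
    have "(LBINT y. \<psi> y) = (LBINT y:{-R..x}. \<psi> y)"
      using R that False by (intro LINT_eq_LBINT) auto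
    then show ?thesis using FTC[of "-R" x] False R that z by (simp add: \<phi>_def)
  qed
  have "smooth_test \<phi>"
    unfolding smooth_test_def
  proof (intro conjI allI)
    fix k x show "(deriv ^^ k) \<phi> differentiable at x"
    proof (cases k)
      case 0 then show ?thesis using D by (auto simp: real_differentiable_def)
    next
      case (Suc n)
      then have "(deriv ^^ k) \<phi> = (deriv ^^ n) \<psi>" by (simp only: funpow_Suc_right o_apply d)
      then show ?thesis using \<psi> by (simp add: smooth_test_def)
    qed
  next
    have "\<phi> x \<noteq> 0 \<Longrightarrow> norm x \<le> R" for x using zero[of x] by force
    then show "bounded {x. \<phi> x \<noteq> 0}" by (auto simp: bounded_iff)
  qed
  then show ?thesis using that d by blast
qed

lemma deriv_funpow_affine:
  fixes \<phi> :: "real \<Rightarrow> real"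
  assumes "\<And>k x. ((deriv ^^ k) \<phi>) differentiable (at x)"
  shows "(deriv ^^ k) (\<lambda>x. \<phi> (c * x + d)) = (\<lambda>x. c ^ k * (deriv ^^ k) \<phi> (c * x + d))"
proof (induct k)
  case (Suc k)
  have "((deriv ^^ k) \<phi> has_real_derivative (deriv ^^ Suc k) \<phi> y) (at y)" for y
    using assms[of k y] by (simp add: DERIV_deriv_iff_real_differentiable)
  then have "((\<lambda>x. c ^ k * (deriv ^^ k) \<phi> (c * x + d)) has_real_derivative
      c ^ k * ((deriv ^^ Suc k) \<phi> (c * x + d) * c)) (at x)" for x
    by (intro DERIV_cmult DERIV_chain2[where f = "(deriv ^^ k) \<phi>"]) (auto intro!: derivative_eq_intros)
  then have "deriv (\<lambda>x. c ^ k * (deriv ^^ k) \<phi> (c * x + d)) = (\<lambda>x. c ^ k * ((deriv ^^ Suc k) \<phi> (c * x + d) * c))"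
    by (auto intro!: DERIV_imp_deriv)
  then show ?case using Suc by (simp add: mult_ac)
qed simp

text \<open>The scalar serves the projection onto mean zero, where a multiple of \<open>j\<close> is
  subtracted from a test function.\<close>

lemma smooth_test_diff:
  assumes "smooth_test \<phi>" "smooth_test \<psi>"
  shows "smooth_test (\<lambda>x. \<phi> x - c * \<psi> x)"
proof -
  have d: "((deriv ^^ k) g has_real_derivative (deriv ^^ Suc k) g y) (at y)" if "smooth_test g" for g k y
    using that by (simp add: smooth_test_def DERIV_deriv_iff_real_differentiable)
  have e: "(deriv ^^ k) (\<lambda>x. \<phi> x - c * \<psi> x) = (\<lambda>x. (deriv ^^ k) \<phi> x - c * (deriv ^^ k) \<psi> x)" for k
  proof (induct k)
    case (Suc k)
    have "deriv (\<lambda>x. (deriv ^^ k) \<phi> x - c * (deriv ^^ k) \<psi> x) = (\<lambda>x. (deriv ^^ Suc k) \<phi> x - c * (deriv ^^ Suc k) \<psi> x)"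
      using d[OF assms(1)] d[OF assms(2)]
      by (intro ext DERIV_imp_deriv DERIV_diff DERIV_cmult) auto
    then show ?case using Suc by simp
  qed simp
  have "{x. \<phi> x - c * \<psi> x \<noteq> 0} \<subseteq> {x. \<phi> x \<noteq> 0} \<union> {x. \<psi> x \<noteq> 0}" by auto
  then have "bounded {x. \<phi> x - c * \<psi> x \<noteq> 0}"
    using assms unfolding smooth_test_def by (meson bounded_Un bounded_subset)
  moreover have "(\<lambda>x. (deriv ^^ k) \<phi> x - c * (deriv ^^ k) \<psi> x) differentiable at x" for k x
    using d[OF assms(1), of k x] d[OF assms(2), of k x] DERIV_diff DERIV_cmult
    unfolding real_differentiable_def by blast
  ultimately show ?thesis unfolding smooth_test_def e by blast
qed

lemma smooth_test_affine:
  assumes "smooth_test \<phi>" "c \<noteq> 0"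
  shows "smooth_test (\<lambda>x. \<phi> (c * x + d))"
proof -
  obtain R where R: "0 < R" "\<And>x. R \<le> \<bar>x\<bar> \<Longrightarrow> \<phi> x = 0" using smooth_test_support[OF assms(1)] by metis
  have "norm x \<le> (R + \<bar>d\<bar>) / \<bar>c\<bar>" if "\<phi> (c * x + d) \<noteq> 0" for x
  proof -
    have "\<bar>c * x + d\<bar> < R" using R that by force
    then have "\<bar>c\<bar> * \<bar>x\<bar> \<le> R + \<bar>d\<bar>" unfolding abs_mult[symmetric] by linarith
    then show ?thesis using assms(2) by (simp add: field_simps)
  qed
  then have b: "bounded {x. \<phi> (c * x + d) \<noteq> 0}" unfolding bounded_iff by blast
  have e: "(deriv ^^ k) (\<lambda>x. \<phi> (c * x + d)) = (\<lambda>x. c ^ k * (deriv ^^ k) \<phi> (c * x + d))" for k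
    using assms(1) by (intro deriv_funpow_affine) (auto simp: smooth_test_def)
  have "((\<lambda>x. c ^ k * (deriv ^^ k) \<phi> (c * x + d)) differentiable at x)" for k x
  proof -
    have "((deriv ^^ k) \<phi> has_real_derivative (deriv ^^ Suc k) \<phi> (c * x + d)) (at (c * x + d))"
      using assms(1) by (simp add: smooth_test_def DERIV_deriv_iff_real_differentiable)
    then have "((\<lambda>x. c ^ k * (deriv ^^ k) \<phi> (c * x + d)) has_real_derivative
        c ^ k * ((deriv ^^ Suc k) \<phi> (c * x + d) * c)) (at x)"
      by (intro DERIV_cmult DERIV_chain2[where f = "(deriv ^^ k) \<phi>"]) (auto intro!: derivative_eq_intros)
    then show ?thesis by (auto simp: real_differentiable_def)
  qed
  then show ?thesis using b unfolding smooth_test_def e by blast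
qed

lemma weak_deriv_loc_int: 
  "weak_deriv v w \<Longrightarrow> set_integrable lborel {a..b} v" "weak_deriv v w \<Longrightarrow> set_integrable lborel {a..b} w"
  by (auto simp: weak_deriv_def loc_int_def)

text \<open>\<open>J\<close> is a smooth step from 0 to 1. Differences of steep dilates of it will
  approximate indicators of intervals.\<close>

lemma friedrichs_antideriv:
  assumes "friedrichs j"
  obtains J where "\<And>x. (J has_real_derivative j x) (at x)" "\<And>x. x \<le> -1 \<Longrightarrow> J x = 0"
    "\<And>x. 1 \<le> x \<Longrightarrow> J x = 1" "\<And>x. 0 \<le> J x" "\<And>x. J x \<le> 1"
proof -
  have st: "smooth_test j" and j0: "\<And>x. 0 \<le> j x" and j1: "\<And>x. 1 \<le> \<bar>x\<bar> \<Longrightarrow> j x = 0"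
    and ji: "(LBINT x. j x) = 1" using assms by (auto simp: friedrichs_def)
  obtain G where G: "\<And>x. (G has_real_derivative j x) (at x)"
    using antiderivative_real smooth_test_isCont[OF st] by metis
  define J where "J x = G x - G (-1)" for x
  have D: "(J has_real_derivative j x) (at x)" for x
    unfolding J_def using G by (auto intro!: derivative_eq_intros)
  have FTC: "(LBINT x:{a..b}. j x) = J b - J a" if "a \<le> b" for a b
    using that by (intro LBINT_FTC D smooth_test_isCont[OF st])
  have mono: "J a \<le> J b" if "a \<le> b" for a b
    using D j0 that by (meson DERIV_nonneg_imp_nondecreasing)
  have Jm: "J (-1) = 0" by (simp add: J_def)
  have l: "J x = 0" if "x \<le> -1" for x
  proof -
    have "(LBINT y:{x..-1}. j y) = (LBINT y:{x..-1}. 0)"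
      using j1 by (intro set_lebesgue_integral_cong) auto
    then show ?thesis using FTC[OF that] Jm by (simp add: set_lebesgue_integral_def)
  qed
  have r: "J x = 1" if "1 \<le> x" for x
  proof -
    have "(LBINT y. j y) = (LBINT y:{-1..x}. j y)"
      using j1 that by (intro LINT_eq_LBINT) auto
    then show ?thesis using FTC[of "-1" x] that ji Jm by simp
  qed
  show ?thesis
  proof (rule that[OF D l r])
    fix x show "0 \<le> J x" using mono[of "min x (-1)" x] l[of "min x (-1)"] by simp
    show "J x \<le> 1" using mono[of x "max x 1"] r[of "max x 1"] by simp
  qed
qed

text \<open>Steep copies of the step \<open>J\<close> at \<open>a\<close> and at \<open>b\<close>
  are subtracted. The endpoints are exempt from the limit, because there every member of the
  sequence involves \<open>J 0\<close>.\<close>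

lemma smooth_indicator:
  assumes j: "friedrichs j" and ab: "a \<le> b"
  obtains \<psi> where "\<And>n. smooth_test (\<psi> n)" "\<And>n x. \<bar>\<psi> n x\<bar> \<le> 1"
    "\<And>n x. x \<notin> {a - 1..b + 1} \<Longrightarrow> \<psi> n x = 0"
    "\<And>x. x \<noteq> a \<Longrightarrow> x \<noteq> b \<Longrightarrow> (\<lambda>n. \<psi> n x) \<longlonglongrightarrow> indicator {a..b} x"
proof -
  have st: "smooth_test j" using j by (simp add: friedrichs_def)
  obtain J where D: "\<And>x. (J has_real_derivative j x) (at x)" and l: "\<And>x. x \<le> -1 \<Longrightarrow> J x = 0"
    and r: "\<And>x. 1 \<le> x \<Longrightarrow> J x = 1" and J0: "\<And>x. 0 \<le> J x" and J1: "\<And>x. J x \<le> 1"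
    using friedrichs_antideriv[OF j] by metis
  define \<psi> where "\<psi> n x = J (real (Suc n) * (x - a)) - J (real (Suc n) * (x - b))" for n x
  have out: "\<psi> n x = 0" if "x \<notin> {a - 1..b + 1}" for n x
  proof (cases "x < a - 1")
    case True
    then have "1 * 1 \<le> real (Suc n) * (a - x)" "1 * 1 \<le> real (Suc n) * (b - x)"
      using ab by (intro mult_mono; simp)+
    then have "real (Suc n) * (x - a) \<le> -1" "real (Suc n) * (x - b) \<le> -1"
      by (simp_all add: algebra_simps)
    then show ?thesis by (simp add: \<psi>_def l)
  next
    case False
    then have x: "x > b + 1" using that by auto
    then have "1 * 1 \<le> real (Suc n) * (x - a)" "1 * 1 \<le> real (Suc n) * (x - b)"
      using ab by (intro mult_mono; simp)+
    then show ?thesis by (simp add: \<psi>_def r)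
  qed
  have lim: "(\<lambda>n. \<psi> n x) \<longlonglongrightarrow> indicator {a..b} x" if "x \<noteq> a" "x \<noteq> b" for x
  proof -
    have big: "eventually (\<lambda>n. 1 \<le> real (Suc n) * d) sequentially" if "d > 0" for d
    proof -
      obtain N where "1 / d < real N" using reals_Archimedean2 by blast
      then have "1 \<le> real (Suc n) * d" if "n \<ge> N" for n
        using \<open>d > 0\<close> that mult_right_mono[of "1/d" "real (Suc n)" d] by simp
      then show ?thesis by (auto simp: eventually_sequentially)
    qed
    have JL: "(\<lambda>n. J (real (Suc n) * d)) \<longlonglongrightarrow> (if d > 0 then 1 else 0)" if "d \<noteq> 0" for d
    proof (cases "d > 0")
      case True
      then show ?thesis using big[OF True] r by (intro tendsto_eventually) (auto elim!: eventually_mono)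
    next
      case False
      then have "-d > 0" using that by simp
      from big[OF this] have "eventually (\<lambda>n. J (real (Suc n) * d) = 0) sequentially"
        by eventually_elim (rule l, simp)
      then show ?thesis using False by (intro tendsto_eventually) (auto elim!: eventually_mono)
    qed
    have "(\<lambda>n. \<psi> n x) \<longlonglongrightarrow> (if x - a > 0 then 1 else 0) - (if x - b > 0 then 1 else 0)"
      unfolding \<psi>_def using that by (intro tendsto_diff JL) auto
    also have "(if x - a > 0 then 1 else 0) - (if x - b > 0 then 1 else 0) = (indicator {a..b} x :: real)"
      using that ab by (auto simp: indicator_def)
    finally show ?thesis .
  qed
  have dd: "deriv (\<psi> n) = (\<lambda>x. real (Suc n) * (j (real (Suc n) * x + - real (Suc n) * a)
      - 1 * j (real (Suc n) * x + - real (Suc n) * b)))" for n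
    unfolding \<psi>_def
    by (intro ext DERIV_imp_deriv) (auto intro!: derivative_eq_intros DERIV_chain2[OF D] simp: algebra_simps)
  have Dp: "\<psi> n differentiable at x" for n x
    unfolding \<psi>_def real_differentiable_def
    by (rule exI) (auto intro!: derivative_eq_intros DERIV_chain2[OF D])
  have sd: "smooth_test (deriv (\<psi> n))" for n
  proof -
    have z: "smooth_test (\<lambda>x. j x - 1 * j x)" by (rule smooth_test_diff[OF st st])
    have h: "smooth_test (\<lambda>x. j (real (Suc n) * x + - real (Suc n) * a)
      - 1 * j (real (Suc n) * x + - real (Suc n) * b))"
      by (intro smooth_test_diff smooth_test_affine st) auto
    \<comment> \<open>The zero function is written as \<open>j x - 1 * j x\<close>, which gives a
      scalar multiple the shape that \<open>smooth_test_diff\<close> covers.\<close>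
    have "deriv (\<psi> n) = (\<lambda>x. (j x - 1 * j x) - (- real (Suc n)) * (j (real (Suc n) * x + - real (Suc n) * a)
      - 1 * j (real (Suc n) * x + - real (Suc n) * b)))" unfolding dd by (simp only: diff_self mult_minus_left diff_minus_eq_add add_0 mult_1)
    then show ?thesis using smooth_test_diff[OF z h, of "- real (Suc n)"] by presburger
  qed
  have "smooth_test (\<psi> n)" for n
    unfolding smooth_test_def
  proof (intro conjI allI)
    fix k x show "(deriv ^^ k) (\<psi> n) differentiable at x"
    proof (cases k)
      case 0 then show ?thesis using Dp by simp
    next
      case (Suc m)
      then have "(deriv ^^ k) (\<psi> n) = (deriv ^^ m) (deriv (\<psi> n))" by (simp only: funpow_Suc_right o_apply)
      then show ?thesis using sd[of n] by (simp add: smooth_test_def)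
    qed
  next
    have "{x. \<psi> n x \<noteq> 0} \<subseteq> {a - 1..b + 1}" using out by blast
    then show "bounded {x. \<psi> n x \<noteq> 0}" using bounded_closed_interval bounded_subset by metis
  qed
  moreover have "\<bar>\<psi> n x\<bar> \<le> 1" for n x unfolding \<psi>_def 
    using J0[of "real (Suc n) * (x - a)"] J1[of "real (Suc n) * (x - a)"]
      J0[of "real (Suc n) * (x - b)"] J1[of "real (Suc n) * (x - b)"] by linarith
  ultimately show ?thesis using that out lim by blast
qed

text \<open>Dominated convergence along smooth approximations of an indicator reduces this to
  integrals over intervals.\<close>

lemma AE_zero_if_test_integrals_zero:
  fixes g :: "real \<Rightarrow> real"
  assumes j: "friedrichs j" and int: "\<And>a b. set_integrable lborel {a..b} g"
    and zero: "\<And>\<psi>. smooth_test \<psi> \<Longrightarrow> (LBINT x. g x * \<psi> x) = 0"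
  shows "AE x in lborel. g x = 0"
proof (rule AE_zero_if_interval_integrals_zero[OF int])
  fix a b :: real
  show "(LBINT x:{a..b}. g x) = 0"
  proof (cases "a \<le> b")
    case True
    obtain \<psi> where \<psi>: "\<And>n. smooth_test (\<psi> n)" "\<And>n x. \<bar>\<psi> n x\<bar> \<le> 1"
      "\<And>n x. x \<notin> {a - 1..b + 1} \<Longrightarrow> \<psi> n x = 0"
      "\<And>x. x \<noteq> a \<Longrightarrow> x \<noteq> b \<Longrightarrow> (\<lambda>n. \<psi> n x) \<longlonglongrightarrow> indicator {a..b} x"
      using smooth_indicator[OF j True] by metis
    let ?g = "\<lambda>x. indicator {a - 1..b + 1} x * g x"
    have gi: "integrable lborel ?g" using int[of "a-1" "b+1"] by (simp add: set_integrable_def)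
    have [measurable]: "?g \<in> borel_measurable borel" using gi by (simp add: integrable_iff_bounded)
    have [measurable]: "\<psi> n \<in> borel_measurable borel" for n
      using smooth_test_integrable[OF \<psi>(1)] by (simp add: integrable_iff_bounded)
    have "(\<lambda>n. LBINT x. ?g x * \<psi> n x) \<longlonglongrightarrow> (LBINT x. ?g x * indicator {a..b} x)"
    proof (rule integral_dominated_convergence[where w = "\<lambda>x. \<bar>?g x\<bar>"])
      have "AE x in lborel. x \<noteq> a \<and> x \<noteq> b"
        using AE_lborel_singleton[of a] AE_lborel_singleton[of b] by eventually_elim auto
      then show "AE x in lborel. (\<lambda>n. ?g x * \<psi> n x) \<longlonglongrightarrow> ?g x * indicator {a..b} x"
        by eventually_elim (intro tendsto_mult tendsto_const \<psi>(4); simp)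
      show "AE x in lborel. norm (?g x * \<psi> n x) \<le> \<bar>?g x\<bar>" for n
        using \<psi>(2)[of n] by (intro AE_I2) (simp add: abs_mult mult_left_le)
    qed (use gi in \<open>auto intro: integrable_abs\<close>)
    moreover have "(LBINT x. ?g x * \<psi> n x) = 0" for n
    proof -
      have "(LBINT x. ?g x * \<psi> n x) = (LBINT x. g x * \<psi> n x)"
        using \<psi>(3)[of _ n] by (intro Bochner_Integration.integral_cong) (auto split: split_indicator)
      then show ?thesis using zero[OF \<psi>(1)] by simp
    qed
    ultimately have "(LBINT x. ?g x * indicator {a..b} x) = 0"
      by (simp add: LIMSEQ_const_iff)
    moreover have "(LBINT x. ?g x * indicator {a..b} x) = (LBINT x:{a..b}. g x)"
      unfolding set_lebesgue_integral_def
      by (intro Bochner_Integration.integral_cong) (auto split: split_indicator)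
    ultimately show ?thesis by simp
  qed (simp add: set_lebesgue_integral_def)
qed

section \<open>Primitives of locally integrable functions and the lemma of du Bois-Reymond\<close>

lemma set_integral_split:
  fixes w :: "real \<Rightarrow> real"
  assumes "\<And>a b. set_integrable lborel {a..b} w" "a \<le> b" "b \<le> d"
  shows "(LBINT x:{a..d}. w x) = (LBINT x:{a..b}. w x) + (LBINT x:{b..d}. w x)"
proof -
  have u: "{a..d} = {a..b} \<union> {b..d}" using assms by auto
  have "AE x in lborel. \<not> (x \<in> {a..b} \<and> x \<in> {b..d})"
    using AE_lborel_singleton[of b] by eventually_elim auto
  from set_integral_Un_AE[OF this _ _ assms(1) assms(1)] show ?thesis unfolding u by simp
qed

text \<open>The signed integral from 0 to \<open>x\<close>: for either sign of \<open>x\<close> one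
  of the two intervals is empty, and at 0 both are null sets.\<close>

definition prim :: "(real \<Rightarrow> real) \<Rightarrow> real \<Rightarrow> real" where
  "prim w x = (LBINT y:{0..x}. w y) - (LBINT y:{x..0}. w y)"

lemma prim_diff:
  assumes int: "\<And>a b. set_integrable lborel {a..b} w" and "a \<le> b"
  shows "prim w b - prim w a = (LBINT y:{a..b}. w y)"
proof -
  have z: "(LBINT y:{0..0}. w y) = 0" using set_integral_split[OF int, of 0 0 0] by simp
  have e: "(LBINT y:{x..x'}. w y) = 0" if "x' \<le> x" for x x'
    using that z set_integral_split[OF int, of x x x] by (cases "x' = x") (simp_all add: set_lebesgue_integral_def)
  consider "0 \<le> a" | "a < 0" "0 \<le> b" | "b < 0" by linarith
  then show ?thesis
  proof cases
    case 1
    then show ?thesis using set_integral_split[OF int, of 0 a b] \<open>a \<le> b\<close> e[of 0 a] e[of 0 b]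
      unfolding prim_def by linarith
  next
    case 2
    then show ?thesis using set_integral_split[OF int, of a 0 b] e[of a 0] e[of 0 b]
      unfolding prim_def by linarith
  next
    case 3
    then show ?thesis using set_integral_split[OF int, of a b 0] \<open>a \<le> b\<close> e[of a 0] e[of b 0]
      unfolding prim_def by linarith
  qed
qed

lemma prim_cont:
  assumes int: "\<And>a b. set_integrable lborel {a..b} w"
  shows "isCont (prim w) x"
proof -
  have i: "continuous_on {x-1..x+1} (\<lambda>y. integral {x-1..y} w)"
    using set_borel_integral_eq_integral(1)[OF int] by (rule indefinite_integral_continuous_1)
  have e: "prim w (x-1) + integral {x-1..y} w = prim w y" if "y \<in> {x-1..x+1}" for y
    using that prim_diff[OF int, of "x-1" y] set_borel_integral_eq_integral(2)[OF int] by simp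
  have "continuous_on {x-1..x+1} (prim w)"
    by (rule continuous_on_eq[OF continuous_on_add[OF continuous_on_const i] e])
  then show ?thesis by (rule continuous_on_interior) (simp add: interior_atLeastAtMost_real)
qed

text \<open>As \<open>w\<close> is merely locally integrable, no product rule is at hand; the
  identity is Fubini's theorem for \<open>w y * deriv \<phi> x\<close> on the triangle
  \<open>y \<le> x\<close>.\<close>

lemma prim_by_parts:
  assumes int: "\<And>a b. set_integrable lborel {a..b} w" and \<phi>: "smooth_test \<phi>"
  shows "(LBINT x. prim w x * deriv \<phi> x) = - (LBINT x. w x * \<phi> x)"
proof -
  obtain R where R: "0 < R" "\<And>x. R \<le> \<bar>x\<bar> \<Longrightarrow> \<phi> x = 0" using smooth_test_support[OF \<phi>] by metis
  obtain R' where R': "0 < R'" "\<And>x. R' \<le> \<bar>x\<bar> \<Longrightarrow> deriv \<phi> x = 0" 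
    using smooth_test_support[OF smooth_test_deriv[OF \<phi>]] by metis
  define S where "S = max R R'"
  let ?d = "deriv \<phi>"
  have S0: "S > 0" using R by (simp add: S_def)
  have dz: "x \<notin> {-S..S} \<Longrightarrow> ?d x = 0" and pz: "x \<notin> {-S<..<S} \<Longrightarrow> \<phi> x = 0" for x
    using R(2)[of x] R'(2)[of x] by (auto simp: S_def max_def abs_if split: if_splits)
  note dc = smooth_test_isCont[OF smooth_test_deriv[OF \<phi>]]
  have FTC: "(LBINT x:{a..b}. ?d x) = \<phi> b - \<phi> a" if "a \<le> b" for a b
    using that by (intro LBINT_FTC smooth_test_DERIV[OF \<phi>] dc)
  let ?w = "\<lambda>x. indicator {-S..S} x * w x"
  have wi: "integrable lborel ?w" using int[of "-S" "S"] by (simp add: set_integrable_def)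
  have di: "integrable lborel ?d" by (rule smooth_test_integrable[OF smooth_test_deriv[OF \<phi>]])
  have [measurable]: "?w \<in> borel_measurable borel" "?d \<in> borel_measurable borel"
    using wi di by (simp_all add: integrable_iff_bounded)
  let ?F = "\<lambda>z. (if snd z \<le> fst z then ?w (snd z) * ?d (fst z) else 0)"
  have "integrable (lborel \<Otimes>\<^sub>M lborel) (\<lambda>z. ?d (fst z) * ?w (snd z))"
  proof (rule lborel_pair.Fubini_integrable)
    show "(\<lambda>z. ?d (fst z) * ?w (snd z)) \<in> borel_measurable (lborel \<Otimes>\<^sub>M lborel)" by measurable
    have "integrable lborel (\<lambda>x. \<bar>?d x\<bar> * (LBINT y. \<bar>?w y\<bar>))" using di by auto
    then show "integrable lborel (\<lambda>x. LBINT y. norm (?d (fst (x, y)) * ?w (snd (x, y))))"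
      by (simp add: abs_mult[of "?d _" "?w _"] del: abs_mult)
    show "AE x in lborel. integrable lborel (\<lambda>y. ?d (fst (x, y)) * ?w (snd (x, y)))"
      using wi by (intro AE_I2) auto
  qed
  then have Fi: "integrable (lborel \<Otimes>\<^sub>M lborel) ?F"
  proof (rule Bochner_Integration.integrable_bound)
    show "?F \<in> borel_measurable (lborel \<Otimes>\<^sub>M lborel)" by measurable
    show "AE z in lborel \<Otimes>\<^sub>M lborel. norm (?F z) \<le> norm (?d (fst z) * ?w (snd z))"
      by (intro AE_I2) (simp add: mult.commute)
  qed
  \<comment> \<open>Subtracting the value at \<open>-S\<close> lets all inner integrals start at
    \<open>-S\<close>. The constant drops out in the end because \<open>deriv \<phi>\<close> has
    integral zero.\<close>
  have "(LBINT x. (prim w x - prim w (-S)) * ?d x) = (LBINT x. LBINT y. ?F (x, y))"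
  proof (intro Bochner_Integration.integral_cong refl)
    fix x
    have "(LBINT y. ?F (x,y)) = (LBINT y:{-S..x}. w y) * ?d x" if "x \<in> {-S..S}"
      unfolding set_lebesgue_integral_def using that 
      by (subst integral_mult_left_zero[symmetric], intro Bochner_Integration.integral_cong)
        (auto split: split_indicator)
    then show "(prim w x - prim w (-S)) * ?d x = (LBINT y. ?F (x, y))"
      using prim_diff[OF int, of "-S" x] dz[of x] by (cases "x \<in> {-S..S}") (auto simp: if_distrib cong: if_cong)
  qed
  also have "\<dots> = (LBINT y. LBINT x. ?F (x, y))"
    by (rule lborel_pair.Fubini_integral[symmetric, of "\<lambda>x y. ?F (x, y)"]) (use Fi in \<open>simp add: case_prod_unfold cong: if_cong\<close>)
  also have "\<dots> = (LBINT y. - (w y * \<phi> y))"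
  proof (intro Bochner_Integration.integral_cong refl)
    fix y
    have "(LBINT x. ?F (x,y)) = w y * (LBINT x:{y..S}. ?d x)" if "y \<in> {-S..S}"
      unfolding set_lebesgue_integral_def using that dz
      by (subst integral_mult_right_zero[symmetric], intro Bochner_Integration.integral_cong)
        (auto split: split_indicator)
    then show "(LBINT x. ?F (x, y)) = - (w y * \<phi> y)"
      using FTC[of y S] pz[of y] pz[of S] by (cases "y \<in> {-S..S}") (auto cong: if_cong)
  qed
  finally have "(LBINT x. prim w x * ?d x - prim w (-S) * ?d x) = - (LBINT x. w x * \<phi> x)"
    by (simp add: algebra_simps)
  moreover have "(LBINT x. ?d x) = 0"
    using LINT_eq_LBINT[of "{-S..S}" ?d] dz FTC[of "-S" S] S0 pz[of S] pz[of "-S"] by simp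
  moreover have "integrable lborel (\<lambda>x. prim w x * ?d x)"
    using prim_cont[OF int] R' dc by (intro integrable_mult_cont_supp[where R = R'] set_integrable_cont)
  ultimately show ?thesis using di by simp
qed

text \<open>The lemma of du Bois-Reymond. The Friedrichs kernel only serves to provide a smooth bump.\<close>
lemma weak_deriv_prim:
  assumes j: "friedrichs j" and wd: "weak_deriv v w"
  obtains c where "AE x in lborel. v x = c + prim w x"
proof -
  note vi = weak_deriv_loc_int(1)[OF wd] and wi = weak_deriv_loc_int(2)[OF wd]
  have pi: "set_integrable lborel {a..b} (prim w)" for a b by (intro set_integrable_cont prim_cont wi)
  let ?g = "\<lambda>x. v x - prim w x"
  have st: "smooth_test j" and ji: "(LBINT x. j x) = 1" using j by (auto simp: friedrichs_def)
  have gi: "set_integrable lborel {a..b} ?g" for a b using vi pi by (intro set_integral_diff)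
  have tint: "integrable lborel (\<lambda>x. u x * \<phi> x)" 
    if "smooth_test \<phi>" "\<And>a b. set_integrable lborel {a..b} u" for \<phi> u
    using smooth_test_support[OF that(1)] that smooth_test_isCont[OF that(1)] 
    by (metis integrable_mult_cont_supp)
  have g0: "(LBINT x. ?g x * deriv \<phi> x) = 0" if "smooth_test \<phi>" for \<phi>
  proof -
    have "(LBINT x. ?g x * deriv \<phi> x) = (LBINT x. v x * deriv \<phi> x) - (LBINT x. prim w x * deriv \<phi> x)"
      unfolding left_diff_distrib
      by (intro Bochner_Integration.integral_diff tint smooth_test_deriv that vi pi)
    then show ?thesis using prim_by_parts[OF wi that] wd that by (simp add: weak_deriv_def)
  qed
  \<comment> \<open>Since \<open>j\<close> has unit mass, this is the value that
    \<open>v - prim w\<close> must have if it is constant.\<close>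
  define c where "c = (LBINT x. ?g x * j x)"
  have "AE x in lborel. ?g x - c = 0"
  proof (rule AE_zero_if_test_integrals_zero[OF j])
    show "set_integrable lborel {a..b} (\<lambda>x. ?g x - c)" for a b
      by (intro set_integral_diff gi set_integrable_cont) auto
    fix \<psi> assume \<psi>: "smooth_test \<psi>"
    let ?I = "LBINT x. \<psi> x"
    \<comment> \<open>Without its mean, \<open>\<psi>\<close> is the derivative of a test function,
      and against such derivatives \<open>?g\<close> integrates to zero.\<close>
    have s: "smooth_test (\<lambda>x. \<psi> x - ?I * j x)" by (rule smooth_test_diff[OF \<psi> st])
    have "(LBINT x. \<psi> x - ?I * j x) = 0"
      using smooth_test_integrable[OF \<psi>] smooth_test_integrable[OF st] ji by simp
    then obtain \<phi> where "smooth_test \<phi>" "deriv \<phi> = (\<lambda>x. \<psi> x - ?I * j x)"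
      using smooth_test_antideriv[OF s] by metis
    then have "(LBINT x. ?g x * (\<psi> x - ?I * j x)) = 0" using g0[of \<phi>] by simp
    moreover have "?g x * (\<psi> x - ?I * j x) = ?g x * \<psi> x - ?I * (?g x * j x)" for x 
      by (simp add: algebra_simps)
    ultimately have "(LBINT x. ?g x * \<psi> x - ?I * (?g x * j x)) = 0" by simp
    then have "(LBINT x. ?g x * \<psi> x) = ?I * c"
      using tint[OF \<psi> gi] tint[OF st gi] unfolding c_def by simp
    moreover have "(LBINT x. (?g x - c) * \<psi> x) = (LBINT x. ?g x * \<psi> x) - c * ?I"
      using tint[OF \<psi> gi] smooth_test_integrable[OF \<psi>] by (simp add: left_diff_distrib)
    ultimately show "(LBINT x. (?g x - c) * \<psi> x) = 0" by simp
  qed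
  then have "AE x in lborel. v x = c + prim w x" by eventually_elim simp
  then show ?thesis by (rule that)
qed

lemma isCont_borel:
  fixes g :: "real \<Rightarrow> real"
  assumes "\<And>x. isCont g x"
  shows "g \<in> borel_measurable borel"
  using assms by (intro borel_measurable_continuous_onI continuous_at_imp_continuous_on) auto

lemma AE_eq_continuous_imp_eq:
  fixes g h :: "real \<Rightarrow> real"
  assumes "AE x in lborel. g x = h x" "\<And>x. isCont g x" "\<And>x. isCont h x"
  shows "g x = h x"
proof (rule ccontr)
  assume n: "g x \<noteq> h x"
  have o: "open {x. g x \<noteq> h x}"
    using assms(2,3) by (intro open_Collect_neq continuous_at_imp_continuous_on) auto
  from assms(1) obtain N where N: "{x. g x \<noteq> h x} \<subseteq> N" "N \<in> null_sets lborel"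
    by (auto elim!: AE_E simp: null_sets_def)
  then have "negligible {x. g x \<noteq> h x}"
    using null_sets_completionI negligible_iff_null_sets negligible_subset by blast
  then show False using open_not_negligible[OF o] n by blast
qed

lemma weak_deriv_cont_rep:
  assumes "friedrichs j" "weak_deriv v w"
  obtains g where "\<And>x. isCont g x" "AE x in lborel. v x = g x"
proof -
  obtain c where "AE x in lborel. v x = c + prim w x" using weak_deriv_prim[OF assms] .
  moreover have "isCont (\<lambda>x. c + prim w x) x" for x
    using prim_cont[OF weak_deriv_loc_int(2)[OF assms(2)]] by (intro continuous_intros)
  ultimately show ?thesis using that by blast
qed

text \<open>By du Bois-Reymond \<open>g\<close> is a constant plus the integral of \<open>w\<close>.
  That integral equals the one of the continuous \<open>h\<close>, which is differentiable
  everywhere.\<close>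

lemma weak_deriv_classical:
  assumes j: "friedrichs j" and wd: "weak_deriv v w"
    and g: "AE x in lborel. v x = g x" "\<And>x. isCont g x"
    and h: "AE x in lborel. w x = h x" "\<And>x. isCont h x"
  shows "(g has_real_derivative h x) (at x)"
proof -
  note wi = weak_deriv_loc_int(2)[OF wd]
  obtain c where c: "AE x in lborel. v x = c + prim w x" using weak_deriv_prim[OF j wd] .
  have gp: "g x = c + prim w x" for x
  proof (rule AE_eq_continuous_imp_eq[where g = g])
    show "AE x in lborel. g x = c + prim w x" using c g(1) by eventually_elim simp
    show "isCont (\<lambda>x. c + prim w x) x" for x using prim_cont[OF wi] by (intro continuous_intros)
  qed (rule g(2))
  obtain H where H: "\<And>x. (H has_real_derivative h x) (at x)" using antiderivative_real h(2) by metis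
  have gH: "g b - g a = H b - H a" if "a \<le> b" for a b
  proof -
    have "g b - g a = (LBINT y:{a..b}. w y)" using gp prim_diff[OF wi that] by simp
    also have "\<dots> = (LBINT y:{a..b}. h y)"
    proof (rule set_lebesgue_integral_cong_AE)
      show "w \<in> borel_measurable lborel" using wd by (auto simp: weak_deriv_def loc_int_def)
      show "h \<in> borel_measurable lborel"
        using isCont_borel[OF h(2)] by simp
      show "AE x\<in>{a..b} in lborel. w x = h x" using h(1) by eventually_elim simp
    qed simp
    also have "\<dots> = H b - H a" using LBINT_FTC[OF that H h(2)] .
    finally show ?thesis .
  qed
  have "g y = H y + (g 0 - H 0)" for y using gH[of 0 y] gH[of y 0] by (cases "0 \<le> y") auto
  then obtain k where "\<And>y. g y = H y + k" by blast
  then have gk: "g = (\<lambda>y. H y + k)" by (intro ext)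
  show ?thesis unfolding gk using H by (auto intro!: derivative_eq_intros)
qed

section \<open>Integrals over the whole line and a Sobolev bound\<close>

lemma L2_cong_AE:
  assumes "L2 v" "AE x in lborel. v x = g x" "g \<in> borel_measurable lborel"
  shows "integrable lborel (\<lambda>x. (g x)\<^sup>2)"
proof (rule integrable_cong_AE_imp)
  show "integrable lborel (\<lambda>x. (v x)\<^sup>2)" using assms(1) by (simp add: L2_def)
  show "(\<lambda>x. (g x)\<^sup>2) \<in> borel_measurable lborel" using assms(3) by measurable
  show "AE x in lborel. (v x)\<^sup>2 = (g x)\<^sup>2" using assms(2) by eventually_elim simp
qed

text \<open>Integrability at infinity only gives \<open>g \<rightarrow> 0\<close> along sequences, which suffices here.\<close>
lemma integrable_small_at_infinity:
  fixes g :: "real \<Rightarrow> real"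
  assumes i: "integrable lborel g" and e: "0 < e"
  obtains a b where "a \<le> - R" "R \<le> b" "\<bar>g a\<bar> < e" "\<bar>g b\<bar> < e"
proof -
  have *: "\<exists>x\<in>S. \<bar>g x\<bar> < e" if S: "S \<in> sets lborel" "emeasure lborel S = \<infinity>" for S
  proof (rule ccontr)
    assume "\<not> (\<exists>x\<in>S. \<bar>g x\<bar> < e)"
    then have "norm (e * indicator S x) \<le> norm (g x)" for x using e
      by (auto split: split_indicator)
    then have "integrable lborel (\<lambda>x. e * indicator S x :: real)"
      using i S(1) by (intro Bochner_Integration.integrable_bound[OF i]) auto
    then have "integrable lborel (indicator S :: real \<Rightarrow> real)" using e by simp
    then show False using S by (simp add: integrable_indicator_iff)
  qed
  have top: "x = \<infinity>" if "\<And>n. ennreal (real n) \<le> x" for x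
  proof (rule ccontr)
    assume "x \<noteq> \<infinity>"
    then obtain n where "x < of_nat n" using ennreal_Ex_less_of_nat[of x] by (auto simp: top.not_eq_extremum)
    then show False using that[of n] by (simp add: ennreal_of_nat_eq_real_of_nat)
  qed
  have inf: "emeasure lborel {r..} = \<infinity>" "emeasure lborel {..r} = \<infinity>" for r :: real
  proof -
    have "ennreal (real n) \<le> emeasure lborel {r..}" for n
      using emeasure_mono[of "{r..r + real n}" "{r..}" lborel] by simp
    then show "emeasure lborel {r..} = \<infinity>" by (rule top)
    have "ennreal (real n) \<le> emeasure lborel {..r}" for n
      using emeasure_mono[of "{r - real n..r}" "{..r}" lborel] by simp
    then show "emeasure lborel {..r} = \<infinity>" by (rule top)
  qed
  obtain a where "a \<le> -R" "\<bar>g a\<bar> < e" using *[OF _ inf(2), of "-R"] by auto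
  moreover obtain b where "R \<le> b" "\<bar>g b\<bar> < e" using *[OF _ inf(1), of R] by auto
  ultimately show ?thesis using that by blast
qed

lemma tendsto_LBINT_UNIV:
  fixes g :: "real \<Rightarrow> real"
  assumes g: "integrable lborel g" and a: "\<And>n. a n \<le> - real n" and b: "\<And>n. real n \<le> b n"
  shows "(\<lambda>n. LBINT x:{a n..b n}. g x) \<longlonglongrightarrow> (LBINT x. g x)"
  unfolding set_lebesgue_integral_def
proof (rule integral_dominated_convergence[where w = "\<lambda>x. \<bar>g x\<bar>"])
  have [measurable]: "g \<in> borel_measurable borel" using g by (simp add: integrable_iff_bounded)
  show "g \<in> borel_measurable lborel" "(\<lambda>x. indicator {a n..b n} x *\<^sub>R g x) \<in> borel_measurable lborel" for n by measurable
  show "AE x in lborel. (\<lambda>n. indicator {a n..b n} x *\<^sub>R g x) \<longlonglongrightarrow> g x"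
  proof (intro AE_I2 tendsto_eventually)
    fix x :: real
    obtain N where N: "\<bar>x\<bar> \<le> real N" using real_arch_simple by blast
    have "x \<in> {a n..b n}" if "n \<ge> N" for n using N that a[of n] b[of n] by auto
    then show "\<forall>\<^sub>F n in sequentially. indicator {a n..b n} x *\<^sub>R g x = g x"
      by (auto simp: eventually_sequentially indicator_def intro!: exI[of _ N])
  qed
qed (use g in \<open>auto split: split_indicator\<close>)

text \<open>Integrability of \<open>g\<close> itself provides endpoints, receding to both
  infinities, along which \<open>g\<close> tends to 0; no pointwise decay is required.\<close>

lemma LINT_deriv_zero:
  fixes g g' :: "real \<Rightarrow> real"
  assumes D: "\<And>x. (g has_real_derivative g' x) (at x)" and c: "\<And>x. isCont g' x"
    and i: "integrable lborel g" "integrable lborel g'"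
  shows "(LBINT x. g' x) = 0"
proof -
  have "\<exists>a b. a \<le> - real n \<and> real n \<le> b \<and> \<bar>g a\<bar> < 1 / Suc n \<and> \<bar>g b\<bar> < 1 / Suc n" for n
    using integrable_small_at_infinity[OF i(1), of "1 / Suc n" "real n"] by (metis divide_pos_pos of_nat_0_less_iff zero_less_Suc zero_less_one)
  then obtain a b where ab: "\<And>n. a n \<le> - real n" "\<And>n. real n \<le> b n" "\<And>n. \<bar>g (a n)\<bar> < 1 / Suc n" "\<And>n. \<bar>g (b n)\<bar> < 1 / Suc n"
    by metis
  have "(\<lambda>n. LBINT x:{a n..b n}. g' x) \<longlonglongrightarrow> (LBINT x. g' x)"
    using tendsto_LBINT_UNIV[OF i(2)] ab by blast
  moreover have "(LBINT x:{a n..b n}. g' x) = g (b n) - g (a n)" for n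
    using ab(1,2)[of n] by (intro LBINT_FTC D c) linarith
  moreover have "(\<lambda>n. g (b n) - g (a n)) \<longlonglongrightarrow> 0 - 0"
  proof (intro tendsto_diff)
    have l: "(\<lambda>n. 1 / real (Suc n)) \<longlonglongrightarrow> 0" using LIMSEQ_inverse_real_of_nat by (simp add: inverse_eq_divide)
    show "(\<lambda>n. g (b n)) \<longlonglongrightarrow> 0" "(\<lambda>n. g (a n)) \<longlonglongrightarrow> 0"
      by (rule Lim_null_comparison[OF _ l], use ab in \<open>auto intro!: always_eventually less_imp_le\<close>)+
  qed
  ultimately show ?thesis using LIMSEQ_unique by fastforce
qed

lemma integrable_prod_L2:
  fixes g h :: "real \<Rightarrow> real"
  assumes "integrable lborel (\<lambda>x. (g x)\<^sup>2)" "integrable lborel (\<lambda>x. (h x)\<^sup>2)"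
    "g \<in> borel_measurable lborel" "h \<in> borel_measurable lborel"
  shows "integrable lborel (\<lambda>x. g x * h x)"
proof (rule Bochner_Integration.integrable_bound)
  show "integrable lborel (\<lambda>x. (g x)\<^sup>2 + (h x)\<^sup>2)" using assms by auto
  show "AE x in lborel. norm (g x * h x) \<le> norm ((g x)\<^sup>2 + (h x)\<^sup>2)"
  proof (intro AE_I2)
    fix x
    have "0 \<le> \<bar>g x\<bar> * \<bar>h x\<bar>" by simp
    moreover have "2 * \<bar>g x\<bar> * \<bar>h x\<bar> \<le> (g x)\<^sup>2 + (h x)\<^sup>2"
      using sum_squares_bound[of "\<bar>g x\<bar>" "\<bar>h x\<bar>"] by simp
    ultimately have "\<bar>g x * h x\<bar> \<le> (g x)\<^sup>2 + (h x)\<^sup>2" unfolding abs_mult by linarith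
    then show "norm (g x * h x) \<le> norm ((g x)\<^sup>2 + (h x)\<^sup>2)" by simp
  qed
qed (use assms in measurable)

text \<open>Sobolev: \<open>g(x)^2 = \<integral> 2 g g'\<close> over \<open>(-\<infinity>, x]\<close>.\<close>
lemma sobolev_sup:
  fixes g g' :: "real \<Rightarrow> real"
  assumes D: "\<And>x. (g has_real_derivative g' x) (at x)" and c: "\<And>x. isCont g' x"
    and i: "integrable lborel (\<lambda>x. (g x)\<^sup>2)" "integrable lborel (\<lambda>x. (g' x)\<^sup>2)"
  shows "(g x)\<^sup>2 \<le> (LBINT x. (g x)\<^sup>2) + (LBINT x. (g' x)\<^sup>2)"
proof (rule field_le_epsilon)
  fix e :: real assume "e > 0"
  have gc: "isCont g y" for y using D DERIV_isCont by blast
  obtain a b where ab: "a \<le> - \<bar>x\<bar>" "\<bar>(g a)\<^sup>2\<bar> < e"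
    using integrable_small_at_infinity[OF i(1) \<open>e > 0\<close>, of "\<bar>x\<bar>"] by metis
  then have ax: "a \<le> x" by linarith
  have "(LBINT y:{a..x}. 2 * g y * g' y) = (g x)\<^sup>2 - (g a)\<^sup>2"
    using ax gc c by (intro LBINT_FTC) (auto intro!: derivative_eq_intros D continuous_intros)
  moreover have "(LBINT y:{a..x}. 2 * g y * g' y) \<le> (LBINT y. (g y)\<^sup>2 + (g' y)\<^sup>2)"
    unfolding set_lebesgue_integral_def
  proof (rule integral_mono)
    show "integrable lborel (\<lambda>y. indicat_real {a..x} y *\<^sub>R (2 * g y * g' y))"
      using set_integrable_cont[of "\<lambda>y. 2 * g y * g' y" a x] gc c
      by (auto simp: set_integrable_def intro!: continuous_intros)
    show "integrable lborel (\<lambda>y. (g y)\<^sup>2 + (g' y)\<^sup>2)" using i by simp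
    show "indicat_real {a..x} y *\<^sub>R (2 * g y * g' y) \<le> (g y)\<^sup>2 + (g' y)\<^sup>2" for y
      using sum_squares_bound[of "g y" "g' y"] by (auto split: split_indicator)
  qed
  ultimately show "(g x)\<^sup>2 \<le> (LBINT x. (g x)\<^sup>2) + (LBINT x. (g' x)\<^sup>2) + e"
    using ab i by simp
qed

section \<open>Quadratic truncations, the chain rule in L2 and the nonlocal potential\<close>

text \<open>Says that \<open>S\<close> is of class \<open>C^1\<close> with Lipschitz derivative
  \<open>S'\<close>, in the form of a quadratic Taylor remainder. This is just what the chain rule
  in L2 consumes, and it admits functions such as the squared positive part, whose derivative has a
  kink.\<close>

definition quad_approx :: "(real \<Rightarrow> real) \<Rightarrow> (real \<Rightarrow> real) \<Rightarrow> real \<Rightarrow> bool" where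
  "quad_approx S S' B \<longleftrightarrow> 0 \<le> B \<and> (\<forall>y z. \<bar>S z - S y - S' y * (z - y)\<bar> \<le> B * (z - y)\<^sup>2)"

lemma quad_approx_DERIV:
  assumes "quad_approx S S' B"
  shows "(S has_real_derivative S' y) (at y)"
proof -
  have "((\<lambda>z. (S z - S y) / (z - y) - S' y) \<longlongrightarrow> 0) (at y)"
  proof (rule Lim_null_comparison)
    show "\<forall>\<^sub>F z in at y. norm ((S z - S y) / (z - y) - S' y) \<le> B * \<bar>z - y\<bar>"
      unfolding eventually_at_filter
    proof (intro always_eventually allI impI)
      fix z assume "z \<noteq> y"
      then have "(S z - S y) / (z - y) - S' y = (S z - S y - S' y * (z - y)) / (z - y)"
        by (simp add: field_simps)
      also have "\<bar>\<dots>\<bar> \<le> B * (z - y)\<^sup>2 / \<bar>z - y\<bar>"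
        using assms unfolding quad_approx_def abs_divide by (intro divide_right_mono) auto
      also have "\<dots> = B * \<bar>z - y\<bar>"
        using \<open>z \<noteq> y\<close> by (simp add: power2_eq_square field_simps abs_if)
      finally show "norm ((S z - S y) / (z - y) - S' y) \<le> B * \<bar>z - y\<bar>" by simp
    qed
    show "((\<lambda>z. B * \<bar>z - y\<bar>) \<longlongrightarrow> 0) (at y)" by (auto intro!: tendsto_eq_intros)
  qed
  then show ?thesis unfolding has_field_derivative_iff by (simp add: LIM_zero_iff)
qed

text \<open>The remainders expanded at \<open>y\<close> and at \<open>z\<close> add up to
  \<open>(S' z - S' y) * (z - y)\<close>.\<close>

lemma quad_approx_lipschitz:
  assumes "quad_approx S S' B"
  shows "\<bar>S' z - S' y\<bar> \<le> 2 * B * \<bar>z - y\<bar>"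
proof (cases "z = y")
  case False
  have "\<bar>S z - S y - S' y * (z - y)\<bar> \<le> B * (z - y)\<^sup>2" "\<bar>S y - S z - S' z * (y - z)\<bar> \<le> B * (z - y)\<^sup>2"
    using assms unfolding quad_approx_def by (metis power2_commute)+
  moreover have "(S' z - S' y) * (z - y) = (S z - S y - S' y * (z - y)) + (S y - S z - S' z * (y - z))"
    by (simp add: algebra_simps)
  ultimately have "\<bar>(S' z - S' y) * (z - y)\<bar> \<le> 2 * B * \<bar>z - y\<bar> * \<bar>z - y\<bar>"
    by (simp add: power2_eq_square)
  then have "\<bar>S' z - S' y\<bar> * \<bar>z - y\<bar> \<le> (2 * B * \<bar>z - y\<bar>) * \<bar>z - y\<bar>" by (simp add: abs_mult)
  then show ?thesis using False by (simp only: mult_le_cancel_right)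
qed simp

lemma quad_approx_isCont: "quad_approx S S' B \<Longrightarrow> isCont S y" "quad_approx S S' B \<Longrightarrow> isCont S' y"
proof -
  assume q: "quad_approx S S' B"
  show "isCont S y" using quad_approx_DERIV[OF q] DERIV_isCont by blast
  have "((\<lambda>z. S' z - S' y) \<longlongrightarrow> 0) (at y)"
  proof (rule Lim_null_comparison)
    show "\<forall>\<^sub>F z in at y. norm (S' z - S' y) \<le> 2 * B * \<bar>z - y\<bar>"
      using quad_approx_lipschitz[OF q] by simp
    show "((\<lambda>z. 2 * B * \<bar>z - y\<bar>) \<longlongrightarrow> 0) (at y)" by (auto intro!: tendsto_eq_intros)
  qed
  then show "isCont S' y" by (simp add: isCont_def LIM_zero_iff)
qed

lemma quad_approx_bounds:
  assumes "quad_approx S S' B" "S 0 = 0" "S' 0 = 0"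
  shows "\<bar>S y\<bar> \<le> B * y\<^sup>2" "\<bar>S' y\<bar> \<le> 2 * B * \<bar>y\<bar>"
proof -
  have "\<bar>S y - S 0 - S' 0 * (y - 0)\<bar> \<le> B * (y - 0)\<^sup>2" using assms(1) unfolding quad_approx_def by blast
  then show "\<bar>S y\<bar> \<le> B * y\<^sup>2" using assms by simp
  show "\<bar>S' y\<bar> \<le> 2 * B * \<bar>y\<bar>" using quad_approx_lipschitz[OF assms(1), of y 0] assms by simp
qed

lemma quad_approx_reflect:
  assumes "quad_approx S S' B" shows "quad_approx (\<lambda>z. S (- z)) (\<lambda>z. - S' (- z)) B"
  unfolding quad_approx_def
proof (intro conjI allI)
  fix y z
  have "\<bar>S (-z) - S (-y) - S' (-y) * (- z - - y)\<bar> \<le> B * (- z - - y)\<^sup>2"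
    using assms unfolding quad_approx_def by blast
  then show "\<bar>S (-z) - S (-y) - - S' (-y) * (z - y)\<bar> \<le> B * (z - y)\<^sup>2"
    by (simp add: algebra_simps power2_eq_square)
qed (use assms in \<open>simp add: quad_approx_def\<close>)

lemma quad_approx_shift:
  assumes "quad_approx S S' B" shows "quad_approx (\<lambda>z. S (z - k)) (\<lambda>z. S' (z - k)) B"
  unfolding quad_approx_def
proof (intro conjI allI)
  fix y z
  have "\<bar>S (z-k) - S (y-k) - S' (y-k) * ((z - k) - (y - k))\<bar> \<le> B * ((z - k) - (y - k))\<^sup>2"
    using assms unfolding quad_approx_def by blast
  then show "\<bar>S (z-k) - S (y-k) - S' (y-k) * (z - y)\<bar> \<le> B * (z - y)\<^sup>2" by simp
qed (use assms in \<open>simp add: quad_approx_def\<close>)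

lemma quad_approx_lincomb:
  assumes "quad_approx S S' B" "quad_approx T T' C" "\<bar>c\<bar> = 1"
  shows "quad_approx (\<lambda>z. S z + c * T z) (\<lambda>z. S' z + c * T' z) (B + C)"
  unfolding quad_approx_def
proof (intro conjI allI)
  fix y z
  have a: "\<bar>S z - S y - S' y * (z - y)\<bar> \<le> B * (z - y)\<^sup>2" "\<bar>T z - T y - T' y * (z - y)\<bar> \<le> C * (z - y)\<^sup>2"
    using assms unfolding quad_approx_def by blast+
  have "\<bar>c * (T z - T y - T' y * (z - y))\<bar> \<le> C * (z - y)\<^sup>2" using a(2) assms(3) by (simp add: abs_mult)
  moreover have "S z + c * T z - (S y + c * T y) - (S' y + c * T' y) * (z - y)
    = (S z - S y - S' y * (z - y)) + c * (T z - T y - T' y * (z - y))" by (simp add: algebra_simps)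
  ultimately show "\<bar>S z + c * T z - (S y + c * T y) - (S' y + c * T' y) * (z - y)\<bar> \<le> (B + C) * (z - y)\<^sup>2"
    using a(1) by (simp add: algebra_simps)
qed (use assms in \<open>simp add: quad_approx_def\<close>)

lemma quad_approx_pos_sq: "quad_approx (\<lambda>z. (max 0 z)\<^sup>2) (\<lambda>z. 2 * max 0 z) 1"
  unfolding quad_approx_def
proof (intro conjI allI)
  fix y z :: real
  consider "0 \<le> y" "0 \<le> z" | "y < 0" "0 \<le> z" | "0 \<le> y" "z < 0" | "y < 0" "z < 0" by linarith
  then show "\<bar>(max 0 z)\<^sup>2 - (max 0 y)\<^sup>2 - 2 * max 0 y * (z - y)\<bar> \<le> 1 * (z - y)\<^sup>2"
  proof cases
    case 1
    then have "(max 0 z)\<^sup>2 - (max 0 y)\<^sup>2 - 2 * max 0 y * (z - y) = (z - y)\<^sup>2"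
      by (simp add: power2_eq_square algebra_simps)
    then show ?thesis by simp
  next
    case 2
    then have "z\<^sup>2 \<le> (z - y)\<^sup>2" by (intro power_mono) auto
    then show ?thesis using 2 by simp
  next
    case 3
    then have "(max 0 z)\<^sup>2 - (max 0 y)\<^sup>2 - 2 * max 0 y * (z - y) = y\<^sup>2 - 2 * y * z"
      by (simp add: power2_eq_square algebra_simps)
    moreover have "2 * y * z \<le> 0" using 3 by (simp add: mult_nonneg_nonpos)
    ultimately have "\<bar>(max 0 z)\<^sup>2 - (max 0 y)\<^sup>2 - 2 * max 0 y * (z - y)\<bar> = y\<^sup>2 - 2 * y * z"
      using zero_le_power2[of y] by linarith
    also have "\<dots> \<le> y\<^sup>2 - 2 * y * z + z\<^sup>2" by simp
    also have "\<dots> = (z - y)\<^sup>2" by (simp add: power2_eq_square algebra_simps)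
    finally show ?thesis by simp
  next
    case 4 then show ?thesis by simp
  qed
qed simp

text \<open>A convex approximation of the positive part from below, with error at most
  \<open>d\<close> and with Lipschitz derivative \<open>sg'\<close>. For \<open>z \<ge> 0\<close> it
  is \<open>z - d + d^2 / (z + d)\<close>.\<close>

definition sg :: "real \<Rightarrow> real \<Rightarrow> real" where "sg d z = (max 0 z)\<^sup>2 / (max 0 z + d)"
definition sg' :: "real \<Rightarrow> real \<Rightarrow> real" where "sg' d z = 1 - d\<^sup>2 / (max 0 z + d)\<^sup>2"

lemma sg_nonpos [simp]: "z \<le> 0 \<Longrightarrow> sg d z = 0" "z \<le> 0 \<Longrightarrow> d > 0 \<Longrightarrow> sg' d z = 0"
  by (simp_all add: sg_def sg'_def)

lemma sg_pos: "0 \<le> z \<Longrightarrow> d > 0 \<Longrightarrow> sg d z = z - d + d\<^sup>2 / (z + d)"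
  by (simp add: sg_def field_simps power2_eq_square)

lemma sg_bounds:
  assumes "d > 0"
  shows "0 \<le> sg d z" "sg d z \<le> max 0 z" "max 0 z - d \<le> sg d z" "0 \<le> sg' d z" "sg' d z \<le> 1"
proof -
  show "0 \<le> sg d z" using assms by (simp add: sg_def)
  show "sg d z \<le> max 0 z" using assms by (simp add: sg_def divide_le_eq power2_eq_square algebra_simps)
  have "(max 0 z - d) * (max 0 z + d) \<le> (max 0 z)\<^sup>2" by (simp add: power2_eq_square algebra_simps)
  then show "max 0 z - d \<le> sg d z" using assms unfolding sg_def by (subst pos_le_divide_eq) auto
  have "d\<^sup>2 \<le> (max 0 z + d)\<^sup>2" using assms by (intro power_mono) auto
  then show "0 \<le> sg' d z" using assms by (simp add: sg'_def divide_le_eq)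
  show "sg' d z \<le> 1" by (simp add: sg'_def)
qed

lemma quad_approx_sg:
  assumes d: "d > 0" shows "quad_approx (sg d) (sg' d) (1 / d)"
  unfolding quad_approx_def
proof (intro conjI allI)
  fix y z :: real
  \<comment> \<open>For nonnegative arguments the remainder is explicit,
    \<open>d^2 (z - y)^2 / ((z + d) (y + d)^2)\<close>, and the denominator is at least
    \<open>d^3\<close>.\<close>
  have pp: "0 \<le> sg d z - sg d y - sg' d y * (z - y) \<and> sg d z - sg d y - sg' d y * (z - y) \<le> 1 / d * (z - y)\<^sup>2"
    if y: "0 \<le> y" and z: "0 \<le> z" for y z
  proof -
    have "sg d z - sg d y - sg' d y * (z - y) = d\<^sup>2 * ((z - y)\<^sup>2 / ((z + d) * (y + d)\<^sup>2))"
      using y z d unfolding sg_pos[OF y d] sg_pos[OF z d] sg'_def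
      by (simp add: divide_simps) (simp add: power2_eq_square algebra_simps)
    moreover have "d\<^sup>2 * ((z - y)\<^sup>2 / ((z + d) * (y + d)\<^sup>2)) \<le> d\<^sup>2 * ((z - y)\<^sup>2 / (d * d\<^sup>2))"
      using y z d by (intro mult_left_mono divide_left_mono mult_mono power_mono) auto
    moreover have "d\<^sup>2 * ((z - y)\<^sup>2 / (d * d\<^sup>2)) = 1 / d * (z - y)\<^sup>2" using d by simp
    moreover have "0 \<le> d\<^sup>2 * ((z - y)\<^sup>2 / ((z + d) * (y + d)\<^sup>2))" using y z d by simp
    ultimately show ?thesis by linarith
  qed
  consider "0 \<le> y" "0 \<le> z" | "y < 0" "0 \<le> z" | "0 \<le> y" "z < 0" | "y < 0" "z < 0" by linarith
  then show "\<bar>sg d z - sg d y - sg' d y * (z - y)\<bar> \<le> 1 / d * (z - y)\<^sup>2"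
  proof cases
    case 1 then show ?thesis using pp[of y z] by linarith
  next
    case 2
    have "\<bar>sg d z\<bar> \<le> 1 / d * z\<^sup>2"
      using pp[of 0 z] 2 d by simp
    also have "\<dots> \<le> 1 / d * (z - y)\<^sup>2" using 2 d by (intro mult_left_mono power_mono) auto
    finally show ?thesis using 2 d by simp
  next
    case 3
    \<comment> \<open>The kink at 0 is crossed: the remainder from \<open>y\<close> to 0 is at most
      \<open>y^2 / d\<close>, the slope at \<open>y\<close> times \<open>- z\<close> at most
      \<open>- 2 y z / d\<close>, and together they stay below \<open>(z - y)^2 / d\<close>.\<close>
    have a: "0 \<le> - sg d y + sg' d y * y \<and> - sg d y + sg' d y * y \<le> 1 / d * y\<^sup>2"
      using pp[of y 0] 3 d by simp
    have "sg' d y \<le> 2 * (1 / d) * y"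
      using quad_approx_lipschitz sg_bounds[OF d, of y] 3 d
      unfolding sg'_def by (simp add: divide_simps) (simp add: power2_eq_square algebra_simps)
    then have b: "sg' d y * (- z) \<le> (2 * (1 / d) * y) * (- z)" using 3 by (intro mult_right_mono) auto
    have b0: "0 \<le> sg' d y * (- z)" using 3 sg_bounds(4)[OF d, of y] by (intro mult_nonneg_nonneg) auto
    have "\<bar>sg d z - sg d y - sg' d y * (z - y)\<bar> = (- sg d y + sg' d y * y) + sg' d y * (- z)"
      using 3 a b0 by (simp add: algebra_simps)
    also have "\<dots> \<le> 1 / d * y\<^sup>2 + (2 * (1 / d) * y) * (- z)" using a b by linarith
    also have "\<dots> \<le> 1 / d * (z - y)\<^sup>2" using d by (simp add: field_simps power2_eq_square)
    finally show ?thesis .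
  next
    case 4 then show ?thesis using d by simp
  qed
qed (use d in simp)

section \<open>The chain rule in L2\<close>

lemma integral_Cauchy_Schwarz:
  fixes a b :: "'a \<Rightarrow> real"
  assumes a: "integrable M (\<lambda>x. (a x)\<^sup>2)" and b: "integrable M (\<lambda>x. (b x)\<^sup>2)"
    and ab: "integrable M (\<lambda>x. a x * b x)"
  shows "(LINT x|M. a x * b x)\<^sup>2 \<le> (LINT x|M. (a x)\<^sup>2) * (LINT x|M. (b x)\<^sup>2)"
proof -
  let ?A = "LINT x|M. (a x)\<^sup>2" and ?B = "LINT x|M. (b x)\<^sup>2" and ?I = "LINT x|M. a x * b x"
  have q: "0 \<le> ?A - 2 * k * ?I + k\<^sup>2 * ?B" for k
  proof -
    have "0 \<le> (LINT x|M. (a x - k * b x)\<^sup>2)" by (rule integral_nonneg_AE) simp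
    also have "\<dots> = (LINT x|M. (a x)\<^sup>2 - (2 * k) * (a x * b x) + k\<^sup>2 * (b x)\<^sup>2)"
      by (intro Bochner_Integration.integral_cong) (simp_all add: power2_eq_square algebra_simps)
    also have "\<dots> = ?A - 2 * k * ?I + k\<^sup>2 * ?B" using assms by simp
    finally show ?thesis .
  qed
  have B0: "0 \<le> ?B" by (rule integral_nonneg_AE) simp
  show ?thesis
  proof (cases "?B = 0")
    case True
    \<comment> \<open>If \<open>b\<close> has vanishing square integral, the quadratic in
      \<open>k\<close> is affine; for a nonzero mixed integral this \<open>k\<close> would give it
      the value -1.\<close>
    then have "?I = 0" using q[of "(?A + 1) / (2 * ?I)"] by (cases "?I = 0") auto
    then show ?thesis using True by simp
  next
    case False
    then have "?B > 0" using B0 by linarith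
    then show ?thesis using q[of "?I / ?B"] by (simp add: field_simps power2_eq_square)
  qed
qed

lemma sq_diff_le: "((a::real) - b)\<^sup>2 \<le> 2 * a\<^sup>2 + 2 * b\<^sup>2"
proof -
  have "0 \<le> (a + b)\<^sup>2" by simp
  then show ?thesis by (simp add: power2_eq_square algebra_simps)
qed

text \<open>Only the difference quotients converge, and only in L2; no derivative in time at a fixed
  point is assumed. The error splits into the Taylor remainder \<open>?r\<close>, of order
  \<open>\<bar>t - s\<bar>\<close> times the squared norm of the quotient, and \<open>S'\<close>
  times the L2 error, for which Cauchy-Schwarz suffices.\<close>

lemma L2_chain_rule:
  fixes g :: "real \<Rightarrow> real \<Rightarrow> real"
  assumes S: "quad_approx S S' B" "S 0 = 0" "S' 0 = 0" and s: "0 \<le> s"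
    and gm: "\<And>t. 0 \<le> t \<Longrightarrow> g t \<in> borel_measurable lborel" and dgm: "dg \<in> borel_measurable lborel"
    and g2: "\<And>t. 0 \<le> t \<Longrightarrow> integrable lborel (\<lambda>x. (g t x)\<^sup>2)" and dg2: "integrable lborel (\<lambda>x. (dg x)\<^sup>2)"
    and lim: "((\<lambda>t. LBINT x. ((g t x - g s x) / (t - s) - dg x)\<^sup>2) \<longlongrightarrow> 0) (at s within {0..})"
  shows "((\<lambda>t. LBINT x. S (g t x)) has_real_derivative (LBINT x. S' (g s x) * dg x)) (at s within {0..})"
proof -
  let ?F = "\<lambda>t. LBINT x. S (g t x)" and ?D = "LBINT x. S' (g s x) * dg x"
  let ?e = "\<lambda>t x. (g t x - g s x) / (t - s) - dg x"
  let ?N = "\<lambda>t. LBINT x. (?e t x)\<^sup>2"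
  let ?A = "LBINT x. (S' (g s x))\<^sup>2" and ?G = "LBINT x. (dg x)\<^sup>2"
  have B: "0 \<le> B" using S(1) by (simp add: quad_approx_def)
  have Sm[measurable]: "S \<in> borel_measurable borel" "S' \<in> borel_measurable borel"
    using quad_approx_isCont[OF S(1)] isCont_borel by auto
  note [measurable] = gm[OF s] dgm
  have S'2: "integrable lborel (\<lambda>x. (S' (g s x))\<^sup>2)"
  proof (rule Bochner_Integration.integrable_bound)
    show "integrable lborel (\<lambda>x. (2 * B)\<^sup>2 * (g s x)\<^sup>2)" using g2[OF s] by simp
    show "AE x in lborel. norm ((S' (g s x))\<^sup>2) \<le> norm ((2 * B)\<^sup>2 * (g s x)\<^sup>2)"
      using power_mono[OF quad_approx_bounds(2)[OF S] abs_ge_zero, of _ 2]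
      by (intro AE_I2) (simp add: power_mult_distrib)
  qed measurable
  have Si: "integrable lborel (\<lambda>x. S (g t x))" if t: "0 \<le> t" for t
  proof (rule Bochner_Integration.integrable_bound)
    show "integrable lborel (\<lambda>x. B * (g t x)\<^sup>2)" using g2[OF t] by simp
    show "AE x in lborel. norm (S (g t x)) \<le> norm (B * (g t x)\<^sup>2)"
      using quad_approx_bounds(1)[OF S] B by (intro AE_I2) simp
  qed (use gm[OF t] in measurable)
  have bound: "\<bar>(?F t - ?F s) / (t - s) - ?D\<bar> \<le> B * \<bar>t - s\<bar> * (2 * ?N t + 2 * ?G) + sqrt (?A * ?N t)"
    if t: "0 \<le> t" "t \<noteq> s" for t
  proof -
    note [measurable] = gm[OF t(1)]
    have di: "integrable lborel (\<lambda>x. (g t x - g s x)\<^sup>2)"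
    proof (rule Bochner_Integration.integrable_bound)
      show "integrable lborel (\<lambda>x. 2 * (g t x)\<^sup>2 + 2 * (g s x)\<^sup>2)" using g2[OF s] g2[OF t(1)] by simp
      show "AE x in lborel. norm ((g t x - g s x)\<^sup>2) \<le> norm (2 * (g t x)\<^sup>2 + 2 * (g s x)\<^sup>2)"
      proof (intro AE_I2)
        fix x
        have "0 \<le> (g t x + g s x)\<^sup>2" by simp
        then have "(g t x - g s x)\<^sup>2 \<le> 2 * (g t x)\<^sup>2 + 2 * (g s x)\<^sup>2"
          by (simp add: power2_eq_square algebra_simps)
        then show "norm ((g t x - g s x)\<^sup>2) \<le> norm (2 * (g t x)\<^sup>2 + 2 * (g s x)\<^sup>2)" by simp
      qed
    qed measurable
    have ei: "integrable lborel (\<lambda>x. (?e t x)\<^sup>2)"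
    proof (rule Bochner_Integration.integrable_bound)
      show "integrable lborel (\<lambda>x. 2 * ((g t x - g s x)\<^sup>2 / (t - s)\<^sup>2) + 2 * (dg x)\<^sup>2)" using di dg2 by simp
      show "AE x in lborel. norm ((?e t x)\<^sup>2) \<le> norm (2 * ((g t x - g s x)\<^sup>2 / (t - s)\<^sup>2) + 2 * (dg x)\<^sup>2)"
      proof (intro AE_I2)
        fix x
        have "(?e t x)\<^sup>2 \<le> 2 * ((g t x - g s x) / (t - s))\<^sup>2 + 2 * (dg x)\<^sup>2" by (rule sq_diff_le)
        then show "norm ((?e t x)\<^sup>2) \<le> norm (2 * ((g t x - g s x)\<^sup>2 / (t - s)\<^sup>2) + 2 * (dg x)\<^sup>2)"
          by (simp add: power_divide)
      qed
    qed measurable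
    let ?r = "\<lambda>x. (S (g t x) - S (g s x) - S' (g s x) * (g t x - g s x)) / (t - s)"
    have rb: "\<bar>?r x\<bar> \<le> B * \<bar>t - s\<bar> * (2 * (?e t x)\<^sup>2 + 2 * (dg x)\<^sup>2)" for x
    proof -
      have "\<bar>?r x\<bar> \<le> B * (g t x - g s x)\<^sup>2 / \<bar>t - s\<bar>"
        using S(1) unfolding quad_approx_def abs_divide by (intro divide_right_mono) auto
      also have "\<dots> = B * \<bar>t - s\<bar> * (?e t x + dg x)\<^sup>2"
      proof -
        have "B * D\<^sup>2 / \<bar>\<tau>\<bar> = B * \<bar>\<tau>\<bar> * (D / \<tau>)\<^sup>2" if "\<tau> \<noteq> 0" for D \<tau> :: real
          using that by (cases "\<tau> > 0") (simp_all add: power2_eq_square field_simps)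
        from this[of "t - s" "g t x - g s x"] show ?thesis using t by simp
      qed
      also have "\<dots> \<le> B * \<bar>t - s\<bar> * (2 * (?e t x)\<^sup>2 + 2 * (dg x)\<^sup>2)"
      proof (intro mult_left_mono)
        show "(?e t x + dg x)\<^sup>2 \<le> 2 * (?e t x)\<^sup>2 + 2 * (dg x)\<^sup>2"
          using sq_diff_le[of "?e t x" "- dg x"] by simp
      qed (use B in auto)
      finally show ?thesis .
    qed
    have r_int: "integrable lborel ?r"
    proof (rule Bochner_Integration.integrable_bound)
      show "integrable lborel (\<lambda>x. B * \<bar>t - s\<bar> * (2 * (?e t x)\<^sup>2 + 2 * (dg x)\<^sup>2))"
        using ei dg2 by (intro integrable_mult_right Bochner_Integration.integrable_add) auto
      show "AE x in lborel. norm (?r x) \<le> norm (B * \<bar>t - s\<bar> * (2 * (?e t x)\<^sup>2 + 2 * (dg x)\<^sup>2))"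
        using rb B by (intro AE_I2) (simp add: abs_mult)
    qed measurable
    have Se: "integrable lborel (\<lambda>x. S' (g s x) * ?e t x)" by (rule integrable_prod_L2[OF S'2 ei]) measurable
    have Sd: "integrable lborel (\<lambda>x. S' (g s x) * dg x)" by (rule integrable_prod_L2[OF S'2 dg2]) measurable
    have "(?F t - ?F s) / (t - s) - ?D = (LBINT x. (S (g t x) - S (g s x)) / (t - s) - S' (g s x) * dg x)"
      using Si[OF t(1)] Si[OF s] Sd by simp
    also have "\<dots> = (LBINT x. ?r x + S' (g s x) * ?e t x)"
    proof (intro Bochner_Integration.integral_cong refl)
      fix x
      have "a / \<tau> - k * d = (a - k * b) / \<tau> + k * (b / \<tau> - d)" for a b k d \<tau> :: real
        by (simp add: diff_divide_distrib right_diff_distrib)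
      then show "(S (g t x) - S (g s x)) / (t - s) - S' (g s x) * dg x = ?r x + S' (g s x) * ?e t x" .
    qed
    also have "\<dots> = (LBINT x. ?r x) + (LBINT x. S' (g s x) * ?e t x)" using r_int Se by simp
    finally have "\<bar>(?F t - ?F s) / (t - s) - ?D\<bar> \<le> \<bar>LBINT x. ?r x\<bar> + \<bar>LBINT x. S' (g s x) * ?e t x\<bar>"
      by linarith
    moreover have "\<bar>LBINT x. S' (g s x) * ?e t x\<bar> \<le> sqrt (?A * ?N t)"
      using integral_Cauchy_Schwarz[OF S'2 ei Se] by (intro real_le_rsqrt) simp
    moreover have "\<bar>LBINT x. ?r x\<bar> \<le> (LBINT x. \<bar>?r x\<bar>)" by (rule integral_abs_bound)
    moreover have "(LBINT x. \<bar>?r x\<bar>) \<le> (LBINT x. B * \<bar>t - s\<bar> * (2 * (?e t x)\<^sup>2 + 2 * (dg x)\<^sup>2))"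
      by (rule integral_mono[OF integrable_abs[OF r_int] _ rb]) (use ei dg2 in simp)
    moreover have "(LBINT x. B * \<bar>t - s\<bar> * (2 * (?e t x)\<^sup>2 + 2 * (dg x)\<^sup>2)) = B * \<bar>t - s\<bar> * (2 * ?N t + 2 * ?G)"
      using ei dg2 by simp
    ultimately show ?thesis by linarith
  qed
  have "((\<lambda>t. (?F t - ?F s) / (t - s) - ?D) \<longlongrightarrow> 0) (at s within {0..})"
  proof (rule Lim_null_comparison)
    show "\<forall>\<^sub>F t in at s within {0..}. norm ((?F t - ?F s) / (t - s) - ?D) 
        \<le> B * \<bar>t - s\<bar> * (2 * ?N t + 2 * ?G) + sqrt (?A * ?N t)"
      unfolding eventually_at_filter using bound by (intro always_eventually allI impI) simp
    have "((\<lambda>t. B * \<bar>t - s\<bar> * (2 * ?N t + 2 * ?G) + sqrt (?A * ?N t)) \<longlongrightarrow>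
        B * \<bar>s - s\<bar> * (2 * 0 + 2 * ?G) + sqrt (?A * 0)) (at s within {0..})"
      by (intro tendsto_intros lim)
    then show "((\<lambda>t. B * \<bar>t - s\<bar> * (2 * ?N t + 2 * ?G) + sqrt (?A * ?N t)) \<longlongrightarrow> 0) (at s within {0..})" by simp
  qed
  then show ?thesis unfolding has_field_derivative_iff by (simp add: LIM_zero_iff)
qed

section \<open>The exponential kernel and its potential\<close>

lemma Gk_integral:
  assumes l: "l > 0"
  shows "integrable lborel (Gk l)" "(LBINT x. Gk l x) = 1"
proof -
  let ?p = "\<lambda>x. indicator {0..} x * exp (- (1 / l) * x)"
  have hb: "has_bochner_integral lborel ?p l"
  proof (rule has_bochner_integral_nn_integral)
    have "((\<lambda>x. exp (- (1 / l) * x)) has_integral exp (- (1 / l) * 0) / (1 / l)) {0..}"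
      using l by (intro has_integral_exp_minus_to_infinity) auto
    then show "(\<integral>\<^sup>+x. ennreal (?p x) \<partial>lborel) = ennreal l"
      using nn_integral_has_integral_lebesgue[where f = "\<lambda>x. exp (- (1 / l) * x)" and I = l and \<Omega> = "{0..}"] by (simp add: nn_integral_completion mult_ac)
  qed (use l in \<open>auto\<close>)
  then have hb2: "has_bochner_integral lborel (\<lambda>x. ?p (- x)) l"
    using lborel_has_bochner_integral_real_affine_iff[of "-1" ?p l 0] by simp
  have "has_bochner_integral lborel (\<lambda>x. (?p x + ?p (- x)) / (2 * l)) ((l + l) / (2 * l))"
    by (intro has_bochner_integral_divide_zero has_bochner_integral_add hb hb2)
  moreover have "AE x in lborel. (?p x + ?p (- x)) / (2 * l) = Gk l x"
    using AE_lborel_singleton[of 0] by eventually_elim (auto simp: Gk_def indicator_def)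
  moreover have "Gk l \<in> borel_measurable borel" unfolding Gk_def by measurable
  ultimately have "has_bochner_integral lborel (Gk l) ((l + l) / (2 * l))"
    by (subst (asm) has_bochner_integral_cong_AE) auto
  then show "integrable lborel (Gk l)" "(LBINT x. Gk l x) = 1"
    using l by (auto simp: has_bochner_integral_iff)
qed

lemma Gk_shift_integral:
  assumes l: "l > 0"
  shows "integrable lborel (\<lambda>x. Gk l (x - y))" "(LBINT x. Gk l (x - y)) = 1"
  using lborel_integrable_real_affine[OF Gk_integral(1)[OF l], of 1 "-y"]
    lborel_integral_real_affine[of 1 "Gk l" "-y"] Gk_integral(2)[OF l] by simp_all

lemma Gk_measurable [measurable]: "Gk l \<in> borel_measurable borel" unfolding Gk_def by measurable

lemma Gk_nonneg: "l > 0 \<Longrightarrow> 0 \<le> Gk l x" by (simp add: Gk_def)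
lemma Gk_le: "l > 0 \<Longrightarrow> Gk l x \<le> 1 / (2 * l)" by (simp add: Gk_def divide_right_mono)

lemma tail_integral_DERIV:
  fixes k :: "real \<Rightarrow> real"
  assumes c: "\<And>x. isCont k x" and i: "\<And>x. set_integrable lborel {..x} k"
  shows "((\<lambda>x. LBINT y:{..x}. k y) has_real_derivative k x) (at x)"
proof -
  obtain H where H: "\<And>x. (H has_real_derivative k x) (at x)" using antiderivative_real c by metis
  have d: "(LBINT y:{..b}. k y) - (LBINT y:{..a}. k y) = H b - H a" if "a \<le> b" for a b
  proof -
    have u: "{..b} = {..a} \<union> {a..b}" using that by auto
    have "AE x in lborel. \<not> (x \<in> {..a} \<and> x \<in> {a..b})"
      using AE_lborel_singleton[of a] by eventually_elim auto
    from set_integral_Un_AE[OF this _ _ i set_integrable_cont[OF c]]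
    show ?thesis unfolding u using LBINT_FTC[OF that H c] by simp
  qed
  have "(LBINT y:{..b}. k y) = H b + ((LBINT y:{..0}. k y) - H 0)" for b
    using d[of 0 b] d[of b 0] by (cases "0 \<le> b") auto
  then have e: "(\<lambda>x. LBINT y:{..x}. k y) = (\<lambda>b. H b + ((LBINT y:{..0}. k y) - H 0))" by (intro ext)
  show ?thesis unfolding e using H by (auto intro!: derivative_eq_intros)
qed

lemma upper_tail_integral_DERIV:
  fixes k :: "real \<Rightarrow> real"
  assumes c: "\<And>x. isCont k x" and i: "\<And>x. set_integrable lborel {x..} k"
  shows "((\<lambda>x. LBINT y:{x..}. k y) has_real_derivative - k x) (at x)"
proof -
  obtain H where H: "\<And>x. (H has_real_derivative k x) (at x)" using antiderivative_real c by metis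
  have d: "(LBINT y:{a..}. k y) - (LBINT y:{b..}. k y) = H b - H a" if "a \<le> b" for a b
  proof -
    have u: "{a..} = {b..} \<union> {a..b}" using that by auto
    have "AE x in lborel. \<not> (x \<in> {b..} \<and> x \<in> {a..b})"
      using AE_lborel_singleton[of b] by eventually_elim auto
    from set_integral_Un_AE[OF this _ _ i set_integrable_cont[OF c]]
    show ?thesis unfolding u using LBINT_FTC[OF that H c] by simp
  qed
  have "(LBINT y:{b..}. k y) = ((LBINT y:{0..}. k y) + H 0) - H b" for b
    using d[of 0 b] d[of b 0] by (cases "0 \<le> b") auto
  then have e: "(\<lambda>x. LBINT y:{x..}. k y) = (\<lambda>b. ((LBINT y:{0..}. k y) + H 0) - H b)" by (intro ext)
  show ?thesis unfolding e using H by (auto intro!: derivative_eq_intros)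
qed

text \<open>The potential \<open>P = (l\<^sup>2/2) Gk l * h\<close> solves \<open>P - l\<^sup>2 P'' = l\<^sup>2 h / 2\<close>.\<close>
lemma potential_derivs:
  fixes h :: "real \<Rightarrow> real"
  assumes c: "\<And>x. isCont h x" and h0: "\<And>x. 0 \<le> h x" and i: "integrable lborel h" and l: "0 < l"
    and P: "\<And>x. P x = 1/2 * l\<^sup>2 * conv (Gk l) h x"
  obtains P1 where "\<And>x. 0 \<le> P x" "\<And>x. (P has_real_derivative P1 x) (at x)"
    "\<And>x. (P1 has_real_derivative P x / l\<^sup>2 - h x / 2) (at x)" "\<And>x. \<bar>P1 x\<bar> \<le> P x / l"
proof -
  let ?ka = "\<lambda>y. exp (y / l) * h y" and ?kb = "\<lambda>y. exp (- y / l) * h y"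
  \<comment> \<open>Split at \<open>x\<close>, the convolution consists of two tail integrals with
    exponential weights. Each is differentiated by the fundamental theorem, which avoids
    differentiating the kernel at its corner.\<close>
  define a where "a x = (LBINT y:{..x}. ?ka y)" for x
  define b where "b x = (LBINT y:{x..}. ?kb y)" for x
  have hm[measurable]: "h \<in> borel_measurable borel" by (rule isCont_borel[OF c])
  have ia: "set_integrable lborel {..x} ?ka" for x
    unfolding set_integrable_def
  proof (rule Bochner_Integration.integrable_bound)
    show "integrable lborel (\<lambda>y. exp (x / l) * h y)" using i by simp
    show "AE y in lborel. norm (indicat_real {..x} y *\<^sub>R (exp (y / l) * h y)) \<le> norm (exp (x / l) * h y)"
      using h0 l by (intro AE_I2) (auto split: split_indicator simp: abs_mult divide_right_mono intro!: mult_right_mono)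
  qed measurable
  have ib: "set_integrable lborel {x..} ?kb" for x
    unfolding set_integrable_def
  proof (rule Bochner_Integration.integrable_bound)
    show "integrable lborel (\<lambda>y. exp (- x / l) * h y)" using i by simp
    show "AE y in lborel. norm (indicat_real {x..} y *\<^sub>R (exp (- y / l) * h y)) \<le> norm (exp (- x / l) * h y)"
      using h0 l by (intro AE_I2) (auto split: split_indicator simp: abs_mult divide_right_mono intro!: mult_right_mono)
  qed measurable
  have Da: "(a has_real_derivative ?ka x) (at x)" for x
    unfolding a_def using c l by (intro tail_integral_DERIV ia) (auto intro!: continuous_intros)
  have Db: "(b has_real_derivative - ?kb x) (at x)" for x
    unfolding b_def using c l by (intro upper_tail_integral_DERIV ib) (auto intro!: continuous_intros)
  have a0: "0 \<le> a x" and b0: "0 \<le> b x" for x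
    unfolding a_def b_def set_lebesgue_integral_def using h0 by (auto intro!: integral_nonneg_AE)
  have cv: "conv (Gk l) h x = (exp (- x / l) * a x + exp (x / l) * b x) / (2 * l)" for x
  proof -
    have "conv (Gk l) h x = (LBINT y. exp (- x / l) / (2 * l) * (indicator {..x} y * ?ka y)
        + exp (x / l) / (2 * l) * (indicator {x..} y * ?kb y))"
      unfolding conv_def
    proof (rule integral_cong_AE)
      show "AE y in lborel. Gk l (x - y) * h y = exp (- x / l) / (2 * l) * (indicator {..x} y * ?ka y)
        + exp (x / l) / (2 * l) * (indicator {x..} y * ?kb y)"
        using AE_lborel_singleton[of x]
      proof eventually_elim
        case (elim y)
        show ?case
        proof (cases "y < x")
          case True
          have "exp (- \<bar>x - y\<bar> / l) = exp (- x / l) * exp (y / l)"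
            using True by (simp add: exp_add[symmetric] diff_divide_distrib)
          then show ?thesis using True by (simp add: Gk_def)
        next
          case False
          have "exp (- \<bar>x - y\<bar> / l) = exp (x / l) * exp (- y / l)"
            using False by (simp add: exp_add[symmetric] diff_divide_distrib)
          then show ?thesis using False elim by (simp add: Gk_def)
        qed
      qed
    qed measurable
    also have "\<dots> = exp (- x / l) / (2 * l) * a x + exp (x / l) / (2 * l) * b x"
      using ia[of x] ib[of x] unfolding set_integrable_def a_def b_def set_lebesgue_integral_def by simp
    finally show ?thesis by (simp add: add_divide_distrib)
  qed
  have Pe: "P x = l / 4 * (exp (- x / l) * a x + exp (x / l) * b x)" for x
    unfolding P cv using l by (simp add: power2_eq_square)
  define P1 where "P1 x = 1 / 4 * (exp (x / l) * b x - exp (- x / l) * a x)" for x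
  have ee: "exp (- x / l) * exp (x / l) = 1" for x by (simp add: exp_add[symmetric])
  have e1: "((\<lambda>x. exp (- x / l)) has_real_derivative exp (- x / l) * (- 1 / l)) (at x)"
    and e2: "((\<lambda>x. exp (x / l)) has_real_derivative exp (x / l) * (1 / l)) (at x)" for x
    using l by (auto intro!: derivative_eq_intros)
  note Ea = DERIV_mult[OF e1 Da] and Eb = DERIV_mult[OF e2 Db]
  have D: "(P has_real_derivative P1 x) (at x)" for x
  proof -
    have "l / 4 * (E * (- 1 / l) * a x + (F * h x) * E + (F * (1 / l) * b x + - (E * h x) * F))
      = 1 / 4 * (F * b x - E * a x)" for E F using l by (simp add: field_simps)
    from this[of "exp (- x / l)" "exp (x / l)"] have "((\<lambda>x. l / 4 * (exp (- x / l) * a x + exp (x / l) * b x)) has_real_derivative P1 x) (at x)"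
      using DERIV_cmult[OF DERIV_add[OF Ea Eb], of "l / 4" x] unfolding P1_def by presburger
    then show ?thesis using Pe by presburger
  qed
  have D1: "(P1 has_real_derivative P x / l\<^sup>2 - h x / 2) (at x)" for x
  proof -
    have "1 / 4 * ((F * (1 / l) * b x + - (E * h x) * F) - (E * (- 1 / l) * a x + (F * h x) * E))
      = l / 4 * (E * a x + F * b x) / l\<^sup>2 - h x / 2" if "E * F = 1" for E F
    proof -
      have "- (E * h x) * F = - h x" "(F * h x) * E = h x" using that by algebra+
      then show ?thesis using l by (simp add: field_simps power2_eq_square)
    qed
    from this[OF ee[of x]] 
    have "((\<lambda>x. 1 / 4 * (exp (x / l) * b x - exp (- x / l) * a x)) has_real_derivative P x / l\<^sup>2 - h x / 2) (at x)"
      using DERIV_cmult[OF DERIV_diff[OF Eb Ea], of "1 / 4" x] unfolding Pe by presburger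
    then show ?thesis unfolding P1_def[abs_def] .
  qed
  \<comment> \<open>\<open>P x / l\<close> and \<open>P1 x\<close> are a quarter of the sum and of
    the difference of the same two nonnegative quantities.\<close>
  have "\<bar>P1 x\<bar> \<le> P x / l" for x
  proof -
    have "P x / l = 1 / 4 * (exp (- x / l) * a x + exp (x / l) * b x)" unfolding Pe using l by simp
    moreover have "0 \<le> exp (- x / l) * a x" "0 \<le> exp (x / l) * b x" using a0 b0 by auto
    moreover have "\<bar>1 / 4 * (Y - X)\<bar> \<le> 1 / 4 * (X + Y)" if "0 \<le> X" "0 \<le> Y" for X Y :: real
      using that by (intro abs_leI) (simp_all add: field_simps)
    ultimately show ?thesis unfolding P1_def by presburger
  qed
  moreover have "0 \<le> P x" for x unfolding Pe using l a0 b0 by simp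
  ultimately show ?thesis using that D D1 by blast
qed

text \<open>Fubini moves the convolution from \<open>h\<close> onto the weight. The weight 1 yields
  the mass of \<open>P\<close>; for the weight of Jensen's inequality it remains to study the kernel
  centred at a fixed \<open>y\<close>.\<close>

lemma potential_integral:
  fixes h \<phi> :: "real \<Rightarrow> real"
  assumes h: "h \<in> borel_measurable borel" "\<And>x. 0 \<le> h x" "integrable lborel h" and l: "0 < l"
    and \<phi>: "\<phi> \<in> borel_measurable borel" "\<And>x. \<bar>\<phi> x\<bar> \<le> 1"
    and P: "\<And>x. P x = 1/2 * l\<^sup>2 * conv (Gk l) h x"
  shows "integrable lborel (\<lambda>x. P x * \<phi> x)"
    "(LBINT x. P x * \<phi> x) = 1/2 * l\<^sup>2 * (LBINT y. h y * (LBINT x. Gk l (x - y) * \<phi> x))"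
    "integrable lborel (\<lambda>y. h y * (LBINT x. Gk l (x - y) * \<phi> x))"
proof -
  note [measurable] = h(1) \<phi>(1)
  have e: "(LBINT x. Gk l (x - y) * h y * \<phi> x) = h y * (LBINT x. Gk l (x - y) * \<phi> x)" for y
    unfolding integral_mult_right_zero[symmetric] by (simp add: mult_ac)
  have e': "(LBINT y. Gk l (x - y) * h y * \<phi> x) = conv (Gk l) h x * \<phi> x" for x
    unfolding conv_def integral_mult_left_zero[symmetric] by simp
  have "integrable (lborel \<Otimes>\<^sub>M lborel) (\<lambda>z. Gk l (snd z - fst z) * h (fst z))"
  proof (rule lborel_pair.Fubini_integrable)
    have "(LBINT x. norm (Gk l (x - y) * h y)) = h y" for y
      using Gk_shift_integral[OF l, of y] h(2)[of y] Gk_nonneg[OF l] by (simp add: abs_mult)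
    then show "integrable lborel (\<lambda>y. LBINT x. norm (Gk l (snd (y, x) - fst (y, x)) * h (fst (y, x))))"
      using h(3) by simp
    show "AE y in lborel. integrable lborel (\<lambda>x. Gk l (snd (y, x) - fst (y, x)) * h (fst (y, x)))"
      using Gk_shift_integral(1)[OF l] by (intro AE_I2) simp
  qed measurable
  then have "integrable (lborel \<Otimes>\<^sub>M lborel) (\<lambda>z. Gk l (snd z - fst z) * h (fst z) * \<phi> (snd z))"
    by (rule Bochner_Integration.integrable_bound)
      (use \<phi>(2) in \<open>auto intro!: AE_I2 mult_left_le simp: abs_mult\<close>)
  then have I: "integrable (lborel \<Otimes>\<^sub>M lborel) (\<lambda>(y, x). Gk l (x - y) * h y * \<phi> x)"
    by (simp add: case_prod_unfold)
  have i1: "integrable lborel (\<lambda>x. conv (Gk l) h x * \<phi> x)"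
    using lborel_pair.integrable_snd[OF I] by (simp only: e')
  then have "integrable lborel (\<lambda>x. 1/2 * l\<^sup>2 * (conv (Gk l) h x * \<phi> x))" by (rule integrable_mult_right)
  then show "integrable lborel (\<lambda>x. P x * \<phi> x)" unfolding P by (simp add: mult.assoc)
  have "(LBINT x. P x * \<phi> x) = 1/2 * l\<^sup>2 * (LBINT x. conv (Gk l) h x * \<phi> x)"
    unfolding P by (simp add: mult.assoc)
  also have "(LBINT x. conv (Gk l) h x * \<phi> x) = (LBINT y. h y * (LBINT x. Gk l (x - y) * \<phi> x))"
    using lborel_pair.Fubini_integral[OF I] by (simp only: e e')
  finally show "(LBINT x. P x * \<phi> x) = 1/2 * l\<^sup>2 * (LBINT y. h y * (LBINT x. Gk l (x - y) * \<phi> x))" .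
  show "integrable lborel (\<lambda>y. h y * (LBINT x. Gk l (x - y) * \<phi> x))"
    using lborel_pair.integrable_fst[OF I] by (simp only: e)
qed

text \<open>The convex function \<open>(1 + t)^(-2)\<close> lies above its tangent at
  \<open>m\<close>. With \<open>u = 1 + t\<close> and \<open>v = 1 + m\<close> this is
  \<open>(v - u)^2 (v + 2 u) \<ge> 0\<close>.\<close>

lemma convex_tangent:
  fixes t m :: real
  assumes "0 \<le> t" "0 \<le> m"
  shows "1 / (1 + m)\<^sup>2 - 2 * (t - m) / (1 + m)^3 \<le> 1 / (1 + t)\<^sup>2"
proof -
  define u v where "u = 1 + t" and "v = 1 + m"
  have uv: "u > 0" "v > 0" using assms by (auto simp: u_def v_def)
  have "0 \<le> (v - u)\<^sup>2 * (v + 2 * u)" using uv by simp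
  then have "(3 * v - 2 * u) * u\<^sup>2 \<le> v ^ 3" by (simp add: power2_eq_square power3_eq_cube algebra_simps)
  then have "(3 * v - 2 * u) / v ^ 3 \<le> 1 / u\<^sup>2" using uv by (simp add: field_simps)
  moreover have "1 / v\<^sup>2 - 2 * (u - v) / v ^ 3 = (3 * v - 2 * u) / v ^ 3"
    using uv by (simp add: field_simps power2_eq_square power3_eq_cube)
  ultimately show ?thesis by (simp add: u_def v_def)
qed

text \<open>Jensen's inequality for the probability density \<open>Gk l (\<cdot> - y)\<close>, in tangent-line form.\<close>
lemma potential_jensen:
  fixes h q :: "real \<Rightarrow> real"
  assumes h: "h \<in> borel_measurable borel" "\<And>x. 0 \<le> h x" "integrable lborel h" and l: "0 < l"
    and P: "\<And>x. P x = 1/2 * l\<^sup>2 * conv (Gk l) h x"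
    and q: "q \<in> borel_measurable borel" "integrable lborel (\<lambda>x. \<bar>q x\<bar>)" "(LBINT x. \<bar>q x\<bar>) \<le> K"
  shows "1 / (1 + K / 2)\<^sup>2 * (LBINT x. P x) \<le> (LBINT x. P x * (1 / (1 + l * \<bar>q x\<bar>)\<^sup>2))"
    "integrable lborel P"
proof -
  note [measurable] = h(1) q(1)
  let ?s = "\<lambda>x. 1 / (1 + l * \<bar>q x\<bar>)\<^sup>2" and ?m = "K / 2"
  have s1: "\<bar>?s x\<bar> \<le> 1" for x
  proof -
    have "1\<^sup>2 \<le> (1 + l * \<bar>q x\<bar>)\<^sup>2" using l by (intro power_mono) auto
    then have "1 \<le> (1 + l * \<bar>q x\<bar>)\<^sup>2" by simp
    then show ?thesis by (simp add: divide_le_eq_1)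
  qed
  have K: "0 \<le> K" using q(3) by (rule order_trans[rotated]) simp
  have one: "integrable lborel (\<lambda>x. P x * 1)" 
    "(LBINT x. P x * 1) = 1/2 * l\<^sup>2 * (LBINT y. h y * (LBINT x. Gk l (x - y) * 1))"
    by (rule potential_integral(1)[OF h l _ _ P] potential_integral(2)[OF h l _ _ P]; simp)+
  show "integrable lborel P" using one(1) by simp
  have G: "1 / (1 + ?m)\<^sup>2 \<le> (LBINT x. Gk l (x - y) * ?s x)" for y
  proof -
    have gi: "integrable lborel (\<lambda>x. Gk l (x - y))" by (rule Gk_shift_integral[OF l])
    have gq: "integrable lborel (\<lambda>x. Gk l (x - y) * \<bar>q x\<bar>)"
    proof (rule Bochner_Integration.integrable_bound)
      show "integrable lborel (\<lambda>x. 1 / (2 * l) * \<bar>q x\<bar>)" using q(2) by simp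
      show "AE x in lborel. norm (Gk l (x - y) * \<bar>q x\<bar>) \<le> norm (1 / (2 * l) * \<bar>q x\<bar>)"
        using mult_right_mono[OF Gk_le[OF l] abs_ge_zero] Gk_nonneg[OF l] l by (intro AE_I2) (auto simp: abs_mult)
    qed measurable
    have gs: "integrable lborel (\<lambda>x. Gk l (x - y) * ?s x)"
      by (rule Bochner_Integration.integrable_bound[OF gi])
        (measurable, intro AE_I2, simp only: real_norm_def abs_mult, rule mult_left_le[OF _ abs_ge_zero], rule s1)
    \<comment> \<open>The kernel is at most \<open>1 / (2 * l)\<close>, which cancels the factor
      \<open>l\<close>: the mean of \<open>l * \<bar>q\<bar>\<close> is at most \<open>K / 2\<close>
      for every \<open>l\<close>.\<close>
    have "l * (LBINT x. Gk l (x - y) * \<bar>q x\<bar>) \<le> l * (LBINT x. 1 / (2 * l) * \<bar>q x\<bar>)"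
      using gq q(2) Gk_le[OF l] l by (intro mult_left_mono integral_mono mult_right_mono) auto
    also have "\<dots> \<le> ?m" using q l by simp
    finally have m: "l * (LBINT x. Gk l (x - y) * \<bar>q x\<bar>) \<le> ?m" .
    have "1 / (1 + ?m)\<^sup>2 \<le> 1 / (1 + ?m)\<^sup>2 - 2 * (l * (LBINT x. Gk l (x - y) * \<bar>q x\<bar>) - ?m) / (1 + ?m)^3"
      using m K by (simp add: divide_nonpos_nonneg)
    also have "\<dots> = (1 / (1 + ?m)\<^sup>2 + 2 * ?m / (1 + ?m)^3) * (LBINT x. Gk l (x - y))
       - 2 * l / (1 + ?m)^3 * (LBINT x. Gk l (x - y) * \<bar>q x\<bar>)"
      unfolding Gk_shift_integral[OF l] by (simp add: diff_divide_distrib right_diff_distrib)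
    also have "\<dots> = (LBINT x. (1 / (1 + ?m)\<^sup>2 + 2 * ?m / (1 + ?m)^3) * Gk l (x - y)
       - 2 * l / (1 + ?m)^3 * (Gk l (x - y) * \<bar>q x\<bar>))" using gi gq by simp
    also have "\<dots> \<le> (LBINT x. Gk l (x - y) * ?s x)"
    proof (rule integral_mono[OF _ gs])
      fix x
      have "Gk l (x - y) * (1 / (1 + ?m)\<^sup>2 - 2 * (l * \<bar>q x\<bar> - ?m) / (1 + ?m)^3) \<le> Gk l (x - y) * ?s x"
        using convex_tangent[of "l * \<bar>q x\<bar>" ?m] l K Gk_nonneg[OF l] by (intro mult_left_mono) auto
      then show "(1 / (1 + ?m)\<^sup>2 + 2 * ?m / (1 + ?m)^3) * Gk l (x - y) - 2 * l / (1 + ?m)^3 * (Gk l (x - y) * \<bar>q x\<bar>)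
        \<le> Gk l (x - y) * ?s x"
        by (simp add: algebra_simps diff_divide_distrib)
    qed (use gi gq in simp)
    finally show ?thesis .
  qed
  have "1 / (1 + ?m)\<^sup>2 * (LBINT x. P x) = 1/2 * l\<^sup>2 * (LBINT y. h y * (1 / (1 + ?m)\<^sup>2))"
  proof -
    have "(LBINT x. P x) = 1/2 * l\<^sup>2 * (LBINT y. h y)"
      using one(2) Gk_shift_integral(2)[OF l] by simp
    then show ?thesis unfolding integral_mult_left_zero by (simp only: mult_ac)
  qed
  also have "\<dots> \<le> 1/2 * l\<^sup>2 * (LBINT y. h y * (LBINT x. Gk l (x - y) * ?s x))"
    using G h by (intro mult_left_mono integral_mono potential_integral(3)[where P = P] l P s1) auto
  also have "\<dots> = (LBINT x. P x * ?s x)"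
    by (rule potential_integral(2)[symmetric]) (use h l P s1 in auto)
  finally show "1 / (1 + K / 2)\<^sup>2 * (LBINT x. P x) \<le> (LBINT x. P x * ?s x)" .
qed

section \<open>A priori estimates\<close>

lemma DERIV_Icc_le:
  fixes G :: "real \<Rightarrow> real"
  assumes D: "\<And>s. a \<le> s \<Longrightarrow> s \<le> b \<Longrightarrow> (G has_real_derivative G' s) (at s within {a..b})"
    and le: "\<And>s. a < s \<Longrightarrow> s < b \<Longrightarrow> G' s \<le> k" and ab: "a \<le> b"
  shows "G b - G a \<le> k * (b - a)"
proof -
  have "(\<lambda>s. G s - k * s) b \<le> (\<lambda>s. G s - k * s) a"
  proof (rule DERIV_nonpos_imp_decreasing_open[OF ab])
    fix s assume s: "a < s" "s < b"
    have "at s within {a..b} = at s" using s by (intro at_within_interior) (simp add: interior_atLeastAtMost_real)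
    then have "((\<lambda>s. G s - k * s) has_real_derivative G' s - k) (at s)"
      using D[of s] s by (auto intro!: derivative_eq_intros)
    then show "\<exists>y. ((\<lambda>s. G s - k * s) has_real_derivative y) (at s) \<and> y \<le> 0" using le[OF s] by force
  next
    have "continuous (at s within {a..b}) G" if "s \<in> {a..b}" for s
      using D[of s] that by (intro DERIV_continuous) auto
    then have "continuous_on {a..b} G" by (simp add: continuous_on_eq_continuous_within)
    then show "continuous_on {a..b} (\<lambda>s. G s - k * s)" by (intro continuous_intros)
  qed
  then show ?thesis by (simp add: algebra_simps)
qed

lemma within_DERIV_le:
  fixes G :: "real \<Rightarrow> real"
  assumes D: "\<And>s. a \<le> s \<Longrightarrow> s \<le> b \<Longrightarrow> (G has_real_derivative G' s) (at s within {0..})"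
    and le: "\<And>s. a < s \<Longrightarrow> s < b \<Longrightarrow> G' s \<le> k" and ab: "0 \<le> a" "a \<le> b"
  shows "G b - G a \<le> k * (b - a)"
  by (rule DERIV_Icc_le[OF DERIV_subset[OF D] le ab(2)]) (use ab in auto)

lemma integrable_abs_if_LBINT_bounded:
  fixes g :: "real \<Rightarrow> real"
  assumes c: "\<And>x. isCont g x" and b: "\<And>n. (LBINT x:{-real n..real n}. \<bar>g x\<bar>) \<le> K"
  shows "integrable lborel (\<lambda>x. \<bar>g x\<bar>)" "(LBINT x. \<bar>g x\<bar>) \<le> K"
proof -
  let ?s = "\<lambda>n x. indicator {-real n..real n} x * \<bar>g x\<bar>"
  have gm[measurable]: "g \<in> borel_measurable borel" by (rule isCont_borel[OF c])
  have si: "integrable lborel (?s n)" for n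
    using set_integrable_cont[of "\<lambda>x. \<bar>g x\<bar>" "-real n" "real n"] c by (auto simp: set_integrable_def intro!: continuous_intros)
  have sb: "(LBINT x. ?s n x) \<le> K" for n using b[of n] by (simp add: set_lebesgue_integral_def)
  have mono: "?s m x \<le> ?s n x" if "m \<le> n" for m n x using that by (auto split: split_indicator)
  have inc: "incseq (\<lambda>n. LBINT x. ?s n x)"
    unfolding incseq_def by (intro allI impI integral_mono si mono)
  obtain L where L: "(\<lambda>n. LBINT x. ?s n x) \<longlonglongrightarrow> L"
    using incseq_convergent[OF inc, of K] sb by blast
  have lim: "(\<lambda>n. ?s n x) \<longlonglongrightarrow> \<bar>g x\<bar>" for x
  proof (rule tendsto_eventually)
    obtain N where N: "\<bar>x\<bar> \<le> real N" using real_arch_simple by blast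
    have "x \<in> {-real n..real n}" if "n \<ge> N" for n using N that by auto
    then show "\<forall>\<^sub>F n in sequentially. ?s n x = \<bar>g x\<bar>"
      by (auto simp: eventually_sequentially indicator_def intro!: exI[of _ N])
  qed
  have am: "AE x in lborel. mono (\<lambda>n. ?s n x)" using mono by (intro AE_I2 monoI) blast
  show i: "integrable lborel (\<lambda>x. \<bar>g x\<bar>)"
    by (rule integrable_monotone_convergence[OF si am _ L]) (use lim in auto)
  have "(LBINT x. \<bar>g x\<bar>) = L"
    by (rule integral_monotone_convergence[OF si am _ L]) (use lim in auto)
  then show "(LBINT x. \<bar>g x\<bar>) \<le> K" using LIMSEQ_le_const2[OF L] sb by blast
qed

lemma LINT_nonpos:
  fixes g :: "real \<Rightarrow> real"
  assumes "\<And>x. g x \<le> 0" shows "(LBINT x. g x) \<le> 0"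
  using integral_nonneg_AE[of "\<lambda>x. - g x" lborel] assms by simp

lemma LBINT_le_LINT:
  fixes g h :: "real \<Rightarrow> real"
  assumes "\<And>x. isCont g x" "integrable lborel h" "\<And>x. x \<in> {a..b} \<Longrightarrow> g x \<le> h x" "\<And>x. 0 \<le> h x"
  shows "(LBINT x:{a..b}. g x) \<le> (LBINT x. h x)"
  unfolding set_lebesgue_integral_def
proof (rule integral_mono)
  show "integrable lborel (\<lambda>x. indicat_real {a..b} x *\<^sub>R g x)"
    using set_integrable_cont[OF assms(1)] by (simp add: set_integrable_def)
  show "indicat_real {a..b} x *\<^sub>R g x \<le> h x" for x using assms(3,4) by (auto split: split_indicator)
qed (rule assms(2))

lemma LBINT_mono_interval:
  fixes g :: "real \<Rightarrow> real"
  assumes "\<And>x. isCont g x" "\<And>x. 0 \<le> g x" "a' \<le> a" "b \<le> b'"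
  shows "(LBINT x:{a..b}. g x) \<le> (LBINT x:{a'..b'}. g x)"
  unfolding set_lebesgue_integral_def
proof (rule integral_mono)
  show "integrable lborel (\<lambda>x. indicat_real {a..b} x *\<^sub>R g x)" "integrable lborel (\<lambda>x. indicat_real {a'..b'} x *\<^sub>R g x)"
    using set_integrable_cont[OF assms(1)] by (simp_all add: set_integrable_def)
  show "indicat_real {a..b} x *\<^sub>R g x \<le> indicat_real {a'..b'} x *\<^sub>R g x" for x
    using assms(2-4) by (auto split: split_indicator)
qed

lemma chi_eq: "0 < eps \<Longrightarrow> chi eps q = (max 0 (- q - 1 / eps))\<^sup>2"
  by (auto simp: chi_def max_def power2_eq_square algebra_simps)

lemma chi_bounds:
  assumes "0 < eps" shows "0 \<le> chi eps q" "chi eps q \<le> q\<^sup>2" "0 \<le> q \<Longrightarrow> chi eps q = 0"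
proof -
  show "0 \<le> chi eps q" by (simp add: chi_def)
  have "0 < 1 / eps" using assms by simp
  then show "chi eps q = 0" if "0 \<le> q"
  proof -
    have "- q - 1 / eps \<le> 0" using that \<open>0 < 1 / eps\<close> by linarith
    then show ?thesis unfolding chi_eq[OF assms] by (simp only: max_absorb1) simp
  qed
  have "(max 0 (- q - 1 / eps))\<^sup>2 \<le> \<bar>q\<bar>\<^sup>2"
    by (intro power_mono) (use \<open>0 < 1 / eps\<close> in linarith)+
  then show "chi eps q \<le> q\<^sup>2" unfolding chi_eq[OF assms] by simp
qed

text \<open>An approximate solution in classical form: \<open>q\<close> and \<open>p\<close> are the
  space derivatives of \<open>U\<close>, \<open>V\<close> its time derivative, \<open>r\<close> the
  derivative of \<open>V\<close> in space and of \<open>q\<close> in time, \<open>P\<close> the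
  potential and \<open>P1\<close> its slope. That \<open>P\<close> is a convolution enters only
  through its sign, its elliptic equation \<open>P1D\<close>, the slope bound \<open>P1b\<close>,
  its integrability and Jensen's inequality \<open>Pj\<close>.\<close>

locale rb_approx =
  fixes f f1 f2 :: "real \<Rightarrow> real" and l eps c C :: real and U q p V r P P1 :: "real \<Rightarrow> real \<Rightarrow> real"
  assumes f1: "\<And>x. (f has_real_derivative f1 x) (at x)"
    and f2: "\<And>x. (f1 has_real_derivative f2 x) (at x)" and f2c: "\<And>x. isCont f2 x"
    and f2b: "\<And>x. c \<le> f2 x" "\<And>x. f2 x \<le> C" and c0: "0 < c" and l0: "0 < l" and eps0: "0 < eps"
    and Uq: "\<And>t x. 0 \<le> t \<Longrightarrow> (U t has_real_derivative q t x) (at x)"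
    and qp: "\<And>t x. 0 \<le> t \<Longrightarrow> (q t has_real_derivative p t x) (at x)"
    and pc: "\<And>t x. 0 \<le> t \<Longrightarrow> isCont (p t) x"
    and Vr: "\<And>t x. 0 \<le> t \<Longrightarrow> (V t has_real_derivative r t x) (at x)"
    and rc: "\<And>t x. 0 \<le> t \<Longrightarrow> isCont (r t) x"
    and U2: "\<And>t. 0 \<le> t \<Longrightarrow> integrable lborel (\<lambda>x. (U t x)\<^sup>2)"
    and q2: "\<And>t. 0 \<le> t \<Longrightarrow> integrable lborel (\<lambda>x. (q t x)\<^sup>2)"
    and p2: "\<And>t. 0 \<le> t \<Longrightarrow> integrable lborel (\<lambda>x. (p t x)\<^sup>2)"
    and V2: "\<And>t. 0 \<le> t \<Longrightarrow> integrable lborel (\<lambda>x. (V t x)\<^sup>2)"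
    and r2: "\<And>t. 0 \<le> t \<Longrightarrow> integrable lborel (\<lambda>x. (r t x)\<^sup>2)"
    and P0: "\<And>t x. 0 \<le> t \<Longrightarrow> 0 \<le> P t x"
    and PP1: "\<And>t x. 0 \<le> t \<Longrightarrow> (P t has_real_derivative P1 t x) (at x)"
    and P1D: "\<And>t x. 0 \<le> t \<Longrightarrow> (P1 t has_real_derivative
        P t x / l\<^sup>2 - f2 (U t x) * ((q t x)\<^sup>2 + chi eps (q t x)) / 2) (at x)"
    and P1b: "\<And>t x. 0 \<le> t \<Longrightarrow> \<bar>P1 t x\<bar> \<le> P t x / l"
    and Pi: "\<And>t. 0 \<le> t \<Longrightarrow> integrable lborel (P t)"
    and Pj: "\<And>t K. 0 \<le> t \<Longrightarrow> integrable lborel (\<lambda>x. \<bar>q t x\<bar>) \<Longrightarrow> (LBINT x. \<bar>q t x\<bar>) \<le> K \<Longrightarrow>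
        1 / (1 + K / 2)\<^sup>2 * (LBINT x. P t x) \<le> (LBINT x. P t x * (1 / (1 + l * \<bar>q t x\<bar>)\<^sup>2))"
    and eq: "\<And>t x. 0 \<le> t \<Longrightarrow> V t x = - (f1 (U t x) * q t x + P1 t x)"
    and UV: "\<And>s. 0 \<le> s \<Longrightarrow> ((\<lambda>t. LBINT x. ((U t x - U s x) / (t - s) - V s x)\<^sup>2) \<longlongrightarrow> 0) (at s within {0..})"
    and qr: "\<And>s. 0 \<le> s \<Longrightarrow> ((\<lambda>t. LBINT x. ((q t x - q s x) / (t - s) - r s x)\<^sup>2) \<longlongrightarrow> 0) (at s within {0..})"
    and Uc: "continuous_on ({0..} \<times> UNIV) (\<lambda>z. U (fst z) (snd z))"
    and Vc: "continuous_on ({0..} \<times> UNIV) (\<lambda>z. V (fst z) (snd z))"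
    and Ut: "\<And>s x. 0 \<le> s \<Longrightarrow> ((\<lambda>t. U t x) has_real_derivative V s x) (at s within {0..})"
begin

lemma C0: "0 < C" using f2b[of 0] c0 by linarith
lemma f2_nonneg: "0 \<le> f2 x" using f2b[of x] c0 by linarith
lemma f1_cont: "isCont f1 x" and f_cont: "isCont f x" using f1 f2 DERIV_isCont by blast+

context
  fixes t :: real assumes t: "0 \<le> t"
begin

lemma U_cont: "isCont (U t) x" and q_cont: "isCont (q t) x" and V_cont: "isCont (V t) x"
  and P_cont: "isCont (P t) x" and P1_cont: "isCont (P1 t) x"
  using Uq[OF t] qp[OF t] Vr[OF t] PP1[OF t] P1D[OF t] DERIV_isCont by blast+

lemma meas [measurable]: "U t \<in> borel_measurable borel" "q t \<in> borel_measurable borel" 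
  "p t \<in> borel_measurable borel" "V t \<in> borel_measurable borel" "r t \<in> borel_measurable borel"
  "P t \<in> borel_measurable borel" "P1 t \<in> borel_measurable borel"
  using U_cont q_cont V_cont P_cont P1_cont pc[OF t] rc[OF t] isCont_borel by blast+

text \<open>Differentiate \<open>eq\<close> in space and eliminate the slope of \<open>P1\<close> by
  the elliptic equation. Half of the quadratic term survives as Riccati damping, and
  \<open>chi eps\<close> switches it off partially where \<open>q\<close> is very negative.\<close>

lemma r_eq: "r t x = - (f1 (U t x) * p t x + f2 (U t x) * ((q t x)\<^sup>2 - chi eps (q t x)) / 2 + P t x / l\<^sup>2)"
proof -
  have "((\<lambda>x. - (f1 (U t x) * q t x + P1 t x)) has_real_derivative
     - (f1 (U t x) * p t x + f2 (U t x) * q t x * q t x + (P t x / l\<^sup>2 - f2 (U t x) * ((q t x)\<^sup>2 + chi eps (q t x)) / 2))) (at x)"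
    by (rule derivative_eq_intros DERIV_chain2[OF f2 Uq[OF t]] qp[OF t] P1D[OF t] refl)+ (simp add: algebra_simps)
  moreover have "V t = (\<lambda>x. - (f1 (U t x) * q t x + P1 t x))" using eq[OF t] by (intro ext)
  ultimately have "r t x = - (f1 (U t x) * p t x + f2 (U t x) * q t x * q t x + (P t x / l\<^sup>2 - f2 (U t x) * ((q t x)\<^sup>2 + chi eps (q t x)) / 2))"
    using DERIV_unique Vr[OF t] by metis
  then show ?thesis by (simp add: power2_eq_square field_simps)
qed

text \<open>A qualitative bound from Sobolev's inequality at one time, with no uniformity claimed;
  it serves integrability only.\<close>

lemma bounded_sup: obtains B where "\<And>x. \<bar>U t x\<bar> \<le> B" "\<And>x. \<bar>q t x\<bar> \<le> B" "\<And>x. \<bar>f1 (U t x)\<bar> \<le> B" "0 \<le> B"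
proof -
  define B1 where "B1 = sqrt ((LBINT x. (U t x)\<^sup>2) + (LBINT x. (q t x)\<^sup>2))"
  define B2 where "B2 = sqrt ((LBINT x. (q t x)\<^sup>2) + (LBINT x. (p t x)\<^sup>2))"
  have B1: "\<bar>U t x\<bar> \<le> B1" for x unfolding B1_def
    by (rule real_le_rsqrt) (use sobolev_sup[OF Uq[OF t] q_cont U2[OF t] q2[OF t]] in simp)
  have B2: "\<bar>q t x\<bar> \<le> B2" for x unfolding B2_def
    by (rule real_le_rsqrt) (use sobolev_sup[OF qp[OF t] pc[OF t] q2[OF t] p2[OF t]] in simp)
  have "compact (f1 ` {-B1..B1})" using f1_cont
    by (intro compact_continuous_image continuous_at_imp_continuous_on) auto
  then obtain B3 where B3: "\<And>x. x \<in> {-B1..B1} \<Longrightarrow> \<bar>f1 x\<bar> \<le> B3"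
    by (meson compact_imp_bounded bounded_real imageI)
  have "\<bar>f1 (U t x)\<bar> \<le> B3" for x using B1[of x] by (intro B3) (auto simp: abs_le_iff)
  then show ?thesis using B1 B2 order_trans[OF abs_ge_zero B1[of 0]]
    by (intro that[of "max B1 (max B2 B3)"]) (auto simp: le_max_iff_disj)
qed

text \<open>Multiply the equation for \<open>q\<close> by \<open>S'(q)\<close> and integrate \<open>(f'(U) S(q))_x\<close> away.\<close>
lemma balance:
  assumes S: "quad_approx S S' B" "S 0 = 0" "S' 0 = 0"
  defines "R \<equiv> \<lambda>x. f2 (U t x) * (q t x * S (q t x) - S' (q t x) * ((q t x)\<^sup>2 - chi eps (q t x)) / 2) - S' (q t x) * P t x / l\<^sup>2"
  shows "integrable lborel R" "(LBINT x. S' (q t x) * r t x) = (LBINT x. R x)"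
proof -
  obtain B0 where B0: "\<And>x. \<bar>q t x\<bar> \<le> B0" "\<And>x. \<bar>f1 (U t x)\<bar> \<le> B0" "0 \<le> B0" using bounded_sup by metis
  have B: "0 \<le> B" using S(1) by (simp add: quad_approx_def)
  note Sb = quad_approx_bounds[OF S]
  have [measurable]: "S \<in> borel_measurable borel" "S' \<in> borel_measurable borel" "f1 \<in> borel_measurable borel" "f2 \<in> borel_measurable borel"
    using quad_approx_isCont[OF S(1)] f1_cont f2c isCont_borel by blast+
  let ?W = "\<lambda>x. f1 (U t x) * S (q t x)" and ?W' = "\<lambda>x. f2 (U t x) * q t x * S (q t x) + f1 (U t x) * (S' (q t x) * p t x)"
  have S'2: "integrable lborel (\<lambda>x. (S' (q t x))\<^sup>2)"
  proof (rule Bochner_Integration.integrable_bound)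
    show "integrable lborel (\<lambda>x. (2 * B)\<^sup>2 * (q t x)\<^sup>2)" using q2[OF t] by simp
    show "AE x in lborel. norm ((S' (q t x))\<^sup>2) \<le> norm ((2 * B)\<^sup>2 * (q t x)\<^sup>2)"
      using power_mono[OF Sb(2) abs_ge_zero, of _ 2] by (intro AE_I2) (simp add: power_mult_distrib)
  qed measurable
  have i1: "integrable lborel (\<lambda>x. S' (q t x) * r t x)" by (rule integrable_prod_L2[OF S'2 r2[OF t]]) measurable
  have i2: "integrable lborel (\<lambda>x. S' (q t x) * p t x)" by (rule integrable_prod_L2[OF S'2 p2[OF t]]) measurable
  have i3: "integrable lborel (\<lambda>x. f1 (U t x) * (S' (q t x) * p t x))"
  proof (rule Bochner_Integration.integrable_bound)
    show "integrable lborel (\<lambda>x. B0 * \<bar>S' (q t x) * p t x\<bar>)" using i2 by (intro integrable_mult_right integrable_abs)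
    show "AE x in lborel. norm (f1 (U t x) * (S' (q t x) * p t x)) \<le> norm (B0 * \<bar>S' (q t x) * p t x\<bar>)"
    proof (intro AE_I2)
      fix x
      have "\<bar>f1 (U t x)\<bar> * \<bar>S' (q t x) * p t x\<bar> \<le> B0 * \<bar>S' (q t x) * p t x\<bar>"
        by (rule mult_right_mono[OF B0(2) abs_ge_zero])
      then show "norm (f1 (U t x) * (S' (q t x) * p t x)) \<le> norm (B0 * \<bar>S' (q t x) * p t x\<bar>)"
        using B0(3) by (simp add: abs_mult)
    qed
  qed measurable
  have i4: "integrable lborel (\<lambda>x. f2 (U t x) * q t x * S (q t x))"
  proof (rule Bochner_Integration.integrable_bound)
    show "integrable lborel (\<lambda>x. C * B0 * (B * (q t x)\<^sup>2))" using q2[OF t] by simp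
    show "AE x in lborel. norm (f2 (U t x) * q t x * S (q t x)) \<le> norm (C * B0 * (B * (q t x)\<^sup>2))"
    proof (intro AE_I2)
      fix x
      have "\<bar>f2 (U t x)\<bar> * \<bar>q t x\<bar> * \<bar>S (q t x)\<bar> \<le> C * B0 * (B * (q t x)\<^sup>2)"
        using f2b[of "U t x"] c0 C0 B0 Sb by (intro mult_mono) auto
      then show "norm (f2 (U t x) * q t x * S (q t x)) \<le> norm (C * B0 * (B * (q t x)\<^sup>2))"
        using C0 B0 B by (simp add: abs_mult)
    qed
  qed measurable
  have iW: "integrable lborel ?W"
  proof (rule Bochner_Integration.integrable_bound)
    show "integrable lborel (\<lambda>x. B0 * (B * (q t x)\<^sup>2))" using q2[OF t] by simp
    show "AE x in lborel. norm (f1 (U t x) * S (q t x)) \<le> norm (B0 * (B * (q t x)\<^sup>2))"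
      using mult_mono[OF B0(2) Sb(1) B0(3) abs_ge_zero] B B0(3) by (intro AE_I2) (simp add: abs_mult)
  qed measurable
  have DW: "(?W has_real_derivative ?W' x) (at x)" for x
    by (rule derivative_eq_intros DERIV_chain2[OF f2 Uq[OF t]] DERIV_chain2[OF quad_approx_DERIV[OF S(1)] qp[OF t]] refl)+
      (simp add: algebra_simps)
  have W'c: "isCont ?W' x" for x
    using isCont_o2[OF U_cont f2c] isCont_o2[OF U_cont f1_cont] isCont_o2[OF q_cont quad_approx_isCont(1)[OF S(1)]]
      isCont_o2[OF q_cont quad_approx_isCont(2)[OF S(1)]] q_cont pc[OF t] by (intro continuous_intros)
  have iW': "integrable lborel ?W'" using i3 i4 by simp
  have z: "(LBINT x. ?W' x) = 0" by (rule LINT_deriv_zero[OF DW W'c iW iW'])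
  have Re: "R = (\<lambda>x. S' (q t x) * r t x + ?W' x)"
    unfolding R_def r_eq by (intro ext) (simp add: field_simps)
  show "integrable lborel R" unfolding Re using i1 iW' by (rule Bochner_Integration.integrable_add)
  show "(LBINT x. S' (q t x) * r t x) = (LBINT x. R x)"
    unfolding Re by (subst Bochner_Integration.integral_add[OF i1 iW']) (simp only: z add_0_right)
qed

text \<open>The integrand is the slope of \<open>P1\<close>. Its zero integral says that the mass of
  \<open>P / l\<^sup>2\<close> equals that of the quadratic terms; in \<open>Dis'_le\<close> this
  trades the one for the other.\<close>

lemma P1_integral: "integrable lborel (P1 t)"
  "integrable lborel (\<lambda>x. P t x / l\<^sup>2 - f2 (U t x) * ((q t x)\<^sup>2 + chi eps (q t x)) / 2)"
  "(LBINT x. P t x / l\<^sup>2 - f2 (U t x) * ((q t x)\<^sup>2 + chi eps (q t x)) / 2) = 0"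
proof -
  have fm[measurable]: "f2 \<in> borel_measurable borel" using f2c isCont_borel by blast
  have cc: "isCont (\<lambda>x. chi eps (q t x)) x" for x
    unfolding chi_eq[OF eps0] using q_cont by (intro continuous_intros)
  then have cm[measurable]: "(\<lambda>x. chi eps (q t x)) \<in> borel_measurable borel" using isCont_borel by blast
  show i1: "integrable lborel (P1 t)"
  proof (rule Bochner_Integration.integrable_bound)
    show "integrable lborel (\<lambda>x. P t x / l)" using Pi[OF t] by simp
    show "AE x in lborel. norm (P1 t x) \<le> norm (P t x / l)" using P1b[OF t] P0[OF t] l0 by (intro AE_I2) simp
  qed measurable
  have ih: "integrable lborel (\<lambda>x. f2 (U t x) * ((q t x)\<^sup>2 + chi eps (q t x)) / 2)"
  proof (rule Bochner_Integration.integrable_bound)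
    show "integrable lborel (\<lambda>x. C * (q t x)\<^sup>2)" using q2[OF t] by simp
    show "AE x in lborel. norm (f2 (U t x) * ((q t x)\<^sup>2 + chi eps (q t x)) / 2) \<le> norm (C * (q t x)\<^sup>2)"
    proof (intro AE_I2)
      fix x
      have "f2 (U t x) * ((q t x)\<^sup>2 + chi eps (q t x)) \<le> C * (2 * (q t x)\<^sup>2)"
        using f2b(2)[of "U t x"] f2_nonneg[of "U t x"] chi_bounds[OF eps0, of "q t x"] C0 by (intro mult_mono) auto
      moreover have "0 \<le> f2 (U t x) * ((q t x)\<^sup>2 + chi eps (q t x))"
        using f2_nonneg chi_bounds[OF eps0, of "q t x"] by simp
      ultimately show "norm (f2 (U t x) * ((q t x)\<^sup>2 + chi eps (q t x)) / 2) \<le> norm (C * (q t x)\<^sup>2)"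
        using C0 by simp
    qed
  qed measurable
  then show i2: "integrable lborel (\<lambda>x. P t x / l\<^sup>2 - f2 (U t x) * ((q t x)\<^sup>2 + chi eps (q t x)) / 2)"
    using Pi[OF t] by simp
  have "isCont (\<lambda>x. P t x / l\<^sup>2 - f2 (U t x) * ((q t x)\<^sup>2 + chi eps (q t x)) / 2) x" for x
    using l0 by (intro continuous_intros P_cont isCont_o2[OF U_cont f2c] q_cont cc) auto
  then show "(LBINT x. P t x / l\<^sup>2 - f2 (U t x) * ((q t x)\<^sup>2 + chi eps (q t x)) / 2) = 0"
    by (rule LINT_deriv_zero[OF P1D[OF t] _ i1 i2])
qed

end

lemma balance_DERIV:
  assumes S: "quad_approx S S' B" "S 0 = 0" "S' 0 = 0" and s: "0 \<le> s"
  shows "((\<lambda>t. LBINT x. S (q t x)) has_real_derivative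
    (LBINT x. f2 (U s x) * (q s x * S (q s x) - S' (q s x) * ((q s x)\<^sup>2 - chi eps (q s x)) / 2) - S' (q s x) * P s x / l\<^sup>2))
    (at s within {0..})"
  unfolding balance(2)[OF s S, symmetric]
  by (rule L2_chain_rule[OF S s _ _ q2 r2[OF s] qr[OF s]]) (use meas s in auto)

section \<open>One-sided bound and total variation\<close>

text \<open>One-sided (Oleinik) bound, with \<open>S(z) = max 0 (z - M)^2\<close>.\<close>
lemma oleinik:
  assumes M: "0 \<le> M" and q0: "\<And>x. q 0 x \<le> M" and t: "0 \<le> t"
  shows "q t x \<le> M"
proof -
  let ?S = "\<lambda>z. (max 0 (z - M))\<^sup>2" and ?S' = "\<lambda>z. 2 * max 0 (z - M)"
  have S: "quad_approx ?S ?S' 1" by (rule quad_approx_shift[OF quad_approx_pos_sq])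
  have S0: "?S 0 = 0" "?S' 0 = 0" using M by auto
  let ?F = "\<lambda>t. LBINT x. ?S (q t x)"
  let ?R = "\<lambda>s x. f2 (U s x) * (q s x * ?S (q s x) - ?S' (q s x) * ((q s x)\<^sup>2 - chi eps (q s x)) / 2) - ?S' (q s x) * P s x / l\<^sup>2"
  have R: "?R s x \<le> 0" if s: "0 \<le> s" for s x
  proof (cases "q s x \<le> M")
    case False
    \<comment> \<open>Above \<open>M\<close> the regularisation \<open>chi eps\<close> is inactive,
      and the cubic terms combine by \<open>y (y - M)^2 - (y - M) y^2 = - M y (y - M)\<close>, which
      has a sign.\<close>
    then have "?R s x = - (f2 (U s x) * (M * (q s x * (q s x - M)))) - 2 * (q s x - M) * P s x / l\<^sup>2"
    proof -
      have "y * (y - M)\<^sup>2 - 2 * (y - M) * (y\<^sup>2 - 0) / 2 = - (M * (y * (y - M)))" for y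
        by (simp add: power2_eq_square field_simps)
      moreover have "max 0 (q s x - M) = q s x - M" using False by simp
      moreover have "chi eps (q s x) = 0" using False M by (intro chi_bounds(3)[OF eps0]) simp
      ultimately show ?thesis by (simp only: mult_minus_right)
    qed
    moreover have "0 \<le> f2 (U s x) * (M * (q s x * (q s x - M)))" "0 \<le> 2 * (q s x - M) * P s x / l\<^sup>2"
      using False M f2_nonneg P0[OF s] by auto
    ultimately show ?thesis by linarith
  qed simp
  have "?F t - ?F 0 \<le> 0 * (t - 0)"
  proof (rule within_DERIV_le[OF balance_DERIV[OF S S0]])
    fix s assume "0 < s" "s < t"
    then show "(LBINT x. ?R s x) \<le> 0" by (intro LINT_nonpos R) simp
  qed (use t in auto)
  moreover have "?F 0 = 0" using q0 by simp
  moreover have "0 \<le> ?F t" by (intro integral_nonneg_AE) simp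
  ultimately have Fz: "?F t = 0" by linarith
  obtain B where "\<And>x. \<bar>q t x\<bar> \<le> B" using bounded_sup[OF t] by metis
  have "integrable lborel (\<lambda>x. ?S (q t x))"
  proof (rule Bochner_Integration.integrable_bound[OF q2[OF t]])
    show "AE x in lborel. norm (?S (q t x)) \<le> norm ((q t x)\<^sup>2)"
      using quad_approx_bounds(1)[OF S S0] by (intro AE_I2) simp
  qed (use meas(2)[OF t] in measurable)
  then have "AE x in lborel. ?S (q t x) = 0"
    using Fz by (subst (asm) integral_nonneg_eq_0_iff_AE) auto
  then have "?S (q t x) = 0"
    by (rule AE_eq_continuous_imp_eq[where h = "\<lambda>_. 0"]) (use q_cont[OF t] in \<open>auto intro!: continuous_intros\<close>)
  then show ?thesis by (simp add: max_def split: if_splits)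
qed

lemma U_tail:
  assumes t: "0 \<le> t" and e: "0 < e"
  obtains a b where "a \<le> - R" "R \<le> b" "\<bar>U t a\<bar> < e" "\<bar>U t b\<bar> < e"
proof -
  obtain a b where "a \<le> - R" "R \<le> b" "\<bar>(U t a)\<^sup>2\<bar> < e\<^sup>2" "\<bar>(U t b)\<^sup>2\<bar> < e\<^sup>2"
    using integrable_small_at_infinity[OF U2[OF t], of "e\<^sup>2" R] e by auto
  then show ?thesis using e by (intro that[of a b]) (auto simp: abs_square_less_1 power2_less_imp_less abs_less_iff
    intro: power2_less_imp_less[of "\<bar>U t _\<bar>" e, simplified] real_sqrt_less_mono)
qed

text \<open>Arbitrarily far to the left there are points where \<open>U t\<close> is small; from
  such a point on, \<open>U t\<close> is the integral of \<open>q t\<close>.\<close>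

lemma U_le_LINT:
  assumes t: "0 \<le> t" and i: "integrable lborel (\<lambda>x. \<bar>q t x\<bar>)"
  shows "\<bar>U t x\<bar> \<le> (LBINT x. \<bar>q t x\<bar>)"
proof (rule field_le_epsilon)
  fix e :: real assume "0 < e"
  obtain a where a: "a \<le> - \<bar>x\<bar>" "\<bar>U t a\<bar> < e" using U_tail[OF t \<open>0 < e\<close>, of "\<bar>x\<bar>"] by metis
  then have ax: "a \<le> x" by linarith
  have "U t x - U t a = (LBINT y:{a..x}. q t y)"
    by (rule LBINT_FTC[OF ax Uq[OF t] q_cont[OF t], symmetric])
  moreover have "\<bar>LBINT y:{a..x}. q t y\<bar> \<le> (LBINT y:{a..x}. \<bar>q t y\<bar>)"
    using integral_abs_bound[of lborel "\<lambda>y. indicator {a..x} y *\<^sub>R q t y"]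
    unfolding set_lebesgue_integral_def by (simp add: abs_mult)
  moreover have "(LBINT y:{a..x}. \<bar>q t y\<bar>) \<le> (LBINT x. \<bar>q t x\<bar>)"
    by (rule LBINT_le_LINT[OF _ i]) (use q_cont[OF t] in \<open>auto intro!: continuous_intros\<close>)
  ultimately show "\<bar>U t x\<bar> \<le> (LBINT x. \<bar>q t x\<bar>) + e" using a by linarith
qed

text \<open>Only the positive part of \<open>q\<close> is estimated in time, with Gronwall's factor,
  since \<open>q \<le> M\<close> makes its quadratic production linear. As \<open>U t\<close> is
  small far out on both sides, the integral of \<open>q\<close> is negligible there, and
  \<open>\<bar>q\<bar> = 2 * max 0 q - q\<close> has at most twice the mass of the positive
  part.\<close>

lemma q_L1:
  assumes M: "0 \<le> M" and q0: "\<And>x. q 0 x \<le> M" 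
    and i0: "integrable lborel (\<lambda>x. \<bar>q 0 x\<bar>)" "(LBINT x. \<bar>q 0 x\<bar>) \<le> K0" and t: "0 \<le> t"
  shows "integrable lborel (\<lambda>x. \<bar>q t x\<bar>)" "(LBINT x. \<bar>q t x\<bar>) \<le> 2 * K0 * exp (C * M / 2 * t)"
proof -
  let ?k = "C * M / 2"
  let ?Kt = "K0 * exp (?k * t)"
  have sgb: "(LBINT x. sg d (q t x)) \<le> ?Kt" if d: "0 < d" for d
  proof -
    have S: "quad_approx (sg d) (sg' d) (1 / d)" by (rule quad_approx_sg[OF d])
    have S0: "sg d 0 = 0" "sg' d 0 = 0" using d by auto
    let ?F = "\<lambda>t. LBINT x. sg d (q t x)"
    let ?R = "\<lambda>s x. f2 (U s x) * (q s x * sg d (q s x) - sg' d (q s x) * ((q s x)\<^sup>2 - chi eps (q s x)) / 2) - sg' d (q s x) * P s x / l\<^sup>2"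
    have si: "integrable lborel (\<lambda>x. sg d (q s x))" if s: "0 \<le> s" for s
    proof (rule Bochner_Integration.integrable_bound)
      show "integrable lborel (\<lambda>x. 1 / d * (q s x)\<^sup>2)" using q2[OF s] by simp
      show "AE x in lborel. norm (sg d (q s x)) \<le> norm (1 / d * (q s x)\<^sup>2)"
        using quad_approx_bounds(1)[OF S S0] d by (intro AE_I2) simp
      show "(\<lambda>x. sg d (q s x)) \<in> borel_measurable lborel"
        using isCont_o2[OF q_cont[OF s] quad_approx_isCont(1)[OF S]] isCont_borel by simp
    qed
    have R: "?R s x \<le> ?k * sg d (q s x)" if s: "0 \<le> s" for s x
    proof (cases "q s x \<le> 0")
      case False
      define z where "z = q s x"
      have z: "0 < z" "z \<le> M" "chi eps z = 0" 
        using False oleinik[OF M q0 s] chi_bounds(3)[OF eps0] by (auto simp: z_def)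
      \<comment> \<open>For the exact positive part the left side is \<open>z^2 / 2\<close>. The
        extra factor \<open>z / (z + d)\<close> shows that smoothing only lowers the
        production.\<close>
      have "z * sg d z - sg' d z * z\<^sup>2 / 2 = z * sg d z / 2 * (z / (z + d))"
      proof -
        have "z * (z\<^sup>2 / Z) - (1 - d\<^sup>2 / Z\<^sup>2) * z\<^sup>2 / 2 = z * (z\<^sup>2 / Z) / 2 * (z / Z)" 
          if Z: "Z = z + d" "Z \<noteq> 0" for Z
        proof -
          have "z * (z\<^sup>2 / Z) - (1 - d\<^sup>2 / Z\<^sup>2) * z\<^sup>2 / 2 = (2 * z ^ 3 * Z - (Z\<^sup>2 - d\<^sup>2) * z\<^sup>2) / (2 * Z\<^sup>2)"
            using Z(2) by (simp add: field_simps power2_eq_square power3_eq_cube)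
          moreover have "2 * z ^ 3 * Z - (Z\<^sup>2 - d\<^sup>2) * z\<^sup>2 = z ^ 4" using Z(1) by algebra
          moreover have "z ^ 4 / (2 * Z\<^sup>2) = z * (z\<^sup>2 / Z) / 2 * (z / Z)"
            by (simp add: power2_eq_square eval_nat_numeral)
          ultimately show ?thesis by simp
        qed
        from this[OF refl] show ?thesis using z d unfolding sg_def sg'_def by (simp add: max_def)
      qed
      also have "\<dots> \<le> z * sg d z / 2 * 1" using z d sg_bounds(1)[OF d, of z] by (intro mult_left_mono) auto
      finally have a: "z * sg d z - sg' d z * z\<^sup>2 / 2 \<le> M * sg d z / 2"
        using mult_right_mono[OF z(2) sg_bounds(1)[OF d, of z]] by simp
      have "f2 (U s x) * (z * sg d z - sg' d z * z\<^sup>2 / 2) \<le> f2 (U s x) * (M * sg d z / 2)"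
        using a f2_nonneg by (intro mult_left_mono) auto
      also have "\<dots> \<le> C * (M * sg d z / 2)" using f2b(2) M sg_bounds(1)[OF d] by (intro mult_right_mono) auto
      finally have "f2 (U s x) * (z * sg d z - sg' d z * z\<^sup>2 / 2) \<le> ?k * sg d z" by simp
      moreover have "0 \<le> sg' d z * P s x / l\<^sup>2" using sg_bounds(4)[OF d] P0[OF s] by simp
      ultimately show ?thesis using z by (simp add: z_def)
    qed (use d in simp)
    \<comment> \<open>Gronwall's inequality by an integrating factor.\<close>
    let ?G = "\<lambda>t. ?F t * exp (- ?k * t)"
    have "?G t - ?G 0 \<le> 0 * (t - 0)"
    proof (rule within_DERIV_le)
      fix s :: real assume s: "0 \<le> s" "s \<le> t"
      show "(?G has_real_derivative (?F s * (exp (- ?k * s) * (- ?k)) + (LBINT x. ?R s x) * exp (- ?k * s))) (at s within {0..})"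
        by (rule DERIV_mult'[OF balance_DERIV[OF S S0 s(1)]]) (auto intro!: derivative_eq_intros)
    next
      fix s :: real assume "0 < s" "s < t"
      then have s: "0 \<le> s" by simp
      have "(LBINT x. ?R s x) \<le> (LBINT x. ?k * sg d (q s x))"
        by (intro integral_mono balance(1)[OF s S S0] R[OF s]) (use si[OF s] in simp)
      then have "(LBINT x. ?R s x) \<le> ?k * ?F s" by simp
      then have "(LBINT x. ?R s x) * exp (- ?k * s) \<le> ?k * ?F s * exp (- ?k * s)"
        by (intro mult_right_mono) auto
      then show "?F s * (exp (- ?k * s) * (- ?k)) + (LBINT x. ?R s x) * exp (- ?k * s) \<le> 0"
        by (simp add: algebra_simps)
    qed (use t in auto)
    then have "?F t * exp (- ?k * t) \<le> ?F 0" by simp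
    also have "?F 0 \<le> (LBINT x. \<bar>q 0 x\<bar>)"
    proof (intro integral_mono si i0(1))
      show "sg d (q 0 x) \<le> \<bar>q 0 x\<bar>" for x using sg_bounds(2)[OF d, of "q 0 x"] by linarith
    qed simp
    also note i0(2)
    finally have "?F t * exp (- ?k * t) * exp (?k * t) \<le> K0 * exp (?k * t)" by (intro mult_right_mono) auto
    then show ?thesis by (simp add: mult.assoc exp_add[symmetric])
  qed
  have posint: "(LBINT x:{a..b}. max 0 (q t x)) \<le> ?Kt" if ab: "a \<le> b" for a b
  proof (rule field_le_epsilon)
    fix e :: real assume e: "0 < e"
    define d where "d = e / (b - a + 1)"
    have d: "0 < d" and de: "d * (b - a) \<le> e" using e ab by (auto simp: d_def field_simps)
    have S: "quad_approx (sg d) (sg' d) (1 / d)" by (rule quad_approx_sg[OF d])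
    have sc: "isCont (\<lambda>x. sg d (q t x)) x" for x
      by (rule isCont_o2[OF q_cont[OF t] quad_approx_isCont(1)[OF S]])
    have si: "integrable lborel (\<lambda>x. sg d (q t x))"
    proof (rule Bochner_Integration.integrable_bound)
      show "integrable lborel (\<lambda>x. 1 / d * (q t x)\<^sup>2)" using q2[OF t] by simp
      show "AE x in lborel. norm (sg d (q t x)) \<le> norm (1 / d * (q t x)\<^sup>2)"
        using quad_approx_bounds(1)[OF S] d by (intro AE_I2) simp
      show "(\<lambda>x. sg d (q t x)) \<in> borel_measurable lborel" using isCont_borel[OF sc] by simp
    qed
    have "(LBINT x:{a..b}. max 0 (q t x)) \<le> (LBINT x:{a..b}. sg d (q t x) + d)"
    proof (rule set_integral_mono)
      show "set_integrable lborel {a..b} (\<lambda>x. max 0 (q t x))" "set_integrable lborel {a..b} (\<lambda>x. sg d (q t x) + d)"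
        using sc q_cont[OF t] by (intro set_integrable_cont continuous_intros; simp)+
      show "max 0 (q t x) \<le> sg d (q t x) + d" for x using sg_bounds(3)[OF d, of "q t x"] by linarith
    qed
    also have "\<dots> = (LBINT x:{a..b}. sg d (q t x)) + (LBINT x:{a..b}. d)"
      using sc by (intro set_integral_add set_integrable_cont) auto
    also have "(LBINT x:{a..b}. d) = d * (b - a)" using ab by (simp add: set_lebesgue_integral_def)
    also have "(LBINT x:{a..b}. sg d (q t x)) \<le> (LBINT x. sg d (q t x))"
      by (intro LBINT_le_LINT si sc) (use sg_bounds[OF d] in auto)
    finally show "(LBINT x:{a..b}. max 0 (q t x)) \<le> ?Kt + e" using sgb[OF d] de by linarith
  qed
  have bnd: "(LBINT x:{-real n..real n}. \<bar>q t x\<bar>) \<le> 2 * ?Kt" for n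
  proof (rule field_le_epsilon)
    fix e :: real assume e: "0 < e"
    \<comment> \<open>The interval is enlarged to endpoints at which \<open>U t\<close> is small, so
      that the integral of \<open>q t\<close> itself costs less than \<open>e\<close>.\<close>
    obtain a b where ab: "a \<le> - real n" "real n \<le> b" "\<bar>U t a\<bar> < e / 2" "\<bar>U t b\<bar> < e / 2"
      using U_tail[OF t, of "e / 2" "real n"] e by auto
    have abo: "a \<le> b" using ab by linarith
    have "(LBINT x:{-real n..real n}. \<bar>q t x\<bar>) \<le> (LBINT x:{a..b}. \<bar>q t x\<bar>)"
      by (rule LBINT_mono_interval[OF _ _ ab(1,2)]) (use q_cont[OF t] in \<open>auto intro!: continuous_intros\<close>)
    also have "\<dots> = (LBINT x:{a..b}. 2 * max 0 (q t x) - q t x)"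
      by (intro set_lebesgue_integral_cong) auto
    also have "\<dots> = 2 * (LBINT x:{a..b}. max 0 (q t x)) - (LBINT x:{a..b}. q t x)"
      using q_cont[OF t] by (subst set_integral_diff) (auto intro!: set_integrable_cont continuous_intros)
    also have "(LBINT x:{a..b}. q t x) = U t b - U t a" by (rule LBINT_FTC[OF abo Uq[OF t] q_cont[OF t]])
    finally show "(LBINT x:{-real n..real n}. \<bar>q t x\<bar>) \<le> 2 * ?Kt + e" using posint[OF abo] ab by linarith
  qed
  show "integrable lborel (\<lambda>x. \<bar>q t x\<bar>)" by (rule integrable_abs_if_LBINT_bounded(1)[OF q_cont[OF t] bnd])
  show "(LBINT x. \<bar>q t x\<bar>) \<le> 2 * K0 * exp (?k * t)"
    using integrable_abs_if_LBINT_bounded(2)[OF q_cont[OF t] bnd] by simp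
qed

section \<open>The dissipation functional and the modulus of continuity in time\<close>

text \<open>The functional whose dissipation controls \<open>\<integral> P\<close>: here \<open>S(z) = - l z \<bar>z\<bar> / (1 + l \<bar>z\<bar>)\<close>, so that
  \<open>S'(z) + 1 = (1 + l \<bar>z\<bar>)^(-2)\<close>, to which Jensen's inequality applies.\<close>
definition dis :: "real \<Rightarrow> real" where "dis z = sg (1 / l) (- z) + (- 1) * sg (1 / l) z"
definition dis' :: "real \<Rightarrow> real" where "dis' z = - sg' (1 / l) (- z) + (- 1) * sg' (1 / l) z"
definition Dis :: "real \<Rightarrow> real" where "Dis t = (LBINT x. dis (q t x))"

lemma quad_approx_dis: "quad_approx dis dis' (l + l)" "dis 0 = 0" "dis' 0 = 0"
proof -
  have S: "quad_approx (sg (1/l)) (sg' (1/l)) l" using quad_approx_sg[of "1/l"] l0 by simp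
  show "quad_approx dis dis' (l + l)"
    unfolding dis_def[abs_def] dis'_def[abs_def]
    by (intro quad_approx_lincomb[OF quad_approx_reflect[OF S] S]) simp
  show "dis 0 = 0" "dis' 0 = 0" using l0 by (simp_all add: dis_def dis'_def)
qed

text \<open>The last bound is the purpose of the construction: \<open>z * dis z + z^2\<close> equals
  \<open>z^2 / (1 + l \<bar>z\<bar>)\<close>, so a quadratic quantity is reduced to a linear one at
  the price of \<open>1 / l\<close>.\<close>

lemma dis_bounds: "\<bar>dis z\<bar> \<le> \<bar>z\<bar>" "dis' z = 1 / (1 + l * \<bar>z\<bar>)\<^sup>2 - 1" "z * dis z + z\<^sup>2 \<le> \<bar>z\<bar> / l"
proof -
  have l: "0 < 1 / l" using l0 by simp
  have "(max 0 y + 1 / l) \<noteq> 0" for y using l by (smt (verit))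
  have e: "sg' (1/l) y = 1 - 1 / (1 + l * y)\<^sup>2" if "0 \<le> y" for y
  proof -
    have "y + 1 / l = (1 + l * y) / l" using l0 by (simp add: field_simps)
    then show ?thesis using that l0 by (simp add: sg'_def power_divide)
  qed
  have s: "sg (1/l) y = l * y\<^sup>2 / (1 + l * y)" if "0 \<le> y" for y
  proof -
    have "y + 1 / l = (1 + l * y) / l" using l0 by (simp add: field_simps)
    then show ?thesis using that l0 by (simp add: sg_def)
  qed
  show "\<bar>dis z\<bar> \<le> \<bar>z\<bar>" using sg_bounds(1,2)[OF l, of z] sg_bounds(1,2)[OF l, of "-z"] l
    unfolding dis_def by (cases "0 \<le> z") auto
  show "dis' z = 1 / (1 + l * \<bar>z\<bar>)\<^sup>2 - 1" unfolding dis'_def using e[of z] e[of "-z"] l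
    by (cases "0 \<le> z") auto
  have key: "y * y - y * (l * y\<^sup>2 / (1 + l * y)) \<le> y / l" if "0 \<le> y" for y
  proof -
    have p: "0 < 1 + l * y" using that l0 by (smt (verit) mult_nonneg_nonneg)
    then have "y * y - y * (l * y\<^sup>2 / (1 + l * y)) = y * y / (1 + l * y)"
      by (simp add: field_simps power2_eq_square)
    also have "\<dots> \<le> y / l" using p that l0 by (simp add: field_simps mult_left_mono)
    finally show ?thesis .
  qed
  show "z * dis z + z\<^sup>2 \<le> \<bar>z\<bar> / l"
    unfolding dis_def using s[of z] s[of "-z"] key[of z] key[of "-z"] l
    by (cases "0 \<le> z") (auto simp: power2_eq_square)
qed

definition IP :: "real \<Rightarrow> real" where "IP t = (LBINT x. P t x)"

definition Dis' :: "real \<Rightarrow> real" where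
  "Dis' s = (LBINT x. f2 (U s x) * (q s x * dis (q s x) - dis' (q s x) * ((q s x)\<^sup>2 - chi eps (q s x)) / 2) - dis' (q s x) * P s x / l\<^sup>2)"

lemma Dis_DERIV: "0 \<le> s \<Longrightarrow> (Dis has_real_derivative Dis' s) (at s within {0..})"
  unfolding Dis_def[abs_def] Dis'_def by (rule balance_DERIV[OF quad_approx_dis])

text \<open>Because \<open>dis'\<close> is the weight minus 1, the balance contains the slope of
  \<open>P1\<close>, whose integral is zero, and \<open>- P / l\<^sup>2\<close> times the weight,
  which Jensen's inequality turns into a multiple of \<open>- IP s\<close>. What is left is at most
  \<open>C / l\<close> times \<open>\<bar>q\<bar>\<close>.\<close>

lemma Dis'_le:
  assumes s: "0 \<le> s" and i: "integrable lborel (\<lambda>x. \<bar>q s x\<bar>)" "(LBINT x. \<bar>q s x\<bar>) \<le> K"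
  shows "Dis' s \<le> C * K / l - 1 / (1 + K / 2)\<^sup>2 / l\<^sup>2 * IP s"
proof -
  let ?R = "\<lambda>s x. f2 (U s x) * (q s x * dis (q s x) - dis' (q s x) * ((q s x)\<^sup>2 - chi eps (q s x)) / 2) - dis' (q s x) * P s x / l\<^sup>2"
  let ?P' = "\<lambda>x. P s x / l\<^sup>2 - f2 (U s x) * ((q s x)\<^sup>2 + chi eps (q s x)) / 2"
  let ?s = "\<lambda>x. 1 / (1 + l * \<bar>q s x\<bar>)\<^sup>2"
  note qd = quad_approx_dis
  have s01: "0 \<le> ?s x" "?s x \<le> 1" for x
  proof -
    have "1\<^sup>2 \<le> (1 + l * \<bar>q s x\<bar>)\<^sup>2" using l0 by (intro power_mono) auto
    then have "1 \<le> (1 + l * \<bar>q s x\<bar>)\<^sup>2" by simp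
    then show "?s x \<le> 1" by (simp add: divide_le_eq_1)
  qed simp
  have Ps: "integrable lborel (\<lambda>x. P s x * ?s x)"
  proof (rule Bochner_Integration.integrable_bound[OF Pi[OF s]])
    show "AE x in lborel. norm (P s x * ?s x) \<le> norm (P s x)"
    proof (intro AE_I2)
      fix x show "norm (P s x * ?s x) \<le> norm (P s x)"
        using mult_left_le[OF s01(2) P0[OF s], of x x] mult_nonneg_nonneg[OF P0[OF s] s01(1), of x x] P0[OF s, of x]
        by (simp only: real_norm_def abs_of_nonneg)
    qed
  qed (use meas[OF s] in measurable)
  have "?R s x \<le> ?P' x - P s x * ?s x / l\<^sup>2 + C / l * \<bar>q s x\<bar>" for x
  proof -
    let ?q = "q s x" and ?c = "chi eps (q s x)"
    \<comment> \<open>The slope \<open>?P'\<close> of \<open>P1\<close> is split off, so that the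
      remaining bracket no longer contains \<open>P\<close> and its cubic and quadratic growth
      cancels by \<open>dis_bounds(3)\<close>.\<close>
    have "?R s x = ?P' x - P s x * ?s x / l\<^sup>2 + f2 (U s x) * (?q * dis ?q + ?q\<^sup>2 - ?s x * (?q\<^sup>2 - ?c) / 2)"
      unfolding dis_bounds(2) by (simp only: left_diff_distrib right_diff_distrib distrib_left diff_divide_distrib add_divide_distrib mult_1 mult.commute[of _ "P s x"])
    also have "f2 (U s x) * (?q * dis ?q + ?q\<^sup>2 - ?s x * (?q\<^sup>2 - ?c) / 2) \<le> f2 (U s x) * (\<bar>?q\<bar> / l)"
    proof (rule mult_left_mono[OF _ f2_nonneg])
      have "0 \<le> ?s x * (?q\<^sup>2 - ?c)" using s01(1)[of x] chi_bounds(2)[OF eps0, of ?q] by (intro mult_nonneg_nonneg) auto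
      moreover have "a - Y / 2 \<le> b" if "0 \<le> Y" "a \<le> b" for a b Y :: real using that by simp
      ultimately show "?q * dis ?q + ?q\<^sup>2 - ?s x * (?q\<^sup>2 - ?c) / 2 \<le> \<bar>?q\<bar> / l" using dis_bounds(3)[of ?q] by blast
    qed
    also have "\<dots> \<le> C * (\<bar>?q\<bar> / l)" using f2b(2) l0 by (intro mult_right_mono) auto
    finally show ?thesis by simp
  qed
  then have "(LBINT x. ?R s x) \<le> (LBINT x. ?P' x - P s x * ?s x / l\<^sup>2 + C / l * \<bar>q s x\<bar>)"
    by (intro integral_mono balance(1)[OF s qd]) (use P1_integral(2)[OF s] Ps i(1) in \<open>auto simp del: times_divide_eq_right\<close>)
  also have "\<dots> = (LBINT x. ?P' x) - (LBINT x. P s x * ?s x) / l\<^sup>2 + C / l * (LBINT x. \<bar>q s x\<bar>)"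
    using P1_integral(2)[OF s] Ps i(1) by (simp del: times_divide_eq_right)
  also have "\<dots> \<le> 0 - 1 / (1 + K / 2)\<^sup>2 * IP s / l\<^sup>2 + C / l * K"
    unfolding P1_integral(3)[OF s] IP_def using Pj[OF s i] i(2) C0 l0
    by (intro add_mono diff_mono divide_right_mono mult_left_mono) auto
  finally have "(LBINT x. ?R s x) \<le> C * K / l - 1 / (1 + K / 2)\<^sup>2 / l\<^sup>2 * IP s" by simp
  then show ?thesis unfolding Dis'_def .
qed

lemma Dis_bound:
  assumes s: "0 \<le> s" and i: "integrable lborel (\<lambda>x. \<bar>q s x\<bar>)" "(LBINT x. \<bar>q s x\<bar>) \<le> K"
  shows "\<bar>Dis s\<bar> \<le> K"
proof -
  have [measurable]: "dis \<in> borel_measurable borel" using quad_approx_isCont[OF quad_approx_dis(1)] isCont_borel by blast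
  have d: "integrable lborel (\<lambda>x. dis (q s x))"
    by (rule Bochner_Integration.integrable_bound[OF i(1)]) (use meas[OF s] dis_bounds(1) in auto)
  have "\<bar>Dis s\<bar> \<le> (LBINT x. \<bar>dis (q s x)\<bar>)" unfolding Dis_def by (rule integral_abs_bound)
  also have "\<dots> \<le> (LBINT x. \<bar>q s x\<bar>)" using d i(1) dis_bounds(1) by (intro integral_mono) auto
  finally show ?thesis using i(2) by simp
qed

lemma V_L1:
  assumes s: "0 \<le> s" and i: "integrable lborel (\<lambda>x. \<bar>q s x\<bar>)" "(LBINT x. \<bar>q s x\<bar>) \<le> K"
    and L: "\<And>y. \<bar>y\<bar> \<le> K \<Longrightarrow> \<bar>f1 y\<bar> \<le> L"
  shows "integrable lborel (\<lambda>x. \<bar>V s x\<bar>)" "(LBINT x. \<bar>V s x\<bar>) \<le> L * K + IP s / l"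
proof -
  have U: "\<bar>f1 (U s x)\<bar> \<le> L" for x using U_le_LINT[OF s i(1), of x] i(2) by (intro L) linarith
  then have L0: "0 \<le> L" using abs_ge_zero[of "f1 (U s 0)"] by (meson order_trans)
  have b: "\<bar>V s x\<bar> \<le> L * \<bar>q s x\<bar> + P s x / l" for x
  proof -
    have "\<bar>V s x\<bar> \<le> \<bar>f1 (U s x)\<bar> * \<bar>q s x\<bar> + \<bar>P1 s x\<bar>"
      unfolding eq[OF s] abs_mult[symmetric] by linarith
    also have "\<dots> \<le> L * \<bar>q s x\<bar> + P s x / l" by (intro add_mono mult_right_mono U P1b[OF s]) auto
    finally show ?thesis .
  qed
  have bi: "integrable lborel (\<lambda>x. L * \<bar>q s x\<bar> + P s x / l)" using i(1) Pi[OF s] by simp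
  show vi: "integrable lborel (\<lambda>x. \<bar>V s x\<bar>)"
  proof (rule Bochner_Integration.integrable_bound[OF bi])
    show "AE x in lborel. norm \<bar>V s x\<bar> \<le> norm (L * \<bar>q s x\<bar> + P s x / l)"
      using b order_trans[OF b abs_ge_self] by (intro AE_I2) simp
  qed (use meas[OF s] in measurable)
  have "(LBINT x. \<bar>V s x\<bar>) \<le> (LBINT x. L * \<bar>q s x\<bar> + P s x / l)"
    by (intro integral_mono vi bi b)
  also have "\<dots> = L * (LBINT x. \<bar>q s x\<bar>) + IP s / l" using i(1) Pi[OF s] by (simp add: IP_def)
  also have "\<dots> \<le> L * K + IP s / l" using mult_left_mono[OF i(2) L0] by simp
  finally show "(LBINT x. \<bar>V s x\<bar>) \<le> L * K + IP s / l" .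
qed

text \<open>The L1 norm of \<open>V\<close> contains \<open>IP s / l\<close>, for which no bound at
  a single time is available. Adding \<open>l * (1 + K / 2)\<^sup>2 * Dis\<close> to the distance
  cancels it; as \<open>Dis\<close> lies between \<open>-K\<close> and \<open>K\<close>, this costs
  a term of order \<open>l\<close>.\<close>

lemma time_modulus:
  assumes i: "\<And>s. 0 \<le> s \<Longrightarrow> s \<le> T \<Longrightarrow> integrable lborel (\<lambda>x. \<bar>q s x\<bar>)"
      "\<And>s. 0 \<le> s \<Longrightarrow> s \<le> T \<Longrightarrow> (LBINT x. \<bar>q s x\<bar>) \<le> K"
    and L: "\<And>y. \<bar>y\<bar> \<le> K \<Longrightarrow> \<bar>f1 y\<bar> \<le> L"
    and st: "0 \<le> s0" "s0 \<le> t" "t \<le> T" and ab: "a \<le> b"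
  shows "(LBINT x:{a..b}. \<bar>U t x - U s0 x\<bar>) \<le> (L * K + C * K * (1 + K / 2)\<^sup>2) * (t - s0) + 2 * l * K * (1 + K / 2)\<^sup>2"
proof (rule field_le_epsilon)
  fix e :: real assume e: "0 < e"
  let ?k = "(1 + K / 2)\<^sup>2"
  have K0: "0 \<le> K" using i(2)[of s0] st by (intro order_trans[OF _ i(2)[of s0]]) auto
  then have k0: "0 < ?k" by simp
  \<comment> \<open>The smoothed modulus \<open>E\<close> loses at most \<open>2 * d\<close> at each
    point, hence at most \<open>e\<close> over the interval.\<close>
  define d where "d = e / (2 * (b - a) + 1)"
  have d: "0 < d" and de: "2 * d * (b - a) \<le> e" using e ab by (auto simp: d_def field_simps)
  define E where "E z = sg d z + 1 * sg d (- z)" for z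
  define E' where "E' z = sg' d z + 1 * (- sg' d (- z))" for z
  have S: "quad_approx E E' (1 / d + 1 / d)"
    unfolding E_def[abs_def] E'_def[abs_def]
    by (intro quad_approx_lincomb quad_approx_reflect quad_approx_sg d) simp
  have S0: "E 0 = 0" "E' 0 = 0" using d by (auto simp: E_def E'_def)
  have E'1: "\<bar>E' z\<bar> \<le> 1" for z
    using sg_bounds(4,5)[OF d, of z] sg_bounds(4,5)[OF d, of "-z"] d unfolding E'_def by (cases "0 \<le> z") auto
  have Elow: "\<bar>z\<bar> \<le> E z + 2 * d" and E0: "0 \<le> E z" for z
    using sg_bounds(1,3)[OF d, of z] sg_bounds(1,3)[OF d, of "-z"] d unfolding E_def by linarith+
  have [measurable]: "E \<in> borel_measurable borel" "E' \<in> borel_measurable borel"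
    using quad_approx_isCont[OF S] isCont_borel by blast+
  let ?g = "\<lambda>t x. U t x - U s0 x"
  have gm: "?g s \<in> borel_measurable lborel" if "0 \<le> s" for s
    using meas(1)[OF that] meas(1)[OF st(1)] by measurable
  have g2: "integrable lborel (\<lambda>x. (?g s x)\<^sup>2)" if "0 \<le> s" for s
  proof (rule Bochner_Integration.integrable_bound)
    show "integrable lborel (\<lambda>x. 2 * (U s x)\<^sup>2 + 2 * (U s0 x)\<^sup>2)" using U2[OF that] U2[OF st(1)] by simp
    show "AE x in lborel. norm ((?g s x)\<^sup>2) \<le> norm (2 * (U s x)\<^sup>2 + 2 * (U s0 x)\<^sup>2)"
      using sq_diff_le by (intro AE_I2) simp
  qed (use gm[OF that] in measurable)
  let ?F = "\<lambda>t. LBINT x. E (?g t x)"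
  \<comment> \<open>The coefficient of \<open>Dis\<close> is fitted to \<open>Dis'_le\<close>: the
    dissipation becomes exactly \<open>IP s / l\<close>.\<close>
  let ?G = "\<lambda>t. ?F t + l * ?k * Dis t"
  have "?G t - ?G s0 \<le> (L * K + C * K * ?k) * (t - s0)"
  proof (rule within_DERIV_le)
    fix s assume "s0 \<le> s"
    then have s: "0 \<le> s" using st by simp
    have "(?F has_real_derivative (LBINT x. E' (?g s x) * V s x)) (at s within {0..})"
      by (rule L2_chain_rule[OF S S0 s gm _ g2 V2[OF s]]) (use UV[OF s] meas[OF s] in auto)
    then show "(?G has_real_derivative (LBINT x. E' (?g s x) * V s x) + l * ?k * Dis' s) (at s within {0..})"
      using Dis_DERIV[OF s] by (intro DERIV_add DERIV_cmult)
  next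
    fix s assume "s0 < s" "s < t"
    then have s: "0 \<le> s" "s \<le> T" using st by auto
    note V = V_L1[OF s(1) i[OF s] L]
    have "(LBINT x. E' (?g s x) * V s x) \<le> (LBINT x. \<bar>V s x\<bar>)"
    proof (rule integral_mono[OF _ V(1)])
      have b: "\<bar>E' (?g s x) * V s x\<bar> \<le> \<bar>V s x\<bar>" for x
        using mult_right_mono[OF E'1 abs_ge_zero, of "?g s x" "V s x"] by (simp add: abs_mult)
      then show "E' (?g s x) * V s x \<le> \<bar>V s x\<bar>" for x using abs_le_D1 by blast
      show "integrable lborel (\<lambda>x. E' (?g s x) * V s x)"
        by (rule Bochner_Integration.integrable_bound[OF V(1)])
          (use b gm[OF s(1)] meas(4)[OF s(1)] in \<open>auto\<close>)
    qed
    also note V(2)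
    finally have 1: "(LBINT x. E' (?g s x) * V s x) \<le> L * K + IP s / l" .
    have "l * ?k * Dis' s \<le> l * ?k * (C * K / l - 1 / ?k / l\<^sup>2 * IP s)"
      using Dis'_le[OF s(1) i[OF s]] k0 l0 by (intro mult_left_mono) auto
    also have "\<dots> = ?k * C * K - IP s / l"
    proof -
      have "l * k * (C * K / l - 1 / k / l\<^sup>2 * I) = k * C * K - I / l" if "k > 0" for k I :: real
        using that l0 by (simp add: field_simps power2_eq_square)
      then show ?thesis using k0 by blast
    qed
    finally show "(LBINT x. E' (?g s x) * V s x) + l * ?k * Dis' s \<le> L * K + C * K * ?k"
      using 1 by (simp add: mult_ac)
  qed (use st in auto)
  moreover have "?F s0 = 0" using S0 by simp
  moreover have "l * ?k * Dis s0 - l * ?k * Dis t \<le> 2 * l * K * ?k"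
  proof -
    have "Dis s0 - Dis t \<le> 2 * K" 
      using Dis_bound[of s0 K] Dis_bound[of t K] i[of t] i[of s0] st by (smt (verit))
    then have "l * ?k * (Dis s0 - Dis t) \<le> l * ?k * (2 * K)" using l0 k0 by (intro mult_left_mono) auto
    then show ?thesis by (simp add: algebra_simps)
  qed
  ultimately have F: "?F t \<le> (L * K + C * K * ?k) * (t - s0) + 2 * l * K * ?k" by linarith
  have t0: "0 \<le> t" using st by simp
  have gc: "isCont (?g t) x" for x using U_cont[OF t0] U_cont[OF st(1)] by (intro continuous_intros)
  have Ec: "isCont (\<lambda>x. E (?g t x)) x" for x by (rule isCont_o2[OF gc quad_approx_isCont(1)[OF S]])
  have Ei: "integrable lborel (\<lambda>x. E (?g t x))"
  proof (rule Bochner_Integration.integrable_bound)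
    show "integrable lborel (\<lambda>x. (1 / d + 1 / d) * (?g t x)\<^sup>2)" using g2[OF t0] by (intro integrable_mult_right)
    show "AE x in lborel. norm (E (?g t x)) \<le> norm ((1 / d + 1 / d) * (?g t x)\<^sup>2)"
      using quad_approx_bounds(1)[OF S S0] by (intro AE_I2) (metis abs_ge_self order_trans real_norm_def)
    show "(\<lambda>x. E (?g t x)) \<in> borel_measurable lborel" using isCont_borel[OF Ec] by simp
  qed
  have "(LBINT x:{a..b}. \<bar>?g t x\<bar>) \<le> (LBINT x:{a..b}. E (?g t x) + 2 * d)"
  proof (rule set_integral_mono)
    show "set_integrable lborel {a..b} (\<lambda>x. \<bar>?g t x\<bar>)"
      by (rule set_integrable_cont) (rule isCont_rabs[OF gc])
    show "set_integrable lborel {a..b} (\<lambda>x. E (?g t x) + 2 * d)"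
      by (rule set_integrable_cont) (rule isCont_add[OF Ec continuous_const])
  qed (use Elow in auto)
  also have "\<dots> = (LBINT x:{a..b}. E (?g t x)) + (LBINT x:{a..b}. 2 * d)"
    using Ec by (intro set_integral_add set_integrable_cont) auto
  also have "(LBINT x:{a..b}. 2 * d) = 2 * d * (b - a)" using ab by (simp add: set_lebesgue_integral_def)
  also have "(LBINT x:{a..b}. E (?g t x)) \<le> ?F t" by (intro LBINT_le_LINT Ei Ec) (use E0 in auto)
  finally show "(LBINT x:{a..b}. \<bar>?g t x\<bar>) \<le> (L * K + C * K * ?k) * (t - s0) + 2 * l * K * ?k + e"
    using F de by linarith
qed

end

section \<open>Approximate Kruzhkov inequalities\<close>

lemma test2_DERIV:
  assumes "test2 \<phi>"
  shows "((\<lambda>s. \<phi> (s, x)) has_real_derivative pt \<phi> (t, x)) (at t)"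
    "((\<lambda>y. \<phi> (t, y)) has_real_derivative px \<phi> (t, x)) (at x)"
proof -
  have "(\<lambda>s. \<phi> (s, x)) differentiable (at t)" "(\<lambda>y. \<phi> (t, y)) differentiable (at x)"
    using assms by (auto simp: test2_def)
  then show "((\<lambda>s. \<phi> (s, x)) has_real_derivative pt \<phi> (t, x)) (at t)"
    "((\<lambda>y. \<phi> (t, y)) has_real_derivative px \<phi> (t, x)) (at x)"
    by (simp_all add: DERIV_deriv_iff_real_differentiable pt_def px_def)
qed

lemma test2_support:
  assumes "test2 \<phi>"
  obtains R where "0 < R" "\<And>t x. R \<le> \<bar>t\<bar> \<or> R \<le> \<bar>x\<bar> \<Longrightarrow> \<phi> (t, x) = 0"
proof -
  obtain B where B: "\<And>z. \<phi> z \<noteq> 0 \<Longrightarrow> norm z \<le> B" using assms by (auto simp: test2_def bounded_iff)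
  have "\<phi> (t, x) = 0" if "max 1 (B + 1) \<le> \<bar>t\<bar> \<or> max 1 (B + 1) \<le> \<bar>x\<bar>" for t x
    using that B[of "(t, x)"] norm_fst_le[of t x] norm_snd_le[of x t] by (cases "\<phi> (t, x) = 0") auto
  then show ?thesis by (intro that[of "max 1 (B + 1)"]) auto
qed

lemma deriv_zero_if_eventually_zero:
  fixes g :: "real \<Rightarrow> real"
  assumes "open A" "x \<in> A" "\<And>y. y \<in> A \<Longrightarrow> g y = 0"
  shows "deriv g x = 0"
proof -
  have "eventually (\<lambda>y. g y = 0) (nhds x)" using assms by (auto simp: eventually_nhds)
  then have "deriv g x = deriv (\<lambda>_. 0) x" by (intro deriv_cong_ev) auto
  then show ?thesis by simp
qed

lemma test2_deriv_zero:
  assumes "\<And>t x. T \<le> t \<or> R \<le> \<bar>x\<bar> \<Longrightarrow> \<phi> (t, x) = 0" and "T < t \<or> R < \<bar>x\<bar>"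
  shows "pt \<phi> (t, x) = 0" "px \<phi> (t, x) = 0"
proof -
  have o: "open {y::real. T < y}" "open {y::real. R < \<bar>y\<bar>}" by (intro open_Collect_less continuous_intros)+
  show "pt \<phi> (t, x) = 0"
    unfolding pt_def fst_conv snd_conv
    by (rule deriv_zero_if_eventually_zero[of "if T < t then {y. T < y} else UNIV"]) (use assms o in \<open>auto split: if_splits\<close>)
  show "px \<phi> (t, x) = 0"
    unfolding px_def fst_conv snd_conv
    by (rule deriv_zero_if_eventually_zero[of "if R < \<bar>x\<bar> then {y. R < \<bar>y\<bar>} else UNIV"]) (use assms o in \<open>auto split: if_splits\<close>)
qed

lemma test2_bounded:
  assumes "test2 \<phi>"
  obtains N where "0 < N" "\<And>z. \<bar>\<phi> z\<bar> \<le> N" "\<And>z. \<bar>pt \<phi> z\<bar> \<le> N" "\<And>z. \<bar>px \<phi> z\<bar> \<le> N"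
proof -
  obtain R where R: "0 < R" "\<And>t x. R \<le> \<bar>t\<bar> \<or> R \<le> \<bar>x\<bar> \<Longrightarrow> \<phi> (t, x) = 0" using test2_support[OF assms] by metis
  have bd: "\<exists>B. \<forall>z\<in>cbox (-R,-R) (R,R). \<bar>g z\<bar> \<le> B" if "continuous_on UNIV g" for g :: "real \<times> real \<Rightarrow> real"
  proof -
    have "compact (g ` cbox (-R,-R) (R,R))"
      using that by (intro compact_continuous_image compact_cbox) (auto intro: continuous_on_subset)
    then show ?thesis by (meson compact_imp_bounded bounded_real imageI)
  qed
  obtain B1 B2 where B: "\<And>z. z \<in> cbox (-R,-R) (R,R) \<Longrightarrow> \<bar>pt \<phi> z\<bar> \<le> B1" "\<And>z. z \<in> cbox (-R,-R) (R,R) \<Longrightarrow> \<bar>px \<phi> z\<bar> \<le> B2"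
    using bd[of "pt \<phi>"] bd[of "px \<phi>"] assms unfolding test2_def by metis
  have z: "pt \<phi> (t, x) = 0 \<and> px \<phi> (t, x) = 0" if "\<not> (\<bar>t\<bar> \<le> R \<and> \<bar>x\<bar> \<le> R)" for t x
  proof -
    have o: "open {y::real. R < \<bar>y\<bar>}" by (intro open_Collect_less continuous_intros)
    have "pt \<phi> (t, x) = 0"
      unfolding pt_def fst_conv snd_conv
      by (rule deriv_zero_if_eventually_zero[of "if R < \<bar>t\<bar> then {y. R < \<bar>y\<bar>} else UNIV"]) (use R that o in \<open>auto split: if_splits\<close>)
    moreover have "px \<phi> (t, x) = 0"
      unfolding px_def fst_conv snd_conv
      by (rule deriv_zero_if_eventually_zero[of "if R < \<bar>x\<bar> then {y. R < \<bar>y\<bar>} else UNIV"]) (use R that o in \<open>auto split: if_splits\<close>)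
    ultimately show ?thesis by simp
  qed
  define B where "B = max 1 (max B1 B2)"
  have pb: "\<bar>pt \<phi> (t, x)\<bar> \<le> B" "\<bar>px \<phi> (t, x)\<bar> \<le> B" for t x
    using B[of "(t, x)"] z[of t x] unfolding B_def cbox_Pair_iff by (cases "\<bar>t\<bar> \<le> R \<and> \<bar>x\<bar> \<le> R"; force simp: abs_le_iff)+
  \<comment> \<open>No continuity of \<open>\<phi>\<close> is used: the mean value theorem starts at
    time \<open>R\<close>, where \<open>\<phi>\<close> vanishes, and \<open>pt \<phi>\<close> is
    bounded.\<close>
  have phi: "\<bar>\<phi> (t, x)\<bar> \<le> B * (2 * R)" for t x
  proof (cases "R \<le> \<bar>t\<bar>")
    case True then show ?thesis using R by (simp add: B_def)
  next
    case False
    have "norm (\<phi> (t, x) - \<phi> (R, x)) \<le> B * norm (t - R)"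
      using pb(1) test2_DERIV(1)[OF assms] 
      by (intro field_differentiable_bound[of UNIV "\<lambda>s. \<phi> (s, x)" "\<lambda>s. pt \<phi> (s, x)"]) auto
    also have "\<dots> \<le> B * (2 * R)" using False by (intro mult_left_mono) (auto simp: B_def)
    finally show ?thesis using R by simp
  qed
  show ?thesis
  proof (rule that[of "max B (B * (2 * R))"])
    show "0 < max B (B * (2 * R))" by (simp add: B_def)
  qed (use pb phi in \<open>auto simp: le_max_iff_disj\<close>)
qed

text \<open>\<open>test2\<close> asks for continuous partial derivatives only; being bounded, they
  make \<open>\<phi>\<close> Lipschitz along the two coordinate directions in turn.\<close>

lemma test2_continuous:
  assumes "test2 \<phi>"
  shows "continuous_on UNIV \<phi>"
proof -
  obtain N where N: "0 < N" "\<And>z. \<bar>pt \<phi> z\<bar> \<le> N" "\<And>z. \<bar>px \<phi> z\<bar> \<le> N" using test2_bounded[OF assms] by metis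
  have "dist (\<phi> z) (\<phi> w) \<le> (N + N) * dist z w" for z w
  proof -
    have "norm (\<phi> (fst z, snd z) - \<phi> (fst w, snd z)) \<le> N * norm (fst z - fst w)"
      using N test2_DERIV(1)[OF assms]
      by (intro field_differentiable_bound[of UNIV "\<lambda>s. \<phi> (s, snd z)" "\<lambda>s. pt \<phi> (s, snd z)"]) auto
    moreover have "norm (\<phi> (fst w, snd z) - \<phi> (fst w, snd w)) \<le> N * norm (snd z - snd w)"
      using N test2_DERIV(2)[OF assms]
      by (intro field_differentiable_bound[of UNIV "\<lambda>y. \<phi> (fst w, y)" "\<lambda>y. px \<phi> (fst w, y)"]) auto
    moreover have "N * norm (fst z - fst w) \<le> N * dist z w" "N * norm (snd z - snd w) \<le> N * dist z w"
      using dist_fst_le[of z w] dist_snd_le[of z w] N(1) by (auto simp: dist_norm)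
    ultimately show ?thesis by (simp add: dist_norm distrib_right)
  qed
  then have "(N + N)-lipschitz_on UNIV \<phi>" using N(1) by (intro lipschitz_onI) auto
  then show ?thesis by (rule lipschitz_on_continuous_on)
qed

text \<open>The expression that \<open>entropy_solution\<close> requires to be nonnegative.
  Approximate solutions are measured by how far below zero it can fall.\<close>

definition kruz :: "(real \<Rightarrow> real) \<Rightarrow> (real \<Rightarrow> real) \<Rightarrow> (real \<Rightarrow> real \<Rightarrow> real) \<Rightarrow> real \<Rightarrow> (real \<times> real \<Rightarrow> real) \<Rightarrow> real" where
  "kruz f u0 w k \<phi> = set_lebesgue_integral lborel ({0<..} \<times> UNIV)
     (\<lambda>z. \<bar>w (fst z) (snd z) - k\<bar> * pt \<phi> z + sgn (w (fst z) (snd z) - k) * (f (w (fst z) (snd z)) - f k) * px \<phi> z)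
   + (LBINT x. \<bar>u0 x - k\<bar> * \<phi> (0, x))"

text \<open>The restriction in time is one-sided, since the trace at time 0 enters the inequality.
  One \<open>N\<close> bounds the function and both derivatives, so that every defect can be stated
  as a multiple of \<open>N\<close>.\<close>

definition test_box :: "real \<Rightarrow> real \<Rightarrow> real \<Rightarrow> (real \<times> real \<Rightarrow> real) \<Rightarrow> bool" where
  "test_box T R N \<phi> \<longleftrightarrow> test2 \<phi> \<and> (\<forall>z. 0 \<le> \<phi> z) \<and> (\<forall>z. \<phi> z \<le> N \<and> \<bar>pt \<phi> z\<bar> \<le> N \<and> \<bar>px \<phi> z\<bar> \<le> N)
    \<and> (\<forall>t x. T \<le> t \<or> R \<le> \<bar>x\<bar> \<longrightarrow> \<phi> (t, x) = 0)"

lemma test_boxD: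
  assumes "test_box T R N \<phi>"
  shows "test2 \<phi>" "0 \<le> \<phi> z" "\<phi> z \<le> N" "\<bar>pt \<phi> z\<bar> \<le> N" "\<bar>px \<phi> z\<bar> \<le> N"
    "T \<le> t \<or> R \<le> \<bar>x\<bar> \<Longrightarrow> \<phi> (t, x) = 0" "T < t \<or> R < \<bar>x\<bar> \<Longrightarrow> pt \<phi> (t, x) = 0 \<and> px \<phi> (t, x) = 0"
    "0 \<le> N" "\<phi> \<in> borel_measurable borel" "pt \<phi> \<in> borel_measurable borel" "px \<phi> \<in> borel_measurable borel"
proof -
  show t2: "test2 \<phi>" and p: "0 \<le> \<phi> z" "\<phi> z \<le> N" "\<bar>pt \<phi> z\<bar> \<le> N" "\<bar>px \<phi> z\<bar> \<le> N"
    using assms unfolding test_box_def by blast+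
  have pz: "\<phi> (t, x) = 0" if "T \<le> t \<or> R \<le> \<bar>x\<bar>" for t x using assms that by (auto simp: test_box_def)
  show "T \<le> t \<or> R \<le> \<bar>x\<bar> \<Longrightarrow> \<phi> (t, x) = 0" by (rule pz)
  show "T < t \<or> R < \<bar>x\<bar> \<Longrightarrow> pt \<phi> (t, x) = 0 \<and> px \<phi> (t, x) = 0"
    using test2_deriv_zero[where \<phi> = \<phi> and T = T and R = R, OF pz] by blast
  show "0 \<le> N" using p(1,2) by linarith
  show "\<phi> \<in> borel_measurable borel" "pt \<phi> \<in> borel_measurable borel" "px \<phi> \<in> borel_measurable borel"
    using test2_continuous[OF t2] t2 by (auto simp: test2_def intro: borel_measurable_continuous_onI)
qed

text \<open>The jump of the sign is compensated: the flux equals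
  \<open>f (max u k) - f (min u k)\<close>.\<close>

lemma kruzhkov_flux_isCont:
  assumes "\<And>x. isCont f x"
  shows "isCont (\<lambda>u. sgn (u - k) * (f u - f k)) (x::real)"
proof -
  have e: "sgn (u - k) * (f u - f k) = (f (max u k) - f k) - (f (min u k) - f k)" for u :: real
    by (auto simp: sgn_if max_def min_def)
  have c: "continuous_on UNIV f" using assms by (intro continuous_at_imp_continuous_on) auto
  have "continuous_on UNIV (\<lambda>u. (f (max u k) - f k) - (f (min u k) - f k))"
    by (intro continuous_intros continuous_on_compose2[OF c]) auto
  then show ?thesis unfolding e by (simp add: continuous_on_eq_continuous_at)
qed

text \<open>Links the Lebesgue integral of \<open>kruz\<close> to the iterated integrals for which
  the Leibniz rule is available. The open condition \<open>0 < t\<close> differs from the closed box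
  by a null set.\<close>

lemma LBINT_time_space:
  fixes g :: "real \<times> real \<Rightarrow> real"
  assumes c: "continuous_on ({0..} \<times> UNIV) g" and T: "0 \<le> T" and R: "0 \<le> R"
    and z: "\<And>t x. 0 < t \<Longrightarrow> T < t \<or> R < \<bar>x\<bar> \<Longrightarrow> g (t, x) = 0"
  shows "set_lebesgue_integral lborel ({0<..} \<times> UNIV) g = integral {0..T} (\<lambda>t. integral {-R..R} (\<lambda>x. g (t, x)))"
proof -
  let ?B = "cbox (0, -R) (T, R)"
  have cB: "continuous_on ?B g" using c by (rule continuous_on_subset) (auto simp: cbox_Pair_eq)
  have "set_lebesgue_integral lborel ({0<..} \<times> UNIV) g = set_lebesgue_integral lborel ?B g"
    unfolding set_lebesgue_integral_def
  proof (rule integral_cong_AE)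
    have "{z \<in> space (lborel \<Otimes>\<^sub>M lborel). fst z \<noteq> (0::real)} = {z :: real \<times> real. fst z \<noteq> 0}"
      by (auto simp: space_pair_measure)
    also have "\<dots> \<in> sets borel" by (intro borel_open open_Collect_neq continuous_intros)
    finally have m0: "{z \<in> space (lborel \<Otimes>\<^sub>M (lborel :: real measure)). fst z \<noteq> (0::real)} \<in> sets (lborel \<Otimes>\<^sub>M lborel)"
      by (simp only: lborel_prod sets_lborel)
    have "AE x in lborel. (x::real) \<noteq> 0" using AE_lborel_singleton[of "0::real"] by simp
    then have "AE x in lborel. AE y in (lborel :: real measure). fst (x, y) \<noteq> (0::real)"
      by eventually_elim simp
    from lborel_pair.AE_pair_measure[OF m0 this]
    have "AE z in lborel \<Otimes>\<^sub>M (lborel :: real measure). fst z \<noteq> (0::real)" .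
    then have "AE z in lborel. fst (z :: real \<times> real) \<noteq> 0" by (simp only: lborel_prod)
    then show "AE x in lborel. indicat_real ({0<..} \<times> UNIV) x *\<^sub>R g x = indicat_real ?B x *\<^sub>R g x"
    proof eventually_elim
      case (elim x)
      obtain t y where x: "x = (t, y)" by (cases x)
      have "y \<in> {-R..R} \<longleftrightarrow> \<not> R < \<bar>y\<bar>" by auto
      then show ?case using z[of t y] elim unfolding x
        by (cases "T < t \<or> R < \<bar>y\<bar>") (auto simp: indicator_def cbox_Pair_iff)
    qed
    have m: "(\<lambda>x. indicat_real ({0..} \<times> UNIV) x *\<^sub>R g x) \<in> borel_measurable borel"
      by (rule borel_measurable_continuous_on_indicator[OF _ c]) (simp add: borel_closed closed_Times)
    have e: "(\<lambda>x. indicat_real ({0<..} \<times> UNIV) x *\<^sub>R g x) = (\<lambda>x. indicat_real ({0<..} \<times> UNIV) x *\<^sub>R (indicat_real ({0..} \<times> UNIV) x *\<^sub>R g x))"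
      by (auto split: split_indicator)
    have mo: "{0<..} \<times> (UNIV :: real set) \<in> sets (borel :: (real \<times> real) measure)"
      by (intro borel_open open_Times) auto
    have "(\<lambda>x. indicat_real ({0<..} \<times> UNIV) x *\<^sub>R (indicat_real ({0..} \<times> UNIV) x *\<^sub>R g x)) \<in> borel_measurable borel"
      by (intro borel_measurable_scaleR borel_measurable_indicator mo m)
    then show "(\<lambda>x. indicat_real ({0<..} \<times> UNIV) x *\<^sub>R g x) \<in> borel_measurable lborel"
      by (subst e) (simp only: measurable_lborel2)
    show "(\<lambda>x. indicat_real ?B x *\<^sub>R g x) \<in> borel_measurable lborel"
      using borel_measurable_continuous_on_indicator[OF _ cB] by simp
  qed
  also have "\<dots> = integral ?B g"
    by (rule set_borel_integral_eq_integral(2)) (use borel_integrable_compact[OF compact_cbox cB] in \<open>simp add: set_integrable_def\<close>)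
  also have "\<dots> = integral {0..T} (\<lambda>t. integral {-R..R} (\<lambda>x. g (t, x)))"
    using integral_prod_continuous[OF cB] by simp
  finally show ?thesis .
qed

text \<open>A convex approximation of the modulus within \<open>d\<close>, with derivatives
  \<open>rt1\<close> and \<open>rt2\<close>. Unlike for \<open>sg\<close>, a second derivative is
  required, because the multiplier \<open>rt1\<close> of the equation is itself differentiated in
  space.\<close>

definition rt :: "real \<Rightarrow> real \<Rightarrow> real" where "rt d z = sqrt (z\<^sup>2 + d\<^sup>2)"
definition rt1 :: "real \<Rightarrow> real \<Rightarrow> real" where "rt1 d z = z / rt d z"
definition rt2 :: "real \<Rightarrow> real \<Rightarrow> real" where "rt2 d z = d\<^sup>2 / (rt d z) ^ 3"

lemma rt_facts:
  assumes d: "0 < d"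
  shows "\<bar>z\<bar> \<le> rt d z" "rt d z \<le> \<bar>z\<bar> + d" "\<bar>rt1 d z\<bar> \<le> 1" "0 \<le> rt2 d z" "rt2 d z \<le> 1 / d"
    "(rt d has_real_derivative rt1 d z) (at z)" "(rt1 d has_real_derivative rt2 d z) (at z)" "isCont (rt2 d) z"
proof -
  have pos: "0 < z\<^sup>2 + d\<^sup>2" for z using d by (simp add: add_nonneg_pos)
  have rp: "0 < rt d z" for z using pos by (simp add: rt_def)
  have sq: "(rt d z)\<^sup>2 = z\<^sup>2 + d\<^sup>2" for z using pos[of z] by (simp add: rt_def)
  have dr: "d \<le> rt d z" for z unfolding rt_def by (rule real_le_rsqrt) simp
  show az: "\<bar>z\<bar> \<le> rt d z" unfolding rt_def by (rule real_le_rsqrt) simp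
  show "rt d z \<le> \<bar>z\<bar> + d" unfolding rt_def using d by (intro real_le_lsqrt) (auto simp: power2_eq_square algebra_simps)
  show "\<bar>rt1 d z\<bar> \<le> 1" using az rp[of z] by (simp add: rt1_def)
  show "0 \<le> rt2 d z" using rp[of z] by (simp add: rt2_def)
  have "d ^ 3 \<le> rt d z ^ 3" using d dr by (intro power_mono) auto
  then show "rt2 d z \<le> 1 / d" using rp[of z] d
    by (simp add: rt2_def field_simps power3_eq_cube power2_eq_square)
  show D: "(rt d has_real_derivative rt1 d z) (at z)" for z
    unfolding rt_def[abs_def] rt1_def
    using pos[of z] by (auto intro!: derivative_eq_intros simp: divide_simps)
  have "((\<lambda>z. z / rt d z) has_real_derivative (1 * rt d z - z * rt1 d z) / (rt d z * rt d z)) (at z)"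
    using rp[of z] by (intro DERIV_divide DERIV_ident D) auto
  moreover have "(1 * rt d z - z * rt1 d z) / (rt d z * rt d z) = rt2 d z"
  proof -
    have "rt d z * (rt d z - z * rt1 d z) = d\<^sup>2" using sq[of z] rp[of z] by (simp add: rt1_def power2_eq_square field_simps)
    then have "rt d z - z * rt1 d z = d\<^sup>2 / rt d z" using rp[of z] by (simp add: field_simps)
    then show ?thesis by (simp add: rt2_def power3_eq_cube)
  qed
  ultimately show "(rt1 d has_real_derivative rt2 d z) (at z)" unfolding rt1_def[abs_def] by simp
  have "isCont (rt d) z" using D DERIV_isCont by blast
  then show "isCont (rt2 d) z" unfolding rt2_def[abs_def] using rp[of z] by (intro continuous_intros) auto
qed

text \<open>The flux of the regularised entropy \<open>rt d (u - k)\<close> is within \<open>L d\<close> of Kruzhkov's flux.\<close>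
lemma regularised_flux:
  fixes f f1 :: "real \<Rightarrow> real"
  assumes d: "0 < d" and f1: "\<And>x. (f has_real_derivative f1 x) (at x)" and f1c: "\<And>x. isCont f1 x"
    and L: "\<And>y. \<bar>y\<bar> \<le> K \<Longrightarrow> \<bar>f1 y\<bar> \<le> L" and k: "\<bar>k\<bar> \<le> K"
  obtains Q where "\<And>u. (Q has_real_derivative rt1 d (u - k) * f1 u) (at u)"
    "\<And>u. \<bar>u\<bar> \<le> K \<Longrightarrow> \<bar>Q u - sgn (u - k) * (f u - f k)\<bar> \<le> L * d"
proof -
  have r1c: "isCont (rt1 d) z" for z using rt_facts(7)[OF d] DERIV_isCont by blast
  have r0: "rt d 0 = d" using d by (simp add: rt_def)
  have L0: "0 \<le> L" using L[of k] k abs_ge_zero[of "f1 k"] by linarith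
  have "isCont (\<lambda>u. rt1 d (u - k) * f1 u) u" for u
    by (intro continuous_intros f1c isCont_o2[OF _ r1c])
  then obtain Q0 where Q0: "\<And>u. (Q0 has_real_derivative rt1 d (u - k) * f1 u) (at u)"
    using antiderivative_real by blast
  define Q where "Q u = Q0 u - Q0 k" for u
  have Q: "(Q has_real_derivative rt1 d (u - k) * f1 u) (at u)" for u
    unfolding Q_def[abs_def] using Q0 by (auto intro!: derivative_eq_intros)
  have R: "((\<lambda>u. rt d (u - k)) has_real_derivative rt1 d (u - k)) (at u)" for u
    using DERIV_shift[of "rt d" "rt1 d (u - k)" u "- k"] rt_facts(6)[OF d, of "u - k"] by simp
  have r1: "rt1 d (u - k) \<le> 1" "- 1 \<le> rt1 d (u - k)" for u using rt_facts(3)[OF d, of "u - k"] by auto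
  have "\<bar>Q u - sgn (u - k) * (f u - f k)\<bar> \<le> L * d" if u: "\<bar>u\<bar> \<le> K" for u
  proof (cases "k \<le> u")
    case True
    \<comment> \<open>A monotone comparison function: its derivative factors as
      \<open>(1 - rt1) * (L - s * f1)\<close>, and both factors are nonnegative. The two signs
      \<open>s\<close> give the two-sided bound.\<close>
    have *: "(\<lambda>u. s * (Q u - (f u - f k)) + L * ((u - k) - rt d (u - k) + d)) u \<ge> 
        (\<lambda>u. s * (Q u - (f u - f k)) + L * ((u - k) - rt d (u - k) + d)) k" if "s = 1 \<or> s = -1" for s
    proof (rule DERIV_nonneg_imp_nondecreasing[OF True])
      fix x assume x: "k \<le> x" "x \<le> u"
      have "\<bar>f1 x\<bar> \<le> L" using x k u by (intro L) auto
      then have "0 \<le> (1 - rt1 d (x - k)) * (L - s * f1 x)"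
        using that r1[of x] by (intro mult_nonneg_nonneg) auto
      moreover have "((\<lambda>u. s * (Q u - (f u - f k)) + L * ((u - k) - rt d (u - k) + d)) has_real_derivative
         s * (rt1 d (x - k) * f1 x - f1 x) + L * (1 - rt1 d (x - k))) (at x)"
        by (rule derivative_eq_intros Q f1 R refl)+ simp
      moreover have "s * (rt1 d (x - k) * f1 x - f1 x) + L * (1 - rt1 d (x - k)) = (1 - rt1 d (x - k)) * (L - s * f1 x)"
        by (simp add: algebra_simps)
      ultimately show "\<exists>y. ((\<lambda>u. s * (Q u - (f u - f k)) + L * ((u - k) - rt d (u - k) + d)) has_real_derivative y) (at x) \<and> 0 \<le> y"
        by (intro exI conjI) (assumption, simp only:)
    qed
    have b: "L * ((u - k) - rt d (u - k) + d) \<le> L * d"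
      using rt_facts(1)[OF d, of "u - k"] True L0 by (intro mult_left_mono) auto
    have e: "sgn (u - k) * (f u - f k) = f u - f k" using True by (cases "u = k") auto
    show ?thesis unfolding e using *[of 1] *[of "-1"] b r0 by (simp add: Q_def abs_le_iff)
  next
    case False
    then have uk: "u \<le> k" by simp
    have *: "(\<lambda>u. s * (Q u + (f u - f k)) + L * ((u - k) + rt d (u - k) - d)) u \<le> 
        (\<lambda>u. s * (Q u + (f u - f k)) + L * ((u - k) + rt d (u - k) - d)) k" if "s = 1 \<or> s = -1" for s
    proof (rule DERIV_nonneg_imp_nondecreasing[OF uk])
      fix x assume x: "u \<le> x" "x \<le> k"
      have "\<bar>f1 x\<bar> \<le> L" using x k u by (intro L) auto
      then have "0 \<le> (1 + rt1 d (x - k)) * (L + s * f1 x)"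
        using that r1[of x] by (intro mult_nonneg_nonneg) auto
      moreover have "((\<lambda>u. s * (Q u + (f u - f k)) + L * ((u - k) + rt d (u - k) - d)) has_real_derivative
         s * (rt1 d (x - k) * f1 x + f1 x) + L * (1 + rt1 d (x - k))) (at x)"
        by (rule derivative_eq_intros Q f1 R refl)+ simp
      moreover have "s * (rt1 d (x - k) * f1 x + f1 x) + L * (1 + rt1 d (x - k)) = (1 + rt1 d (x - k)) * (L + s * f1 x)"
        by (simp add: algebra_simps)
      ultimately show "\<exists>y. ((\<lambda>u. s * (Q u + (f u - f k)) + L * ((u - k) + rt d (u - k) - d)) has_real_derivative y) (at x) \<and> 0 \<le> y"
        by (intro exI conjI) (assumption, simp only:)
    qed
    have b: "L * (d - ((u - k) + rt d (u - k))) \<le> L * d"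
      using rt_facts(1)[OF d, of "u - k"] False L0 by (intro mult_left_mono) auto
    have e: "sgn (u - k) * (f u - f k) = - (f u - f k)" using False by simp
    show ?thesis unfolding e using *[of 1] *[of "-1"] b r0 by (simp add: Q_def right_diff_distrib abs_le_iff)
  qed
  then show ?thesis using that[OF Q] by blast
qed

context rb_approx
begin

text \<open>The equation is multiplied by \<open>rt1 d (U - k)\<close> and the weight. The entropy
  production of \<open>P\<close> is at most \<open>N * (M / d + 1) * IP\<close>, which
  \<open>Dis\<close> pays for after multiplication by \<open>l\<^sup>2\<close>; returning from
  \<open>rt d\<close> to the modulus costs \<open>d\<close> per unit of area. \<open>K'\<close> may
  exceed \<open>K\<close>, because \<open>k\<close> will run through the values of another
  function.\<close>

lemma kruzhkov_approx:
  assumes i: "\<And>s. 0 \<le> s \<Longrightarrow> s \<le> T \<Longrightarrow> integrable lborel (\<lambda>x. \<bar>q s x\<bar>)"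
      "\<And>s. 0 \<le> s \<Longrightarrow> s \<le> T \<Longrightarrow> (LBINT x. \<bar>q s x\<bar>) \<le> K"
    and L: "\<And>y. \<bar>y\<bar> \<le> K' \<Longrightarrow> \<bar>f1 y\<bar> \<le> L" and KK: "K \<le> K'" and k: "\<bar>k\<bar> \<le> K'"
    and M: "0 \<le> M" and qM: "\<And>s x. 0 \<le> s \<Longrightarrow> s \<le> T \<Longrightarrow> q s x \<le> M"
    and \<phi>: "test_box T R N \<phi>" and T: "0 \<le> T" and R: "0 \<le> R" and d: "0 < d"
  shows "- (N * ((M / d + 1) * (1 + K / 2)\<^sup>2 * (2 * K * l\<^sup>2 + C * K * T * l) + d * (2 * R + (1 + L) * (2 * R * T)))) \<le> kruz f (U 0) U k \<phi>"
proof -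
  let ?k = "(1 + K / 2)\<^sup>2"
  have K0: "0 \<le> K" using T by (intro order_trans[OF _ i(2)[of 0]]) auto
  then have k0: "0 < ?k" by simp
  have L0: "0 \<le> L" using L[of k] k abs_ge_zero[of "f1 k"] by linarith
  have UK: "\<bar>U s x\<bar> \<le> K'" if "0 \<le> s" "s \<le> T" for s x
    using U_le_LINT[OF that(1) i(1)[OF that], of x] i(2)[OF that] KK by linarith
  note t2 = test_boxD(1)[OF \<phi>] and p0 = test_boxD(2)[OF \<phi>] and pN = test_boxD(3-5)[OF \<phi>] and pz = test_boxD(6)[OF \<phi>]
    and N0 = test_boxD(8)[OF \<phi>]
  obtain Q where Q: "\<And>u. (Q has_real_derivative rt1 d (u - k) * f1 u) (at u)"
    "\<And>u. \<bar>u\<bar> \<le> K' \<Longrightarrow> \<bar>Q u - sgn (u - k) * (f u - f k)\<bar> \<le> L * d"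
    using regularised_flux[OF d f1 f1_cont L k] by metis
  note E = rt_facts[OF d]
  have Ec: "continuous_on UNIV (rt d)" "continuous_on UNIV (rt1 d)" "continuous_on UNIV (rt2 d)" "continuous_on UNIV Q"
    using DERIV_isCont[OF E(6)] DERIV_isCont[OF E(7)] E(8) DERIV_isCont[OF Q(1)]
    by (auto intro!: continuous_at_imp_continuous_on)
  let ?S = "{0..} \<times> (UNIV :: real set)"
  have cp: "continuous_on S (\<lambda>z. \<phi> z)" "continuous_on S (\<lambda>z. pt \<phi> z)" "continuous_on S (\<lambda>z. px \<phi> z)" for S
    using test2_continuous[OF t2] t2 by (auto simp: test2_def intro: continuous_on_subset)
  have cU: "continuous_on ?S (\<lambda>z. g (U (fst z) (snd z)))" if "continuous_on UNIV g" for g :: "real \<Rightarrow> real"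
    by (rule continuous_on_compose2[OF that Uc]) auto
  have shc: "continuous_on UNIV (\<lambda>u. g (u - k))" if "continuous_on UNIV g" for g :: "real \<Rightarrow> real"
    by (intro continuous_on_compose2[OF that] continuous_intros) auto
  note cE = cU[OF shc[OF Ec(1)]] and cE1 = cU[OF shc[OF Ec(2)]] and cQ = cU[OF Ec(4)]
  let ?Hd = "\<lambda>t x. rt1 d (U t x - k) * V t x * \<phi> (t, x) + rt d (U t x - k) * pt \<phi> (t, x)"
  let ?yd = "\<lambda>t x. rt d (U t x - k) * pt \<phi> (t, x) + Q (U t x) * px \<phi> (t, x)"
  \<comment> \<open>Without \<open>P\<close> the weighted entropy \<open>H\<close> would change
    exactly at the rate \<open>Yd\<close>. Thus only the effect of \<open>P\<close> remains in the
    derivative of \<open>H - Y\<close>.\<close>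
  define H where "H t = integral {-R..R} (\<lambda>x. rt d (U t x - k) * \<phi> (t, x))" for t
  define Yd where "Yd t = integral {-R..R} (?yd t)" for t
  define Y where "Y t = integral {0..t} Yd" for t
  have cHd: "continuous_on ?S (\<lambda>z. ?Hd (fst z) (snd z))"
    using cE1 Vc cp cE by (auto intro!: continuous_intros)
  have cyd: "continuous_on ?S (\<lambda>z. ?yd (fst z) (snd z))" using cE cQ cp by (auto intro!: continuous_intros)
  have sec: "continuous_on A (\<lambda>x. g (t, x))" if "continuous_on ?S g" "0 \<le> t" for g :: "real \<times> real \<Rightarrow> real" and t A
    by (rule continuous_on_compose2[OF that(1)]) (use that(2) in \<open>auto intro!: continuous_intros\<close>)
  have HD: "(H has_real_derivative integral {-R..R} (?Hd s)) (at s within {0..})" if s: "0 \<le> s" for s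
  proof -
    have "((\<lambda>t. integral (cbox (-R) R) (\<lambda>x. rt d (U t x - k) * \<phi> (t, x))) has_field_derivative integral (cbox (-R) R) (?Hd s)) (at s within {0..})"
    proof (rule leibniz_rule_field_derivative)
      fix t x :: real assume t: "t \<in> {0..}"
      have "((\<lambda>t. rt d (U t x - k)) has_real_derivative rt1 d (U t x - k) * V t x) (at t within {0..})"
        by (rule DERIV_chain2[OF DERIV_subset[OF E(6)]])
           (use t Ut in \<open>auto intro!: derivative_eq_intros\<close>)
      from DERIV_mult[OF this DERIV_subset[OF test2_DERIV(1)[OF t2, of x t]]]
      show "((\<lambda>t. rt d (U t x - k) * \<phi> (t, x)) has_real_derivative ?Hd t x) (at t within {0..})"
        by (simp add: algebra_simps)
    next
      fix t :: real assume "t \<in> {0..}"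
      then have "continuous_on {-R..R} (\<lambda>x. rt d (U t x - k) * \<phi> (t, x))"
        using sec[OF continuous_on_mult[OF cE cp(1)], of t] by simp
      then show "(\<lambda>x. rt d (U t x - k) * \<phi> (t, x)) integrable_on cbox (-R) R"
        by (simp add: integrable_continuous_real)
    next
      show "continuous_on ({0..} \<times> cbox (-R) R) (\<lambda>(t, x). ?Hd t x)"
        unfolding case_prod_unfold by (rule continuous_on_subset[OF cHd]) auto
    qed (use s in auto)
    then show ?thesis by (simp add: H_def[abs_def])
  qed
  have Yc: "continuous_on {0..T} Yd"
  proof -
    have "continuous_on ({0..T} \<times> cbox (-R) R) (\<lambda>(t, x). ?yd t x)"
      unfolding case_prod_unfold by (rule continuous_on_subset[OF cyd]) auto
    from integral_continuous_on_param[OF this] show ?thesis by (simp add: Yd_def[abs_def])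
  qed
  have YD: "(Y has_real_derivative Yd s) (at s within {0..T})" if "0 \<le> s" "s \<le> T" for s
    unfolding Y_def[abs_def] using integral_has_real_derivative[OF Yc] that by simp
  let ?a = "N * (M / d + 1)"
  have a0: "0 \<le> ?a" using N0 M d by simp
  have Hle: "integral {-R..R} (?Hd s) \<le> Yd s + ?a * IP s" if s: "0 \<le> s" "s \<le> T" for s
  proof -
    \<comment> \<open>Its derivative integrates to zero, as the weight vanishes at both ends. The
      second summand moves the derivative from \<open>P\<close> onto the multiplier and the weight,
      which leaves \<open>?e\<close> with the factor \<open>P\<close>.\<close>
    let ?W = "\<lambda>x. Q (U s x) * \<phi> (s, x) + rt1 d (U s x - k) * (P s x * \<phi> (s, x))"
    let ?W' = "\<lambda>x. (rt1 d (U s x - k) * f1 (U s x) * q s x * \<phi> (s, x) + Q (U s x) * px \<phi> (s, x))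
       + (rt2 d (U s x - k) * q s x * (P s x * \<phi> (s, x)) + rt1 d (U s x - k) * (P1 s x * \<phi> (s, x) + P s x * px \<phi> (s, x)))"
    let ?e = "\<lambda>x. (rt2 d (U s x - k) * q s x * \<phi> (s, x) + rt1 d (U s x - k) * px \<phi> (s, x)) * P s x"
    have DW: "(?W has_real_derivative ?W' x) (at x)" for x
    proof -
      have "((\<lambda>x. Q (U s x)) has_real_derivative rt1 d (U s x - k) * f1 (U s x) * q s x) (at x)"
        by (rule DERIV_chain2[OF Q(1) Uq[OF s(1)]])
      moreover have "((\<lambda>x. rt1 d (U s x - k)) has_real_derivative rt2 d (U s x - k) * q s x) (at x)"
        by (rule DERIV_chain2[OF E(7)]) (use Uq[OF s(1)] in \<open>auto intro!: derivative_eq_intros\<close>)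
      ultimately show ?thesis
        using test2_DERIV(2)[OF t2, of s x] PP1[OF s(1), of x] 
        by (auto intro!: derivative_eq_intros simp: algebra_simps)
    qed
    have "(?W' has_integral ?W R - ?W (-R)) {-R..R}"
      using R DW by (intro fundamental_theorem_of_calculus)
        (auto simp: has_real_derivative_iff_has_vector_derivative[symmetric] intro: DERIV_subset)
    then have W0: "(?W' has_integral 0) {-R..R}" using pz[of s R] pz[of s "-R"] R by simp
    have cU': "continuous_on {-R..R} (U s)" "continuous_on {-R..R} (q s)" "continuous_on {-R..R} (P s)"
      using U_cont[OF s(1)] q_cont[OF s(1)] P_cont[OF s(1)] by (auto intro!: continuous_at_imp_continuous_on)
    have ce: "continuous_on {-R..R} ?e"
    proof -
      have "continuous_on {-R..R} (\<lambda>x. px \<phi> (s, x))" "continuous_on {-R..R} (\<lambda>x. \<phi> (s, x))"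
        using sec[OF cp(3) s(1)] sec[OF cp(1) s(1)] by auto
      moreover have "continuous_on {-R..R} (\<lambda>x. g (U s x - k))" if "continuous_on UNIV g" for g :: "real \<Rightarrow> real"
        by (rule continuous_on_compose2[OF that]) (use cU' in \<open>auto intro!: continuous_intros\<close>)
      ultimately show ?thesis using cU' Ec by (auto intro!: continuous_intros)
    qed
    have Hi: "?Hd s integrable_on {-R..R}" using sec[OF cHd s(1)] by (simp add: integrable_continuous_real)
    have yi: "?yd s integrable_on {-R..R}" using sec[OF cyd s(1)] by (simp add: integrable_continuous_real)
    have ei: "?e integrable_on {-R..R}" using ce by (simp add: integrable_continuous_real)
    have pw: "?Hd s x + ?W' x = ?yd s x + ?e x" for x unfolding eq[OF s(1)] by (simp add: algebra_simps)
    have "integral {-R..R} (?Hd s) = integral {-R..R} (\<lambda>x. ?Hd s x + ?W' x)"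
      using has_integral_add[OF integrable_integral[OF Hi] W0] by (simp add: integral_unique)
    also have "\<dots> = integral {-R..R} (\<lambda>x. ?yd s x + ?e x)" unfolding pw ..
    also have "\<dots> = Yd s + integral {-R..R} ?e" unfolding Yd_def by (rule Henstock_Kurzweil_Integration.integral_add[OF yi ei])
    finally have HY: "integral {-R..R} (?Hd s) = Yd s + integral {-R..R} ?e" .
    have "integral {-R..R} ?e \<le> ?a * IP s"
    proof -
      have el: "?e x \<le> ?a * P s x" for x
      proof -
        \<comment> \<open>Here the one-sided bound suffices: the factors of \<open>q\<close> are
          nonnegative, so negative values of \<open>q\<close> only help.\<close>
        have "rt2 d (U s x - k) * q s x * \<phi> (s, x) \<le> M / d * N"
        proof (cases "q s x \<le> 0")
          case True
          then have "rt2 d (U s x - k) * q s x * \<phi> (s, x) \<le> 0"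
            using E(4) p0 by (intro mult_nonpos_nonneg mult_nonneg_nonpos) auto
          then show ?thesis using M N0 d by (smt (verit) divide_nonneg_pos mult_nonneg_nonneg)
        next
          case False
          then have "rt2 d (U s x - k) * q s x * \<phi> (s, x) \<le> 1 / d * M * N"
            using E(4,5) p0 pN(1) qM[OF s] M d by (intro mult_mono) auto
          then show ?thesis by simp
        qed
        moreover have "rt1 d (U s x - k) * px \<phi> (s, x) \<le> N"
          using mult_mono[OF E(3)[of "U s x - k"] pN(3)[of "(s, x)"]] abs_ge_self[of "rt1 d (U s x - k) * px \<phi> (s, x)"]
          by (simp add: abs_mult)
        ultimately have "rt2 d (U s x - k) * q s x * \<phi> (s, x) + rt1 d (U s x - k) * px \<phi> (s, x) \<le> ?a"
          by (simp add: algebra_simps)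
        then show ?thesis using P0[OF s(1)] by (rule mult_right_mono)
      qed
      have "integral {-R..R} ?e = (LBINT x:{-R..R}. ?e x)"
        by (rule set_borel_integral_eq_integral(2)[symmetric]) (rule borel_integrable_atLeastAtMost'[OF ce])
      also have "\<dots> \<le> (LBINT x:{-R..R}. ?a * P s x)"
        by (rule set_integral_mono[OF borel_integrable_atLeastAtMost'[OF ce] set_integrable_cont el])
          (use P_cont[OF s(1)] in \<open>auto intro!: continuous_intros\<close>)
      also have "\<dots> \<le> (LBINT x. ?a * P s x)"
        by (rule LBINT_le_LINT) (use P_cont[OF s(1)] Pi[OF s(1)] a0 P0[OF s(1)] in \<open>auto intro!: continuous_intros\<close>)
      also have "\<dots> = ?a * IP s" by (simp add: IP_def)
      finally show ?thesis .
    qed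
    then show ?thesis unfolding HY by (rule add_left_mono)
  qed
  \<comment> \<open>By \<open>Dis'_le\<close> the term \<open>- IP / (?k * l\<^sup>2)\<close> occurs
    in \<open>Dis'\<close>; with this coefficient it cancels the error
    \<open>?a * IP\<close>.\<close>
  let ?G = "\<lambda>t. H t - Y t + ?a * ?k * l\<^sup>2 * Dis t"
  have "?G T - ?G 0 \<le> (?a * ?k * (C * K * l)) * (T - 0)"
  proof (rule DERIV_Icc_le[OF _ _ T])
    fix s assume s: "0 \<le> s" "s \<le> T"
    show "(?G has_real_derivative (integral {-R..R} (?Hd s) - Yd s + ?a * ?k * l\<^sup>2 * Dis' s)) (at s within {0..T})"
    proof -
      have sub: "{0..T} \<subseteq> {0..}" by auto
      show ?thesis by (rule DERIV_add[OF DERIV_diff[OF DERIV_subset[OF HD[OF s(1)] sub] YD[OF s]]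
          DERIV_cmult[OF DERIV_subset[OF Dis_DERIV[OF s(1)] sub]]])
    qed
  next
    fix s assume "0 < s" "s < T"
    then have s: "0 \<le> s" "s \<le> T" by auto
    have "?a * ?k * l\<^sup>2 * Dis' s \<le> ?a * ?k * l\<^sup>2 * (C * K / l - 1 / ?k / l\<^sup>2 * IP s)"
      using Dis'_le[OF s(1) i[OF s]] a0 k0 l0 by (intro mult_left_mono) auto
    also have "\<dots> = ?a * ?k * (C * K * l) - ?a * IP s"
    proof -
      have "a * k * l\<^sup>2 * (C * K / l - 1 / k / l\<^sup>2 * I) = a * k * (C * K * l) - a * I" if "k > 0" for a k I :: real
        using that l0 by (simp add: field_simps power2_eq_square)
      then show ?thesis using k0 by blast
    qed
    finally show "integral {-R..R} (?Hd s) - Yd s + ?a * ?k * l\<^sup>2 * Dis' s \<le> ?a * ?k * (C * K * l)"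
      using Hle[OF s] by linarith
  qed
  moreover have "H T = 0" unfolding H_def using pz[of T] by simp
  moreover have "Y 0 = 0" by (simp add: Y_def)
  moreover have "?a * ?k * l\<^sup>2 * Dis 0 - ?a * ?k * l\<^sup>2 * Dis T \<le> ?a * ?k * (2 * K * l\<^sup>2)"
  proof -
    have "Dis 0 - Dis T \<le> 2 * K" 
      using Dis_bound[of 0 K] Dis_bound[of T K] i[of 0] i[of T] T by (smt (verit))
    then have "?a * ?k * l\<^sup>2 * (Dis 0 - Dis T) \<le> ?a * ?k * l\<^sup>2 * (2 * K)" using a0 k0 by (intro mult_left_mono) auto
    moreover have "A * w * (x - y) \<le> A * w * (2 * K) \<Longrightarrow> A * w * x - A * w * y \<le> A * (2 * K * w)" for A w x y :: real
      by (simp add: algebra_simps)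
    ultimately show ?thesis by blast
  qed
  moreover have "HT - YT + Z * w * DT - (H0 - Y0 + Z * w * D0) \<le> Z * e * (T - 0) \<Longrightarrow> HT = 0 \<Longrightarrow> Y0 = 0 \<Longrightarrow>
      Z * w * D0 - Z * w * DT \<le> Z * b \<Longrightarrow> 0 \<le> H0 + YT + Z * (b + e * T)" for HT YT Z w DT H0 Y0 D0 e b :: real
    by (simp add: algebra_simps)
  ultimately have main: "0 \<le> H 0 + Y T + ?a * ?k * (2 * K * l\<^sup>2 + C * K * l * T)" by blast
  let ?g = "\<lambda>z. \<bar>U (fst z) (snd z) - k\<bar> * pt \<phi> z + sgn (U (fst z) (snd z) - k) * (f (U (fst z) (snd z)) - f k) * px \<phi> z"
  have fc: "continuous_on UNIV (\<lambda>u. sgn (u - k) * (f u - f k))"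
    using kruzhkov_flux_isCont[OF f_cont] by (intro continuous_at_imp_continuous_on) auto
  have cg: "continuous_on ?S ?g"
    using cU[OF fc] Uc cp by (auto intro!: continuous_intros)
  have gi: "set_lebesgue_integral lborel ({0<..} \<times> UNIV) ?g = integral {0..T} (\<lambda>t. integral {-R..R} (\<lambda>x. ?g (t, x)))"
    by (rule LBINT_time_space[OF cg T R]) (simp add: test2_deriv_zero[where \<phi> = \<phi> and T = T and R = R, OF pz])
  have ydle: "Yd t \<le> integral {-R..R} (\<lambda>x. ?g (t, x)) + (N * (d * (1 + L))) * (2 * R)" if t: "0 \<le> t" "t \<le> T" for t
  proof -
    have "Yd t \<le> integral {-R..R} (\<lambda>x. ?g (t, x) + N * (d * (1 + L)))"
      unfolding Yd_def
    proof (rule integral_le)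
      show "?yd t integrable_on {-R..R}" using sec[OF cyd t(1)] by (simp add: integrable_continuous_real)
      show "(\<lambda>x. ?g (t, x) + N * (d * (1 + L))) integrable_on {-R..R}"
        by (intro integrable_continuous_real continuous_on_add[OF sec[OF cg t(1)] continuous_on_const])
      fix x
      have "\<bar>rt d (U t x - k) - \<bar>U t x - k\<bar>\<bar> \<le> d" using E(1,2)[of "U t x - k"] by linarith
      from mult_mono[OF this pN(2)[of "(t, x)"]] have 1: "(rt d (U t x - k) - \<bar>U t x - k\<bar>) * pt \<phi> (t, x) \<le> d * N"
        using d abs_ge_self[of "(rt d (U t x - k) - \<bar>U t x - k\<bar>) * pt \<phi> (t, x)"] by (simp add: abs_mult)
      from mult_mono[OF Q(2)[OF UK[OF t]] pN(3)[of "(t, x)"], of x]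
      have 2: "(Q (U t x) - sgn (U t x - k) * (f (U t x) - f k)) * px \<phi> (t, x) \<le> L * d * N"
        using d L0 abs_ge_self[of "(Q (U t x) - sgn (U t x - k) * (f (U t x) - f k)) * px \<phi> (t, x)"] by (simp add: abs_mult)
      show "?yd t x \<le> ?g (t, x) + N * (d * (1 + L))"
        using 1 2 by (simp add: algebra_simps)
    qed
    also have "\<dots> = integral {-R..R} (\<lambda>x. ?g (t, x)) + integral {-R..R} (\<lambda>x. N * (d * (1 + L)))"
      using sec[OF cg t(1)] by (intro Henstock_Kurzweil_Integration.integral_add integrable_continuous_real) auto
    also have "integral {-R..R} (\<lambda>x. N * (d * (1 + L))) = (N * (d * (1 + L))) * (2 * R)" using R by simp
    finally show ?thesis .
  qed
  have "continuous_on ({0..T} \<times> cbox (-R) R) (\<lambda>(t, x). ?g (t, x))"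
    unfolding case_prod_unfold prod.collapse by (rule continuous_on_subset[OF cg]) auto
  from integral_continuous_on_param[OF this] 
  have ig: "continuous_on {0..T} (\<lambda>t. integral {-R..R} (\<lambda>x. ?g (t, x)))" by simp
  have "Y T \<le> integral {0..T} (\<lambda>t. integral {-R..R} (\<lambda>x. ?g (t, x)) + (N * (d * (1 + L))) * (2 * R))"
    unfolding Y_def by (intro integral_le integrable_continuous_real Yc continuous_intros ig) (use ydle in auto)
  also have "\<dots> = set_lebesgue_integral lborel ({0<..} \<times> UNIV) ?g + (N * (d * (1 + L))) * (2 * R) * T"
  proof -
    have "integral {0..T} (\<lambda>t. integral {-R..R} (\<lambda>x. ?g (t, x)) + (N * (d * (1 + L))) * (2 * R))
      = integral {0..T} (\<lambda>t. integral {-R..R} (\<lambda>x. ?g (t, x))) + integral {0..T} (\<lambda>t. (N * (d * (1 + L))) * (2 * R))"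
      by (intro Henstock_Kurzweil_Integration.integral_add integrable_continuous_real ig) auto
    then show ?thesis unfolding gi using T by (simp add: mult_ac)
  qed
  finally have YT: "Y T \<le> set_lebesgue_integral lborel ({0<..} \<times> UNIV) ?g + (N * (d * (1 + L))) * (2 * R) * T" .
  have H0: "H 0 \<le> (LBINT x. \<bar>U 0 x - k\<bar> * \<phi> (0, x)) + d * N * (2 * R)"
  proof -
    have c1: "continuous_on {-R..R} (\<lambda>x. \<bar>U 0 x - k\<bar> * \<phi> (0, x))" "continuous_on {-R..R} (\<lambda>x. rt d (U 0 x - k) * \<phi> (0, x))"
      using sec[OF continuous_on_mult[OF continuous_on_rabs[OF continuous_on_diff[OF Uc continuous_on_const]] cp(1)], of 0]
        sec[OF continuous_on_mult[OF cE cp(1)], of 0] by auto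
    have "H 0 \<le> integral {-R..R} (\<lambda>x. \<bar>U 0 x - k\<bar> * \<phi> (0, x) + d * N)"
      unfolding H_def
    proof (rule integral_le)
      show "(\<lambda>x. rt d (U 0 x - k) * \<phi> (0, x)) integrable_on {-R..R}" using c1 by (simp add: integrable_continuous_real)
      show "(\<lambda>x. \<bar>U 0 x - k\<bar> * \<phi> (0, x) + d * N) integrable_on {-R..R}"
        by (intro integrable_continuous_real continuous_on_add[OF c1(1) continuous_on_const])
      fix x
      have "rt d (U 0 x - k) * \<phi> (0, x) \<le> (\<bar>U 0 x - k\<bar> + d) * \<phi> (0, x)" by (intro mult_right_mono E(2) p0)
      moreover have "d * \<phi> (0, x) \<le> d * N" using d pN(1) by (intro mult_left_mono) auto
      ultimately show "rt d (U 0 x - k) * \<phi> (0, x) \<le> \<bar>U 0 x - k\<bar> * \<phi> (0, x) + d * N"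
        by (simp add: distrib_right)
    qed
    also have "\<dots> = integral {-R..R} (\<lambda>x. \<bar>U 0 x - k\<bar> * \<phi> (0, x)) + integral {-R..R} (\<lambda>x. d * N)"
      using c1 by (intro Henstock_Kurzweil_Integration.integral_add integrable_continuous_real) auto
    also have "integral {-R..R} (\<lambda>x. d * N) = d * N * (2 * R)" using R by simp
    also have "integral {-R..R} (\<lambda>x. \<bar>U 0 x - k\<bar> * \<phi> (0, x)) = (LBINT x:{-R..R}. \<bar>U 0 x - k\<bar> * \<phi> (0, x))"
      by (rule set_borel_integral_eq_integral(2)[symmetric]) (rule borel_integrable_atLeastAtMost'[OF c1(1)])
    also have "\<dots> = (LBINT x. \<bar>U 0 x - k\<bar> * \<phi> (0, x))"
    proof (intro LINT_eq_LBINT[symmetric])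
      fix x assume "x \<notin> {-R..R}"
      then have "R \<le> \<bar>x\<bar>" by auto
      then show "\<bar>U 0 x - k\<bar> * \<phi> (0, x) = 0" using pz[of 0 x] by simp
    qed
    finally show ?thesis .
  qed
  have "N * (m * k * X + d * (2 * R + (1 + L) * (2 * R * T)))
    = N * m * k * X + (N * (d * (1 + L))) * (2 * R) * T + d * N * (2 * R)" for m k X
    by (simp add: algebra_simps)
  note e = this[of "M / d + 1" ?k "2 * K * l\<^sup>2 + C * K * l * T"]
  have "C * K * T * l = C * K * l * T" by simp
  then show ?thesis using main YT H0 e unfolding kruz_def by (simp only:)
qed

end

section \<open>Doubling of variables\<close>

text \<open>A \<open>C^1\<close> bump of unit mass; 30 is the reciprocal of the integral of
  \<open>s^2 (1 - s)^2\<close> over the unit interval. Its support lies to the right of 0, so that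
  as a mollifier in time it looks only forward.\<close>

definition rho :: "real \<Rightarrow> real \<Rightarrow> real" where
  "rho h z = 30 / h * (max 0 (z / h * (1 - z / h)))\<^sup>2"
definition rho' :: "real \<Rightarrow> real \<Rightarrow> real" where
  "rho' h z = 30 / h * (2 * max 0 (z / h * (1 - z / h)) * ((1 - 2 * (z / h)) / h))"

lemma rho_facts:
  assumes h: "0 < h"
  shows "(rho h has_real_derivative rho' h z) (at z)" "isCont (rho' h) z" "0 \<le> rho h z"
    "z \<notin> {0<..<h} \<Longrightarrow> rho h z = 0" "z \<notin> {0<..<h} \<Longrightarrow> rho' h z = 0"
    "h \<le> 1 \<Longrightarrow> \<bar>rho h z\<bar> \<le> 60 / h\<^sup>2" "h \<le> 1 \<Longrightarrow> \<bar>rho' h z\<bar> \<le> 60 / h\<^sup>2"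
    "integrable lborel (rho h)" "(LBINT z. rho h z) = 1"
proof -
  let ?g = "\<lambda>z. z / h * (1 - z / h)"
  have Dg: "(?g has_real_derivative (1 - 2 * (z / h)) / h) (at z)" for z
    using h by (auto intro!: derivative_eq_intros simp: field_simps)
  show D: "(rho h has_real_derivative rho' h z) (at z)" for z
    unfolding rho_def[abs_def] rho'_def
    by (intro DERIV_cmult DERIV_chain2[OF quad_approx_DERIV[OF quad_approx_pos_sq] Dg])
  show c': "isCont (rho' h) z" for z
    unfolding rho'_def[abs_def] using h by (intro continuous_intros) auto
  have c: "isCont (rho h) z" for z using D DERIV_isCont by blast
  show "0 \<le> rho h z" using h by (simp add: rho_def)
  have gz: "max 0 (?g z) = 0" if "z \<notin> {0<..<h}" for z
  proof -
    have "?g z \<le> 0" using that h by (cases "z \<le> 0") (auto intro: mult_nonpos_nonneg mult_nonneg_nonpos simp: divide_le_0_iff)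
    then show ?thesis by simp
  qed
  show z: "rho h z = 0" if "z \<notin> {0<..<h}" for z using gz[OF that] by (simp add: rho_def)
  show z': "rho' h z = 0" if "z \<notin> {0<..<h}" for z using gz[OF that] by (simp add: rho'_def)
  have g1: "0 \<le> max 0 (?g z)" "max 0 (?g z) \<le> 1" if "z \<in> {0<..<h}" for z
  proof -
    have u: "0 < z / h" "z / h < 1" using that h by auto
    then have "z / h * (1 - z / h) \<le> 1 * 1" by (intro mult_mono) auto
    then show "0 \<le> max 0 (?g z)" "max 0 (?g z) \<le> 1" by auto
  qed
  \<comment> \<open>For \<open>h \<le> 1\<close> one constant \<open>60 / h^2\<close> bounds both
    the bump and its derivative.\<close>
  have hh: "30 / h \<le> 60 / h\<^sup>2" if "h \<le> 1" using h that by (simp add: field_simps power2_eq_square)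
  show "\<bar>rho h z\<bar> \<le> 60 / h\<^sup>2" if "h \<le> 1"
  proof (cases "z \<in> {0<..<h}")
    case True
    have "(max 0 (?g z))\<^sup>2 \<le> 1" using g1[OF True] by (simp add: power_le_one)
    then have "30 / h * (max 0 (?g z))\<^sup>2 \<le> 30 / h * 1" using h by (intro mult_left_mono) auto
    then show ?thesis using hh[OF that] h by (simp add: rho_def)
  qed (use z h in simp)
  show "\<bar>rho' h z\<bar> \<le> 60 / h\<^sup>2" if "h \<le> 1"
  proof (cases "z \<in> {0<..<h}")
    case True
    have "\<bar>1 - 2 * (z / h)\<bar> \<le> 1" using True h by (auto simp: abs_le_iff field_simps)
    then have "max 0 (?g z) * \<bar>1 - 2 * (z / h)\<bar> \<le> 1 * 1" using g1[OF True] by (intro mult_mono) auto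
    then have "60 / h\<^sup>2 * (max 0 (?g z) * \<bar>1 - 2 * (z / h)\<bar>) \<le> 60 / h\<^sup>2 * 1" by (intro mult_left_mono) auto
    moreover have "\<bar>rho' h z\<bar> = 60 / h\<^sup>2 * (max 0 (?g z) * \<bar>1 - 2 * (z / h)\<bar>)"
      unfolding rho'_def using g1[OF True] h by (simp add: abs_mult power2_eq_square)
    ultimately show ?thesis by simp
  qed (use z' in simp)
  have si: "set_integrable lborel {0..h} (rho h)" by (rule set_integrable_cont[OF c])
  have e: "(\<lambda>x. indicator {0..h} x *\<^sub>R rho h x) = rho h"
    using z by (force split: split_indicator)
  show "integrable lborel (rho h)" using si unfolding set_integrable_def e .
  have "(LBINT z. rho h z) = (LBINT z:{0..h}. rho h z)"
    using z by (intro LINT_eq_LBINT) auto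
  also have "\<dots> = (LBINT z:{0..h}. 30 / h * (z / h * (1 - z / h))\<^sup>2)"
    by (intro set_lebesgue_integral_cong) (use h in \<open>auto simp: rho_def max_def\<close>)
  also have "\<dots> = (10 * (h / h) ^ 3 - 15 * (h / h) ^ 4 + 6 * (h / h) ^ 5) - (10 * (0 / h) ^ 3 - 15 * (0 / h) ^ 4 + 6 * (0 / h) ^ 5)"
  proof (rule LBINT_FTC)
    fix z
    show "((\<lambda>z. 10 * (z / h) ^ 3 - 15 * (z / h) ^ 4 + 6 * (z / h) ^ 5) has_real_derivative 30 / h * (z / h * (1 - z / h))\<^sup>2) (at z)"
      using h by (auto intro!: derivative_eq_intros simp: field_simps power2_eq_square eval_nat_numeral)
    show "isCont (\<lambda>z. 30 / h * (z / h * (1 - z / h))\<^sup>2) z" using h by (intro continuous_intros) auto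
  qed (use h in simp)
  also have "\<dots> = 1" using h by simp
  finally show "(LBINT z. rho h z) = 1" .
qed

lemma integrable_bounded_box:
  fixes g :: "'a::euclidean_space \<Rightarrow> real"
  assumes "g \<in> borel_measurable borel" "\<And>z. \<bar>g z\<bar> \<le> B" "\<And>z. z \<notin> cbox a b \<Longrightarrow> g z = 0"
  shows "integrable lborel g"
proof (rule Bochner_Integration.integrable_bound)
  show "integrable lborel (\<lambda>z. B * indicator (cbox a b) z :: real)"
    using emeasure_lborel_cbox_finite[of a b] by (intro integrable_mult_right) (simp add: integrable_indicator_iff)
  show "AE z in lborel. norm (g z) \<le> norm (B * indicator (cbox a b) z :: real)"
    using assms(2,3) by (intro AE_I2) (auto simp: indicator_def intro: order_trans[OF _ abs_ge_self])
qed (use assms in simp)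

lemma LINT_translate:
  fixes g :: "real \<times> real \<Rightarrow> real"
  assumes [measurable]: "g \<in> borel_measurable borel"
  shows "(LBINT z. g z) = (LBINT w. g (c + w))"
  by (subst lborel_distr_plus[symmetric, of c]) (simp add: integral_distr)

lemma borel_fst_snd [measurable]:
  "(fst :: 'a::second_countable_topology \<times> 'b::second_countable_topology \<Rightarrow> 'a) \<in> borel \<rightarrow>\<^sub>M borel"
  "(snd :: 'a \<times> 'b \<Rightarrow> 'b) \<in> borel \<rightarrow>\<^sub>M borel"
  by (intro borel_measurable_continuous_onI continuous_intros)+

definition cut :: "real \<Rightarrow> real \<times> real \<Rightarrow> real" where "cut h w = rho h (fst w) * rho h (snd w)"

lemma cut_facts:
  assumes h: "0 < h"
  shows "0 \<le> cut h w" "w \<notin> {0<..<h} \<times> {0<..<h} \<Longrightarrow> cut h w = 0" "cut h \<in> borel_measurable borel"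
    "integrable lborel (cut h)" "(LBINT w. cut h w) = 1"
proof -
  note r = rho_facts[OF h]
  show "0 \<le> cut h w" using r(3) by (simp add: cut_def)
  show "w \<notin> {0<..<h} \<times> {0<..<h} \<Longrightarrow> cut h w = 0" using r(4) unfolding cut_def by (cases w) auto
  have [measurable]: "rho h \<in> borel_measurable borel" using r(1) DERIV_isCont isCont_borel by blast
  show "cut h \<in> borel_measurable borel" unfolding cut_def by measurable
  have I: "integrable (lborel \<Otimes>\<^sub>M lborel) (\<lambda>w. rho h (fst w) * rho h (snd w))"
  proof (rule lborel_pair.Fubini_integrable)
    show "(\<lambda>w. rho h (fst w) * rho h (snd w)) \<in> borel_measurable (lborel \<Otimes>\<^sub>M lborel)" by measurable
    have "(LBINT y. norm (rho h x * rho h y)) = rho h x" for x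
      using r(3,8,9) by (simp add: abs_mult)
    then show "integrable lborel (\<lambda>x. LBINT y. norm (rho h (fst (x, y)) * rho h (snd (x, y))))"
      using r(8) by simp
  qed (use r(8) in auto)
  then show "integrable lborel (cut h)" by (simp add: cut_def[abs_def] lborel_prod)
  have "(LBINT w. cut h w) = (LINT w|(lborel \<Otimes>\<^sub>M lborel). rho h (fst w) * rho h (snd w))"
    by (simp add: cut_def[abs_def] lborel_prod)
  also have "\<dots> = (LBINT x. LBINT y. rho h x * rho h y)"
    using lborel_pair.integral_fst'[OF I] by simp
  also have "\<dots> = 1" using r(9) by simp
  finally show "(LBINT w. cut h w) = 1" .
qed

text \<open>Written as \<open>f (max a b) - f (min a b)\<close>, the flux inherits the Lipschitz
  constant of \<open>f\<close>. If \<open>a\<close> lies between \<open>b\<close> and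
  \<open>b'\<close>, the two increments add up to \<open>L * \<bar>b - b'\<bar>\<close>.\<close>

lemma kruzhkov_flux_lipschitz:
  fixes f f1 :: "real \<Rightarrow> real"
  assumes f1: "\<And>x. (f has_real_derivative f1 x) (at x)" and L: "\<And>y. \<bar>y\<bar> \<le> K \<Longrightarrow> \<bar>f1 y\<bar> \<le> L"
    and K: "\<bar>a\<bar> \<le> K" "\<bar>b\<bar> \<le> K" "\<bar>b'\<bar> \<le> K"
  shows "\<bar>sgn (a - b) * (f a - f b) - sgn (a - b') * (f a - f b')\<bar> \<le> L * \<bar>b - b'\<bar>"
    "\<bar>sgn (a - b) * (f a - f b)\<bar> \<le> L * \<bar>a - b\<bar>"
proof -
  have fl: "\<bar>f x - f y\<bar> \<le> L * \<bar>x - y\<bar>" if "\<bar>x\<bar> \<le> K" "\<bar>y\<bar> \<le> K" for x y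
  proof -
    have "norm (f x - f y) \<le> L * norm (x - y)"
      by (rule field_differentiable_bound[of "{-K..K}" f f1 L])
        (use that L f1 in \<open>auto simp: abs_le_iff intro: DERIV_subset\<close>)
    then show ?thesis by simp
  qed
  show "\<bar>sgn (a - b) * (f a - f b)\<bar> \<le> L * \<bar>a - b\<bar>"
  proof (cases "a = b")
    case False
    then have "\<bar>sgn (a - b)\<bar> = 1" by (simp add: sgn_if)
    then show ?thesis using fl[OF K(1,2)] by (simp add: abs_mult)
  qed simp
  have main: "\<bar>sgn (a - b) * (f a - f b) - sgn (a - b') * (f a - f b')\<bar> \<le> L * \<bar>b - b'\<bar>"
    if K: "\<bar>b\<bar> \<le> K" "\<bar>b'\<bar> \<le> K" and bb: "b \<le> b'" for b b'
  proof -
    have e: "sgn (a - b) * (f a - f b) = f (max a b) - f (min a b)" for b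
      by (auto simp: sgn_if max_def min_def)
    consider "a \<le> b" | "b < a" "a < b'" | "b' \<le> a" by linarith
    then show ?thesis
    proof cases
      case 1 
      then have "max a b = b" "min a b = a" "max a b' = b'" "min a b' = a" using bb by auto
      then show ?thesis unfolding e using fl[OF K] by simp
    next
      case 2
      then have "max a b = a" "min a b = b" "max a b' = b'" "min a b' = a" by auto
      then have e2: "f (max a b) - f (min a b) - (f (max a b') - f (min a b')) = (f a - f b) - (f b' - f a)" by simp
      have "\<bar>f a - f b\<bar> \<le> L * (a - b)" "\<bar>f b' - f a\<bar> \<le> L * (b' - a)"
        using fl[OF \<open>\<bar>a\<bar> \<le> K\<close> K(1)] fl[OF K(2) \<open>\<bar>a\<bar> \<le> K\<close>] 2 by auto
      then have "\<bar>(f a - f b) - (f b' - f a)\<bar> \<le> L * (a - b) + L * (b' - a)" by linarith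
      also have "L * (a - b) + L * (b' - a) = L * \<bar>b - b'\<bar>" using bb by (simp add: algebra_simps)
      finally show ?thesis unfolding e e2 .
    next
      case 3
      then have "max a b = a" "min a b = b" "max a b' = a" "min a b' = b'" using bb by auto
      then show ?thesis unfolding e using fl[OF K(2,1)] bb by (simp add: abs_minus_commute)
    qed
  qed
  show "\<bar>sgn (a - b) * (f a - f b) - sgn (a - b') * (f a - f b')\<bar> \<le> L * \<bar>b - b'\<bar>"
  proof (cases "b \<le> b'")
    case True then show ?thesis by (rule main[OF K(2,3)])
  next
    case False
    then have "b' \<le> b" by simp
    from main[OF K(3,2) this] show ?thesis by (simp only: abs_minus_commute[of b b']
      abs_minus_commute[of "sgn (a - b) * (f a - f b)"])
  qed
qed

lemma double_integrable:
  fixes g :: "'a::euclidean_space \<Rightarrow> 'b::euclidean_space \<Rightarrow> real"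
  assumes m: "(\<lambda>p. g (fst p) (snd p)) \<in> borel_measurable borel" and b: "\<And>z w. \<bar>g z w\<bar> \<le> B"
    and z': "\<forall>z w. z \<notin> cbox a a' \<or> w \<notin> cbox d d' \<longrightarrow> g z w = 0"
  shows "(LBINT z. LBINT w. g z w) = (LBINT w. LBINT z. g z w)"
    "integrable lborel (\<lambda>z. LBINT w. g z w)" "integrable lborel (\<lambda>w. LBINT z. g z w)"
    "integrable lborel (\<lambda>w. g z w)" "integrable lborel (\<lambda>z. g z w)"
proof -
  note z = z'[rule_format]
  have "integrable lborel (\<lambda>p. g (fst p) (snd p))"
  proof (rule integrable_bounded_box[OF m b])
    fix p :: "'a \<times> 'b" assume "p \<notin> cbox (a, d) (a', d')"
    then show "g (fst p) (snd p) = 0" by (intro z) (auto simp: cbox_Pair_eq mem_Times_iff)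
  qed
  then have I: "integrable (lborel \<Otimes>\<^sub>M lborel) (\<lambda>(x, y). g x y)" by (simp add: lborel_prod case_prod_unfold)
  show "(LBINT z. LBINT w. g z w) = (LBINT w. LBINT z. g z w)"
    using lborel_pair.Fubini_integral[OF I] by simp
  show "integrable lborel (\<lambda>z. LBINT w. g z w)" by (rule lborel_pair.integrable_fst[OF I])
  show "integrable lborel (\<lambda>w. LBINT z. g z w)" by (rule lborel_pair.integrable_snd[OF I])
  have "Pair z \<in> borel \<rightarrow>\<^sub>M (borel :: ('a \<times> 'b) measure)" by (intro borel_measurable_continuous_onI continuous_intros)
  from measurable_compose[OF this m] have "(\<lambda>w. g z w) \<in> borel_measurable borel" by simp
  then show "integrable lborel (\<lambda>w. g z w)"
    by (rule integrable_bounded_box[OF _ b, where a = d and b = d']) (use z in auto)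
  have "(\<lambda>z. (z, w)) \<in> borel \<rightarrow>\<^sub>M (borel :: ('a \<times> 'b) measure)" by (intro borel_measurable_continuous_onI continuous_intros)
  from measurable_compose[OF this m] have "(\<lambda>z. g z w) \<in> borel_measurable borel" by simp
  then show "integrable lborel (\<lambda>z. g z w)"
    by (rule integrable_bounded_box[OF _ b, where a = a and b = a']) (use z in auto)
qed

text \<open>Nonnegativity off the box confines a constant loss to the volume of the box.\<close>

lemma LINT_bound_box:
  fixes g :: "'a::euclidean_space \<Rightarrow> real"
  assumes i: "integrable lborel g" and b: "\<And>z. z \<in> cbox a b \<Longrightarrow> - B \<le> g z" and z: "\<And>z. z \<notin> cbox a b \<Longrightarrow> 0 \<le> g z"
  shows "- (B * measure lborel (cbox a b)) \<le> (LBINT z. g z)"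
proof -
  have "(LBINT z. - B * indicator (cbox a b) z) \<le> (LBINT z. g z)"
  proof (rule integral_mono[OF _ i])
    show "integrable lborel (\<lambda>z. - B * indicator (cbox a b) z :: real)"
      using emeasure_lborel_cbox_finite[of a b] by (intro integrable_mult_right) (simp add: integrable_indicator_iff)
  qed (use b z in \<open>auto simp: indicator_def\<close>)
  then show ?thesis by simp
qed

text \<open>Kruzhkov's entropy flux. Its symmetry in \<open>a\<close> and \<open>b\<close> is what
  makes the two doubled inequalities fit together.\<close>

definition kfl :: "(real \<Rightarrow> real) \<Rightarrow> real \<Rightarrow> real \<Rightarrow> real" where
  "kfl f a b = sgn (a - b) * (f a - f b)"

lemma kfl_commute: "kfl f a b = kfl f b a"
  unfolding kfl_def by (simp add: sgn_if)

text \<open>As a factor in the integrand, the condition of positive time leaves integrals over the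
  whole plane, to which translation invariance applies.\<close>

definition half :: "real \<times> real \<Rightarrow> real" where "half z = indicator {0<..} (fst z)"

lemma half_cases: "half z = 1 \<and> 0 < fst z \<or> half z = 0 \<and> fst z \<le> 0"
  by (auto simp: half_def indicator_def)

lemma half_measurable [measurable]: "half \<in> borel_measurable borel"
  unfolding half_def by measurable

lemma kruz_half:
  "kruz f u0 w k \<phi> = (LBINT z. half z * (\<bar>w (fst z) (snd z) - k\<bar> * pt \<phi> z + kfl f (w (fst z) (snd z)) k * px \<phi> z))
    + (LBINT x. \<bar>u0 x - k\<bar> * \<phi> (0, x))"
proof -
  have "indicat_real ({0<..} \<times> UNIV) z = half z" for z by (cases z) (auto simp: half_def indicator_def)
  then show ?thesis unfolding kruz_def set_lebesgue_integral_def kfl_def by simp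
qed

text \<open>The doubled weight is admissible in either variable. The derivatives of the mollifier
  appear with opposite signs, which is the source of the later cancellation; the box grows by 1
  because \<open>h \<le> 1\<close>.\<close>

lemma doubled_test:
  fixes \<Phi> :: "real \<times> real \<Rightarrow> real"
  assumes \<Phi>: "test_box T R N \<Phi>" and h: "0 < h" "h \<le> 1"
  shows "test_box (T + 1) (R + 1) (2 * N * (60 / h\<^sup>2)\<^sup>2) (\<lambda>z. \<Phi> z * cut h (\<zeta> - z))"
    "pt (\<lambda>z. \<Phi> z * cut h (\<zeta> - z)) z = pt \<Phi> z * cut h (\<zeta> - z) - \<Phi> z * (rho' h (fst \<zeta> - fst z) * rho h (snd \<zeta> - snd z))"
    "px (\<lambda>z. \<Phi> z * cut h (\<zeta> - z)) z = px \<Phi> z * cut h (\<zeta> - z) - \<Phi> z * (rho h (fst \<zeta> - fst z) * rho' h (snd \<zeta> - snd z))"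
    "test_box (T + 1) (R + 1) (2 * N * (60 / h\<^sup>2)\<^sup>2) (\<lambda>\<zeta>. \<Phi> z * cut h (\<zeta> - z))"
    "pt (\<lambda>\<zeta>. \<Phi> z * cut h (\<zeta> - z)) \<zeta> = \<Phi> z * (rho' h (fst \<zeta> - fst z) * rho h (snd \<zeta> - snd z))"
    "px (\<lambda>\<zeta>. \<Phi> z * cut h (\<zeta> - z)) \<zeta> = \<Phi> z * (rho h (fst \<zeta> - fst z) * rho' h (snd \<zeta> - snd z))"
proof -
  note r = rho_facts[OF h(1)]
  let ?r = "60 / h\<^sup>2"
  have r0: "1 \<le> ?r" using h by (simp add: field_simps power_le_one) (metis less_eq_real_def one_le_numeral order_trans power_le_one)
  note t2 = test_boxD(1)[OF \<Phi>] and p0 = test_boxD(2)[OF \<Phi>] and pN = test_boxD(3-5)[OF \<Phi>] and pz = test_boxD(6)[OF \<Phi>]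
    and N0 = test_boxD(8)[OF \<Phi>]
  have rc: "continuous_on UNIV (rho h)" "continuous_on UNIV (rho' h)"
    using DERIV_isCont[OF r(1)] r(2) by (auto intro!: continuous_at_imp_continuous_on)
  have cc: "continuous_on UNIV (\<lambda>w :: real \<times> real. g (a - fst w))" "continuous_on UNIV (\<lambda>w :: real \<times> real. g (a - snd w))"
    "continuous_on UNIV (\<lambda>w :: real \<times> real. g (fst w - a))" "continuous_on UNIV (\<lambda>w :: real \<times> real. g (snd w - a))"
    if "continuous_on UNIV g" for g :: "real \<Rightarrow> real" and a
    by (rule continuous_on_compose2[OF that]; auto intro!: continuous_intros)+
  note ccr = cc[OF rc(1)] cc[OF rc(2)]
  have D1: "((\<lambda>s. rho h (a - s)) has_real_derivative - rho' h (a - t)) (at t)" for a t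
  proof -
    have "((\<lambda>s. a - s) has_real_derivative -1) (at t)" by (auto intro!: derivative_eq_intros)
    from DERIV_chain2[OF r(1) this] show ?thesis by simp
  qed
  have D2: "((\<lambda>s. rho h (s - a)) has_real_derivative rho' h (t - a)) (at t)" for a t
  proof -
    have "((\<lambda>s. s - a) has_real_derivative 1) (at t)" by (auto intro!: derivative_eq_intros)
    from DERIV_chain2[OF r(1) this] show ?thesis by simp
  qed
  have prod: "\<bar>a * b\<bar> \<le> ?r\<^sup>2" if "\<bar>a\<bar> \<le> ?r" "\<bar>b\<bar> \<le> ?r" for a b
    using mult_mono[OF that] r0 by (simp add: abs_mult power2_eq_square)
  note rb = r(6,7)[OF h(2)]
  have r1: "1 * N \<le> ?r\<^sup>2 * N" using N0 r0 by (intro mult_right_mono) (auto simp: one_le_power)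
  have pb: "\<bar>a * b\<bar> \<le> N * ?r\<^sup>2" if "\<bar>a\<bar> \<le> N" "\<bar>b\<bar> \<le> ?r\<^sup>2" for a b
    using mult_mono[OF that] N0 by (simp add: abs_mult)
  have aN: "\<bar>\<Phi> z\<bar> \<le> N" for z using p0 pN(1) by simp
  define \<phi> where "\<phi> = (\<lambda>z. \<Phi> z * cut h (\<zeta> - z))"
  define \<psi> where "\<psi> = (\<lambda>\<zeta>. \<Phi> z * cut h (\<zeta> - z))"
  have Dt: "((\<lambda>s. \<phi> (s, x)) has_real_derivative pt \<Phi> (t, x) * cut h (\<zeta> - (t, x)) - \<Phi> (t, x) * (rho' h (fst \<zeta> - t) * rho h (snd \<zeta> - x))) (at t)" for t x
    unfolding \<phi>_def cut_def fst_diff snd_diff fst_conv snd_conv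
    using DERIV_mult[OF test2_DERIV(1)[OF t2, of x t] DERIV_cmult_right[OF D1[of "fst \<zeta>" t], of "rho h (snd \<zeta> - x)"]]
    by (simp add: algebra_simps)
  have Dx: "((\<lambda>y. \<phi> (t, y)) has_real_derivative px \<Phi> (t, x) * cut h (\<zeta> - (t, x)) - \<Phi> (t, x) * (rho h (fst \<zeta> - t) * rho' h (snd \<zeta> - x))) (at x)" for t x
    unfolding \<phi>_def cut_def fst_diff snd_diff fst_conv snd_conv
    using DERIV_mult[OF test2_DERIV(2)[OF t2, of t x] DERIV_cmult[OF D1[of "snd \<zeta>" x], of "rho h (fst \<zeta> - t)"]]
    by (simp add: algebra_simps)
  have Et: "((\<lambda>s. \<psi> (s, y)) has_real_derivative \<Phi> z * (rho' h (s - fst z) * rho h (y - snd z))) (at s)" for s y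
    unfolding \<psi>_def cut_def fst_diff snd_diff fst_conv snd_conv
    by (intro DERIV_cmult DERIV_cmult_right D2)
  have Ex: "((\<lambda>y. \<psi> (s, y)) has_real_derivative \<Phi> z * (rho h (s - fst z) * rho' h (y - snd z))) (at y)" for s y
    unfolding \<psi>_def cut_def fst_diff snd_diff fst_conv snd_conv
    by (intro DERIV_cmult D2)
  have pt\<phi>: "pt \<phi> w = pt \<Phi> w * cut h (\<zeta> - w) - \<Phi> w * (rho' h (fst \<zeta> - fst w) * rho h (snd \<zeta> - snd w))"
    and px\<phi>: "px \<phi> w = px \<Phi> w * cut h (\<zeta> - w) - \<Phi> w * (rho h (fst \<zeta> - fst w) * rho' h (snd \<zeta> - snd w))" for w
    using DERIV_imp_deriv[OF Dt[of "snd w" "fst w"]] DERIV_imp_deriv[OF Dx[of "fst w" "snd w"]]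
    by (simp_all add: pt_def[of \<phi>] px_def[of \<phi>])
  have pt\<psi>: "pt \<psi> w = \<Phi> z * (rho' h (fst w - fst z) * rho h (snd w - snd z))"
    and px\<psi>: "px \<psi> w = \<Phi> z * (rho h (fst w - fst z) * rho' h (snd w - snd z))" for w
    using DERIV_imp_deriv[OF Et[of "snd w" "fst w"]] DERIV_imp_deriv[OF Ex[of "fst w" "snd w"]]
    by (simp_all add: pt_def[of \<psi>] px_def[of \<psi>])
  show "pt (\<lambda>z. \<Phi> z * cut h (\<zeta> - z)) z = pt \<Phi> z * cut h (\<zeta> - z) - \<Phi> z * (rho' h (fst \<zeta> - fst z) * rho h (snd \<zeta> - snd z))"
    "px (\<lambda>z. \<Phi> z * cut h (\<zeta> - z)) z = px \<Phi> z * cut h (\<zeta> - z) - \<Phi> z * (rho h (fst \<zeta> - fst z) * rho' h (snd \<zeta> - snd z))"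
    using pt\<phi> px\<phi> by (simp_all add: \<phi>_def)
  show "pt (\<lambda>\<zeta>. \<Phi> z * cut h (\<zeta> - z)) \<zeta> = \<Phi> z * (rho' h (fst \<zeta> - fst z) * rho h (snd \<zeta> - snd z))"
    "px (\<lambda>\<zeta>. \<Phi> z * cut h (\<zeta> - z)) \<zeta> = \<Phi> z * (rho h (fst \<zeta> - fst z) * rho' h (snd \<zeta> - snd z))"
    using pt\<psi> px\<psi> by (simp_all add: \<psi>_def)
  have c\<Phi>: "continuous_on UNIV \<Phi>" "continuous_on UNIV (pt \<Phi>)" "continuous_on UNIV (px \<Phi>)"
    using test2_continuous[OF t2] t2 by (auto simp: test2_def)
  have cutc: "continuous_on UNIV (\<lambda>w. cut h (\<zeta> - w))" 
    unfolding cut_def fst_diff snd_diff by (intro continuous_on_mult ccr)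
  have cutb: "\<bar>cut h w\<bar> \<le> ?r\<^sup>2" for w unfolding cut_def by (intro prod rb)
  have sm: "\<bar>a - b\<bar> \<le> 2 * N * ?r\<^sup>2" if "\<bar>a\<bar> \<le> N * ?r\<^sup>2" "\<bar>b\<bar> \<le> N * ?r\<^sup>2" for a b
    using that by linarith
  have one: "a \<le> 2 * N * ?r\<^sup>2" if "\<bar>a\<bar> \<le> N * ?r\<^sup>2" for a
  proof -
    have "0 \<le> N * ?r\<^sup>2" using N0 by simp
    then show ?thesis using that by linarith
  qed
  show "test_box (T + 1) (R + 1) (2 * N * ?r\<^sup>2) (\<lambda>z. \<Phi> z * cut h (\<zeta> - z))"
    unfolding test_box_def test2_def \<phi>_def[symmetric]
  proof (intro conjI allI impI)
    show "(\<lambda>s. \<phi> (s, x)) differentiable at t" "(\<lambda>y. \<phi> (t, y)) differentiable at x" for t x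
      using Dt Dx unfolding real_differentiable_def by blast+
    show "continuous_on UNIV (pt \<phi>)" "continuous_on UNIV (px \<phi>)"
      unfolding pt\<phi>[abs_def] px\<phi>[abs_def] by (intro continuous_on_diff continuous_on_mult c\<Phi> cutc ccr)+
    have "bounded {w. \<Phi> w \<noteq> 0}" using t2 by (simp add: test2_def)
    then show "bounded {w. \<phi> w \<noteq> 0}" by (rule bounded_subset) (auto simp: \<phi>_def)
    show "0 \<le> \<phi> w" for w unfolding \<phi>_def by (intro mult_nonneg_nonneg p0 cut_facts(1)[OF h(1)])
    show "\<phi> w \<le> 2 * N * ?r\<^sup>2" for w unfolding \<phi>_def by (intro one pb aN cutb)
    show "\<bar>pt \<phi> w\<bar> \<le> 2 * N * ?r\<^sup>2" "\<bar>px \<phi> w\<bar> \<le> 2 * N * ?r\<^sup>2" for w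
      unfolding pt\<phi> px\<phi> by (intro sm pb pN aN cutb prod rb)+
    show "\<phi> (t, x) = 0" if "T + 1 \<le> t \<or> R + 1 \<le> \<bar>x\<bar>" for t x
      using pz[of t x] that by (auto simp: \<phi>_def)
  qed
  show "test_box (T + 1) (R + 1) (2 * N * ?r\<^sup>2) (\<lambda>\<zeta>. \<Phi> z * cut h (\<zeta> - z))"
    unfolding test_box_def test2_def \<psi>_def[symmetric]
  proof (intro conjI allI impI)
    show "(\<lambda>s. \<psi> (s, x)) differentiable at t" "(\<lambda>y. \<psi> (t, y)) differentiable at x" for t x
      using Et Ex unfolding real_differentiable_def by blast+
    show "continuous_on UNIV (pt \<psi>)" "continuous_on UNIV (px \<psi>)"
      unfolding pt\<psi>[abs_def] px\<psi>[abs_def] by (intro continuous_on_mult continuous_on_const ccr)+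
    have "{w. \<psi> w \<noteq> 0} \<subseteq> cbox z (z + (h, h))"
    proof
      fix w assume "w \<in> {w. \<psi> w \<noteq> 0}"
      then have "cut h (w - z) \<noteq> 0" by (auto simp: \<psi>_def)
      then have "w - z \<in> {0<..<h} \<times> {0<..<h}" using cut_facts(2)[OF h(1)] by blast
      then show "w \<in> cbox z (z + (h, h))" by (cases w; cases z) (auto simp: cbox_Pair_iff)
    qed
    then show "bounded {w. \<psi> w \<noteq> 0}" using bounded_cbox bounded_subset by blast
    show "0 \<le> \<psi> w" for w unfolding \<psi>_def by (intro mult_nonneg_nonneg p0 cut_facts(1)[OF h(1)])
    show "\<psi> w \<le> 2 * N * ?r\<^sup>2" for w unfolding \<psi>_def by (intro one pb aN cutb)
    show "\<bar>pt \<psi> w\<bar> \<le> 2 * N * ?r\<^sup>2" "\<bar>px \<psi> w\<bar> \<le> 2 * N * ?r\<^sup>2" for w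
      unfolding pt\<psi> px\<psi> using one[of "\<bar>_\<bar>"] by (simp_all only: abs_idempotent, auto intro!: one pb pN aN cutb prod rb)
    show "\<psi> (s, y) = 0" if "T + 1 \<le> s \<or> R + 1 \<le> \<bar>y\<bar>" for s y
    proof (rule ccontr)
      assume a: "\<psi> (s, y) \<noteq> 0"
      then have "\<Phi> (fst z, snd z) \<noteq> 0" "cut h ((s, y) - z) \<noteq> 0" by (auto simp: \<psi>_def)
      then have "fst z < T" "\<bar>snd z\<bar> < R" "(s, y) - z \<in> {0<..<h} \<times> {0<..<h}"
        using pz[of "fst z" "snd z"] cut_facts(2)[OF h(1), of "(s, y) - z"] by (force, force, blast)
      then show False using that h by (cases z) auto
    qed
  qed
qed

text \<open>The inequality for \<open>A\<close> is taken with constant \<open>B \<zeta>\<close>, the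
  one for \<open>B\<close> with constant \<open>A z\<close>, and each is integrated over the other
  variable. The terms with derivatives of the mollifier cancel. The defects are multiplied by the
  size of the doubled weight and the area of the box. Only \<open>B\<close> needs a modulus of
  continuity \<open>\<omega>\<close>; \<open>A\<close> is just bounded and measurable.\<close>

lemma doubling:
  fixes f f1 u0 :: "real \<Rightarrow> real" and A B :: "real \<Rightarrow> real \<Rightarrow> real" and \<Phi> :: "real \<times> real \<Rightarrow> real"
  assumes f1: "\<And>x. (f has_real_derivative f1 x) (at x)" and L: "\<And>y. \<bar>y\<bar> \<le> K \<Longrightarrow> \<bar>f1 y\<bar> \<le> L"
    and Am: "(\<lambda>z. A (fst z) (snd z)) \<in> borel_measurable borel" and AK: "\<And>t x. \<bar>A t x\<bar> \<le> K"
    and Bm: "(\<lambda>z. B (fst z) (snd z)) \<in> borel_measurable borel" and BK: "\<And>t x. \<bar>B t x\<bar> \<le> K"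
    and um: "u0 \<in> borel_measurable borel" and uK: "\<And>x. \<bar>u0 x\<bar> \<le> K"
    and krA: "\<And>k \<phi> N. \<bar>k\<bar> \<le> K \<Longrightarrow> test_box (T + 1) (R + 1) N \<phi> \<Longrightarrow> - (\<delta>A * N) \<le> kruz f u0 A k \<phi>"
    and krB: "\<And>k \<phi> N. \<bar>k\<bar> \<le> K \<Longrightarrow> test_box (T + 1) (R + 1) N \<phi> \<Longrightarrow> - (\<delta>B * N) \<le> kruz f u0 B k \<phi>"
    and \<delta>: "0 \<le> \<delta>A" "0 \<le> \<delta>B" and \<Phi>: "test_box T R N \<Phi>" and h: "0 < h" "h \<le> 1" and TR: "0 < T" "0 < R"
    and \<omega>: "\<And>t \<sigma> \<xi>. 0 \<le> t \<Longrightarrow> t \<le> T \<Longrightarrow> 0 \<le> \<sigma> \<Longrightarrow> \<sigma> \<le> h \<Longrightarrow> 0 \<le> \<xi> \<Longrightarrow> \<xi> \<le> h \<Longrightarrow>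
       (LBINT x:{-R..R}. \<bar>B (t + \<sigma>) (x + \<xi>) - B t x\<bar>) \<le> \<omega>"
    and \<omega>0: "(LBINT x:{-R..R}. \<bar>u0 x - B 0 x\<bar>) \<le> \<omega>0"
  shows "0 \<le> (LBINT z. half z * (\<bar>A (fst z) (snd z) - B (fst z) (snd z)\<bar> * pt \<Phi> z + kfl f (A (fst z) (snd z)) (B (fst z) (snd z)) * px \<Phi> z))
     + N * ((1 + L) * T * \<omega> + (\<omega> + \<omega>0)) + (\<delta>A + \<delta>B) * (2 * N * (60 / h\<^sup>2)\<^sup>2) * (4 * (T + 1) * (R + 1))"
proof -
  define Az where "Az z = A (fst z) (snd z)" for z
  define Bz where "Bz z = B (fst z) (snd z)" for z
  have [measurable]: "Az \<in> borel_measurable borel" "Bz \<in> borel_measurable borel"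
    unfolding Az_def[abs_def] Bz_def[abs_def] by (rule Am Bm)+
  note [measurable] = um
  note r = rho_facts[OF h(1)] and cf = cut_facts[OF h(1)]
  note t2 = test_boxD(1)[OF \<Phi>] and p0 = test_boxD(2)[OF \<Phi>] and pN = test_boxD(3-5)[OF \<Phi>] and pz = test_boxD(6)[OF \<Phi>]
    and N0 = test_boxD(8)[OF \<Phi>]
  have K0: "0 \<le> K" using AK[of 0 0] by linarith
  have L0: "0 \<le> L" using L[of 0] K0 abs_ge_zero[of "f1 0"] by simp
  have dz: "pt \<Phi> (t, x) = 0 \<and> px \<Phi> (t, x) = 0 \<and> \<Phi> (t, x) = 0" if "T < t \<or> R < \<bar>x\<bar>" for t x
    using test_boxD(7)[OF \<Phi> that] pz[of t x] that by auto
  note [measurable] = test_boxD(9-11)[OF \<Phi>]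
  have [measurable]: "rho h \<in> borel_measurable borel" "rho' h \<in> borel_measurable borel"
    using DERIV_isCont[OF r(1)] r(2) isCont_borel by blast+
  note [measurable] = cf(3)
  have fm[measurable]: "f \<in> borel_measurable borel" using DERIV_isCont[OF f1] isCont_borel by blast
  have kflm[measurable (raw)]: "(\<lambda>p. kfl f (X p) (Y p)) \<in> borel_measurable M" if [measurable]: "X \<in> borel_measurable M" "Y \<in> borel_measurable M" for X Y M
    unfolding kfl_def by measurable
  have Ab: "\<bar>Az z\<bar> \<le> K" "\<bar>Bz z\<bar> \<le> K" for z using AK BK by (auto simp: Az_def Bz_def)
  have kb: "\<bar>kfl f a b\<bar> \<le> L * (2 * K)" if "\<bar>a\<bar> \<le> K" "\<bar>b\<bar> \<le> K" for a b
  proof -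
    have "\<bar>kfl f a b\<bar> \<le> L * \<bar>a - b\<bar>" unfolding kfl_def by (rule kruzhkov_flux_lipschitz(2)[OF f1 L that that(2)])
    also have "\<dots> \<le> L * (2 * K)" using that L0 by (intro mult_left_mono) auto
    finally show ?thesis .
  qed
  let ?r = "60 / h\<^sup>2"
  define kt where "kt w = rho' h (fst w) * rho h (snd w)" for w
  define kx where "kx w = rho h (fst w) * rho' h (snd w)" for w
  have [measurable]: "kt \<in> borel_measurable borel" "kx \<in> borel_measurable borel" unfolding kt_def kx_def by measurable
  have prod: "\<bar>a * b\<bar> \<le> ?r\<^sup>2" if "\<bar>a\<bar> \<le> ?r" "\<bar>b\<bar> \<le> ?r" for a b
    using mult_mono[OF that] by (simp add: abs_mult power2_eq_square)
  note rb = r(6,7)[OF h(2)]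
  have kb3: "\<bar>cut h w\<bar> \<le> ?r\<^sup>2" "\<bar>kt w\<bar> \<le> ?r\<^sup>2" "\<bar>kx w\<bar> \<le> ?r\<^sup>2" for w
    unfolding cut_def kt_def kx_def by (intro prod rb)+
  have kz: "cut h w = 0 \<and> kt w = 0 \<and> kx w = 0" if "w \<notin> {0<..<h} \<times> {0<..<h}" for w
    using that r(4,5) unfolding cut_def kt_def kx_def by (cases w) auto
  let ?Z0 = "(- (T + 1), - (R + 1))" and ?Z1 = "(T + 1, R + 1)"
  let ?Z = "cbox ?Z0 ?Z1"
  let ?V = "4 * (T + 1) * (R + 1)"
  have V: "measure lborel ?Z = ?V"
  proof -
    have "measure lborel ?Z = measure lborel (cbox (- (T + 1)) (T + 1)) * measure lborel (cbox (- (R + 1)) (R + 1))"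
      using content_Pair[of "- (T + 1)" "- (R + 1)" "T + 1" "R + 1"] by simp
    then show ?thesis using TR by (simp add: algebra_simps)
  qed
  have zZ: "half z = 0 \<or> (pt \<Phi> z = 0 \<and> px \<Phi> z = 0 \<and> \<Phi> z = 0)" if "z \<notin> ?Z" for z
  proof -
    obtain t x where z: "z = (t, x)" by (cases z)
    show ?thesis
    proof (cases "0 < t")
      case True
      then have "T < t \<or> R < \<bar>x\<bar>" using that TR unfolding z cbox_Pair_iff by auto
      then show ?thesis using dz z by blast
    qed (simp add: z half_def)
  qed
  \<comment> \<open>On the support of the mollifier \<open>\<zeta>\<close> is within
    \<open>h \<le> 1\<close> of \<open>z\<close> in each coordinate; so if \<open>\<zeta>\<close>
    leaves the enlarged box, \<open>z\<close> has left the support of \<open>\<Phi>\<close>.\<close>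
  have \<zeta>Z: "half \<zeta> = 0 \<or> (pt \<Phi> z = 0 \<and> px \<Phi> z = 0 \<and> \<Phi> z = 0) \<or> (cut h (\<zeta> - z) = 0 \<and> kt (\<zeta> - z) = 0 \<and> kx (\<zeta> - z) = 0)"
    if "\<zeta> \<notin> ?Z" for \<zeta> z
  proof (cases "\<zeta> - z \<in> {0<..<h} \<times> {0<..<h}")
    case True
    obtain t x s y where z: "z = (t, x)" "\<zeta> = (s, y)" by (cases z, cases \<zeta>)
    show ?thesis
    proof (cases "0 < s")
      case 0: True
      have "T + 1 < s \<or> R + 1 < \<bar>y\<bar>" using that TR 0 unfolding z cbox_Pair_iff by auto
      moreover have "s - t < h" "0 < s - t" "y - x < h" "0 < y - x" using True z by auto
      ultimately have "T < t \<or> R < \<bar>x\<bar>" using h by linarith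
      then show ?thesis using dz z by blast
    qed (simp add: z half_def)
  qed (use kz in blast)
  have hb: "0 \<le> half z" "half z \<le> 1" for z using half_cases[of z] by auto
  define e1 where "e1 z b = \<bar>Az z - b\<bar> * pt \<Phi> z + kfl f (Az z) b * px \<Phi> z" for z b
  have e1b: "\<bar>e1 z b\<bar> \<le> 2 * K * N + L * (2 * K) * N" if "\<bar>b\<bar> \<le> K" for z b
  proof -
    have "\<bar>\<bar>Az z - b\<bar> * pt \<Phi> z\<bar> \<le> 2 * K * N" unfolding abs_mult using Ab(1)[of z] that pN(2) K0 by (intro mult_mono) auto
    moreover have "\<bar>kfl f (Az z) b * px \<Phi> z\<bar> \<le> L * (2 * K) * N" unfolding abs_mult
      using kb[OF Ab(1) that] pN(3) L0 K0 by (intro mult_mono) auto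
    ultimately show ?thesis unfolding e1_def by linarith
  qed
  \<comment> \<open>In \<open>G1\<close> the derivatives fall on \<open>\<Phi>\<close>, in
    \<open>G2\<close> on the mollifier; \<open>g0\<close> is the initial term of the inequality for
    \<open>A\<close>.\<close>
  define G1 where "G1 z \<zeta> = half z * half \<zeta> * (e1 z (Bz \<zeta>) * cut h (\<zeta> - z))" for z \<zeta>
  define G2 where "G2 z \<zeta> = half z * half \<zeta> * ((\<bar>Az z - Bz \<zeta>\<bar> * kt (\<zeta> - z) + kfl f (Az z) (Bz \<zeta>) * kx (\<zeta> - z)) * \<Phi> z)" for z \<zeta>
  define g0 where "g0 x \<zeta> = half \<zeta> * (\<bar>u0 x - Bz \<zeta>\<bar> * (\<Phi> (0, x) * cut h (\<zeta> - (0, x))))" for x \<zeta>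
  have hh: "\<bar>half z * half \<zeta> * a\<bar> \<le> \<bar>a\<bar>" "\<bar>half z * a\<bar> \<le> \<bar>a\<bar>" for z \<zeta> a
    using half_cases[of z] half_cases[of \<zeta>] by auto
  have G1m: "(\<lambda>p. G1 (fst p) (snd p)) \<in> borel_measurable borel" unfolding G1_def e1_def by measurable
  have G2m: "(\<lambda>p. G2 (fst p) (snd p)) \<in> borel_measurable borel" unfolding G2_def by measurable
  have g0m: "(\<lambda>p. g0 (fst p) (snd p)) \<in> borel_measurable borel" unfolding g0_def by measurable
  let ?b1 = "(2 * K * N + L * (2 * K) * N) * ?r\<^sup>2"
  have G1b: "\<bar>G1 z \<zeta>\<bar> \<le> ?b1" for z \<zeta>
    unfolding G1_def by (rule order_trans[OF hh(1)], unfold abs_mult[of "e1 _ _"], rule mult_mono[OF e1b[OF Ab(2)] kb3(1)])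
      (use K0 L0 N0 in auto)
  have G2b: "\<bar>G2 z \<zeta>\<bar> \<le> (2 * K * ?r\<^sup>2 + L * (2 * K) * ?r\<^sup>2) * N" for z \<zeta>
  proof -
    have "\<bar>\<bar>Az z - Bz \<zeta>\<bar> * kt (\<zeta> - z)\<bar> \<le> 2 * K * ?r\<^sup>2" unfolding abs_mult
      using Ab(1)[of z] Ab(2)[of \<zeta>] kb3 K0 by (intro mult_mono) auto
    moreover have "\<bar>kfl f (Az z) (Bz \<zeta>) * kx (\<zeta> - z)\<bar> \<le> L * (2 * K) * ?r\<^sup>2" unfolding abs_mult
      using kb[OF Ab] kb3 L0 K0 by (intro mult_mono) auto
    ultimately have "\<bar>\<bar>Az z - Bz \<zeta>\<bar> * kt (\<zeta> - z) + kfl f (Az z) (Bz \<zeta>) * kx (\<zeta> - z)\<bar> \<le> 2 * K * ?r\<^sup>2 + L * (2 * K) * ?r\<^sup>2" by linarith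
    then have "\<bar>(\<bar>Az z - Bz \<zeta>\<bar> * kt (\<zeta> - z) + kfl f (Az z) (Bz \<zeta>) * kx (\<zeta> - z)) * \<Phi> z\<bar> \<le> (2 * K * ?r\<^sup>2 + L * (2 * K) * ?r\<^sup>2) * N"
      unfolding abs_mult[of _ "\<Phi> z"] using p0 pN(1) K0 L0 by (intro mult_mono) auto
    then show ?thesis unfolding G2_def by (rule order_trans[OF hh(1)])
  qed
  have g0b: "\<bar>g0 x \<zeta>\<bar> \<le> 2 * K * (N * ?r\<^sup>2)" for x \<zeta>
  proof -
    have "\<bar>\<bar>u0 x - Bz \<zeta>\<bar> * (\<Phi> (0, x) * cut h (\<zeta> - (0, x)))\<bar> \<le> 2 * K * (N * ?r\<^sup>2)" unfolding abs_mult
      using uK[of x] Ab(2)[of \<zeta>] p0 pN(1) kb3(1) K0 N0 by (intro mult_mono) auto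
    then show ?thesis unfolding g0_def by (rule order_trans[OF hh(2)])
  qed
  have G1z: "G1 z \<zeta> = 0" if "z \<notin> ?Z \<or> \<zeta> \<notin> ?Z" for z \<zeta>
    using that zZ[of z] \<zeta>Z[of \<zeta> z] unfolding G1_def e1_def by auto
  have G2z: "G2 z \<zeta> = 0" if "z \<notin> ?Z \<or> \<zeta> \<notin> ?Z" for z \<zeta>
    using that zZ[of z] \<zeta>Z[of \<zeta> z] unfolding G2_def by auto
  have g0z: "g0 x \<zeta> = 0" if "x \<notin> cbox (-(R+1)) (R+1) \<or> \<zeta> \<notin> ?Z" for x \<zeta>
    using that
  proof
    assume "x \<notin> cbox (-(R+1)) (R+1)"
    then have "R \<le> \<bar>x\<bar>" using TR by auto
    then show ?thesis using pz[of 0 x] by (simp add: g0_def)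
  next
    assume "\<zeta> \<notin> ?Z"
    then show ?thesis using \<zeta>Z[of \<zeta> "(0, x)"] by (auto simp: g0_def)
  qed
  have G1z': "\<forall>z \<zeta>. z \<notin> ?Z \<or> \<zeta> \<notin> ?Z \<longrightarrow> G1 z \<zeta> = 0" and G2z': "\<forall>z \<zeta>. z \<notin> ?Z \<or> \<zeta> \<notin> ?Z \<longrightarrow> G2 z \<zeta> = 0"
    and g0z': "\<forall>x \<zeta>. x \<notin> cbox (-(R+1)) (R+1) \<or> \<zeta> \<notin> ?Z \<longrightarrow> g0 x \<zeta> = 0"
    using G1z G2z g0z by blast+
  note I1 = double_integrable[OF G1m G1b G1z'] and I2 = double_integrable[OF G2m G2b G2z'] and I0 = double_integrable[OF g0m g0b g0z']
  note dt = doubled_test[OF \<Phi> h]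
  let ?Nh = "2 * N * ?r\<^sup>2"
  \<comment> \<open>The inequality for \<open>A\<close> at a fixed \<open>\<zeta>\<close> of
    positive time; off the box all integrands vanish, so the defect is integrated over the box
    only.\<close>
  have stepA: "- (\<delta>A * ?Nh * ?V) \<le> (LBINT \<zeta>. (LBINT z. G1 z \<zeta>) - (LBINT z. G2 z \<zeta>) + (LBINT x. g0 x \<zeta>))"
    unfolding V[symmetric]
  proof (rule LINT_bound_box)
    show "integrable lborel (\<lambda>\<zeta>. (LBINT z. G1 z \<zeta>) - (LBINT z. G2 z \<zeta>) + (LBINT x. g0 x \<zeta>))"
      using I1(3) I2(3) I0(3) by simp
    fix \<zeta>
    have e: "(LBINT z. G1 z \<zeta>) - (LBINT z. G2 z \<zeta>) + (LBINT x. g0 x \<zeta>)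
      = half \<zeta> * kruz f u0 A (Bz \<zeta>) (\<lambda>z. \<Phi> z * cut h (\<zeta> - z))"
    proof -
      have "(LBINT z. G1 z \<zeta>) - (LBINT z. G2 z \<zeta>) = (LBINT z. G1 z \<zeta> - G2 z \<zeta>)"
        using I1(5) I2(5) by simp
      also have "\<dots> = (LBINT z. half \<zeta> * (half z * (\<bar>A (fst z) (snd z) - Bz \<zeta>\<bar> * pt (\<lambda>z. \<Phi> z * cut h (\<zeta> - z)) z 
          + kfl f (A (fst z) (snd z)) (Bz \<zeta>) * px (\<lambda>z. \<Phi> z * cut h (\<zeta> - z)) z)))"
        unfolding dt(2,3) G1_def G2_def e1_def kt_def kx_def Az_def
        by (intro Bochner_Integration.integral_cong refl) (simp add: algebra_simps)
      also have "\<dots> = half \<zeta> * (LBINT z. half z * (\<bar>A (fst z) (snd z) - Bz \<zeta>\<bar> * pt (\<lambda>z. \<Phi> z * cut h (\<zeta> - z)) z 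
          + kfl f (A (fst z) (snd z)) (Bz \<zeta>) * px (\<lambda>z. \<Phi> z * cut h (\<zeta> - z)) z))"
        by (rule integral_mult_right_zero)
      finally have x: "(LBINT z. G1 z \<zeta>) - (LBINT z. G2 z \<zeta>) = \<dots>" .
      show ?thesis unfolding kruz_half x g0_def distrib_left integral_mult_right_zero ..
    qed
    show "- (\<delta>A * ?Nh) \<le> (LBINT z. G1 z \<zeta>) - (LBINT z. G2 z \<zeta>) + (LBINT x. g0 x \<zeta>)"
    proof -
      have "- (\<delta>A * ?Nh) \<le> kruz f u0 A (Bz \<zeta>) (\<lambda>z. \<Phi> z * cut h (\<zeta> - z))" by (rule krA[OF Ab(2) dt(1)])
      moreover have "- (\<delta>A * ?Nh) \<le> 0" using \<delta> N0 by simp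
      ultimately show ?thesis unfolding e using half_cases[of \<zeta>] by auto
    qed
    show "0 \<le> (LBINT z. G1 z \<zeta>) - (LBINT z. G2 z \<zeta>) + (LBINT x. g0 x \<zeta>)" if "\<zeta> \<notin> ?Z"
      using G1z G2z g0z that by simp
  qed
  have stepB: "- (\<delta>B * ?Nh * ?V) \<le> (LBINT z. (LBINT \<zeta>. G2 z \<zeta>))"
    unfolding V[symmetric]
  proof (rule LINT_bound_box)
    show "integrable lborel (\<lambda>z. (LBINT \<zeta>. G2 z \<zeta>))" by (rule I2(2))
    fix z
    have e: "(LBINT \<zeta>. G2 z \<zeta>) = half z * kruz f u0 B (Az z) (\<lambda>\<zeta>. \<Phi> z * cut h (\<zeta> - z))"
    proof -
      \<comment> \<open>A point \<open>\<zeta>\<close> at time 0 can only be coupled with a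
        \<open>z\<close> of negative time, because the mollifier looks forward. Hence the inequality
        for \<open>B\<close> has no initial term.\<close>
      have c: "half z * (\<Phi> z * cut h ((0, x) - z)) = 0" for x
        using half_cases[of z] cf(2)[of "(0, x) - z"] by (cases z) auto
      have "(LBINT \<zeta>. G2 z \<zeta>) = (LBINT \<zeta>. half z * (half \<zeta> * (\<bar>B (fst \<zeta>) (snd \<zeta>) - Az z\<bar> * pt (\<lambda>\<zeta>. \<Phi> z * cut h (\<zeta> - z)) \<zeta> 
          + kfl f (B (fst \<zeta>) (snd \<zeta>)) (Az z) * px (\<lambda>\<zeta>. \<Phi> z * cut h (\<zeta> - z)) \<zeta>)))"
        unfolding dt(5,6) G2_def kt_def kx_def Bz_def kfl_commute[of f _ "Az z"] abs_minus_commute[of _ "Az z"]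
        by (intro Bochner_Integration.integral_cong refl) (simp add: algebra_simps)
      also have "\<dots> = half z * (LBINT \<zeta>. half \<zeta> * (\<bar>B (fst \<zeta>) (snd \<zeta>) - Az z\<bar> * pt (\<lambda>\<zeta>. \<Phi> z * cut h (\<zeta> - z)) \<zeta> 
          + kfl f (B (fst \<zeta>) (snd \<zeta>)) (Az z) * px (\<lambda>\<zeta>. \<Phi> z * cut h (\<zeta> - z)) \<zeta>))"
        by (rule integral_mult_right_zero)
      finally have x: "(LBINT \<zeta>. G2 z \<zeta>) = \<dots>" .
      have "half z * (LBINT x. \<bar>u0 x - Az z\<bar> * (\<Phi> z * cut h ((0, x) - z))) = (LBINT x. \<bar>u0 x - Az z\<bar> * (half z * (\<Phi> z * cut h ((0, x) - z))))"
        unfolding integral_mult_right_zero[symmetric] by (intro Bochner_Integration.integral_cong refl) (simp add: mult_ac)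
      then have x0: "half z * (LBINT x. \<bar>u0 x - Az z\<bar> * (\<Phi> z * cut h ((0, x) - z))) = 0" unfolding c by simp
      have "half z * (a + b) = half z * a" if "half z * b = 0" for a b using that by (simp add: distrib_left)
      from this[OF x0] show ?thesis unfolding kruz_half x by (rule sym)
    qed
    show "- (\<delta>B * ?Nh) \<le> (LBINT \<zeta>. G2 z \<zeta>)"
    proof -
      have "- (\<delta>B * ?Nh) \<le> kruz f u0 B (Az z) (\<lambda>\<zeta>. \<Phi> z * cut h (\<zeta> - z))" by (rule krB[OF Ab(1) dt(4)])
      moreover have "- (\<delta>B * ?Nh) \<le> 0" using \<delta> N0 by simp
      ultimately show ?thesis unfolding e using half_cases[of z] by auto
    qed
    show "0 \<le> (LBINT \<zeta>. G2 z \<zeta>)" if "z \<notin> ?Z" using G2z that by simp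
  qed
  have split: "(LBINT \<zeta>. (LBINT z. G1 z \<zeta>) - (LBINT z. G2 z \<zeta>) + (LBINT x. g0 x \<zeta>))
    = (LBINT \<zeta>. LBINT z. G1 z \<zeta>) - (LBINT \<zeta>. LBINT z. G2 z \<zeta>) + (LBINT \<zeta>. LBINT x. g0 x \<zeta>)"
    using I1(3) I2(3) I0(3) by simp
  have sum: "- ((\<delta>A + \<delta>B) * ?Nh * ?V) \<le> (LBINT z. LBINT \<zeta>. G1 z \<zeta>) + (LBINT x. LBINT \<zeta>. g0 x \<zeta>)"
  proof -
    have "- (a * n * v) \<le> X - Y + W \<Longrightarrow> - (b * n * v) \<le> Y \<Longrightarrow> - ((a + b) * n * v) \<le> X + W" for a b n v X Y W :: real
      by (simp add: algebra_simps)
    from this[OF _ stepB] stepA show ?thesis unfolding split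
      I1(1) I2(1) I0(1) by blast
  qed
  have w01: "cut h w = 0 \<or> (0 < fst w \<and> fst w < h \<and> 0 < snd w \<and> snd w < h)" for w using cf(2)[of w] by (cases w) auto
  have addm[measurable]: "(\<lambda>p :: (real \<times> real) \<times> (real \<times> real). fst p + snd p) \<in> borel \<rightarrow>\<^sub>M borel"
    by (intro borel_measurable_continuous_onI continuous_intros)
  have addm'[measurable]: "(\<lambda>z :: real \<times> real. z + w) \<in> borel \<rightarrow>\<^sub>M borel" "(\<lambda>w. z + w) \<in> borel \<rightarrow>\<^sub>M borel" for w z :: "real \<times> real"
    by (intro borel_measurable_continuous_onI continuous_intros)+
  define bx where "bx z = (indicator {0<..T} (fst z) * indicator {-R..R} (snd z) :: real)" for z
  have [measurable]: "bx \<in> borel_measurable borel" unfolding bx_def by measurable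
  \<comment> \<open>The cost of replacing \<open>B\<close> at the shifted point by its value at
    \<open>z\<close>. For each shift its integral is at most \<open>T * \<omega>\<close> times the
    mollifier.\<close>
  define S where "S z w = bx z * \<bar>Bz (z + w) - Bz z\<bar> * cut h w" for z w
  have Sm: "(\<lambda>p. S (fst p) (snd p)) \<in> borel_measurable borel" unfolding S_def by measurable
  have bx01: "0 \<le> bx z" "bx z \<le> 1" for z by (auto simp: bx_def indicator_def)
  have Sb: "\<bar>S z w\<bar> \<le> 1 * (2 * K) * ?r\<^sup>2" for z w
    unfolding S_def abs_mult using bx01[of z] Ab(2)[of "z + w"] Ab(2)[of z] kb3(1)[of w] K0 by (intro mult_mono) auto
  have Sz: "S z w = 0" if "z \<notin> cbox (0, -R) (T, R) \<or> w \<notin> cbox (0, 0) (h, h)" for z w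
    using that
  proof
    assume "z \<notin> cbox (0, -R) (T, R)"
    then have "bx z = 0" by (cases z) (auto simp: bx_def indicator_def cbox_Pair_iff)
    then show ?thesis by (simp add: S_def)
  next
    assume "w \<notin> cbox (0, 0) (h, h)"
    then show ?thesis using w01[of w] by (cases w) (auto simp: S_def cbox_Pair_iff)
  qed
  have Sz': "\<forall>z w. z \<notin> cbox (0, -R) (T, R) \<or> w \<notin> cbox (0, 0) (h, h) \<longrightarrow> S z w = 0" using Sz by blast
  note IS = double_integrable[OF Sm Sb Sz']
  have bxT: "e1 z b = 0" if "half z = 1" "bx z = 0" for z b
  proof -
    obtain t x where z: "z = (t, x)" by (cases z)
    have "T < t \<or> R < \<bar>x\<bar>" using that unfolding z bx_def half_def by (auto simp: indicator_def split: if_splits)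
    then show ?thesis using dz by (auto simp: e1_def z)
  qed
  have e1L: "e1 z (Bz \<zeta>) \<le> e1 z (Bz z) + (1 + L) * N * \<bar>Bz \<zeta> - Bz z\<bar>" for z \<zeta>
  proof -
    have 1: "\<bar>\<bar>Az z - Bz \<zeta>\<bar> - \<bar>Az z - Bz z\<bar>\<bar> \<le> \<bar>Bz \<zeta> - Bz z\<bar>" by linarith
    have 2: "\<bar>kfl f (Az z) (Bz \<zeta>) - kfl f (Az z) (Bz z)\<bar> \<le> L * \<bar>Bz \<zeta> - Bz z\<bar>"
      unfolding kfl_def by (rule kruzhkov_flux_lipschitz(1)[OF f1 L Ab(1) Ab(2) Ab(2)])
    have "(\<bar>Az z - Bz \<zeta>\<bar> - \<bar>Az z - Bz z\<bar>) * pt \<Phi> z \<le> \<bar>Bz \<zeta> - Bz z\<bar> * N"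
      using mult_mono[OF 1 pN(2)[of z]] abs_ge_self[of "(\<bar>Az z - Bz \<zeta>\<bar> - \<bar>Az z - Bz z\<bar>) * pt \<Phi> z"] by (simp add: abs_mult)
    moreover have "(kfl f (Az z) (Bz \<zeta>) - kfl f (Az z) (Bz z)) * px \<Phi> z \<le> L * \<bar>Bz \<zeta> - Bz z\<bar> * N"
      using mult_mono[OF 2 pN(3)[of z]] L0 abs_ge_self[of "(kfl f (Az z) (Bz \<zeta>) - kfl f (Az z) (Bz z)) * px \<Phi> z"] by (simp add: abs_mult)
    ultimately show ?thesis unfolding e1_def by (simp add: algebra_simps)
  qed
  let ?g = "\<lambda>z. half z * e1 z (Bz z)"
  have gi: "integrable lborel ?g"
  proof (rule integrable_bounded_box)
    show "?g \<in> borel_measurable borel" unfolding e1_def by measurable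
    show "\<bar>?g z\<bar> \<le> 2 * K * N + L * (2 * K) * N" for z by (rule order_trans[OF hh(2) e1b[OF Ab(2)]])
    show "?g z = 0" if "z \<notin> ?Z" for z using zZ[OF that] by (auto simp: e1_def)
  qed
  have "(LBINT \<zeta>. G1 z \<zeta>) \<le> ?g z + (1 + L) * N * (LBINT w. S z w)" for z
  proof -
    have m: "(\<lambda>\<zeta>. G1 z \<zeta>) \<in> borel_measurable borel" unfolding G1_def e1_def by measurable
    \<comment> \<open>After translation the mollifier depends on \<open>w\<close> alone, and its
      unit mass reproduces the integrand on the diagonal up to \<open>S\<close>. For
      \<open>z\<close> of positive time the shifted point has positive time too.\<close>
    have "(LBINT \<zeta>. G1 z \<zeta>) = (LBINT w. G1 z (z + w))" by (rule LINT_translate[OF m])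
    also have "\<dots> \<le> (LBINT w. ?g z * cut h w + (1 + L) * N * S z w)"
    proof (rule integral_mono)
      show "integrable lborel (\<lambda>w. G1 z (z + w))"
      proof (rule integrable_bounded_box[OF _ G1b])
        show "(\<lambda>w. G1 z (z + w)) \<in> borel_measurable borel" unfolding G1_def e1_def by measurable
        show "G1 z (z + w) = 0" if "w \<notin> cbox (0, 0) (h, h)" for w
          using that w01[of w] by (cases w) (auto simp: G1_def cbox_Pair_iff)
      qed
      show "integrable lborel (\<lambda>w. ?g z * cut h w + (1 + L) * N * S z w)" using cf(4) IS(4) by simp
      fix w
      show "G1 z (z + w) \<le> ?g z * cut h w + (1 + L) * N * S z w"
      proof (cases "half z = 0 \<or> cut h w = 0")
        case True
        moreover have "0 \<le> (1 + L) * N * S z w" using L0 N0 bx01 cf(1) unfolding S_def by simp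
        ultimately show ?thesis by (auto simp: G1_def)
      next
        case False
        then have hz: "half z = 1" "0 < fst z" and w: "0 < fst w" using half_cases[of z] w01[of w] by auto
        then have hzw: "half (z + w) = 1" by (simp add: half_def)
        show ?thesis
        proof (cases "bx z = 0")
          case True
          then show ?thesis using bxT[OF hz(1)] by (simp add: G1_def S_def)
        next
          case bF: False
          then have "bx z = 1" by (auto simp: bx_def indicator_def split: if_splits)
          then have "G1 z (z + w) = e1 z (Bz (z + w)) * cut h w" "S z w = \<bar>Bz (z + w) - Bz z\<bar> * cut h w"
            using hz hzw by (simp_all add: G1_def S_def)
          moreover have "e1 z (Bz (z + w)) * cut h w \<le> (e1 z (Bz z) + (1 + L) * N * \<bar>Bz (z + w) - Bz z\<bar>) * cut h w"
            by (rule mult_right_mono[OF e1L cf(1)])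
          ultimately show ?thesis using hz by (simp add: algebra_simps)
        qed
      qed
    qed
    also have "\<dots> = ?g z * (LBINT w. cut h w) + (1 + L) * N * (LBINT w. S z w)"
      using cf(4) IS(4) by simp
    finally show ?thesis using cf(5) by simp
  qed
  then have "(LBINT z. LBINT \<zeta>. G1 z \<zeta>) \<le> (LBINT z. ?g z + (1 + L) * N * (LBINT w. S z w))"
    by (intro integral_mono I1(2)) (use gi IS(2) in auto)
  also have "\<dots> = (LBINT z. ?g z) + (1 + L) * N * (LBINT z. LBINT w. S z w)" using gi IS(2) by simp
  finally have C1: "(LBINT z. LBINT \<zeta>. G1 z \<zeta>) \<le> (LBINT z. ?g z) + (1 + L) * N * (LBINT w. LBINT z. S z w)"
    unfolding IS(1) .
  have om0: "0 \<le> \<omega>"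
    using \<omega>[of 0 0 0] TR h by (simp add: set_lebesgue_integral_def)
  have inner: "(LBINT z. S z w) \<le> T * \<omega> * cut h w" for w
  proof (cases "cut h w = 0")
    case False
    then have w: "0 < fst w" "fst w < h" "0 < snd w" "snd w < h" using w01[of w] by auto
    let ?s = "\<lambda>z. bx z * \<bar>Bz (z + w) - Bz z\<bar>"
    have si: "integrable lborel ?s"
    proof (rule integrable_bounded_box)
      show "?s \<in> borel_measurable borel" by measurable
      show "\<bar>?s z\<bar> \<le> 1 * (2 * K)" for z
        unfolding abs_mult using bx01[of z] Ab(2)[of "z + w"] Ab(2)[of z] K0 by (intro mult_mono) auto
      show "?s z = 0" if "z \<notin> cbox (0, -R) (T, R)" for z
        using that by (cases z) (auto simp: bx_def indicator_def cbox_Pair_iff)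
    qed
    then have si': "integrable (lborel \<Otimes>\<^sub>M lborel) ?s" by (simp add: lborel_prod)
    have "(LBINT z. ?s z) = (LINT z|(lborel \<Otimes>\<^sub>M lborel). ?s z)" by (simp add: lborel_prod)
    also have "\<dots> = (LBINT t. LBINT x. ?s (t, x))" using lborel_pair.integral_fst'[OF si'] by simp
    also have "\<dots> \<le> (LBINT t. \<omega> * indicator {0..T} t)"
    proof (rule integral_mono)
      show "integrable lborel (\<lambda>t. LBINT x. ?s (t, x))" using lborel_pair.integrable_fst'[OF si'] by simp
      show "integrable lborel (\<lambda>t. \<omega> * indicator {0..T} t :: real)" 
        using emeasure_lborel_cbox_finite[of 0 T] by (intro integrable_mult_right) (simp add: integrable_indicator_iff)
      fix t
      have "(LBINT x. ?s (t, x)) = indicator {0<..T} t * (LBINT x:{-R..R}. \<bar>B (t + fst w) (x + snd w) - B t x\<bar>)"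
        unfolding set_lebesgue_integral_def integral_mult_right_zero[symmetric]
        by (intro Bochner_Integration.integral_cong refl) (simp add: bx_def Bz_def)
      also have "\<dots> \<le> \<omega> * indicator {0..T} t" using \<omega>[of t "fst w" "snd w"] w om0 by (auto simp: indicator_def)
      finally show "(LBINT x. ?s (t, x)) \<le> \<omega> * indicator {0..T} t" .
    qed
    also have "\<dots> = T * \<omega>" using TR by simp
    finally have "(LBINT z. ?s z) * cut h w \<le> T * \<omega> * cut h w" by (rule mult_right_mono[OF _ cf(1)])
    then show ?thesis unfolding S_def by simp
  qed (simp add: S_def)
  have "(LBINT w. LBINT z. S z w) \<le> (LBINT w. T * \<omega> * cut h w)"
    by (intro integral_mono IS(3) inner) (use cf(4) in simp)
  then have "(LBINT w. LBINT z. S z w) \<le> T * \<omega>" using cf(5) by simp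
  then have C2: "(LBINT z. LBINT \<zeta>. G1 z \<zeta>) \<le> (LBINT z. ?g z) + (1 + L) * N * (T * \<omega>)"
    using C1 mult_left_mono[of _ "T * \<omega>" "(1 + L) * N"] L0 N0 by (smt (verit) mult_nonneg_nonneg)
  \<comment> \<open>The initial term after the same translation compares \<open>u0\<close> with
    \<open>B\<close> at a point slightly later and further right; hence both
    \<open>\<omega>0\<close> and \<open>\<omega>\<close> enter.\<close>
  define g1 where "g1 x w = \<bar>u0 x - Bz ((0, x) + w)\<bar> * (\<Phi> (0, x) * cut h w)" for x w
  have g1m: "(\<lambda>p. g1 (fst p) (snd p)) \<in> borel_measurable borel"
  proof -
    have [measurable]: "(\<lambda>p :: real \<times> (real \<times> real). (0, fst p) + snd p) \<in> borel \<rightarrow>\<^sub>M borel"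
      "(\<lambda>p :: real \<times> (real \<times> real). (0 :: real, fst p)) \<in> borel \<rightarrow>\<^sub>M borel"
      by (intro borel_measurable_continuous_onI continuous_intros)+
    show ?thesis unfolding g1_def by measurable
  qed
  have g1b: "\<bar>g1 x w\<bar> \<le> 2 * K * (N * ?r\<^sup>2)" for x w
    unfolding g1_def abs_mult using uK[of x] Ab(2)[of "(0, x) + w"] p0 pN(1) kb3(1) K0 N0 by (intro mult_mono) auto
  have g1z: "g1 x w = 0" if "x \<notin> cbox (-R) R \<or> w \<notin> cbox (0, 0) (h, h)" for x w
    using that
  proof
    assume "x \<notin> cbox (-R) R"
    then have "R \<le> \<bar>x\<bar>" by auto
    then show ?thesis using pz[of 0 x] by (simp add: g1_def)
  next
    assume "w \<notin> cbox (0, 0) (h, h)"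
    then show ?thesis using w01[of w] by (cases w) (auto simp: g1_def cbox_Pair_iff)
  qed
  have g1z': "\<forall>x w. x \<notin> cbox (-R) R \<or> w \<notin> cbox (0, 0) (h, h) \<longrightarrow> g1 x w = 0" using g1z by blast
  note J1 = double_integrable[OF g1m g1b g1z']
  have "(LBINT \<zeta>. g0 x \<zeta>) = (LBINT w. g1 x w)" for x
  proof -
    have "(\<lambda>\<zeta>. g0 x \<zeta>) \<in> borel_measurable borel"
    proof -
      have [measurable]: "(\<lambda>\<zeta> :: real \<times> real. \<zeta> - (0, x)) \<in> borel \<rightarrow>\<^sub>M borel"
        by (intro borel_measurable_continuous_onI continuous_intros)
      show ?thesis unfolding g0_def by measurable
    qed
    from LINT_translate[OF this, of "(0, x)"]
    have "(LBINT \<zeta>. g0 x \<zeta>) = (LBINT w. g0 x ((0, x) + w))" .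
    also have "\<dots> = (LBINT w. g1 x w)"
    proof (intro Bochner_Integration.integral_cong refl)
      fix w show "g0 x ((0, x) + w) = g1 x w" using w01[of w] by (auto simp: g0_def g1_def half_def)
    qed
    finally show ?thesis .
  qed
  then have "(LBINT x. LBINT \<zeta>. g0 x \<zeta>) = (LBINT w. LBINT x. g1 x w)" using J1(1) by simp
  also have "\<dots> \<le> (LBINT w. N * (\<omega> + \<omega>0) * cut h w)"
  proof (intro integral_mono J1(3))
    show "integrable lborel (\<lambda>w. N * (\<omega> + \<omega>0) * cut h w)" using cf(4) by simp
    fix w
    show "(LBINT x. g1 x w) \<le> N * (\<omega> + \<omega>0) * cut h w"
    proof (cases "cut h w = 0")
      case False
      then have w: "0 < fst w" "fst w < h" "0 < snd w" "snd w < h" using w01[of w] by auto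
      have sm: "(\<lambda>x. B t (x + y)) \<in> borel_measurable borel" for t y
      proof -
        have "(\<lambda>x :: real. (t, x + y)) \<in> borel \<rightarrow>\<^sub>M borel" by (intro borel_measurable_continuous_onI continuous_intros)
        from measurable_compose[OF this Bm] show ?thesis by simp
      qed
      have bi: "integrable lborel (\<lambda>x. indicator {-R..R} x * \<bar>u x - v x\<bar>)"
        if [measurable]: "u \<in> borel_measurable borel" "v \<in> borel_measurable borel" and b: "\<And>x. \<bar>u x\<bar> \<le> K" "\<And>x. \<bar>v x\<bar> \<le> K" for u v :: "real \<Rightarrow> real"
      proof (rule integrable_bounded_box[where a = "-R" and b = R])
        show "\<bar>indicator {-R..R} x * \<bar>u x - v x\<bar>\<bar> \<le> 2 * K" for x using b(1)[of x] b(2)[of x] K0 by (auto simp: indicator_def)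
      qed auto
      have m0: "(\<lambda>x. B 0 x) \<in> borel_measurable borel" using sm[of 0 0] by simp
      have i1: "integrable lborel (\<lambda>x. indicator {-R..R} x * \<bar>u0 x - B 0 x\<bar>)"
        by (rule bi) (use um m0 uK BK in auto)
      have i2: "integrable lborel (\<lambda>x. indicator {-R..R} x * \<bar>B (fst w) (x + snd w) - B 0 x\<bar>)"
        by (rule bi) (use sm m0 BK in auto)
      have "(LBINT x. g1 x w) \<le> (LBINT x. N * cut h w * (indicator {-R..R} x * \<bar>u0 x - B 0 x\<bar> + indicator {-R..R} x * \<bar>B (fst w) (x + snd w) - B 0 x\<bar>))"
      proof (rule integral_mono[OF J1(5)])
        show "integrable lborel (\<lambda>x. N * cut h w * (indicator {-R..R} x * \<bar>u0 x - B 0 x\<bar> + indicator {-R..R} x * \<bar>B (fst w) (x + snd w) - B 0 x\<bar>))"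
          using i1 i2 by (intro integrable_mult_right Bochner_Integration.integrable_add)
        fix x
        show "g1 x w \<le> N * cut h w * (indicator {-R..R} x * \<bar>u0 x - B 0 x\<bar> + indicator {-R..R} x * \<bar>B (fst w) (x + snd w) - B 0 x\<bar>)"
        proof (cases "x \<in> {-R..R}")
          case True
          have "\<bar>u0 x - Bz ((0, x) + w)\<bar> \<le> \<bar>u0 x - B 0 x\<bar> + \<bar>B (fst w) (x + snd w) - B 0 x\<bar>"
            unfolding Bz_def by simp
          then have "g1 x w \<le> (\<bar>u0 x - B 0 x\<bar> + \<bar>B (fst w) (x + snd w) - B 0 x\<bar>) * (N * cut h w)"
            unfolding g1_def using p0 pN(1) cf(1) N0 by (intro mult_mono) auto
          then show ?thesis using True by (simp add: mult_ac)
        next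
          case False
          then show ?thesis using g1z[of x w] by simp
        qed
      qed
      also have "\<dots> = N * cut h w * ((LBINT x. indicator {-R..R} x * \<bar>u0 x - B 0 x\<bar>) + (LBINT x. indicator {-R..R} x * \<bar>B (fst w) (x + snd w) - B 0 x\<bar>))"
        using i1 i2 by simp
      also have "\<dots> \<le> N * cut h w * (\<omega>0 + \<omega>)"
        using \<omega>0 \<omega>[of 0 "fst w" "snd w"] w TR N0 cf(1)[of w]
        by (intro mult_left_mono add_mono) (auto simp: set_lebesgue_integral_def)
      finally show ?thesis by (simp add: mult_ac add.commute)
    qed (simp add: g1_def)
  qed
  also have "\<dots> = N * (\<omega> + \<omega>0)" using cf(5) by simp
  finally have C3: "(LBINT x. LBINT \<zeta>. g0 x \<zeta>) \<le> N * (\<omega> + \<omega>0)" .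
  have "N * ((1 + L) * T * \<omega> + (\<omega> + \<omega>0)) = (1 + L) * N * (T * \<omega>) + N * (\<omega> + \<omega>0)" by (simp add: algebra_simps)
  then show ?thesis using sum C2 C3 unfolding e1_def Az_def Bz_def by linarith
qed

section \<open>Classical form of the approximate solutions\<close>

lemma jointly_continuous_if_locally_uniform:
  fixes W :: "real \<Rightarrow> real \<Rightarrow> real"
  assumes c: "\<And>s x. 0 \<le> s \<Longrightarrow> isCont (W s) x"
    and u: "\<And>s. 0 \<le> s \<Longrightarrow> ((\<lambda>t. N s t) \<longlongrightarrow> 0) (at s within {0..})"
    and b: "\<And>s t x. 0 \<le> s \<Longrightarrow> 0 \<le> t \<Longrightarrow> \<bar>W t x - W s x\<bar> \<le> N s t"
  shows "continuous_on ({0..} \<times> UNIV) (\<lambda>z. W (fst z) (snd z))"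
  unfolding continuous_on_def
proof
  fix z :: "real \<times> real" assume z: "z \<in> {0..} \<times> UNIV"
  obtain s y where zs: "z = (s, y)" "0 \<le> s" using z by (cases z) auto
  let ?F = "at z within {0..} \<times> UNIV"
  have f: "filterlim fst (nhds s) ?F" "filterlim snd (nhds y) ?F"
    using tendsto_fst[OF tendsto_ident_at[of z]] tendsto_snd[OF tendsto_ident_at[of z]] by (simp_all add: zs)
  have ev: "eventually (\<lambda>w. 0 \<le> fst w) ?F" unfolding eventually_at_filter by (auto intro!: always_eventually)
  \<comment> \<open>The limit along \<open>at s\<close> says nothing about \<open>N s s\<close>;
    with the value 0 there, the bound still holds and the limit extends to the full
    neighbourhood.\<close>
  define N' where "N' t = (if t = s then 0 else N s t)" for t
  have "((\<lambda>w. N' (fst w)) \<longlongrightarrow> 0) ?F"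
  proof (rule tendstoI)
    fix e :: real assume e: "0 < e"
    have "eventually (\<lambda>t. dist (N s t) 0 < e) (at s within {0..})" using tendstoD[OF u[OF zs(2)] e] .
    then have "eventually (\<lambda>t. t \<in> {0..} \<longrightarrow> dist (N' t) 0 < e) (nhds s)"
      unfolding eventually_at_filter by (rule eventually_mono) (use e in \<open>auto simp: N'_def\<close>)
    from eventually_compose_filterlim[OF this f(1)] ev
    show "eventually (\<lambda>w. dist (N' (fst w)) 0 < e) ?F" by eventually_elim auto
  qed
  moreover have "\<forall>\<^sub>F w in ?F. norm (W (fst w) (snd w) - W s (snd w)) \<le> N' (fst w)"
    using ev by eventually_elim (use b[OF zs(2)] in \<open>auto simp: N'_def\<close>)
  ultimately have "((\<lambda>w. W (fst w) (snd w) - W s (snd w)) \<longlongrightarrow> 0) ?F"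
    by (rule Lim_null_comparison[rotated])
  moreover have "((\<lambda>w. W s (snd w)) \<longlongrightarrow> W s y) ?F"
    using c[OF zs(2), of y] f(2) by (rule isCont_tendsto_compose)
  ultimately have "((\<lambda>w. (W (fst w) (snd w) - W s (snd w)) + W s (snd w)) \<longlongrightarrow> 0 + W s y) ?F" by (rule tendsto_add)
  then show "((\<lambda>z. W (fst z) (snd z)) \<longlongrightarrow> W (fst z) (snd z)) ?F" by (simp add: zs)
qed

lemma C4_derivs:
  assumes "C4 f"
  shows "(f has_real_derivative deriv f x) (at x)" "(deriv f has_real_derivative deriv (deriv f) x) (at x)"
    "isCont (deriv (deriv f)) x"
proof -
  have d: "((deriv ^^ k) f) differentiable (at x)" if "k < 4" for k x using assms that by (simp add: C4_def)
  show "(f has_real_derivative deriv f x) (at x)" using d[of 0 x] by (simp add: DERIV_deriv_iff_real_differentiable)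
  show "(deriv f has_real_derivative deriv (deriv f) x) (at x)"
    using d[of 1 x] by (simp add: DERIV_deriv_iff_real_differentiable)
  have "(deriv ^^ 2) f differentiable (at x)" by (rule d) simp
  then show "isCont (deriv (deriv f)) x"
    using differentiable_imp_continuous_within by (force simp: numeral_2_eq_2)
qed

text \<open>The solution class supplies weak derivatives at each time and L2 limits in time.
  Continuous representatives make the space derivatives classical, and Sobolev's inequality in space
  makes the limits in time uniform in \<open>x\<close>.\<close>

lemma approx_solution_classical:
  assumes f: "C4 f" and c: "0 < c" and f2b: "\<And>v. c \<le> (deriv ^^ 2) f v" "\<And>v. (deriv ^^ 2) f v \<le> C"
    and l: "0 < l" and eps: "0 < eps" and j: "friedrichs j" and sol: "approx_solution f l eps w0 U D"
  obtains q p V r P P1 where "rb_approx f (deriv f) (deriv (deriv f)) l eps c C U q p V r P P1"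
proof -
  let ?f1 = "deriv f" and ?f2 = "deriv (deriv f)"
  have f2e: "(deriv ^^ 2) f = ?f2" by (simp add: numeral_2_eq_2)
  note fd = C4_derivs[OF f]
  have Uc: "continuous_on ({0..} \<times> UNIV) (\<lambda>z. U (fst z) (snd z))" and HU: "H_curve 3 U D"
    using sol by (auto simp: approx_solution_def)
  obtain V0 DV where HV: "H_curve 2 V0 DV" and dq: "\<And>s i. 0 \<le> s \<Longrightarrow> i \<le> 2 \<Longrightarrow>
      ((\<lambda>t. LBINT x. ((D t i x - D s i x) / (t - s) - DV s i x)\<^sup>2) \<longlongrightarrow> 0) (at s within {0..})"
    and weq: "\<And>t. 0 \<le> t \<Longrightarrow> weak_deriv (\<lambda>x. f (U t x) + 1/2 * l\<^sup>2 *
                 conv (Gk l) (\<lambda>y. ?f2 (U t y) * ((D t 1 y)\<^sup>2 + chi eps (D t 1 y))) x) (\<lambda>x. - V0 t x)"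
    using sol unfolding approx_solution_def f2e by blast
  have D0: "D t 0 = U t" and wdU: "i < 3 \<Longrightarrow> weak_deriv (D t i) (D t (Suc i))" and L2U: "i \<le> 3 \<Longrightarrow> L2 (D t i)" if "0 \<le> t" for t i
    using HU that by (auto simp: H_curve_def H_derivs_def)
  have DV0: "DV t 0 = V0 t" and wdV: "i < 2 \<Longrightarrow> weak_deriv (DV t i) (DV t (Suc i))" and L2V: "i \<le> 2 \<Longrightarrow> L2 (DV t i)" if "0 \<le> t" for t i
    using HV that by (auto simp: H_curve_def H_derivs_def)
  have cV: "((\<lambda>t. LBINT x. (DV t i x - DV s i x)\<^sup>2) \<longlongrightarrow> 0) (at s within {0..})" if "0 \<le> s" "i \<le> 2" for s i
    using HV that by (auto simp: H_curve_def)
  \<comment> \<open>The representatives are chosen for all times at once, with nothing claimed at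
    negative ones.\<close>
  have "\<forall>t. \<exists>g. 0 \<le> t \<longrightarrow> (\<forall>x. isCont g x) \<and> (AE x in lborel. D t 1 x = g x)"
    using weak_deriv_cont_rep[OF j wdU[of _ 1]] by (metis One_nat_def Suc_less_eq lessI less_trans numeral_3_eq_3)
  then obtain q where q: "\<And>t x. 0 \<le> t \<Longrightarrow> isCont (q t) x" "\<And>t. 0 \<le> t \<Longrightarrow> AE x in lborel. D t 1 x = q t x" by metis
  have "\<forall>t. \<exists>g. 0 \<le> t \<longrightarrow> (\<forall>x. isCont g x) \<and> (AE x in lborel. D t 2 x = g x)"
    using weak_deriv_cont_rep[OF j wdU[of _ 2]] by (metis numeral_2_eq_2 numeral_3_eq_3 lessI)
  then obtain p where p: "\<And>t x. 0 \<le> t \<Longrightarrow> isCont (p t) x" "\<And>t. 0 \<le> t \<Longrightarrow> AE x in lborel. D t 2 x = p t x" by metis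
  have "\<forall>t. \<exists>g. 0 \<le> t \<longrightarrow> (\<forall>x. isCont g x) \<and> (AE x in lborel. DV t 0 x = g x)"
    using weak_deriv_cont_rep[OF j wdV[of _ 0]] by (metis zero_less_numeral)
  then obtain V where V: "\<And>t x. 0 \<le> t \<Longrightarrow> isCont (V t) x" "\<And>t. 0 \<le> t \<Longrightarrow> AE x in lborel. DV t 0 x = V t x" by metis
  have "\<forall>t. \<exists>g. 0 \<le> t \<longrightarrow> (\<forall>x. isCont g x) \<and> (AE x in lborel. DV t 1 x = g x)"
    using weak_deriv_cont_rep[OF j wdV[of _ 1]] by (metis numeral_2_eq_2 One_nat_def lessI)
  then obtain r where r: "\<And>t x. 0 \<le> t \<Longrightarrow> isCont (r t) x" "\<And>t. 0 \<le> t \<Longrightarrow> AE x in lborel. DV t 1 x = r t x" by metis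
  have Ucont: "isCont (U t) x" if t: "0 \<le> t" for t x
  proof -
    have "continuous_on UNIV (\<lambda>x. U t x)"
    proof -
      have "continuous_on UNIV (\<lambda>x. (t, x))" by (intro continuous_on_Pair continuous_on_const continuous_on_id)
      from continuous_on_compose2[OF Uc this] show ?thesis using t by (simp add: image_subset_iff)
    qed
    then show ?thesis by (simp add: continuous_on_eq_continuous_at)
  qed
  have Uq: "(U t has_real_derivative q t x) (at x)" if t: "0 \<le> t" for t x
    by (rule weak_deriv_classical[OF j wdU[OF t, of 0] _ _ _ q(1)[OF t]]) (use D0[OF t] Ucont[OF t] q(2)[OF t] in auto)
  have qp: "(q t has_real_derivative p t x) (at x)" if t: "0 \<le> t" for t x
    by (rule weak_deriv_classical[OF j wdU[OF t, of 1] q(2)[OF t] q(1)[OF t] _ p(1)[OF t]]) (use p(2)[OF t] in \<open>simp_all add: numeral_2_eq_2\<close>)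
  have Vr: "(V t has_real_derivative r t x) (at x)" if t: "0 \<le> t" for t x
    by (rule weak_deriv_classical[OF j wdV[OF t, of 0] V(2)[OF t] V(1)[OF t] _ r(1)[OF t]]) (use r(2)[OF t] in simp_all)
  have m: "U t \<in> borel_measurable borel" "q t \<in> borel_measurable borel" "p t \<in> borel_measurable borel" 
     "V t \<in> borel_measurable borel" "r t \<in> borel_measurable borel" if "0 \<le> t" for t
    using isCont_borel[OF Ucont[OF that]] isCont_borel[OF q(1)[OF that]] isCont_borel[OF p(1)[OF that]] 
      isCont_borel[OF V(1)[OF that]] isCont_borel[OF r(1)[OF that]] by auto
  have Dm: "i \<le> 3 \<Longrightarrow> D t i \<in> borel_measurable borel" "i \<le> 2 \<Longrightarrow> DV t i \<in> borel_measurable borel" if "0 \<le> t" for t i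
    using L2U[OF that] L2V[OF that] by (auto simp: L2_def)
  have U2: "integrable lborel (\<lambda>x. (U t x)\<^sup>2)" if t: "0 \<le> t" for t using L2U[OF t, of 0] D0[OF t] by (simp add: L2_def)
  have q2: "integrable lborel (\<lambda>x. (q t x)\<^sup>2)" if t: "0 \<le> t" for t 
    by (rule L2_cong_AE[OF L2U[OF t, of 1] q(2)[OF t]]) (use m[OF t] in auto)
  have p2: "integrable lborel (\<lambda>x. (p t x)\<^sup>2)" if t: "0 \<le> t" for t 
    by (rule L2_cong_AE[OF L2U[OF t, of 2] p(2)[OF t]]) (use m[OF t] in auto)
  have V2: "integrable lborel (\<lambda>x. (V t x)\<^sup>2)" if t: "0 \<le> t" for t 
    by (rule L2_cong_AE[OF L2V[OF t, of 0] V(2)[OF t]]) (use m[OF t] in auto)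
  have r2: "integrable lborel (\<lambda>x. (r t x)\<^sup>2)" if t: "0 \<le> t" for t 
    by (rule L2_cong_AE[OF L2V[OF t, of 1] r(2)[OF t]]) (use m[OF t] in auto)
  have in0: "eventually (\<lambda>t. (0::real) \<le> t) (at s within {0..})" for s
    unfolding eventually_at_filter by (auto intro!: always_eventually)
  have sq_lim: "((\<lambda>t. LBINT x. (b t x)\<^sup>2) \<longlongrightarrow> 0) (at s within {0..})"
    if "((\<lambda>t. LBINT x. (a t x)\<^sup>2) \<longlongrightarrow> 0) (at s within {0..})" and ab: "\<And>t. 0 \<le> t \<Longrightarrow> AE x in lborel. a t x = b t x"
      and m [measurable]: "\<And>t. 0 \<le> t \<Longrightarrow> a t \<in> borel_measurable borel" "\<And>t. 0 \<le> t \<Longrightarrow> b t \<in> borel_measurable borel"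
    for a b :: "real \<Rightarrow> real \<Rightarrow> real" and s
  proof (rule Lim_transform_eventually[OF that(1)])
    show "\<forall>\<^sub>F t in at s within {0..}. (LBINT x. (a t x)\<^sup>2) = (LBINT x. (b t x)\<^sup>2)"
      using in0
    proof eventually_elim
      case (elim t)
      note [measurable] = m[OF elim]
      have "AE x in lborel. (a t x)\<^sup>2 = (b t x)\<^sup>2" using ab[OF elim] by eventually_elim simp
      then show ?case by (intro integral_cong_AE) measurable
    qed
  qed
  have Dm': "D t 0 \<in> borel_measurable borel" "D t 1 \<in> borel_measurable borel" "DV t 0 \<in> borel_measurable borel" "DV t 1 \<in> borel_measurable borel"
    if "0 \<le> t" for t by (rule Dm[OF that]; simp)+
  have UV: "((\<lambda>t. LBINT x. ((U t x - U s x) / (t - s) - V s x)\<^sup>2) \<longlongrightarrow> 0) (at s within {0..})" if s: "0 \<le> s" for s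
  proof (rule sq_lim[OF dq[OF s, of 0]])
    fix t :: real assume t: "0 \<le> t"
    note [measurable] = m[OF s] m[OF t] Dm'[OF s] Dm'[OF t]
    show "AE x in lborel. (D t 0 x - D s 0 x) / (t - s) - DV s 0 x = (U t x - U s x) / (t - s) - V s x"
      unfolding D0[OF s] D0[OF t] using V(2)[OF s] by eventually_elim simp
    show "(\<lambda>x. (D t 0 x - D s 0 x) / (t - s) - DV s 0 x) \<in> borel_measurable borel" by measurable
    show "(\<lambda>x. (U t x - U s x) / (t - s) - V s x) \<in> borel_measurable borel" by measurable
  qed simp
  have qr: "((\<lambda>t. LBINT x. ((q t x - q s x) / (t - s) - r s x)\<^sup>2) \<longlongrightarrow> 0) (at s within {0..})" if s: "0 \<le> s" for s
  proof (rule sq_lim[OF dq[OF s, of 1]])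
    fix t :: real assume t: "0 \<le> t"
    note [measurable] = m[OF s] m[OF t] Dm'[OF s] Dm'[OF t]
    show "AE x in lborel. (D t 1 x - D s 1 x) / (t - s) - DV s 1 x = (q t x - q s x) / (t - s) - r s x"
      using r(2)[OF s] q(2)[OF s] q(2)[OF t] by eventually_elim simp
    show "(\<lambda>x. (D t 1 x - D s 1 x) / (t - s) - DV s 1 x) \<in> borel_measurable borel" by measurable
    show "(\<lambda>x. (q t x - q s x) / (t - s) - r s x) \<in> borel_measurable borel" by measurable
  qed simp
  have VV: "((\<lambda>t. LBINT x. (V t x - V s x)\<^sup>2) \<longlongrightarrow> 0) (at s within {0..})" if s: "0 \<le> s" for s
  proof (rule sq_lim[OF cV[OF s, of 0]])
    fix t :: real assume t: "0 \<le> t"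
    note [measurable] = m[OF s] m[OF t] Dm'[OF s] Dm'[OF t]
    show "AE x in lborel. DV t 0 x - DV s 0 x = V t x - V s x" using V(2)[OF s] V(2)[OF t] by eventually_elim simp
    show "(\<lambda>x. DV t 0 x - DV s 0 x) \<in> borel_measurable borel" by measurable
    show "(\<lambda>x. V t x - V s x) \<in> borel_measurable borel" by measurable
  qed simp
  have rr: "((\<lambda>t. LBINT x. (r t x - r s x)\<^sup>2) \<longlongrightarrow> 0) (at s within {0..})" if s: "0 \<le> s" for s
  proof (rule sq_lim[OF cV[OF s, of 1]])
    fix t :: real assume t: "0 \<le> t"
    note [measurable] = m[OF s] m[OF t] Dm'[OF s] Dm'[OF t]
    show "AE x in lborel. DV t 1 x - DV s 1 x = r t x - r s x" using r(2)[OF s] r(2)[OF t] by eventually_elim simp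
    show "(\<lambda>x. DV t 1 x - DV s 1 x) \<in> borel_measurable borel" by measurable
    show "(\<lambda>x. r t x - r s x) \<in> borel_measurable borel" by measurable
  qed simp
  have sqd: "integrable lborel (\<lambda>x. (a x - b x)\<^sup>2)" 
    if [measurable]: "a \<in> borel_measurable borel" "b \<in> borel_measurable borel" and ab: "integrable lborel (\<lambda>x. (a x)\<^sup>2)" "integrable lborel (\<lambda>x. (b x)\<^sup>2)" for a b :: "real \<Rightarrow> real"
  proof (rule Bochner_Integration.integrable_bound)
    show "integrable lborel (\<lambda>x. 2 * (a x)\<^sup>2 + 2 * (b x)\<^sup>2)" using ab by simp
    show "AE x in lborel. norm ((a x - b x)\<^sup>2) \<le> norm (2 * (a x)\<^sup>2 + 2 * (b x)\<^sup>2)"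
      using sq_diff_le by (intro AE_I2) simp
  qed measurable
  \<comment> \<open>Sobolev's bound for \<open>V t - V s\<close>: continuity of \<open>V\<close> and
    of its space derivative in L2 gives continuity uniform in \<open>x\<close>.\<close>
  let ?N = "\<lambda>s t. sqrt ((LBINT x. (V t x - V s x)\<^sup>2) + (LBINT x. (r t x - r s x)\<^sup>2))"
  have Vc: "continuous_on ({0..} \<times> UNIV) (\<lambda>z. V (fst z) (snd z))"
  proof (rule jointly_continuous_if_locally_uniform[where N = ?N])
    show "isCont (V s) x" if "0 \<le> s" for s x by (rule V(1)[OF that])
    show "(?N s \<longlongrightarrow> 0) (at s within {0..})" if s: "0 \<le> s" for s
      using tendsto_real_sqrt[OF tendsto_add[OF VV[OF s] rr[OF s]]] by simp
    show "\<bar>V t x - V s x\<bar> \<le> ?N s t" if s: "0 \<le> s" "0 \<le> t" for s t x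
    proof (rule real_le_rsqrt)
      have "(V t x - V s x)\<^sup>2 \<le> (LBINT x. (V t x - V s x)\<^sup>2) + (LBINT x. (r t x - r s x)\<^sup>2)"
        by (rule sobolev_sup) (auto intro!: derivative_intros Vr s continuous_intros r(1) sqd m V2 r2)
      then show "\<bar>V t x - V s x\<bar>\<^sup>2 \<le> (LBINT x. (V t x - V s x)\<^sup>2) + (LBINT x. (r t x - r s x)\<^sup>2)" by simp
    qed
  qed
  have Ut: "((\<lambda>t. U t x) has_real_derivative V s x) (at s within {0..})" if s: "0 \<le> s" for s x
  proof -
    \<comment> \<open>The same bound for the error of the difference quotient turns
      differentiability in L2 into differentiability at every point.\<close>
    let ?M = "\<lambda>t. sqrt ((LBINT x. ((U t x - U s x) / (t - s) - V s x)\<^sup>2) + (LBINT x. ((q t x - q s x) / (t - s) - r s x)\<^sup>2))"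
    have "((\<lambda>t. (U t x - U s x) / (t - s) - V s x) \<longlongrightarrow> 0) (at s within {0..})"
    proof (rule Lim_null_comparison)
      show "(?M \<longlongrightarrow> 0) (at s within {0..})"
        using tendsto_real_sqrt[OF tendsto_add[OF UV[OF s] qr[OF s]]] by simp
      show "\<forall>\<^sub>F t in at s within {0..}. norm ((U t x - U s x) / (t - s) - V s x) \<le> ?M t"
        using in0
      proof eventually_elim
        case (elim t)
        have i: "integrable lborel (\<lambda>x. ((a x - b x) / (t - s) - d x)\<^sup>2)" 
          if "a \<in> borel_measurable borel" "b \<in> borel_measurable borel" "d \<in> borel_measurable borel" 
            "integrable lborel (\<lambda>x. (a x)\<^sup>2)" "integrable lborel (\<lambda>x. (b x)\<^sup>2)" "integrable lborel (\<lambda>x. (d x)\<^sup>2)" for a b d :: "real \<Rightarrow> real"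
        proof (rule sqd)
          have "integrable lborel (\<lambda>x. (a x - b x)\<^sup>2 / (t - s)\<^sup>2)" using sqd[of a b] that by simp
          then show "integrable lborel (\<lambda>x. ((a x - b x) / (t - s))\<^sup>2)" by (simp add: power_divide)
          note [measurable] = that(1,2)
          show "(\<lambda>x. (a x - b x) / (t - s)) \<in> borel_measurable borel" by measurable
        qed (rule that)+
        have "((U t x - U s x) / (t - s) - V s x)\<^sup>2 \<le> (LBINT x. ((U t x - U s x) / (t - s) - V s x)\<^sup>2) + (LBINT x. ((q t x - q s x) / (t - s) - r s x)\<^sup>2)"
        proof (rule sobolev_sup)
          show "((\<lambda>x. (U t x - U s x) / (t - s) - V s x) has_real_derivative (q t x - q s x) / (t - s) - r s x) (at x)" for x
            by (intro DERIV_diff DERIV_cdivide Uq Vr s elim)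
          have "isCont (\<lambda>x. (q t x - q s x) * (1 / (t - s)) - r s x) x" for x by (intro continuous_intros q(1) r(1) s elim)
          then show "isCont (\<lambda>x. (q t x - q s x) / (t - s) - r s x) x" for x by simp
          show "integrable lborel (\<lambda>x. ((U t x - U s x) / (t - s) - V s x)\<^sup>2)"
            by (intro i m s elim U2 V2)
          show "integrable lborel (\<lambda>x. ((q t x - q s x) / (t - s) - r s x)\<^sup>2)"
            by (intro i m s elim q2 r2)
        qed
        then show ?case by (intro real_le_rsqrt) simp
      qed
    qed
    then show ?thesis unfolding has_field_derivative_iff by (simp add: LIM_zero_iff)
  qed
  define h where "h t y = ?f2 (U t y) * ((q t y)\<^sup>2 + chi eps (q t y))" for t y
  define P where "P t x = 1/2 * l\<^sup>2 * conv (Gk l) (h t) x" for t x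
  have f20: "0 \<le> ?f2 x" "?f2 x \<le> C" for x using f2b[of x] c unfolding f2e by auto
  have hc: "isCont (h t) x" if t: "0 \<le> t" for t x
    unfolding h_def chi_eq[OF eps] by (intro continuous_intros isCont_o2[OF Ucont[OF t] fd(3)] q(1)[OF t])
  have h0: "0 \<le> h t x" for t x unfolding h_def using f20 chi_bounds[OF eps, of "q t x"] by simp
  have hi: "integrable lborel (h t)" if t: "0 \<le> t" for t
  proof (rule Bochner_Integration.integrable_bound)
    show "integrable lborel (\<lambda>x. 2 * C * (q t x)\<^sup>2)" using q2[OF t] by simp
    show "h t \<in> borel_measurable lborel" using isCont_borel[OF hc[OF t]] by simp
    show "AE x in lborel. norm (h t x) \<le> norm (2 * C * (q t x)\<^sup>2)"
    proof (intro AE_I2)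
      fix x
      have "h t x \<le> C * ((q t x)\<^sup>2 + (q t x)\<^sup>2)"
        unfolding h_def using f20[of "U t x"] chi_bounds[OF eps, of "q t x"] by (intro mult_mono) auto
      then show "norm (h t x) \<le> norm (2 * C * (q t x)\<^sup>2)" using h0[of t x] by simp
    qed
  qed
  have "\<forall>t. \<exists>P1. 0 \<le> t \<longrightarrow> (\<forall>x. 0 \<le> P t x \<and> (P t has_real_derivative P1 x) (at x) \<and>
      (P1 has_real_derivative P t x / l\<^sup>2 - h t x / 2) (at x) \<and> \<bar>P1 x\<bar> \<le> P t x / l)"
  proof (intro allI)
    fix t :: real
    show "\<exists>P1. 0 \<le> t \<longrightarrow> (\<forall>x. 0 \<le> P t x \<and> (P t has_real_derivative P1 x) (at x) \<and>
      (P1 has_real_derivative P t x / l\<^sup>2 - h t x / 2) (at x) \<and> \<bar>P1 x\<bar> \<le> P t x / l)"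
    proof (cases "0 \<le> t")
      case True
      from potential_derivs[OF hc[OF True] h0 hi[OF True] l P_def] show ?thesis by metis
    qed simp
  qed
  then obtain P1 where P1: "\<And>t x. 0 \<le> t \<Longrightarrow> 0 \<le> P t x" "\<And>t x. 0 \<le> t \<Longrightarrow> (P t has_real_derivative P1 t x) (at x)"
    "\<And>t x. 0 \<le> t \<Longrightarrow> (P1 t has_real_derivative P t x / l\<^sup>2 - h t x / 2) (at x)" "\<And>t x. 0 \<le> t \<Longrightarrow> \<bar>P1 t x\<bar> \<le> P t x / l" by metis
  have hm: "h t \<in> borel_measurable borel" if "0 \<le> t" for t by (rule isCont_borel[OF hc[OF that]])
  have Pi: "integrable lborel (P t)" if t: "0 \<le> t" for t
  proof -
    have "integrable lborel (\<lambda>x. P t x * 1)"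
      by (rule potential_integral(1)[OF hm[OF t] h0 hi[OF t] l _ _ P_def]) auto
    then show ?thesis by simp
  qed
  have Pj: "1 / (1 + K / 2)\<^sup>2 * (LBINT x. P t x) \<le> (LBINT x. P t x * (1 / (1 + l * \<bar>q t x\<bar>)\<^sup>2))"
    if t: "0 \<le> t" and "integrable lborel (\<lambda>x. \<bar>q t x\<bar>)" "(LBINT x. \<bar>q t x\<bar>) \<le> K" for t K
    by (rule potential_jensen(1)[OF hm[OF t] h0 hi[OF t] l P_def m(2)[OF t] that(2,3)])
  have eq: "V t x = - (?f1 (U t x) * q t x + P1 t x)" if t: "0 \<le> t" for t x
  proof -
    \<comment> \<open>The weak equation contains the L2 derivative \<open>D t 1\<close>; under the
      convolution it may be replaced by its continuous representative \<open>q t\<close>.\<close>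
    have ce: "conv (Gk l) (\<lambda>y. ?f2 (U t y) * ((D t 1 y)\<^sup>2 + chi eps (D t 1 y))) x = conv (Gk l) (h t) x" for x
      unfolding conv_def
    proof (rule integral_cong_AE)
      note [measurable] = m[OF t]
      have [measurable]: "D t 1 \<in> borel_measurable borel" by (rule Dm[OF t]) simp
      have [measurable]: "?f2 \<in> borel_measurable borel" using fd(3) isCont_borel by blast
      show "AE y in lborel. Gk l (x - y) * (?f2 (U t y) * ((D t 1 y)\<^sup>2 + chi eps (D t 1 y))) = Gk l (x - y) * h t y"
        using q(2)[OF t] by eventually_elim (simp add: h_def)
      show "(\<lambda>y. Gk l (x - y) * (?f2 (U t y) * ((D t 1 y)\<^sup>2 + chi eps (D t 1 y)))) \<in> borel_measurable lborel"
        unfolding chi_eq[OF eps] by measurable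
      show "(\<lambda>y. Gk l (x - y) * h t y) \<in> borel_measurable lborel" using hm[OF t] by measurable
    qed
    have w: "weak_deriv (\<lambda>x. f (U t x) + P t x) (\<lambda>x. - V0 t x)" using weq[OF t] unfolding ce P_def .
    have D: "((\<lambda>x. f (U t x) + P t x) has_real_derivative ?f1 (U t x) * q t x + P1 t x) (at x)" for x
      by (intro DERIV_add DERIV_chain2[OF fd(1) Uq[OF t]] P1(2)[OF t])
    have "((\<lambda>x. f (U t x) + P t x) has_real_derivative - V t x) (at x)"
    proof (rule weak_deriv_classical[OF j w])
      show "isCont (\<lambda>x. f (U t x) + P t x) x" for x using D DERIV_isCont by blast
      show "AE x in lborel. - V0 t x = - V t x" using V(2)[OF t] unfolding DV0[OF t] by eventually_elim simp
      show "isCont (\<lambda>x. - V t x) x" for x using V(1)[OF t] by (intro continuous_intros)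
    qed simp
    then show ?thesis using DERIV_unique[OF D] by force
  qed
  have "rb_approx f ?f1 ?f2 l eps c C U q p V r P P1"
    by unfold_locales (use fd f2b c l eps Uq qp p(1) Vr r(1) U2 q2 p2 V2 r2 P1 Pi Pj eq UV qr Uc Vc Ut in \<open>auto simp: f2e h_def\<close>)
  then show ?thesis by (rule that)
qed

section \<open>The initial datum\<close>

lemma AE_lborel_reflect:
  assumes "AE z in lborel. P z" "Measurable.pred borel P"
  shows "AE y in lborel. P (x - y :: real)"
  using AE_borel_affine[of "-1" P x] assms by simp

lemma mollify_facts:
  assumes j: "friedrichs j" and e: "0 < e"
  shows "0 \<le> mollify j e y" "e \<le> \<bar>y\<bar> \<Longrightarrow> mollify j e y = 0" "isCont (mollify j e) y"
    "integrable lborel (mollify j e)" "(LBINT y. mollify j e y) = 1"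
proof -
  have st: "smooth_test j" and j0: "\<And>x. 0 \<le> j x" and j1: "\<And>x. 1 \<le> \<bar>x\<bar> \<Longrightarrow> j x = 0"
    and ji: "(LBINT x. j x) = 1" using j by (auto simp: friedrichs_def)
  show "0 \<le> mollify j e y" using j0 e by (simp add: mollify_def)
  show "mollify j e y = 0" if "e \<le> \<bar>y\<bar>"
    using that e j1[of "y / e"] by (simp add: mollify_def abs_divide field_simps)
  show "isCont (mollify j e) y" unfolding mollify_def[abs_def]
    using e by (intro continuous_intros isCont_o2[OF _ smooth_test_isCont[OF st]]) auto
  have i: "integrable lborel (\<lambda>y. j (0 + (1 / e) * y))"
    using lborel_integrable_real_affine[OF smooth_test_integrable[OF st], of "1 / e" 0] e by simp
  have e1: "mollify j e = (\<lambda>y. j (0 + (1 / e) * y) / e)" by (auto simp: mollify_def)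
  show "integrable lborel (mollify j e)" unfolding e1 using i by (rule integrable_divide)
  have "(LBINT x. j x) = \<bar>1 / e\<bar> * (LBINT y. j (0 + (1 / e) * y))"
    using lborel_integral_real_affine[of "1 / e" j 0] e by simp
  then show "(LBINT y. mollify j e y) = 1" unfolding e1 using ji e by simp
qed

text \<open>A continuous primitive \<open>g\<close> of the datum replaces \<open>u0\<close> throughout.\<close>
locale datum =
  fixes u0 u0' g :: "real \<Rightarrow> real" and M :: real
  assumes u0m: "u0 \<in> borel_measurable lborel" and gu: "AE x in lborel. u0 x = g x" and gc: "\<And>x. isCont g x"
    and gp: "\<And>a b. a \<le> b \<Longrightarrow> g b - g a = (LBINT x:{a..b}. u0' x)"
    and di: "integrable lborel u0'" and d2: "integrable lborel (\<lambda>x. (u0' x)\<^sup>2)"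
    and dM: "AE x in lborel. u0' x \<le> M" and M0: "0 \<le> M"
begin

definition E where "E = sqrt (LBINT x. (u0' x)\<^sup>2)"

lemma dm [measurable]: "u0' \<in> borel_measurable borel" using di by (simp add: integrable_iff_bounded)
lemma gm [measurable]: "g \<in> borel_measurable borel" by (rule isCont_borel[OF gc])

text \<open>Cauchy-Schwarz with a square integrable derivative. The exponent 1/2 is why mollifying
  the datum at scale \<open>e\<close> costs \<open>sqrt e\<close>.\<close>

lemma g_holder: "\<bar>g x - g y\<bar> \<le> sqrt \<bar>x - y\<bar> * E"
proof -
  have *: "\<bar>g b - g a\<bar> \<le> sqrt \<bar>b - a\<bar> * E" if ab: "a \<le> b" for a b
  proof -
    have i1: "integrable lborel (\<lambda>x. (indicator {a..b} x :: real)\<^sup>2)"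
      using emeasure_lborel_cbox_finite[of a b] by (simp add: integrable_indicator_iff power2_eq_square indicator_inter_arith[symmetric])
    have "integrable lborel (\<lambda>x. indicator {a..b} x * u0' x)"
      using integrable_mult_indicator[of "{a..b}" lborel u0'] di by simp
    from integral_Cauchy_Schwarz[OF i1 d2 this]
    have "(LBINT x. indicator {a..b} x * u0' x)\<^sup>2 \<le> (b - a) * (LBINT x. (u0' x)\<^sup>2)"
      using ab by (simp add: power2_eq_square[of "indicator _ _"] indicator_inter_arith[symmetric])
    then have "(g b - g a)\<^sup>2 \<le> (b - a) * (LBINT x. (u0' x)\<^sup>2)"
      using gp[OF ab] by (simp add: set_lebesgue_integral_def)
    then have "\<bar>g b - g a\<bar> \<le> sqrt ((b - a) * (LBINT x. (u0' x)\<^sup>2))" by (intro real_le_rsqrt) simp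
    then show ?thesis using ab by (simp add: E_def real_sqrt_mult)
  qed
  show ?thesis using *[of x y] *[of y x] by (cases "x \<le> y") (auto simp: abs_minus_commute)
qed

lemma E0: "0 \<le> E" by (simp add: E_def)

text \<open>The derivative of the mollified datum is an average of translates of \<open>u0'\<close>,
  hence it keeps the upper bound and does not increase the L1 norm; the distance to \<open>g\<close>
  comes from the Hoelder bound.\<close>

lemma mollified:
  assumes j: "friedrichs j" and e: "0 < e" and Uc: "\<And>x. isCont U x" and UD: "\<And>x. (U has_real_derivative q x) (at x)"
    and qc: "\<And>x. isCont q x" and Uw: "AE x in lborel. U x = conv u0 (mollify j e) x"
  shows "\<bar>U x - g x\<bar> \<le> sqrt e * E" "q x \<le> M" "integrable lborel (\<lambda>x. \<bar>q x\<bar>)" "(LBINT x. \<bar>q x\<bar>) \<le> (LBINT x. \<bar>u0' x\<bar>)"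
proof -
  let ?m = "mollify j e"
  note mf = mollify_facts[OF j e]
  have [measurable]: "?m \<in> borel_measurable borel" by (rule isCont_borel[OF mf(3)])
  have [measurable]: "u0 \<in> borel_measurable borel" using u0m by simp
  define W where "W x = (LBINT y. g (x - y) * ?m y)" for x
  have Wi: "integrable lborel (\<lambda>y. g (x - y) * ?m y)" for x
  proof (rule integrable_mult_cont_supp[where R = e])
    show "set_integrable lborel {a..b} (\<lambda>y. g (x - y))" for a b
      by (intro set_integrable_cont isCont_o2[OF _ gc]) (intro continuous_intros)
  qed (use mf in auto)
  have cW: "conv u0 ?m x = W x" for x
    unfolding conv_def W_def
  proof (rule integral_cong_AE)
    have "AE y in lborel. u0 (x - y) = g (x - y)"
      using AE_lborel_reflect[of "\<lambda>z. u0 z = g z" x] gu by simp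
    then show "AE y in lborel. u0 (x - y) * ?m y = g (x - y) * ?m y" by eventually_elim simp
  qed measurable
  have dW: "\<bar>W x - W y\<bar> \<le> sqrt \<bar>x - y\<bar> * E" for x y
  proof -
    have "\<bar>W x - W y\<bar> = \<bar>LBINT z. (g (x - z) - g (y - z)) * ?m z\<bar>"
      unfolding W_def using Wi by (simp add: left_diff_distrib)
    also have "\<dots> \<le> (LBINT z. \<bar>(g (x - z) - g (y - z)) * ?m z\<bar>)" by (rule integral_abs_bound)
    also have "\<dots> \<le> (LBINT z. sqrt \<bar>x - y\<bar> * E * ?m z)"
    proof (rule integral_mono)
      show "integrable lborel (\<lambda>z. \<bar>(g (x - z) - g (y - z)) * ?m z\<bar>)" using Wi by (simp add: left_diff_distrib)
      show "integrable lborel (\<lambda>z. sqrt \<bar>x - y\<bar> * E * ?m z)" using mf(4) by simp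
      show "\<bar>(g (x - z) - g (y - z)) * ?m z\<bar> \<le> sqrt \<bar>x - y\<bar> * E * ?m z" for z
        using mult_right_mono[OF g_holder[of "x - z" "y - z"] mf(1)[of z]] mf(1)[of z] by (simp add: abs_mult)
    qed
    finally show ?thesis using mf(5) by simp
  qed
  have Wc: "isCont W x" for x
  proof -
    have "((\<lambda>y. W y - W x) \<longlongrightarrow> 0) (at x)"
    proof (rule Lim_null_comparison)
      show "\<forall>\<^sub>F y in at x. norm (W y - W x) \<le> sqrt \<bar>y - x\<bar> * E" using dW by (intro always_eventually) simp
      show "((\<lambda>y. sqrt \<bar>y - x\<bar> * E) \<longlongrightarrow> 0) (at x)" by (auto intro!: tendsto_eq_intros)
    qed
    then show ?thesis by (simp add: isCont_def LIM_zero_iff)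
  qed
  have UW: "U x = W x" for x
    by (rule AE_eq_continuous_imp_eq[OF _ Uc Wc]) (use Uw cW in simp)
  show "\<bar>U x - g x\<bar> \<le> sqrt e * E"
  proof -
    have "U x - g x = (LBINT z. (g (x - z) - g x) * ?m z)"
      unfolding UW W_def using Wi mf(4,5) by (simp add: left_diff_distrib)
    then have "\<bar>U x - g x\<bar> \<le> (LBINT z. \<bar>(g (x - z) - g x) * ?m z\<bar>)" using integral_abs_bound by metis
    also have "\<dots> \<le> (LBINT z. sqrt e * E * ?m z)"
    proof (rule integral_mono)
      show "integrable lborel (\<lambda>z. \<bar>(g (x - z) - g x) * ?m z\<bar>)" using Wi mf(4) by (simp add: left_diff_distrib)
      show "integrable lborel (\<lambda>z. sqrt e * E * ?m z)" using mf(4) by simp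
      fix z
      show "\<bar>(g (x - z) - g x) * ?m z\<bar> \<le> sqrt e * E * ?m z"
      proof (cases "e \<le> \<bar>z\<bar>")
        case False
        then have "\<bar>g (x - z) - g x\<bar> \<le> sqrt e * E"
          using g_holder[of "x - z" x] mult_right_mono[of "sqrt \<bar>z\<bar>" "sqrt e" E] E0 by simp
        from mult_right_mono[OF this mf(1)[of z]] show ?thesis using mf(1)[of z] by (simp add: abs_mult)
      qed (simp add: mf(2))
    qed
    finally show ?thesis using mf(5) by simp
  qed
  \<comment> \<open>The mollified derivative. It is identified with \<open>q\<close> through
    integrals over intervals, since \<open>u0'\<close> is not a classical derivative of
    \<open>g\<close>.\<close>
  define k where "k z = (LBINT y. ?m y * u0' (z - y))" for z
  have Kint: "integrable (lborel \<Otimes>\<^sub>M lborel) (\<lambda>p. ?m (fst p) * u0' (snd p - fst p))"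
  proof (rule lborel_pair.Fubini_integrable)
    have sh: "(LBINT z. \<bar>u0' (z - y)\<bar>) = (LBINT z. \<bar>u0' z\<bar>)" for y
      using lborel_integral_real_affine[of 1 "\<lambda>z. \<bar>u0' z\<bar>" "-y"] by simp
    have "(LBINT z. norm (?m y * u0' (z - y))) = ?m y * (LBINT z. \<bar>u0' z\<bar>)" for y
      using mf(1)[of y] by (simp add: abs_mult sh)
    then show "integrable lborel (\<lambda>y. LBINT z. norm (?m (fst (y, z)) * u0' (snd (y, z) - fst (y, z))))"
      using mf(4) by simp
    have "integrable lborel (\<lambda>z. u0' (z - y))" for y
      using lborel_integrable_real_affine[OF di, of 1 "-y"] by simp
    then show "AE y in lborel. integrable lborel (\<lambda>z. ?m (fst (y, z)) * u0' (snd (y, z) - fst (y, z)))"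
      by (intro AE_I2) simp
  qed measurable
  then have Ki: "integrable (lborel \<Otimes>\<^sub>M lborel) (\<lambda>(y, z). ?m y * u0' (z - y))" by (simp add: case_prod_unfold)
  have Kn: "integrable (lborel \<Otimes>\<^sub>M lborel) (\<lambda>(y, z). norm (?m y * u0' (z - y)))"
    using integrable_norm[OF Ki] by (simp add: case_prod_unfold)
  have ki: "integrable lborel k" unfolding k_def using lborel_pair.integrable_snd[OF Ki] by simp
  have kz: "set_integrable lborel {a..b} k" for a b
    unfolding set_integrable_def using ki by (intro integrable_mult_indicator) auto
  have qk: "AE x in lborel. q x - k x = 0"
  proof (rule AE_zero_if_interval_integrals_zero)
    show "set_integrable lborel {a..b} (\<lambda>x. q x - k x)" for a b
      by (intro set_integral_diff set_integrable_cont qc kz)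
    fix a b :: real
    show "(LBINT x:{a..b}. q x - k x) = 0"
    proof (cases "a \<le> b")
      case True
      have Kab: "integrable (lborel \<Otimes>\<^sub>M lborel) (\<lambda>(y, z). indicator {a..b} z * (?m y * u0' (z - y)))"
      proof (rule Bochner_Integration.integrable_bound[OF Ki])
        show "AE p in lborel \<Otimes>\<^sub>M lborel. norm (case p of (y, z) \<Rightarrow> indicator {a..b} z * (?m y * u0' (z - y))) \<le> norm (case p of (y, z) \<Rightarrow> ?m y * u0' (z - y))"
          by (intro AE_I2) (auto simp: indicator_def)
      qed measurable
      have "U b - U a = (LBINT y. (g (b - y) - g (a - y)) * ?m y)"
        unfolding UW W_def using Wi by (simp add: left_diff_distrib)
      also have "\<dots> = (LBINT y. LBINT z. indicator {a..b} z * (?m y * u0' (z - y)))"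
      proof (intro Bochner_Integration.integral_cong refl)
        fix y
        have "g (b - y) - g (a - y) = (LBINT z. indicator {a - y..b - y} z * u0' z)"
          using gp[of "a - y" "b - y"] True by (simp add: set_lebesgue_integral_def)
        also have "\<dots> = (LBINT z. indicator {a - y..b - y} (z - y) * u0' (z - y))"
          using lborel_integral_real_affine[of 1 "\<lambda>z. indicator {a - y..b - y} z * u0' z" "-y"] by simp
        also have "\<dots> = (LBINT z. indicator {a..b} z * u0' (z - y))"
          by (intro Bochner_Integration.integral_cong refl) (auto simp: indicator_def)
        finally show "(g (b - y) - g (a - y)) * ?m y = (LBINT z. indicator {a..b} z * (?m y * u0' (z - y)))"
          unfolding integral_mult_left_zero[symmetric] by (simp add: mult_ac)
      qed
      also have "\<dots> = (LBINT z. LBINT y. indicator {a..b} z * (?m y * u0' (z - y)))"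
        using lborel_pair.Fubini_integral[OF Kab] by simp
      also have "\<dots> = (LBINT z:{a..b}. k z)"
        unfolding k_def set_lebesgue_integral_def by simp
      finally have "U b - U a = (LBINT z:{a..b}. k z)" .
      moreover have "(LBINT z:{a..b}. q z) = U b - U a" by (rule LBINT_FTC[OF True UD qc])
      ultimately show ?thesis using set_integral_diff(2)[OF set_integrable_cont[OF qc] kz] by simp
    qed (simp add: set_lebesgue_integral_def)
  qed
  have kM: "k z \<le> M" for z
  proof -
    have u: "AE y in lborel. u0' (z - y) \<le> M" using AE_lborel_reflect[of "\<lambda>z. u0' z \<le> M" z] dM by simp
    show ?thesis
    proof (cases "integrable lborel (\<lambda>y. ?m y * u0' (z - y))")
      case True
      have "k z \<le> (LBINT y. M * ?m y)" unfolding k_def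
      proof (rule integral_mono_AE[OF True])
        show "integrable lborel (\<lambda>y. M * ?m y)" using mf(4) by simp
        show "AE y in lborel. ?m y * u0' (z - y) \<le> M * ?m y"
          using u by eventually_elim (simp only: mult.commute[of M], rule mult_left_mono, simp_all add: mf(1))
      qed
      then show ?thesis using mf(5) by simp
    next
      case False
      \<comment> \<open>Where the integrand is not integrable the integral is 0 by convention, and
        \<open>0 \<le> M\<close>.\<close>
      then show ?thesis using M0 by (simp add: k_def not_integrable_integral_eq)
    qed
  qed
  have "AE x in lborel. max (q x) M = M" using qk by eventually_elim (use kM in \<open>auto simp: max_def intro: antisym\<close>)
  then have "max (q x) M = M" by (rule AE_eq_continuous_imp_eq) (auto intro!: continuous_intros qc)
  then show "q x \<le> M" by linarith
  have ak: "AE x in lborel. \<bar>k x\<bar> = \<bar>q x\<bar>" using qk by eventually_elim simp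
  have [measurable]: "q \<in> borel_measurable borel" by (rule isCont_borel[OF qc])
  have km[measurable]: "k \<in> borel_measurable borel" using ki by (simp add: integrable_iff_bounded)
  show "integrable lborel (\<lambda>x. \<bar>q x\<bar>)"
    by (rule integrable_cong_AE_imp[OF integrable_abs[OF ki] _ ak]) measurable
  have "(LBINT x. \<bar>q x\<bar>) = (LBINT x. \<bar>k x\<bar>)" by (rule integral_cong_AE) (use ak in \<open>auto elim: eventually_mono\<close>)
  also have "\<dots> \<le> (LBINT z. LBINT y. norm (?m y * u0' (z - y)))"
  proof (rule integral_mono)
    show "integrable lborel (\<lambda>x. \<bar>k x\<bar>)" using ki by simp
    show "integrable lborel (\<lambda>z. LBINT y. norm (?m y * u0' (z - y)))" using lborel_pair.integrable_snd[OF Kn] by simp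
    show "\<bar>k z\<bar> \<le> (LBINT y. norm (?m y * u0' (z - y)))" for z unfolding k_def
      using integral_norm_bound[of lborel "\<lambda>y. ?m y * u0' (z - y)"] by simp
  qed
  also have "\<dots> = (LBINT y. LBINT z. norm (?m y * u0' (z - y)))"
    using lborel_pair.Fubini_integral[OF Kn] by simp
  also have "\<dots> = (LBINT y. ?m y * (LBINT z. \<bar>u0' z\<bar>))"
  proof (intro Bochner_Integration.integral_cong refl)
    fix y
    have "(LBINT z. \<bar>u0' (z - y)\<bar>) = (LBINT z. \<bar>u0' z\<bar>)"
      using lborel_integral_real_affine[of 1 "\<lambda>z. \<bar>u0' z\<bar>" "-y"] by simp
    then show "(LBINT z. norm (?m y * u0' (z - y))) = ?m y * (LBINT z. \<bar>u0' z\<bar>)"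
      using mf(1)[of y] by (simp add: abs_mult)
  qed
  also have "\<dots> = (LBINT x. \<bar>u0' x\<bar>)" using mf(5) by simp
  finally show "(LBINT x. \<bar>q x\<bar>) \<le> (LBINT x. \<bar>u0' x\<bar>)" .
qed

end

section \<open>Comparison on space-time boxes\<close>

lemma LBINT_shift:
  fixes g :: "real \<Rightarrow> real"
  shows "(LBINT x:{a..b}. g (x + c)) = (LBINT x:{a + c..b + c}. g x)"
proof -
  have "(LBINT x:{a + c..b + c}. g x) = (LBINT x. indicator {a + c..b + c} (c + x) * g (c + x))"
    unfolding set_lebesgue_integral_def
    using lborel_integral_real_affine[of 1 "\<lambda>x. indicator {a + c..b + c} x *\<^sub>R g x" c] by simp
  also have "\<dots> = (LBINT x. indicator {a..b} x * g (x + c))"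
    by (intro Bochner_Integration.integral_cong refl) (auto simp: indicator_def add.commute)
  finally show ?thesis by (simp add: set_lebesgue_integral_def)
qed

text \<open>Two primitives take the place of Fubini: with \<open>Q\<close> a primitive of
  \<open>\<bar>q\<bar>\<close> and \<open>R\<close> one of \<open>Q\<close>, the integral is at most
  a difference of two increments of \<open>R\<close>, to which the mean value theorem and the
  monotonicity of \<open>Q\<close> apply.\<close>

lemma translation_modulus:
  fixes U q :: "real \<Rightarrow> real"
  assumes D: "\<And>x. (U has_real_derivative q x) (at x)" and qc: "\<And>x. isCont q x"
    and i: "integrable lborel (\<lambda>x. \<bar>q x\<bar>)" "(LBINT x. \<bar>q x\<bar>) \<le> K" and ab: "a \<le> b" and z: "0 \<le> z"
  shows "(LBINT x:{a..b}. \<bar>U (x + z) - U x\<bar>) \<le> K * z"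
proof -
  have ac: "isCont (\<lambda>x. \<bar>q x\<bar>) x" for x using qc by (intro continuous_intros)
  obtain Q where Q: "\<And>x. (Q has_real_derivative \<bar>q x\<bar>) (at x)" using antiderivative_real ac by blast
  have Qc: "isCont Q x" for x using Q DERIV_isCont by blast
  have Uc: "isCont U x" for x using D DERIV_isCont by blast
  obtain R where R: "\<And>x. (R has_real_derivative Q x) (at x)" using antiderivative_real Qc by blast
  have Qm: "Q x \<le> Q y" if "x \<le> y" for x y
    using Q that by (intro DERIV_nonneg_imp_nondecreasing[of x y Q]) (auto intro!: exI)
  have UQ: "\<bar>U y - U x\<bar> \<le> Q y - Q x" if "x \<le> y" for x y
  proof -
    have "(\<lambda>x. Q x - U x) x \<le> (\<lambda>x. Q x - U x) y" 
    proof (rule DERIV_nonneg_imp_nondecreasing[OF that])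
      fix w
      have "((\<lambda>x. Q x - U x) has_real_derivative \<bar>q w\<bar> - q w) (at w)" by (rule DERIV_diff[OF Q D])
      then show "\<exists>y. ((\<lambda>x. Q x - U x) has_real_derivative y) (at w) \<and> 0 \<le> y" by (intro exI conjI) auto
    qed
    moreover have "(\<lambda>x. Q x + U x) x \<le> (\<lambda>x. Q x + U x) y" 
    proof (rule DERIV_nonneg_imp_nondecreasing[OF that])
      fix w
      have "((\<lambda>x. Q x + U x) has_real_derivative \<bar>q w\<bar> + q w) (at w)" by (rule DERIV_add[OF Q D])
      then show "\<exists>y. ((\<lambda>x. Q x + U x) has_real_derivative y) (at w) \<and> 0 \<le> y" by (intro exI conjI) auto
    qed
    ultimately show ?thesis by (simp add: abs_le_iff)
  qed
  have sc: "isCont (\<lambda>x. g (x + z)) x" if "\<And>x. isCont g x" for g :: "real \<Rightarrow> real" and x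
    by (rule isCont_o2[OF _ that]) (intro continuous_intros)
  have "(LBINT x:{a..b}. \<bar>U (x + z) - U x\<bar>) \<le> (LBINT x:{a..b}. Q (x + z) - Q x)"
    by (rule set_integral_mono) (use UQ z in \<open>auto intro!: set_integrable_cont continuous_intros sc Uc Qc\<close>)
  also have "\<dots> = (LBINT x:{a..b}. Q (x + z)) - (LBINT x:{a..b}. Q x)"
    by (intro set_integral_diff set_integrable_cont sc Qc)
  also have "(LBINT x:{a..b}. Q (x + z)) = R (b + z) - R (a + z)"
    unfolding LBINT_shift using ab by (intro LBINT_FTC R Qc) auto
  also have "(LBINT x:{a..b}. Q x) = R b - R a" by (rule LBINT_FTC[OF ab R Qc])
  also have "R (b + z) - R (a + z) - (R b - R a) = (R (b + z) - R b) - (R (a + z) - R a)" by simp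
  also have "\<dots> \<le> Q (b + z) * z - Q a * z"
  proof -
    have "R (b + z) - R b \<le> Q (b + z) * z \<and> Q a * z \<le> R (a + z) - R a"
    proof (cases "z = 0")
      case False
      then have z0: "0 < z" using z by simp
      obtain y where y: "b < y" "y < b + z" "R (b + z) - R b = (b + z - b) * Q y"
        using MVT2[of b "b + z" R Q] R z0 by auto
      obtain y' where y': "a < y'" "y' < a + z" "R (a + z) - R a = (a + z - a) * Q y'"
        using MVT2[of a "a + z" R Q] R z0 by auto
      show ?thesis using y y' Qm[of y "b + z"] Qm[of a y'] z by (simp add: mult_left_mono mult.commute)
    qed simp
    then show ?thesis by linarith
  qed
  also have "\<dots> = (Q (b + z) - Q a) * z" by (simp add: left_diff_distrib)
  also have "\<dots> \<le> K * z"
  proof (rule mult_right_mono[OF _ z])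
    have "Q (b + z) - Q a = (LBINT x:{a..b+z}. \<bar>q x\<bar>)" using ab z by (intro LBINT_FTC[symmetric] Q ac) auto
    also have "\<dots> \<le> (LBINT x. \<bar>q x\<bar>)" by (rule LBINT_le_LINT[OF ac i(1)]) auto
    finally show "Q (b + z) - Q a \<le> K" using i(2) by simp
  qed
  finally show ?thesis .
qed

text \<open>The initial term is Lipschitz in the datum; this moves the inequality from the mollified
  datum of each approximate solution to the common \<open>g\<close>.\<close>

lemma kruz_change_datum:
  assumes t: "test_box T R N \<phi>" and m: "a \<in> borel_measurable borel" "b \<in> borel_measurable borel"
    and ab: "\<And>x. \<bar>a x - b x\<bar> \<le> e" and bb: "\<And>x. \<bar>b x\<bar> \<le> B" and R: "0 \<le> R"
  shows "kruz f a w k \<phi> \<le> kruz f b w k \<phi> + N * (e * (2 * R))"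
proof -
  have t2: "test2 \<phi>" and p0: "\<And>z. 0 \<le> \<phi> z" and pN: "\<And>z. \<phi> z \<le> N" and pz: "\<And>t x. R \<le> \<bar>x\<bar> \<Longrightarrow> \<phi> (t, x) = 0"
    using t by (auto simp: test_box_def)
  have N0: "0 \<le> N" using p0[of 0] pN[of 0] by linarith
  have e0: "0 \<le> e" using ab[of 0] by linarith
  have "continuous_on UNIV (\<lambda>x. \<phi> (0, x))" 
    by (rule continuous_on_compose2[OF test2_continuous[OF t2]]) (auto intro!: continuous_intros)
  then have [measurable]: "(\<lambda>x. \<phi> (0, x)) \<in> borel_measurable borel" by (rule borel_measurable_continuous_onI)
  note [measurable] = m
  have B0: "0 \<le> B" using bb[of 0] by linarith
  have i: "integrable lborel (\<lambda>x. \<bar>u x - k\<bar> * \<phi> (0, x))" if [measurable]: "u \<in> borel_measurable borel" and b: "\<And>x. \<bar>u x\<bar> \<le> B'" for u B'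
  proof (rule integrable_bounded_box[where a = "-R" and b = R])
    show "\<bar>\<bar>u x - k\<bar> * \<phi> (0, x)\<bar> \<le> (B' + \<bar>k\<bar>) * N" for x
      unfolding abs_mult using b[of x] p0 pN N0 by (intro mult_mono) auto
    show "\<bar>u x - k\<bar> * \<phi> (0, x) = 0" if "x \<notin> cbox (-R) R" for x
    proof -
      have "R \<le> \<bar>x\<bar>" using that by auto
      then show ?thesis by (simp add: pz)
    qed
  qed measurable
  have ia: "integrable lborel (\<lambda>x. \<bar>a x - k\<bar> * \<phi> (0, x))"
    by (rule i[where B' = "B + e"]) (use m ab bb in \<open>auto intro: order_trans[OF abs_triangle_ineq2_sym] simp: abs_le_iff\<close>, smt (verit) ab bb, smt (verit) ab bb)
  have ib: "integrable lborel (\<lambda>x. \<bar>b x - k\<bar> * \<phi> (0, x))" by (rule i[OF m(2) bb])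
  have ic: "integrable lborel (\<lambda>x. e * N * indicator {-R..R} x :: real)"
    using emeasure_lborel_cbox_finite[of "-R" R] by (intro integrable_mult_right) (simp add: integrable_indicator_iff)
  have "(LBINT x. \<bar>a x - k\<bar> * \<phi> (0, x)) \<le> (LBINT x. \<bar>b x - k\<bar> * \<phi> (0, x) + e * N * indicator {-R..R} x)"
  proof (rule integral_mono[OF ia])
    show "integrable lborel (\<lambda>x. \<bar>b x - k\<bar> * \<phi> (0, x) + e * N * indicator {-R..R} x)" using ib ic by simp
    fix x
    show "\<bar>a x - k\<bar> * \<phi> (0, x) \<le> \<bar>b x - k\<bar> * \<phi> (0, x) + e * N * indicator {-R..R} x"
    proof (cases "R \<le> \<bar>x\<bar>")
      case True then show ?thesis using pz[of x 0] e0 N0 by simp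
    next
      case False
      have "\<bar>a x - k\<bar> * \<phi> (0, x) \<le> (\<bar>b x - k\<bar> + e) * \<phi> (0, x)" using ab[of x] p0 by (intro mult_right_mono) auto
      also have "\<dots> \<le> \<bar>b x - k\<bar> * \<phi> (0, x) + e * N" using mult_left_mono[OF pN e0, of "(0, x)"] by (simp add: distrib_right)
      finally show ?thesis using False by (simp add: indicator_def abs_le_iff not_le abs_less_iff less_imp_le)
    qed
  qed
  also have "\<dots> = (LBINT x. \<bar>b x - k\<bar> * \<phi> (0, x)) + e * N * (2 * R)"
    using ib ic R by simp
  finally show ?thesis unfolding kruz_def by (simp add: mult_ac)
qed

lemma kruz_cong:
  assumes t: "test_box T R N \<phi>" and w: "\<And>t x. 0 < t \<Longrightarrow> t \<le> T \<Longrightarrow> w t x = w' t x"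
  shows "kruz f u w k \<phi> = kruz f u w' k \<phi>"
proof -
  have pz: "\<And>t x. T \<le> t \<or> R \<le> \<bar>x\<bar> \<Longrightarrow> \<phi> (t, x) = 0" using t by (auto simp: test_box_def)
  show ?thesis unfolding kruz_half
  proof (intro arg_cong2[where f = "(+)"] refl Bochner_Integration.integral_cong)
    fix z :: "real \<times> real"
    obtain t x where z: "z = (t, x)" by (cases z)
    show "half z * (\<bar>w (fst z) (snd z) - k\<bar> * pt \<phi> z + kfl f (w (fst z) (snd z)) k * px \<phi> z)
      = half z * (\<bar>w' (fst z) (snd z) - k\<bar> * pt \<phi> z + kfl f (w' (fst z) (snd z)) k * px \<phi> z)"
      using test2_deriv_zero[where \<phi> = \<phi> and T = T and R = R, OF pz, of t x] w[of t x] half_cases[of z]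
      unfolding z by (cases "T < t") auto
  qed
qed

text \<open>The weight decreases along every characteristic cone of speed \<open>\<Lambda> - 1\<close>.\<close>
lemma cone_test:
  assumes T: "0 < T" and \<Lambda>: "1 \<le> \<Lambda>" and Rc: "0 < Rc"
  obtains \<Phi> N where "test_box T (Rc + \<Lambda> * T) N \<Phi>"
    "\<And>t x. 0 < t \<Longrightarrow> pt \<Phi> (t, x) + (\<Lambda> - 1) * \<bar>px \<Phi> (t, x)\<bar> \<le> 0"
    "\<And>t x. 0 < t \<Longrightarrow> t \<le> T / 2 \<Longrightarrow> 1 \<le> Rc - \<Lambda> * t - sqrt (1 + x\<^sup>2) \<Longrightarrow>
       pt \<Phi> (t, x) + (\<Lambda> - 1) * \<bar>px \<Phi> (t, x)\<bar> \<le> - (T ^ 4)"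
proof -
  \<comment> \<open>The squared positive parts are of class \<open>C^1\<close>, and
    \<open>sqrt (1 + x\<^sup>2)\<close> replaces \<open>\<bar>x\<bar>\<close> to avoid the corner at
    0. The factor \<open>a\<close> switches the weight off at time \<open>T\<close>.\<close>
  define a where "a t = max 0 (T\<^sup>2 - t\<^sup>2)" for t
  define b where "b t x = max 0 (Rc - \<Lambda> * t - sqrt (1 + x\<^sup>2))" for t x
  define \<Phi> where "\<Phi> z = (a (fst z))\<^sup>2 * (b (fst z) (snd z))\<^sup>2" for z
  have sq: "((\<lambda>y. (max 0 (F y))\<^sup>2) has_real_derivative 2 * max 0 (F x) * D) (at x)" if "(F has_real_derivative D) (at x)" for F :: "real \<Rightarrow> real" and D x
    using DERIV_chain2[OF quad_approx_DERIV[OF quad_approx_pos_sq] that] .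
  have Da: "((\<lambda>t. (a t)\<^sup>2) has_real_derivative 2 * a t * (- 2 * t)) (at t)" for t
    unfolding a_def by (rule sq) (auto intro!: derivative_eq_intros)
  have Dbt: "((\<lambda>t. (b t x)\<^sup>2) has_real_derivative 2 * b t x * (- \<Lambda>)) (at t)" for t x
    unfolding b_def by (rule sq) (auto intro!: derivative_eq_intros)
  have s1: "0 < 1 + x\<^sup>2" for x :: real by (simp add: add_pos_nonneg)
  have Dbx: "((\<lambda>x. (b t x)\<^sup>2) has_real_derivative 2 * b t x * (- (x / sqrt (1 + x\<^sup>2)))) (at x)" for t x
    unfolding b_def by (rule sq) (use s1[of x] in \<open>auto intro!: derivative_eq_intros simp: field_simps\<close>)
  have Dt: "((\<lambda>s. \<Phi> (s, x)) has_real_derivative 2 * a t * (- 2 * t) * (b t x)\<^sup>2 + 2 * b t x * (- \<Lambda>) * (a t)\<^sup>2) (at t)" for t x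
    unfolding \<Phi>_def fst_conv snd_conv by (rule DERIV_mult[OF Da Dbt])
  have Dx: "((\<lambda>y. \<Phi> (t, y)) has_real_derivative (a t)\<^sup>2 * (2 * b t x * (- (x / sqrt (1 + x\<^sup>2))))) (at x)" for t x
    unfolding \<Phi>_def fst_conv snd_conv by (rule DERIV_cmult[OF Dbx])
  have ptE: "pt \<Phi> z = 2 * a (fst z) * (- 2 * fst z) * (b (fst z) (snd z))\<^sup>2 + 2 * b (fst z) (snd z) * (- \<Lambda>) * (a (fst z))\<^sup>2"
    and pxE: "px \<Phi> z = (a (fst z))\<^sup>2 * (2 * b (fst z) (snd z) * (- (snd z / sqrt (1 + (snd z)\<^sup>2))))" for z
    using DERIV_imp_deriv[OF Dt] DERIV_imp_deriv[OF Dx] by (simp_all add: pt_def[of \<Phi>] px_def[of \<Phi>])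
  have z: "\<Phi> (t, x) = 0" if "T \<le> t \<or> Rc + \<Lambda> * T \<le> \<bar>x\<bar>" for t x
  proof (cases "\<bar>t\<bar> \<ge> T")
    case True
    then have "T\<^sup>2 \<le> \<bar>t\<bar>\<^sup>2" using T by (intro power_mono) auto
    then show ?thesis by (simp add: \<Phi>_def a_def)
  next
    case False
    then have x: "Rc + \<Lambda> * T \<le> \<bar>x\<bar>" using that by auto
    have "\<Lambda> * (- t) \<le> \<Lambda> * T" using False \<Lambda> by (intro mult_left_mono) auto
    moreover have "\<bar>x\<bar> \<le> sqrt (1 + x\<^sup>2)" by (rule real_le_rsqrt) simp
    ultimately have "Rc - \<Lambda> * t - sqrt (1 + x\<^sup>2) \<le> 0" using x by simp
    then show ?thesis by (simp add: \<Phi>_def b_def)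
  qed
  have z2: "\<Phi> (t, x) = 0" if "T \<le> \<bar>t\<bar>" for t x
  proof -
    have "T\<^sup>2 \<le> \<bar>t\<bar>\<^sup>2" using T that by (intro power_mono) auto
    then show ?thesis by (simp add: \<Phi>_def a_def)
  qed
  have ca: "continuous_on UNIV (\<lambda>z :: real \<times> real. a (fst z))" "continuous_on UNIV (\<lambda>z :: real \<times> real. b (fst z) (snd z))"
    unfolding a_def b_def by (intro continuous_intros)+
  have t2: "test2 \<Phi>"
    unfolding test2_def
  proof (intro conjI allI)
    show "(\<lambda>s. \<Phi> (s, x)) differentiable at t" "(\<lambda>y. \<Phi> (t, y)) differentiable at x" for t x
      using Dt Dx unfolding real_differentiable_def by blast+
    show "continuous_on UNIV (pt \<Phi>)" unfolding ptE[abs_def] by (intro continuous_intros ca)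
    have "sqrt (1 + x\<^sup>2) \<noteq> 0" for x :: real using s1[of x] by simp
    then show "continuous_on UNIV (px \<Phi>)" unfolding pxE[abs_def] by (intro continuous_intros ca) auto
    have "{z. \<Phi> z \<noteq> 0} \<subseteq> cbox (-T, - (Rc + \<Lambda> * T)) (T, Rc + \<Lambda> * T)"
    proof
      fix z assume "z \<in> {z. \<Phi> z \<noteq> 0}"
      then have "\<not> (T \<le> \<bar>fst z\<bar>)" "\<not> (Rc + \<Lambda> * T \<le> \<bar>snd z\<bar>)" using z[of "fst z" "snd z"] z2[of "fst z" "snd z"] by auto
      then show "z \<in> cbox (-T, - (Rc + \<Lambda> * T)) (T, Rc + \<Lambda> * T)" by (cases z) (auto simp: cbox_Pair_iff)
    qed
    then show "bounded {z. \<Phi> z \<noteq> 0}" using bounded_cbox bounded_subset by blast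
  qed
  obtain N where N: "\<And>z. \<bar>\<Phi> z\<bar> \<le> N" "\<And>z. \<bar>pt \<Phi> z\<bar> \<le> N" "\<And>z. \<bar>px \<Phi> z\<bar> \<le> N" using test2_bounded[OF t2] by metis
  have key: "pt \<Phi> (t, x) + (\<Lambda> - 1) * \<bar>px \<Phi> (t, x)\<bar> \<le> - 2 * ((a t)\<^sup>2 * b t x)" if t: "0 < t" for t x
  proof -
    have ab0: "0 \<le> a t" "0 \<le> b t x" by (auto simp: a_def b_def)
    have "\<bar>x\<bar> \<le> sqrt (1 + x\<^sup>2)" by (rule real_le_rsqrt) simp
    then have "\<bar>x / sqrt (1 + x\<^sup>2)\<bar> \<le> 1" using s1[of x] by (simp add: abs_divide)
    then have "\<bar>px \<Phi> (t, x)\<bar> \<le> (a t)\<^sup>2 * (2 * b t x * 1)"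
      unfolding pxE abs_mult fst_conv snd_conv using ab0 by (intro mult_mono) auto
    then have "(\<Lambda> - 1) * \<bar>px \<Phi> (t, x)\<bar> \<le> (\<Lambda> - 1) * ((a t)\<^sup>2 * (2 * b t x * 1))" using \<Lambda> by (intro mult_left_mono) auto
    moreover have "2 * a t * (- 2 * t) * (b t x)\<^sup>2 \<le> 0"
      using ab0 t by (intro mult_nonpos_nonneg mult_nonneg_nonpos) auto
    ultimately show ?thesis unfolding ptE fst_conv snd_conv by (simp add: algebra_simps)
  qed
  have ab: "0 \<le> (a t)\<^sup>2 * b t x" for t x by (simp add: b_def)
  show ?thesis
  proof (rule that[of N \<Phi>])
    show "test_box T (Rc + \<Lambda> * T) N \<Phi>"
      unfolding test_box_def using t2 N z by (auto simp: \<Phi>_def abs_le_iff)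
    show "pt \<Phi> (t, x) + (\<Lambda> - 1) * \<bar>px \<Phi> (t, x)\<bar> \<le> 0" if "0 < t" for t x using key[OF that, of x] ab[of t x] by linarith
    show "pt \<Phi> (t, x) + (\<Lambda> - 1) * \<bar>px \<Phi> (t, x)\<bar> \<le> - (T ^ 4)" if t: "0 < t" "t \<le> T / 2" and g: "1 \<le> Rc - \<Lambda> * t - sqrt (1 + x\<^sup>2)" for t x
    proof -
      \<comment> \<open>In the first half of the time interval \<open>a\<close> is at least three
        quarters of \<open>T\<^sup>2\<close>; twice the square of 3/4 exceeds 1, which leaves
        \<open>T ^ 4\<close>.\<close>
      have "t\<^sup>2 \<le> (T / 2)\<^sup>2" using t by (intro power_mono) auto
      then have "3 / 4 * T\<^sup>2 \<le> T\<^sup>2 - t\<^sup>2" by (simp add: power_divide)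
      then have "3 / 4 * T\<^sup>2 \<le> a t" unfolding a_def by linarith
      then have "(3 / 4 * T\<^sup>2)\<^sup>2 \<le> (a t)\<^sup>2" by (intro power_mono) auto
      moreover have "(3 / 4 * T\<^sup>2)\<^sup>2 = 9 / 16 * T ^ 4" by (simp add: power_mult_distrib power2_eq_square eval_nat_numeral)
      moreover have "(a t)\<^sup>2 * 1 \<le> (a t)\<^sup>2 * b t x" using g by (intro mult_left_mono) (auto simp: b_def)
      moreover have "0 \<le> T ^ 4" using T by simp
      ultimately show ?thesis using key[OF t(1), of x] by linarith
    qed
  qed
qed

text \<open>\<open>doubling\<close> asks for bounds at all times, but a solution is bounded by
  \<open>KT T\<close> up to time \<open>T\<close> only. By \<open>kruz_cong\<close> the truncation
  does not change \<open>kruz\<close> for weights that vanish from time \<open>T\<close> on.\<close>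

definition tr :: "real \<Rightarrow> (real \<Rightarrow> real \<Rightarrow> real) \<Rightarrow> real \<Rightarrow> real \<Rightarrow> real" where
  "tr T U t x = (if 0 \<le> t \<and> t \<le> T then U t x else 0)"

lemma tr_measurable:
  assumes "continuous_on ({0..} \<times> UNIV) (\<lambda>z. U (fst z) (snd z))"
  shows "(\<lambda>z. tr T U (fst z) (snd z)) \<in> borel_measurable borel"
proof -
  have "(\<lambda>z. indicat_real ({0..T} \<times> UNIV) z *\<^sub>R U (fst z) (snd z)) \<in> borel_measurable borel"
  proof (rule borel_measurable_continuous_on_indicator)
    show "{0..T} \<times> (UNIV :: real set) \<in> sets borel" by (intro borel_closed closed_Times) auto
    show "continuous_on ({0..T} \<times> UNIV) (\<lambda>z. U (fst z) (snd z))" by (rule continuous_on_subset[OF assms]) auto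
  qed
  also have "(\<lambda>z. indicat_real ({0..T} \<times> UNIV) z *\<^sub>R U (fst z) (snd z)) = (\<lambda>z. tr T U (fst z) (snd z))"
    by (auto simp: tr_def indicator_def)
  finally show ?thesis .
qed

definition bx :: "real \<Rightarrow> real \<Rightarrow> real \<times> real \<Rightarrow> real" where
  "bx T R z = indicator {0<..T} (fst z) * indicator {-R..R} (snd z)"

lemma bx_measurable [measurable]: "bx T R \<in> borel_measurable borel" unfolding bx_def by measurable

lemma bx_bounds: "0 \<le> bx T R z" "bx T R z \<le> 1" by (auto simp: bx_def indicator_def)

lemma bx_zero: "z \<notin> cbox (0, -R) (T, R) \<Longrightarrow> bx T R z = 0"
  by (cases z) (auto simp: bx_def indicator_def cbox_Pair_iff)

lemma bx_integrable:
  fixes g :: "real \<times> real \<Rightarrow> real"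
  assumes [measurable]: "g \<in> borel_measurable borel" and "\<And>z. bx T R z \<noteq> 0 \<Longrightarrow> \<bar>g z\<bar> \<le> B"
  shows "integrable lborel (\<lambda>z. bx T R z * g z)"
proof (rule integrable_bounded_box[where a = "(0, -R)" and b = "(T, R)"])
  show "\<bar>bx T R z * g z\<bar> \<le> max 0 B" for z
    using assms(2)[of z] by (auto simp: bx_def indicator_def)
qed (auto simp: bx_zero)

lemma bx_integral:
  fixes g :: "real \<times> real \<Rightarrow> real"
  assumes i: "integrable lborel (\<lambda>z. bx T R z * g z)"
  shows "(LBINT z. bx T R z * g z) = (LBINT t. indicator {0<..T} t * (LBINT x:{-R..R}. g (t, x)))"
    "integrable lborel (\<lambda>t. indicator {0<..T} t * (LBINT x:{-R..R}. g (t, x)))"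
proof -
  have e: "(LBINT x. bx T R (t, x) * g (t, x)) = indicator {0<..T} t * (LBINT x:{-R..R}. g (t, x))" for t
    unfolding set_lebesgue_integral_def integral_mult_right_zero[symmetric] by (simp add: bx_def mult.assoc)
  have I: "integrable (lborel \<Otimes>\<^sub>M lborel) (\<lambda>z. bx T R z * g z)" using i by (simp add: lborel_prod)
  show "(LBINT z. bx T R z * g z) = (LBINT t. indicator {0<..T} t * (LBINT x:{-R..R}. g (t, x)))"
    using lborel_pair.integral_fst'[OF I] by (simp only: e lborel_prod)
  show "integrable lborel (\<lambda>t. indicator {0<..T} t * (LBINT x:{-R..R}. g (t, x)))"
    using lborel_pair.integrable_fst'[OF I] by (simp only: e)
qed

text \<open>Since \<open>\<bar>F z\<bar> \<le> L * D z\<close>, the integrand is at most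
  \<open>D\<close> times the decay of the cone weight. The claim about \<open>D\<close> and
  \<open>F\<close> is a single closed formula, so that the weight is fixed before they are
  chosen.\<close>

lemma cone_estimate:
  assumes T1: "0 < T1" and R1: "0 < R1" and L0: "0 \<le> L"
  obtains R N \<Phi> where "0 < R" "test_box (2 * T1) R N \<Phi>"
    "\<forall>D F K. D \<in> borel_measurable borel \<longrightarrow> F \<in> borel_measurable borel \<longrightarrow> (\<forall>z. 0 \<le> D z) \<longrightarrow> (\<forall>z. D z \<le> K) \<longrightarrow>
       (\<forall>z. \<bar>F z\<bar> \<le> L * D z) \<longrightarrow>
       (LBINT z. half z * (D z * pt \<Phi> z + F z * px \<Phi> z)) \<le> - ((2 * T1) ^ 4 * (LBINT z. bx T1 R1 z * D z))"
proof -
  define T where "T = 2 * T1"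
  \<comment> \<open>Large enough that the cone contains the whole box up to time \<open>T1\<close>
    with a margin of 1, which is what the strict decay in \<open>cone_test\<close> requires.\<close>
  define Rc where "Rc = (L + 1) * T1 + sqrt (1 + R1\<^sup>2) + 1"
  define R where "R = Rc + (L + 1) * T"
  have T0: "0 < T" using T1 by (simp add: T_def)
  have Rc0: "0 < Rc" unfolding Rc_def using L0 T1 by (intro add_nonneg_pos add_nonneg_nonneg mult_nonneg_nonneg) auto
  have R0: "0 < R" unfolding R_def using Rc0 L0 T0 by (intro add_pos_nonneg mult_nonneg_nonneg) auto
  have "1 \<le> L + 1" using L0 by simp
  then obtain \<Phi> N where \<Phi>: "test_box T R N \<Phi>"
    and Q1: "\<And>t x. 0 < t \<Longrightarrow> pt \<Phi> (t, x) + L * \<bar>px \<Phi> (t, x)\<bar> \<le> 0"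
    and Q2: "\<And>t x. 0 < t \<Longrightarrow> t \<le> T / 2 \<Longrightarrow> 1 \<le> Rc - (L + 1) * t - sqrt (1 + x\<^sup>2) \<Longrightarrow> pt \<Phi> (t, x) + L * \<bar>px \<Phi> (t, x)\<bar> \<le> - (T ^ 4)"
    using cone_test[OF T0 _ Rc0, of "L + 1"] unfolding R_def by (metis add_diff_cancel_right')
  note pN = test_boxD(4,5)[OF \<Phi>] and dz = test_boxD(7)[OF \<Phi>] and [measurable] = test_boxD(10,11)[OF \<Phi>]
  have "(LBINT z. half z * (D z * pt \<Phi> z + F z * px \<Phi> z)) \<le> - (T ^ 4 * (LBINT z. bx T1 R1 z * D z))"
    if m [measurable]: "D \<in> borel_measurable borel" "F \<in> borel_measurable borel" and D0: "\<And>z. 0 \<le> D z" and DK: "\<And>z. D z \<le> K" and FL: "\<And>z. \<bar>F z\<bar> \<le> L * D z"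
    for D F K
  proof -
    have K0: "0 \<le> K" using D0[of 0] DK[of 0] by linarith
    have iJ: "integrable lborel (\<lambda>z. bx T1 R1 z * D z)"
      by (rule bx_integrable[where B = K]) (use D0 DK in \<open>auto simp: abs_of_nonneg\<close>)
    have "integrable lborel (\<lambda>z. half z * (D z * pt \<Phi> z + F z * px \<Phi> z))"
    proof (rule integrable_bounded_box[where a = "(0, -R)" and b = "(T, R)" and B = "K * N + L * K * N"])
      show "(\<lambda>z. half z * (D z * pt \<Phi> z + F z * px \<Phi> z)) \<in> borel_measurable borel" by measurable
      fix z :: "real \<times> real"
      have 1: "\<bar>D z * pt \<Phi> z\<bar> \<le> K * N"
        unfolding abs_mult using D0[of z] DK[of z] pN K0 by (intro mult_mono) auto
      have 2: "\<bar>F z\<bar> \<le> L * K" using FL[of z] mult_left_mono[OF DK[of z] L0] by linarith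
      have 3: "\<bar>F z * px \<Phi> z\<bar> \<le> L * K * N"
        unfolding abs_mult using 2 pN K0 L0 by (intro mult_mono) auto
      show "\<bar>half z * (D z * pt \<Phi> z + F z * px \<Phi> z)\<bar> \<le> K * N + L * K * N"
        using half_cases[of z] 1 3 by auto
      assume "z \<notin> cbox (0, -R) (T, R)"
      then show "half z * (D z * pt \<Phi> z + F z * px \<Phi> z) = 0"
      proof (cases "0 < fst z")
        case True
        with \<open>z \<notin> _\<close> have "T < fst z \<or> R < \<bar>snd z\<bar>" by (cases z) (auto simp: cbox_Pair_iff)
        then show ?thesis using dz[of "fst z" "snd z"] by simp
      qed (use half_cases[of z] in auto)
    qed
    then have "(LBINT z. half z * (D z * pt \<Phi> z + F z * px \<Phi> z)) \<le> (LBINT z. - (T ^ 4) * (bx T1 R1 z * D z))"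
    proof (rule integral_mono)
      show "integrable lborel (\<lambda>z. - (T ^ 4) * (bx T1 R1 z * D z))"
        by (rule integrable_mult_right[OF iJ])
      fix z :: "real \<times> real"
      obtain t x where z: "z = (t, x)" by (cases z)
      have "F z * px \<Phi> z \<le> \<bar>F z\<bar> * \<bar>px \<Phi> z\<bar>" by (metis abs_ge_self abs_mult)
      also have "\<dots> \<le> L * D z * \<bar>px \<Phi> z\<bar>" using FL by (intro mult_right_mono) auto
      finally have le: "D z * pt \<Phi> z + F z * px \<Phi> z \<le> D z * (pt \<Phi> (t, x) + L * \<bar>px \<Phi> (t, x)\<bar>)" unfolding z by (simp add: algebra_simps)
      show "half z * (D z * pt \<Phi> z + F z * px \<Phi> z) \<le> - (T ^ 4) * (bx T1 R1 z * D z)"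
      proof (cases "0 < t")
        case False
        then show ?thesis using z by (simp add: half_def bx_def)
      next
        case t: True
        then have hz: "half z = 1" using z by (simp add: half_def)
        show ?thesis
        proof (cases "t \<le> T1 \<and> \<bar>x\<bar> \<le> R1")
          case True
          have "x\<^sup>2 \<le> R1\<^sup>2" using True R1 by (simp add: abs_le_square_iff[symmetric])
          then have 1: "sqrt (1 + x\<^sup>2) \<le> sqrt (1 + R1\<^sup>2)" by simp
          have "(L + 1) * t \<le> (L + 1) * T1" using True L0 by (intro mult_left_mono) auto
          then have "1 \<le> Rc - (L + 1) * t - sqrt (1 + x\<^sup>2)" using 1 unfolding Rc_def by linarith
          from Q2[OF t _ this] True have "pt \<Phi> (t, x) + L * \<bar>px \<Phi> (t, x)\<bar> \<le> - (T ^ 4)" by (simp add: T_def)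
          from mult_left_mono[OF this D0[of z]] have "D z * (pt \<Phi> (t, x) + L * \<bar>px \<Phi> (t, x)\<bar>) \<le> - (T ^ 4) * D z" by (simp add: mult.commute)
          moreover have "bx T1 R1 z = 1" using True t z by (auto simp: bx_def indicator_def)
          ultimately show ?thesis using le hz by simp
        next
          case False
          then have "bx T1 R1 z = 0" using z by (auto simp: bx_def indicator_def)
          moreover have "D z * (pt \<Phi> (t, x) + L * \<bar>px \<Phi> (t, x)\<bar>) \<le> 0" using D0 Q1[OF t] by (rule mult_nonneg_nonpos)
          ultimately show ?thesis using le hz by simp
        qed
      qed
    qed
    then show ?thesis by simp
  qed
  then show ?thesis using R0 \<Phi> unfolding T_def by (intro that[of R N \<Phi>]) blast+
qed

section \<open>Estimates uniform in the regularisation and the comparison of solutions\<close>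

locale rb_limit = datum +
  fixes f :: "real \<Rightarrow> real" and c C :: real
  assumes fC4: "C4 f" and c0: "0 < c" and f2b: "\<And>v. c \<le> (deriv ^^ 2) f v" "\<And>v. (deriv ^^ 2) f v \<le> C"
begin

lemmas fd = C4_derivs[OF fC4]

lemma f_isCont: "isCont f x" using fd(1) DERIV_isCont by blast

definition Lf :: "real \<Rightarrow> real" where
  "Lf K = (SOME L. 0 \<le> L \<and> (\<forall>y. \<bar>y\<bar> \<le> K \<longrightarrow> \<bar>deriv f y\<bar> \<le> L))"

lemma Lf: "0 \<le> Lf K" "\<bar>y\<bar> \<le> K \<Longrightarrow> \<bar>deriv f y\<bar> \<le> Lf K"
proof -
  have "compact (deriv f ` {-K..K})" using DERIV_isCont[OF fd(2)]
    by (intro compact_continuous_image continuous_at_imp_continuous_on) auto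
  then obtain B where B: "\<And>x. x \<in> {-K..K} \<Longrightarrow> \<bar>deriv f x\<bar> \<le> B"
    by (meson compact_imp_bounded bounded_real imageI)
  have "0 \<le> max 0 B \<and> (\<forall>y. \<bar>y\<bar> \<le> K \<longrightarrow> \<bar>deriv f y\<bar> \<le> max 0 B)"
    using B by (auto simp: abs_le_iff le_max_iff_disj)
  then have "0 \<le> Lf K \<and> (\<forall>y. \<bar>y\<bar> \<le> K \<longrightarrow> \<bar>deriv f y\<bar> \<le> Lf K)" unfolding Lf_def by (rule someI)
  then show "0 \<le> Lf K" "\<bar>y\<bar> \<le> K \<Longrightarrow> \<bar>deriv f y\<bar> \<le> Lf K" by auto
qed

text \<open>The total variation bound of \<open>q_L1\<close> at time \<open>T\<close>. By
  \<open>U_le_LINT\<close> it also bounds the solution itself.\<close>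

definition KT :: "real \<Rightarrow> real" where "KT T = 2 * (LBINT x. \<bar>u0' x\<bar>) * exp (C * M / 2 * T)"

lemma C0: "0 < C" using f2b[of 0] c0 by linarith

lemma KT0: "0 \<le> KT T" by (simp add: KT_def)

lemma KT_mono: "s \<le> T \<Longrightarrow> KT s \<le> KT T"
  unfolding KT_def using C0 M0 by (intro mult_left_mono) (auto intro!: mult_left_mono)

text \<open>The condition \<open>eps \<le> l\<close> ties the mollification of the datum to
  \<open>l\<close>, so that all errors are functions of \<open>l\<close> alone.\<close>

definition appr :: "real \<Rightarrow> (real \<Rightarrow> real \<Rightarrow> real) \<Rightarrow> bool" where
  "appr l U \<longleftrightarrow> (\<exists>eps j D. 0 < eps \<and> eps \<le> l \<and> friedrichs j \<and> approx_solution f l eps (conv u0 (mollify j eps)) U D)"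

definition Tm :: "real \<Rightarrow> real" where "Tm T = Lf (KT T) * KT T + C * KT T * (1 + KT T / 2)\<^sup>2"
definition Tl :: "real \<Rightarrow> real" where "Tl T = 2 * KT T * (1 + KT T / 2)\<^sup>2"
text \<open>Three errors of order \<open>sqrt l\<close>: the effect of the potential, the smoothing
  of the entropy, and the change from the mollified datum to \<open>g\<close>.\<close>

definition Kr :: "real \<Rightarrow> real \<Rightarrow> real \<Rightarrow> real" where
  "Kr T R K' = (M + 1) * (1 + KT T / 2)\<^sup>2 * (2 * KT T + C * KT T * T) + (2 * R + (1 + Lf K') * (2 * R * T)) + E * (2 * R)"

lemma Tm0: "0 \<le> Tm T" and Tl0: "0 \<le> Tl T" 
  unfolding Tm_def Tl_def using KT0[of T] Lf(1) C0 by (auto intro!: add_nonneg_nonneg mult_nonneg_nonneg)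

lemma Kr0: "0 \<le> R \<Longrightarrow> 0 \<le> T \<Longrightarrow> 0 \<le> Kr T R K'"
  unfolding Kr_def using KT0[of T] Lf(1) C0 M0 E0 by (auto intro!: add_nonneg_nonneg mult_nonneg_nonneg)

text \<open>Everything that later sections use about approximate solutions, with constants that
  depend neither on \<open>l\<close> nor on \<open>eps\<close>.\<close>

lemma appr_facts:
  assumes l: "0 < l" "l \<le> 1" and ap: "appr l U"
  shows "continuous_on ({0..} \<times> UNIV) (\<lambda>z. U (fst z) (snd z))"
    "\<And>T s x. 0 \<le> s \<Longrightarrow> s \<le> T \<Longrightarrow> \<bar>U s x\<bar> \<le> KT T"
    "\<And>T s a b z. 0 \<le> s \<Longrightarrow> s \<le> T \<Longrightarrow> a \<le> b \<Longrightarrow> 0 \<le> z \<Longrightarrow> (LBINT x:{a..b}. \<bar>U s (x + z) - U s x\<bar>) \<le> KT T * z"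
    "\<And>T s t a b. 0 \<le> s \<Longrightarrow> s \<le> t \<Longrightarrow> t \<le> T \<Longrightarrow> a \<le> b \<Longrightarrow> (LBINT x:{a..b}. \<bar>U t x - U s x\<bar>) \<le> Tm T * (t - s) + Tl T * l"
    "\<And>x. \<bar>U 0 x - g x\<bar> \<le> sqrt l * E"
    "\<And>T R N K' k \<phi>. \<bar>k\<bar> \<le> K' \<Longrightarrow> KT T \<le> K' \<Longrightarrow> 0 \<le> T \<Longrightarrow> 0 \<le> R \<Longrightarrow> test_box T R N \<phi> \<Longrightarrow> - (Kr T R K' * sqrt l * N) \<le> kruz f g U k \<phi>"
    "\<And>s x. 0 \<le> s \<Longrightarrow> isCont (U s) x"
proof -
  obtain eps j D where e: "0 < eps" "eps \<le> l" and j: "friedrichs j" and sol: "approx_solution f l eps (conv u0 (mollify j eps)) U D"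
    using ap by (auto simp: appr_def)
  obtain q p V r P P1 where rb: "rb_approx f (deriv f) (deriv (deriv f)) l eps c C U q p V r P P1"
    using approx_solution_classical[OF fC4 c0 f2b l(1) e(1) j sol] by metis
  interpret rb_approx f "deriv f" "deriv (deriv f)" l eps c C U q p V r P P1 by (rule rb)
  have i0: "AE x in lborel. U 0 x = conv u0 (mollify j eps) x" using sol by (simp add: approx_solution_def)
  note mo = mollified[OF j e(1) U_cont[OF order_refl] Uq[OF order_refl] q_cont[OF order_refl] i0]
  show "continuous_on ({0..} \<times> UNIV) (\<lambda>z. U (fst z) (snd z))" by (rule Uc)
  have qM: "q s x \<le> M" if "0 \<le> s" for s x by (rule oleinik[OF M0 mo(2) that])
  have qi: "integrable lborel (\<lambda>x. \<bar>q s x\<bar>)" if "0 \<le> s" for s by (rule q_L1(1)[OF M0 mo(2,3,4) that])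
  have qK: "(LBINT x. \<bar>q s x\<bar>) \<le> KT T" if "0 \<le> s" "s \<le> T" for s T
    using q_L1(2)[OF M0 mo(2,3,4) that(1)] KT_mono[OF that(2)] by (simp add: KT_def)
  have qi': "integrable lborel (\<lambda>x. \<bar>q s x\<bar>)" if "0 \<le> s" "s \<le> T" for s T using qi that by blast
  have qM': "q s x \<le> M" if "0 \<le> s" "s \<le> T" for s x T using qM that by blast
  show "\<bar>U s x\<bar> \<le> KT T" if "0 \<le> s" "s \<le> T" for T s x
    using U_le_LINT[OF that(1) qi[OF that(1)], of x] qK[OF that] by linarith
  show "(LBINT x:{a..b}. \<bar>U s (x + z) - U s x\<bar>) \<le> KT T * z" if "0 \<le> s" "s \<le> T" "a \<le> b" "0 \<le> z" for T s a b z
    by (rule translation_modulus[OF Uq[OF that(1)] q_cont[OF that(1)] qi[OF that(1)] qK[OF that(1,2)] that(3,4)])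
  show "(LBINT x:{a..b}. \<bar>U t x - U s x\<bar>) \<le> Tm T * (t - s) + Tl T * l" if "0 \<le> s" "s \<le> t" "t \<le> T" "a \<le> b" for T s t a b
    using time_modulus[where T = T and K = "KT T" and L = "Lf (KT T)", OF qi' qK Lf(2) that] by (simp add: Tm_def Tl_def mult_ac)
  show U0: "\<bar>U 0 x - g x\<bar> \<le> sqrt l * E" for x
    using mo(1)[of x] mult_right_mono[OF _ E0, of "sqrt eps" "sqrt l"] e by simp
  show "isCont (U s) x" if "0 \<le> s" for s x by (rule U_cont[OF that])
  show "- (Kr T R K' * sqrt l * N) \<le> kruz f g U k \<phi>"
    if k: "\<bar>k\<bar> \<le> K'" and K': "KT T \<le> K'" and TR: "0 \<le> T" "0 \<le> R" and \<phi>: "test_box T R N \<phi>" for T R N K' k \<phi>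
  proof -
    \<comment> \<open>This scale balances the error \<open>l / d\<close> of the potential against
      the error \<open>d\<close> of the smoothed entropy.\<close>
    let ?d = "sqrt l" and ?K = "KT T"
    have d: "0 < ?d" "?d \<le> 1" "?d * ?d = l" using l by auto
    have N0: "0 \<le> N" by (rule test_boxD(8)[OF \<phi>])
    have 1: "- (N * ((M / ?d + 1) * (1 + ?K / 2)\<^sup>2 * (2 * ?K * l\<^sup>2 + C * ?K * T * l) + ?d * (2 * R + (1 + Lf K') * (2 * R * T)))) \<le> kruz f (U 0) U k \<phi>"
      by (rule kruzhkov_approx[OF qi' qK Lf(2) K' k M0 qM' \<phi> TR d(1)])
    have "kruz f (U 0) U k \<phi> \<le> kruz f g U k \<phi> + N * (sqrt l * E * (2 * R))"
    proof (rule kruz_change_datum[OF \<phi> _ _ U0 _ TR(2)])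
      show "U 0 \<in> borel_measurable borel" "g \<in> borel_measurable borel" using meas(1)[OF order_refl] gm by auto
      show "\<bar>g x\<bar> \<le> KT 0 + sqrt l * E" for x
        using U0[of x] U_le_LINT[OF order_refl qi[OF order_refl], of x] qK[OF order_refl order_refl] by linarith
    qed
    moreover have "(M / ?d + 1) * (1 + ?K / 2)\<^sup>2 * (2 * ?K * l\<^sup>2 + C * ?K * T * l) \<le> ?d * ((M + 1) * (1 + ?K / 2)\<^sup>2 * (2 * ?K + C * ?K * T))"
    proof -
      have "l\<^sup>2 \<le> l" using l by (simp add: power2_eq_square mult_left_le)
      then have "2 * ?K * l\<^sup>2 + C * ?K * T * l \<le> (2 * ?K + C * ?K * T) * l"
        using mult_left_mono[of "l\<^sup>2" l "2 * ?K"] KT0[of T] by (simp add: algebra_simps)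
      moreover have "M / ?d + 1 \<le> (M + 1) / ?d" using d(1,2) by (simp add: add_divide_distrib)
      ultimately have "(M / ?d + 1) * (1 + ?K / 2)\<^sup>2 * (2 * ?K * l\<^sup>2 + C * ?K * T * l) \<le> (M + 1) / ?d * (1 + ?K / 2)\<^sup>2 * ((2 * ?K + C * ?K * T) * l)"
        using KT0[of T] C0 M0 TR l d by (intro mult_mono) auto
      also have "\<dots> = ?d * ((M + 1) * (1 + ?K / 2)\<^sup>2 * (2 * ?K + C * ?K * T))"
      proof -
        have "X / s * w * (y * (s * s)) = s * (X * w * y)" if "0 < s" for X s w y :: real using that by (simp add: field_simps)
        from this[OF d(1)] show ?thesis unfolding d(3) .
      qed
      finally show ?thesis .
    qed
    then have "N * ((M / ?d + 1) * (1 + ?K / 2)\<^sup>2 * (2 * ?K * l\<^sup>2 + C * ?K * T * l)) \<le> N * (?d * ((M + 1) * (1 + ?K / 2)\<^sup>2 * (2 * ?K + C * ?K * T)))"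
      by (rule mult_left_mono[OF _ N0])
    moreover have "N * (a + ?d * b) = N * a + N * (?d * b)" "(x + y + E * (2 * R)) * ?d * N = N * (?d * x) + N * (?d * y) + N * (?d * E * (2 * R))" for a b x y
      by (simp_all add: algebra_simps)
    ultimately show ?thesis using 1 unfolding Kr_def by (simp only:)
  qed
qed

lemma appr_shift_modulus:
  assumes l: "0 < l" "l \<le> 1" and ap: "appr l U" and t: "0 \<le> t" "0 \<le> \<sigma>" "t + \<sigma> \<le> T" and \<xi>: "0 \<le> \<xi>" and ab: "a \<le> b"
  shows "(LBINT x:{a..b}. \<bar>U (t + \<sigma>) (x + \<xi>) - U t x\<bar>) \<le> Tm T * \<sigma> + Tl T * l + KT T * \<xi>"
proof -
  note F = appr_facts[OF l ap]
  have c: "isCont (\<lambda>x. U s (x + z)) x" if "0 \<le> s" for s x z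
    by (rule isCont_o2[OF _ F(7)[OF that]]) (intro continuous_intros)
  have c1: "isCont (\<lambda>x. \<bar>U (t + \<sigma>) (x + \<xi>) - U t (x + \<xi>)\<bar>) x" for x using c t by (intro continuous_rabs continuous_diff) auto
  have c2: "isCont (\<lambda>x. \<bar>U t (x + \<xi>) - U t x\<bar>) x" for x using c F(7) t by (intro continuous_rabs continuous_diff) auto
  have c3: "isCont (\<lambda>x. \<bar>U (t + \<sigma>) (x + \<xi>) - U t x\<bar>) x" for x using c F(7) t by (intro continuous_rabs continuous_diff) auto
  note i1 = set_integrable_cont[of _ a b, OF c1] and i2 = set_integrable_cont[of _ a b, OF c2]
  have "(LBINT x:{a..b}. \<bar>U (t + \<sigma>) (x + \<xi>) - U t x\<bar>) \<le> (LBINT x:{a..b}. \<bar>U (t + \<sigma>) (x + \<xi>) - U t (x + \<xi>)\<bar> + \<bar>U t (x + \<xi>) - U t x\<bar>)"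
    by (intro set_integral_mono set_integrable_cont[OF c3] set_integral_add i1 i2) auto
  also have "\<dots> = (LBINT x:{a..b}. \<bar>U (t + \<sigma>) (x + \<xi>) - U t (x + \<xi>)\<bar>) + (LBINT x:{a..b}. \<bar>U t (x + \<xi>) - U t x\<bar>)"
    by (rule set_integral_add[OF i1 i2])
  also have "(LBINT x:{a..b}. \<bar>U (t + \<sigma>) (x + \<xi>) - U t (x + \<xi>)\<bar>) = (LBINT x:{a + \<xi>..b + \<xi>}. \<bar>U (t + \<sigma>) x - U t x\<bar>)"
    by (rule LBINT_shift)
  finally show ?thesis
    using F(4)[of t "t + \<sigma>" T "a + \<xi>" "b + \<xi>"] F(3)[of t T a b \<xi>] t \<xi> ab by simp
qed

text \<open>\<open>A\<close> stands for an entropy solution, with \<open>\<delta> = 0\<close>, or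
  for another approximate solution. As a predicate it allows the test radius \<open>Ra\<close> to be
  fixed before \<open>\<eta>\<close> and \<open>e\<close>.\<close>

definition comparable :: "real \<Rightarrow> real \<Rightarrow> real \<Rightarrow> real \<Rightarrow> real \<Rightarrow> real \<Rightarrow> real \<Rightarrow> bool" where
  "comparable T1 R1 Ta Ra K \<eta> e \<longleftrightarrow> (\<forall>l \<delta> A U. 0 < l \<longrightarrow> l < \<eta> \<longrightarrow> 0 \<le> \<delta> \<longrightarrow> \<delta> < \<eta> \<longrightarrow> appr l U \<longrightarrow>
     (\<lambda>z. A (fst z) (snd z)) \<in> borel_measurable borel \<longrightarrow> (\<forall>t x. \<bar>A t x\<bar> \<le> K) \<longrightarrow>
     (\<forall>k \<phi> N. \<bar>k\<bar> \<le> K \<longrightarrow> test_box Ta Ra N \<phi> \<longrightarrow> - (\<delta> * N) \<le> kruz f g A k \<phi>) \<longrightarrow>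
     (LBINT z. bx T1 R1 z * \<bar>A (fst z) (snd z) - U (fst z) (snd z)\<bar>) < e)"

lemma comparableD:
  assumes "comparable T1 R1 Ta Ra K \<eta> e" "0 < l" "l < \<eta>" "0 \<le> \<delta>" "\<delta> < \<eta>" "appr l U"
    "(\<lambda>z. A (fst z) (snd z)) \<in> borel_measurable borel" "\<And>t x. \<bar>A t x\<bar> \<le> K"
    "\<And>k \<phi> N. \<bar>k\<bar> \<le> K \<Longrightarrow> test_box Ta Ra N \<phi> \<Longrightarrow> - (\<delta> * N) \<le> kruz f g A k \<phi>"
  shows "(LBINT z. bx T1 R1 z * \<bar>A (fst z) (snd z) - U (fst z) (snd z)\<bar>) < e"
  using assms unfolding comparable_def by blast

text \<open>Doubling with the cone weight. The order of choices matters: \<open>h\<close> is fixed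
  first, by the modulus of \<open>U\<close>, and only then \<open>\<eta>\<close>, which has to beat
  the powers of \<open>1 / h\<close> in front of the defects.\<close>

lemma compare:
  assumes T1: "0 < T1" and R1: "0 < R1" and K1: "KT (2 * T1 + 1) \<le> K1" and gK: "\<And>x. \<bar>g x\<bar> \<le> K1"
  obtains Ra where "0 < Ra" "\<forall>e>0. \<exists>\<eta>>0. \<eta> \<le> 1 \<and> comparable T1 R1 (2 * T1 + 1) Ra K1 \<eta> e"
proof -
  define T where "T = 2 * T1"
  define L where "L = Lf K1"
  have L0: "0 \<le> L" unfolding L_def by (rule Lf(1))
  have T0: "0 < T" using T1 by (simp add: T_def)
  have K10: "0 \<le> K1" using gK[of 0] by linarith
  obtain R N \<Phi> where R0: "0 < R" and \<Phi>: "test_box T R N \<Phi>"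
    and cone: "\<forall>D F K. D \<in> borel_measurable borel \<longrightarrow> F \<in> borel_measurable borel \<longrightarrow> (\<forall>z. 0 \<le> D z) \<longrightarrow> (\<forall>z. D z \<le> K) \<longrightarrow>
       (\<forall>z. \<bar>F z\<bar> \<le> L * D z) \<longrightarrow>
       (LBINT z. half z * (D z * pt \<Phi> z + F z * px \<Phi> z)) \<le> - (T ^ 4 * (LBINT z. bx T1 R1 z * D z))"
    unfolding T_def by (rule cone_estimate[OF T1 R1 L0])
  have N0: "0 \<le> N" by (rule test_boxD(8)[OF \<Phi>])
  have [measurable]: "f \<in> borel_measurable borel" by (rule isCont_borel[OF f_isCont])
  define Tm' where "Tm' = Tm (T + 1) + KT (T + 1)"
  define Tl' where "Tl' = Tl (T + 1)"
  define Kr' where "Kr' = Kr (T + 1) (R + 1) K1"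
  have nn: "0 \<le> Tm'" "0 \<le> Tl'" "0 \<le> Kr'" unfolding Tm'_def Tl'_def Kr'_def using Tm0 Tl0 KT0 Kr0[of "R + 1" "T + 1"] R0 T0
    by (auto intro: add_nonneg_nonneg)
  define c1 where "c1 = N * ((1 + L) * T + 1)"
  have c10: "0 \<le> c1" unfolding c1_def using N0 L0 T0 by (intro mult_nonneg_nonneg add_nonneg_nonneg) auto
  have main: "\<exists>\<eta>>0. \<eta> \<le> 1 \<and> comparable T1 R1 (2 * T1 + 1) (R + 1) K1 \<eta> e" if e: "0 < e" for e
  proof -
    \<comment> \<open>The cone weight gains the factor \<open>T ^ 4\<close>. One share
      \<open>\<tau>\<close> of the budget is for the modulus at scale \<open>h\<close>, the other
      for all that vanishes with \<open>l\<close> and \<open>\<delta>\<close>; the total is half of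
      \<open>T ^ 4 * e\<close>.\<close>
    define \<tau> where "\<tau> = T ^ 4 * e / 4"
    have \<tau>: "0 < \<tau>" "2 * \<tau> < T ^ 4 * e" using e T0 by (auto simp: \<tau>_def)
    define h where "h = min 1 (\<tau> / (c1 * Tm' + 1))"
    have cT: "0 \<le> c1 * Tm'" using c10 nn by simp
    have h: "0 < h" "h \<le> 1" using \<tau> cT by (auto simp: h_def)
    have h2: "c1 * (Tm' * h) \<le> \<tau>"
    proof -
      have "c1 * Tm' * h \<le> (c1 * Tm' + 1) * (\<tau> / (c1 * Tm' + 1))" using cT h by (intro mult_mono) (auto simp: h_def)
      also have "\<dots> = \<tau>" using cT by simp
      finally show ?thesis by (simp add: mult.assoc)
    qed
    define D where "D = (2 * N * (60 / h\<^sup>2)\<^sup>2) * (4 * (T + 1) * (R + 1))"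
    have D0: "0 \<le> D" unfolding D_def using N0 T0 R0 by (intro mult_nonneg_nonneg) auto
    define S where "S = c1 * Tl' + N * (2 * R * E) + D + Kr' * D"
    have S0: "0 \<le> S" unfolding S_def using c10 nn N0 R0 E0 D0 by (intro add_nonneg_nonneg mult_nonneg_nonneg) auto
    \<comment> \<open>By now \<open>h\<close> is fixed and with it \<open>S\<close>. The threshold
      will be \<open>y * y\<close>, so that \<open>l\<close>, \<open>sqrt l\<close> and
      \<open>\<delta>\<close> are all at most \<open>y\<close>.\<close>
    define y where "y = min 1 (\<tau> / (S + 1))"
    have y: "0 < y" "y \<le> 1" using \<tau> S0 by (auto simp: y_def)
    have Sy: "S * y \<le> \<tau>"
    proof -
      have "S * y \<le> (S + 1) * (\<tau> / (S + 1))" using S0 y by (intro mult_mono) (auto simp: y_def)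
      also have "\<dots> = \<tau>" using S0 by simp
      finally show ?thesis .
    qed
    have yy: "y * y \<le> y" using y by (simp add: mult_left_le)
    have "(LBINT z. bx T1 R1 z * \<bar>A (fst z) (snd z) - U (fst z) (snd z)\<bar>) < e"
      if l: "0 < l" "l < y * y" and \<delta>: "0 \<le> \<delta>" "\<delta> < y * y" and ap: "appr l U"
        and Am: "(\<lambda>z. A (fst z) (snd z)) \<in> borel_measurable borel" and AK: "\<forall>t x. \<bar>A t x\<bar> \<le> K1"
        and krA: "\<forall>k \<phi> N. \<bar>k\<bar> \<le> K1 \<longrightarrow> test_box (2 * T1 + 1) (R + 1) N \<phi> \<longrightarrow> - (\<delta> * N) \<le> kruz f g A k \<phi>" for l \<delta> A U
    proof -
      have l1: "l \<le> 1" using l yy y by linarith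
      note F = appr_facts[OF l(1) l1 ap]
      define s where "s = sqrt l"
      have s: "0 \<le> s" "l \<le> s" "s \<le> y"
      proof -
        show "0 \<le> s" using l by (simp add: s_def)
        have "s < sqrt (y * y)" using l(2) unfolding s_def by (rule real_sqrt_less_mono)
        then show sy: "s \<le> y" using y by (simp add: real_sqrt_mult)
        have "s * s \<le> s" using sy y \<open>0 \<le> s\<close> by (intro mult_left_le) auto
        then show "l \<le> s" using l by (simp add: s_def)
      qed
      define B where "B = tr (T + 1) U"
      have Bm: "(\<lambda>z. B (fst z) (snd z)) \<in> borel_measurable borel" unfolding B_def by (rule tr_measurable[OF F(1)])
      have KK: "KT (T + 1) \<le> K1" using K1 by (simp add: T_def)
      have BK: "\<bar>B t x\<bar> \<le> K1" for t x
        using F(2)[of t "T + 1" x] KK K10 by (auto simp: B_def tr_def)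
      have BU: "B t x = U t x" if "0 \<le> t" "t \<le> T + 1" for t x using that by (simp add: B_def tr_def)
      have krB: "- (Kr' * s * N') \<le> kruz f g B k \<phi>" if "\<bar>k\<bar> \<le> K1" "test_box (T + 1) (R + 1) N' \<phi>" for k \<phi> N'
      proof -
        have "kruz f g B k \<phi> = kruz f g U k \<phi>" by (rule kruz_cong[OF that(2)]) (simp add: BU)
        then show ?thesis using F(6)[OF that(1) KK _ _ that(2)] T0 R0 by (simp add: Kr'_def s_def)
      qed
      have \<omega>: "(LBINT x:{-R..R}. \<bar>B (t + \<sigma>) (x + \<xi>) - B t x\<bar>) \<le> Tm' * h + Tl' * l"
        if "0 \<le> t" "t \<le> T" "0 \<le> \<sigma>" "\<sigma> \<le> h" "0 \<le> \<xi>" "\<xi> \<le> h" for t \<sigma> \<xi>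
      proof -
        have "Tm (T + 1) * \<sigma> \<le> Tm (T + 1) * h" "KT (T + 1) * \<xi> \<le> KT (T + 1) * h" using that Tm0 KT0 by (auto intro: mult_left_mono)
        then show ?thesis using appr_shift_modulus[OF l(1) l1 ap that(1,3), of "T + 1" \<xi> "-R" R] that h R0
          by (simp add: BU Tm'_def Tl'_def algebra_simps)
      qed
      have \<omega>0: "(LBINT x:{-R..R}. \<bar>g x - B 0 x\<bar>) \<le> 2 * R * (s * E)"
      proof -
        have c: "isCont (\<lambda>x. \<bar>g x - U 0 x\<bar>) x" for x using gc F(7) by (intro continuous_rabs continuous_diff) auto
        have "(LBINT x:{-R..R}. \<bar>g x - U 0 x\<bar>) \<le> (LBINT x:{-R..R}. s * E)"
          using F(5) by (intro set_integral_mono set_integrable_cont[OF c] set_integrable_cont) (auto simp: s_def abs_minus_commute)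
        also have "\<dots> = 2 * R * (s * E)"
        proof -
          have "(LBINT x:{-R..R}. k) = 2 * R * k" for k :: real using R0 by (simp add: set_lebesgue_integral_def)
          then show ?thesis .
        qed
        finally have "(LBINT x:{-R..R}. \<bar>g x - U 0 x\<bar>) \<le> 2 * R * (s * E)" .
        moreover have "B 0 = U 0" using BU[of 0] T0 by auto
        ultimately show ?thesis by simp
      qed
      have krA': "- (\<delta> * N') \<le> kruz f g A k \<phi>" if "\<bar>k\<bar> \<le> K1" "test_box (T + 1) (R + 1) N' \<phi>" for k \<phi> N'
        using krA that unfolding T_def by blast
      have AK': "\<bar>A t x\<bar> \<le> K1" for t x using AK by blast
      have LL: "\<bar>deriv f y\<bar> \<le> L" if "\<bar>y\<bar> \<le> K1" for y unfolding L_def by (rule Lf(2)[OF that])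
      have Ks: "0 \<le> Kr' * s" using nn s by simp
      let ?I = "LBINT z. half z * (\<bar>A (fst z) (snd z) - B (fst z) (snd z)\<bar> * pt \<Phi> z + kfl f (A (fst z) (snd z)) (B (fst z) (snd z)) * px \<Phi> z)"
      let ?J = "LBINT z. bx T1 R1 z * \<bar>A (fst z) (snd z) - B (fst z) (snd z)\<bar>"
      have dbl: "0 \<le> ?I + N * ((1 + L) * T * (Tm' * h + Tl' * l) + (Tm' * h + Tl' * l + 2 * R * (s * E))) + (\<delta> + Kr' * s) * (2 * N * (60 / h\<^sup>2)\<^sup>2) * (4 * (T + 1) * (R + 1))"
        by (rule doubling[where f = f and ?f1.0 = "deriv f" and K = K1 and L = L, OF fd(1) LL Am AK' Bm BK gm gK krA' krB \<delta>(1) Ks \<Phi> h T0 R0 \<omega> \<omega>0])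
      have JU: "?J = (LBINT z. bx T1 R1 z * \<bar>A (fst z) (snd z) - U (fst z) (snd z)\<bar>)"
        using T1 by (intro Bochner_Integration.integral_cong refl) (auto simp: bx_def indicator_def BU T_def)
      have IJ: "?I \<le> - (T ^ 4 * ?J)"
      proof -
        have ab: "\<bar>A (fst z) (snd z) - B (fst z) (snd z)\<bar> \<le> 2 * K1" for z using AK'[of "fst z" "snd z"] BK[of "fst z" "snd z"] by linarith
        have kb: "\<bar>kfl f (A (fst z) (snd z)) (B (fst z) (snd z))\<bar> \<le> L * \<bar>A (fst z) (snd z) - B (fst z) (snd z)\<bar>" for z
          unfolding kfl_def by (rule kruzhkov_flux_lipschitz(2)[OF fd(1) LL AK' BK BK])
        note [measurable] = Am Bm
        show ?thesis
          by (rule cone[rule_format, where K = "2 * K1"]) (simp_all add: kfl_def[symmetric] ab kb del: abs_mult, simp_all add: kfl_def)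
      qed
      have al: "N * ((1 + L) * T * (p + q) + (p + q + 2 * R * (s * E))) + (\<delta> + Kr' * s) * (2 * N * (60 / h\<^sup>2)\<^sup>2) * (4 * (T + 1) * (R + 1))
          = c1 * p + c1 * q + N * (2 * R * E) * s + (\<delta> * D + Kr' * D * s)" for p q
      proof -
        have "N * (X * (p + q) + (p + q + 2 * R * (s * E))) + (\<delta> + Kr' * s) * Y * Z = N * (X + 1) * p + N * (X + 1) * q + N * (2 * R * E) * s + (\<delta> * (Y * Z) + Kr' * (Y * Z) * s)"
          for X Y Z by (simp add: algebra_simps)
        then show ?thesis unfolding c1_def D_def by blast
      qed
      have b1: "c1 * (Tl' * l) \<le> c1 * Tl' * y" using mult_left_mono[of l y "c1 * Tl'"] s c10 nn by (simp add: mult.assoc)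
      have b2: "N * (2 * R * E) * s \<le> N * (2 * R * E) * y" using s N0 R0 E0 by (intro mult_left_mono) auto
      have b3: "\<delta> * D \<le> D * y" using mult_left_mono[of \<delta> y D] \<delta> yy D0 by (simp add: mult.commute)
      have b4: "Kr' * D * s \<le> Kr' * D * y" using s nn D0 by (intro mult_left_mono) auto
      have "S * y = c1 * Tl' * y + N * (2 * R * E) * y + D * y + Kr' * D * y" unfolding S_def by (simp add: algebra_simps)
      then have "T ^ 4 * ?J \<le> 2 * \<tau>" using dbl IJ b1 b2 b3 b4 h2 Sy al[of "Tm' * h" "Tl' * l"] by linarith
      then have "T ^ 4 * ?J < T ^ 4 * e" using \<tau> by linarith
      then show ?thesis using T0 unfolding JU by simp
    qed
    moreover have "0 < y * y" "y * y \<le> 1" using mult_pos_pos[OF y(1) y(1)] y yy by linarith+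
    ultimately show ?thesis unfolding comparable_def by blast
  qed
  show ?thesis
  proof (rule that[of "R + 1"])
    show "0 < R + 1" using R0 by simp
  qed (intro allI impI, rule main)
qed

end

text \<open>Approximate solutions are controlled at nonnegative times only; the value 0 before time
  0 yields a measurable function on the plane.\<close>

definition tp :: "(real \<Rightarrow> real \<Rightarrow> real) \<Rightarrow> real \<Rightarrow> real \<Rightarrow> real" where
  "tp U t x = (if 0 \<le> t then U t x else 0)"

lemma tp_measurable:
  assumes "continuous_on ({0..} \<times> UNIV) (\<lambda>z. U (fst z) (snd z))"
  shows "(\<lambda>z. tp U (fst z) (snd z)) \<in> borel_measurable borel"
proof -
  have "(\<lambda>z. indicat_real ({0..} \<times> UNIV) z *\<^sub>R U (fst z) (snd z)) \<in> borel_measurable borel"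
  proof (rule borel_measurable_continuous_on_indicator[OF _ assms])
    show "{0::real..} \<times> (UNIV :: real set) \<in> sets borel" by (intro borel_closed closed_Times) auto
  qed
  also have "(\<lambda>z. indicat_real ({0..} \<times> UNIV) z *\<^sub>R U (fst z) (snd z)) = (\<lambda>z. tp U (fst z) (snd z))"
    by (auto simp: tp_def indicator_def)
  finally show ?thesis .
qed

lemma kruz_tendsto:
  assumes f_isCont: "\<And>x. isCont f x" and fL: "\<And>y. \<bar>y\<bar> \<le> K \<Longrightarrow> \<bar>f y\<bar> \<le> L"
    and m: "\<And>n. (\<lambda>z. S n (fst z) (snd z)) \<in> borel_measurable borel" "(\<lambda>z. w (fst z) (snd z)) \<in> borel_measurable borel"
    and SK: "\<And>n t x. 0 < t \<Longrightarrow> t \<le> T \<Longrightarrow> \<bar>S n t x\<bar> \<le> K"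
    and lim: "AE z in lborel. 0 < fst z \<longrightarrow> (\<lambda>n. S n (fst z) (snd z)) \<longlonglongrightarrow> w (fst z) (snd z)"
    and \<phi>: "test_box T R N \<phi>"
  shows "(\<lambda>n. kruz f g (S n) k \<phi>) \<longlonglongrightarrow> kruz f g w k \<phi>"
proof -
  note pN = test_boxD(4,5)[OF \<phi>] and dz = test_boxD(7)[OF \<phi>] and [measurable] = test_boxD(10,11)[OF \<phi>]
  note [measurable] = m isCont_borel[OF f_isCont]
  let ?I = "\<lambda>w z. half z * (\<bar>w (fst z) (snd z) - k\<bar> * pt \<phi> z + kfl f (w (fst z) (snd z)) k * px \<phi> z)"
  let ?C = "(K + \<bar>k\<bar>) * N + (L + \<bar>f k\<bar>) * N"
  have N0: "0 \<le> N" using pN(1)[of 0] by linarith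
  have "(\<lambda>n. LBINT z. ?I (S n) z)
      \<longlonglongrightarrow> (LBINT z. ?I w z)"
  proof (rule integral_dominated_convergence[where w = "\<lambda>z. bx T R z * ?C"])
    show "(\<lambda>z. ?I w z) \<in> borel_measurable lborel"
      unfolding kfl_def measurable_lborel2 by measurable
    show "(\<lambda>z. ?I (S n) z) \<in> borel_measurable lborel" for n
      unfolding kfl_def measurable_lborel2 by measurable
    show "integrable lborel (\<lambda>z. bx T R z * ?C)" by (rule bx_integrable[where B = "\<bar>?C\<bar>"]) auto
    show "AE z in lborel. (\<lambda>n. ?I (S n) z)
      \<longlonglongrightarrow> ?I w z"
      using lim
    proof (eventually_elim)
      case (elim z)
      show ?case
      proof (cases "0 < fst z")
        case True
        then have l: "(\<lambda>n. S n (fst z) (snd z)) \<longlonglongrightarrow> w (fst z) (snd z)" using elim by blast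
        have "(\<lambda>n. kfl f (S n (fst z) (snd z)) k) \<longlonglongrightarrow> kfl f (w (fst z) (snd z)) k"
          unfolding kfl_def by (rule isCont_tendsto_compose[OF kruzhkov_flux_isCont[OF f_isCont] l])
        then show ?thesis using l by (intro tendsto_intros)
      next
        case False
        then have "half z = 0" using half_cases[of z] by auto
        then show ?thesis by simp
      qed
    qed
    show "AE z in lborel. norm (?I (S n) z) \<le> bx T R z * ?C" for n
    proof (rule AE_I2)
      fix z :: "real \<times> real"
      obtain t x where z: "z = (t, x)" by (cases z)
      show "norm (?I (S n) z) \<le> bx T R z * ?C"
      proof (cases "0 < t \<and> t \<le> T \<and> \<bar>x\<bar> \<le> R")
        case True
        then have "bx T R z = 1" "half z = 1" using z by (auto simp: bx_def half_def indicator_def)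
        have s: "\<bar>S n t x\<bar> \<le> K" using SK True by blast
        have "\<bar>kfl f (S n t x) k\<bar> \<le> \<bar>f (S n t x) - f k\<bar>" by (auto simp: kfl_def sgn_if)
        then have 1: "\<bar>kfl f (S n t x) k\<bar> \<le> L + \<bar>f k\<bar>" using fL[OF s] by linarith
        then have 2: "\<bar>kfl f (S n t x) k * px \<phi> z\<bar> \<le> (L + \<bar>f k\<bar>) * N" unfolding abs_mult using pN by (intro mult_mono) auto
        have "\<bar>S n t x - k\<bar> \<le> K + \<bar>k\<bar>" using s by linarith
        then have "\<bar>\<bar>S n t x - k\<bar> * pt \<phi> z\<bar> \<le> (K + \<bar>k\<bar>) * N" unfolding abs_mult using pN s by (intro mult_mono) auto
        then show ?thesis using 2 \<open>bx T R z = 1\<close> \<open>half z = 1\<close> z by simp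
      next
        case False
        then have "bx T R z = 0" using z by (auto simp: bx_def indicator_def)
        moreover have "half z = 0 \<or> pt \<phi> z = 0 \<and> px \<phi> z = 0"
          using False dz[of t x] z half_cases[of z] by auto
        ultimately show ?thesis by auto
      qed
    qed
  qed
  then show ?thesis unfolding kruz_half by (intro tendsto_add tendsto_const)
qed

text \<open>A constant added to the entropy contributes minus the integral of its initial trace, and
  a constant flux contributes nothing. This disposes of affine entropies in the maximum
  principle.\<close>

lemma test2_half_integrals:
  assumes \<phi>: "test_box T R N \<phi>" and T: "0 < T"
  shows "(LBINT z. half z * pt \<phi> z) = - (LBINT x. \<phi> (0, x))" "(LBINT z. half z * px \<phi> z) = 0"
    "integrable lborel (\<lambda>z. half z * pt \<phi> z)" "integrable lborel (\<lambda>z. half z * px \<phi> z)" "integrable lborel (\<lambda>x. \<phi> (0, x))"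
proof -
  note t2 = test_boxD(1)[OF \<phi>] and pz = test_boxD(6)[OF \<phi>] and dz = test_boxD(7)[OF \<phi>] and N0 = test_boxD(8)[OF \<phi>]
    and [measurable] = test_boxD(10,11)[OF \<phi>]
  have pN: "\<bar>pt \<phi> z\<bar> \<le> N" "\<bar>px \<phi> z\<bar> \<le> N" "\<bar>\<phi> z\<bar> \<le> N" for z
    using test_boxD(2-5)[OF \<phi>, of z] by auto
  have cc: "continuous_on UNIV (pt \<phi>)" "continuous_on UNIV (px \<phi>)" using t2 by (auto simp: test2_def)
  have slice: "isCont (\<lambda>s. pt \<phi> (s, x)) t" "isCont (\<lambda>y. px \<phi> (t, y)) x" for t x
    using continuous_on_compose2[OF cc(1), of UNIV "\<lambda>s. (s, x)"] continuous_on_compose2[OF cc(2), of UNIV "\<lambda>y. (t, y)"]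
    by (auto simp: continuous_on_eq_continuous_at intro!: continuous_intros)
  have z0: "half z * pt \<phi> z = 0 \<and> half z * px \<phi> z = 0" if "z \<notin> cbox (0, -R) (T, R)" for z
  proof (cases "0 < fst z")
    case True
    with that have "T < fst z \<or> R < \<bar>snd z\<bar>" by (cases z) (auto simp: cbox_Pair_iff)
    then show ?thesis using dz[of "fst z" "snd z"] by simp
  qed (use half_cases[of z] in auto)
  show it: "integrable lborel (\<lambda>z. half z * pt \<phi> z)"
    by (rule integrable_bounded_box[where B = N and a = "(0, -R)" and b = "(T, R)"]) (use z0 pN half_cases N0 in \<open>auto simp: abs_mult half_def indicator_def\<close>)
  show ix: "integrable lborel (\<lambda>z. half z * px \<phi> z)"
    by (rule integrable_bounded_box[where B = N and a = "(0, -R)" and b = "(T, R)"]) (use z0 pN half_cases N0 in \<open>auto simp: abs_mult half_def indicator_def\<close>)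
  show "integrable lborel (\<lambda>x. \<phi> (0, x))"
  proof (rule integrable_bounded_box[where B = N and a = "-R" and b = R])
    have "isCont (\<lambda>y. \<phi> (0, y)) x" for x using test2_DERIV(2)[OF t2] DERIV_isCont by blast
    then show "(\<lambda>x. \<phi> (0, x)) \<in> borel_measurable borel" by (rule isCont_borel)
    show "\<phi> (0, z) = 0" if "z \<notin> cbox (- R) R" for z using that by (intro pz) auto
  qed (use pN in auto)
  have inner: "(LBINT t. half (t, x) * pt \<phi> (t, x)) = - \<phi> (0, x)" for x
  proof -
    have "(LBINT t. half (t, x) * pt \<phi> (t, x)) = (LBINT t:{0..T}. pt \<phi> (t, x))"
      unfolding set_lebesgue_integral_def
    proof (rule integral_cong_AE)
      have "AE t in lborel. t \<noteq> (0::real)" by (rule AE_lborel_singleton)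
      then show "AE t in lborel. half (t, x) * pt \<phi> (t, x) = indicat_real {0..T} t *\<^sub>R pt \<phi> (t, x)"
      proof eventually_elim
        case (elim t)
        then show ?case using dz[of t x] by (auto simp: half_def indicator_def)
      qed
    qed measurable
    also have "\<dots> = \<phi> (T, x) - \<phi> (0, x)" using T by (intro LBINT_FTC test2_DERIV(1)[OF t2] slice) auto
    finally show ?thesis using pz[of T x] by simp
  qed
  have inner': "(LBINT x. half (t, x) * px \<phi> (t, x)) = 0" for t
  proof -
    have e: "indicat_real {- \<bar>R\<bar>..\<bar>R\<bar>} x *\<^sub>R px \<phi> (t, x) = px \<phi> (t, x)" for x
      by (cases "R < \<bar>x\<bar>") (use dz[of t x] in \<open>auto simp: indicator_def\<close>)
    have "(LBINT x:{-\<bar>R\<bar>..\<bar>R\<bar>}. px \<phi> (t, x)) = \<phi> (t, \<bar>R\<bar>) - \<phi> (t, - \<bar>R\<bar>)" by (intro LBINT_FTC test2_DERIV(2)[OF t2] slice) auto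
    also have "\<dots> = 0" using pz[of t "\<bar>R\<bar>"] pz[of t "-\<bar>R\<bar>"] abs_ge_self[of R] by auto
    finally have "(LBINT x. px \<phi> (t, x)) = 0" unfolding set_lebesgue_integral_def e .
    then show ?thesis using half_cases[of "(t, 0)"] by (auto simp: half_def)
  qed
  have "integrable (lborel \<Otimes>\<^sub>M lborel) (\<lambda>(t, x). half (t, x) * pt \<phi> (t, x))" "integrable (lborel \<Otimes>\<^sub>M lborel) (\<lambda>z. half z * px \<phi> z)"
    using it ix by (simp_all add: lborel_prod split_def)
  from lborel_pair.integral_snd[OF this(1)] lborel_pair.integral_fst'[OF this(2)]
  show "(LBINT z. half z * pt \<phi> z) = - (LBINT x. \<phi> (0, x))" "(LBINT z. half z * px \<phi> z) = 0"
    by (simp_all add: inner inner' lborel_prod split_def)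
qed

section \<open>The limit\<close>

lemma integrable_bounded_mult:
  fixes F h :: "'a \<Rightarrow> real"
  assumes h: "integrable M h" and F: "F \<in> borel_measurable M" "\<And>x. \<bar>F x\<bar> \<le> K"
  shows "integrable M (\<lambda>x. F x * h x)"
proof (rule Bochner_Integration.integrable_bound[OF integrable_mult_right[OF integrable_abs[OF h], of K]])
  have [measurable]: "h \<in> borel_measurable M" using h by (simp add: integrable_iff_bounded)
  show "(\<lambda>x. F x * h x) \<in> borel_measurable M" using F(1) by measurable
  have "\<bar>F x\<bar> * \<bar>h x\<bar> \<le> \<bar>K * \<bar>h x\<bar>\<bar>" for x
    using mult_right_mono[OF F(2)[of x], of "\<bar>h x\<bar>"] by linarith
  then show "AE x in M. norm (F x * h x) \<le> norm (K * \<bar>h x\<bar>)" by (auto simp: abs_mult)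
qed

locale rb_family = rb_limit +
  fixes u :: "real \<Rightarrow> real \<Rightarrow> real \<Rightarrow> real"
  assumes cds: "\<And>l. 0 < l \<Longrightarrow> constructed_dissipative_solution f u0 l (u l)"
begin

text \<open>One approximate solution is picked for each \<open>l\<close>, within \<open>l\<close> of
  \<open>u l\<close> on a box of size \<open>1 / l\<close>. As \<open>l\<close> tends to 0 the boxes
  exhaust the half-plane, so limits of the two families agree locally.\<close>

lemma v_ex:
  assumes l: "0 < l"
  shows "\<exists>U. appr l U \<and> (\<forall>t\<in>{0..1 / l}. \<forall>x\<in>{- (1 / l)..1 / l}. \<bar>U t x - u l t x\<bar> < l)"
proof -
  obtain j epss U D where j: "friedrichs j" and p: "\<forall>k. 0 < epss k" and lim: "epss \<longlonglongrightarrow> 0"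
    and sol: "\<forall>k. approx_solution f l (epss k) (conv u0 (mollify j (epss k))) (U k) (D k)"
    and cv: "\<forall>T a b e. 0 < e \<longrightarrow> (\<forall>\<^sub>F k in sequentially. \<forall>t\<in>{0..T}. \<forall>x\<in>{a..b}. \<bar>U k t x - u l t x\<bar> < e)"
    using cds[OF l] unfolding constructed_dissipative_solution_def by blast
  have "\<forall>\<^sub>F k in sequentially. epss k < l" using lim l by (rule order_tendstoD(2))
  moreover have "\<forall>\<^sub>F k in sequentially. \<forall>t\<in>{0..1 / l}. \<forall>x\<in>{- (1 / l)..1 / l}. \<bar>U k t x - u l t x\<bar> < l" using cv l by blast
  ultimately have "\<forall>\<^sub>F k in sequentially. epss k < l \<and> (\<forall>t\<in>{0..1 / l}. \<forall>x\<in>{- (1 / l)..1 / l}. \<bar>U k t x - u l t x\<bar> < l)"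
    by (rule eventually_conj)
  then obtain k where k: "epss k < l" "\<forall>t\<in>{0..1 / l}. \<forall>x\<in>{- (1 / l)..1 / l}. \<bar>U k t x - u l t x\<bar> < l"
    using eventually_happens trivial_limit_sequentially by blast
  have "appr l (U k)" unfolding appr_def using p j sol k(1) less_imp_le by blast
  then show ?thesis using k(2) by blast
qed

definition v :: "real \<Rightarrow> real \<Rightarrow> real \<Rightarrow> real" where
  "v l = (SOME U. appr l U \<and> (\<forall>t\<in>{0..1 / l}. \<forall>x\<in>{- (1 / l)..1 / l}. \<bar>U t x - u l t x\<bar> < l))"

lemma v:
  assumes "0 < l"
  shows "appr l (v l)" "\<And>t x. 0 \<le> t \<Longrightarrow> t \<le> 1 / l \<Longrightarrow> \<bar>x\<bar> \<le> 1 / l \<Longrightarrow> \<bar>v l t x - u l t x\<bar> < l"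
proof -
  have *: "appr l (v l) \<and> (\<forall>t\<in>{0..1 / l}. \<forall>x\<in>{- (1 / l)..1 / l}. \<bar>v l t x - u l t x\<bar> < l)"
    unfolding v_def by (rule someI_ex[OF v_ex[OF assms]])
  then show "appr l (v l)" by blast
  show "\<bar>v l t x - u l t x\<bar> < l" if "0 \<le> t" "t \<le> 1 / l" "\<bar>x\<bar> \<le> 1 / l" for t x
    using * that by (auto simp: abs_le_iff minus_le_iff)
qed

text \<open>\<open>u l\<close> comes without measurability; continuity at a fixed time is inherited
  by uniform convergence.\<close>

lemma u_cont:
  assumes l: "0 < l" "l \<le> 1" and t: "0 \<le> t"
  shows "continuous_on {a..b} (u l t)"
proof -
  obtain j epss U D where j: "friedrichs j" and p: "\<forall>k. 0 < epss k" and lim: "epss \<longlonglongrightarrow> 0"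
    and sol: "\<forall>k. approx_solution f l (epss k) (conv u0 (mollify j (epss k))) (U k) (D k)"
    and cv: "\<forall>T a b e. 0 < e \<longrightarrow> (\<forall>\<^sub>F k in sequentially. \<forall>t\<in>{0..T}. \<forall>x\<in>{a..b}. \<bar>U k t x - u l t x\<bar> < e)"
    using cds[OF l(1)] unfolding constructed_dissipative_solution_def by blast
  have c: "continuous_on {a..b} (U k t)" for k
  proof (rule continuous_on_compose2[where g = "\<lambda>z. U k (fst z) (snd z)" and f = "\<lambda>x. (t, x)" and t = "{0..} \<times> UNIV", simplified])
    show "continuous_on ({0..} \<times> UNIV) (\<lambda>z. U k (fst z) (snd z))" using sol by (simp add: approx_solution_def)
  qed (use t in \<open>auto intro!: continuous_intros\<close>)
  have ul: "uniform_limit {a..b} (\<lambda>k. U k t) (u l t) sequentially"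
  proof (rule uniform_limitI)
    fix e :: real assume "0 < e"
    then have "\<forall>\<^sub>F k in sequentially. \<forall>s\<in>{0..t}. \<forall>x\<in>{a..b}. \<bar>U k s x - u l s x\<bar> < e" using cv by blast
    then show "\<forall>\<^sub>F k in sequentially. \<forall>x\<in>{a..b}. dist (U k t x) (u l t x) < e"
      by (rule eventually_mono) (use t in \<open>auto simp: dist_real_def\<close>)
  qed
  show ?thesis by (rule uniform_limit_theorem[OF _ ul]) (use c in auto)
qed

text \<open>\<open>g\<close> is the uniform limit of the initial values of \<open>v l\<close>, each
  bounded by \<open>KT 0\<close>.\<close>

lemma g_bound: "\<bar>g x\<bar> \<le> KT 0"
proof (rule field_le_epsilon)
  fix e :: real assume e: "0 < e"
  define y where "y = min 1 (e / (E + 1))"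
  have y: "0 < y" "y \<le> 1" using e E0 by (auto simp: y_def)
  have l: "0 < y * y" "y * y \<le> 1" using mult_pos_pos[OF y(1) y(1)] mult_mono[of y 1 y 1] y by auto
  note F = appr_facts[OF l v(1)[OF l(1)]]
  have "y * E \<le> e / (E + 1) * (E + 1)" using E0 y by (intro mult_mono) (auto simp: y_def)
  also have "\<dots> = e" using E0 by simp
  finally have "sqrt (y * y) * E \<le> e" using y by (simp add: real_sqrt_mult)
  then show "\<bar>g x\<bar> \<le> KT 0 + e" using F(2)[of 0 0 x] F(5)[of x] by linarith
qed

text \<open>\<open>compare\<close> with a truncated approximate solution as \<open>A\<close>, whose
  defect is \<open>Q * sqrt l'\<close>; the choice of \<open>y\<close> keeps that below the
  threshold.\<close>

lemma L1_cauchy: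
  assumes T1: "0 < T1" and R1: "0 < R1" and e: "0 < e"
  obtains \<eta> where "0 < \<eta>" "\<eta> \<le> 1" "\<And>l l'. 0 < l \<Longrightarrow> l < \<eta> \<Longrightarrow> 0 < l' \<Longrightarrow> l' < \<eta> \<Longrightarrow>
     (LBINT z. bx T1 R1 z * \<bar>tp (v l') (fst z) (snd z) - tp (v l) (fst z) (snd z)\<bar>) < e"
proof -
  define T where "T = 2 * T1 + 1"
  define K1 where "K1 = KT T"
  have T0: "0 < T" using T1 by (simp add: T_def)
  have gK: "\<bar>g x\<bar> \<le> K1" for x using g_bound[of x] KT_mono[of 0 T] T0 by (simp add: K1_def)
  obtain Ra where Ra: "0 < Ra" and cmp: "\<forall>e>0. \<exists>\<eta>>0. \<eta> \<le> 1 \<and> comparable T1 R1 T Ra K1 \<eta> e"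
    unfolding K1_def T_def by (rule compare[OF T1 R1 order_refl gK[unfolded K1_def T_def]])
  obtain \<eta>0 where \<eta>0: "0 < \<eta>0" "\<eta>0 \<le> 1" and C: "comparable T1 R1 T Ra K1 \<eta>0 e"
    using cmp[rule_format, OF e] by blast
  define Q where "Q = Kr T Ra K1"
  have Q0: "0 \<le> Q" unfolding Q_def using Ra T0 by (intro Kr0) auto
  define y where "y = \<eta>0 / (Q + 1)"
  have y: "0 < y" using \<eta>0 Q0 by (simp add: y_def)
  define \<eta> where "\<eta> = min \<eta>0 (y * y)"
  have \<eta>: "0 < \<eta>" "\<eta> \<le> 1" using \<eta>0 y by (auto simp: \<eta>_def)
  show ?thesis
  proof (rule that[OF \<eta>])
    fix l l' assume l: "0 < l" "l < \<eta>" and l': "0 < l'" "l' < \<eta>"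
    have l1: "l \<le> 1" "l' \<le> 1" using l l' \<eta> by auto
    note F = appr_facts[OF l'(1) l1(2) v(1)[OF l'(1)]]
    define A where "A = tr T (v l')"
    have "sqrt l' < y"
    proof -
      have "sqrt l' < sqrt (y * y)" using l' by (intro real_sqrt_less_mono) (simp add: \<eta>_def)
      then show ?thesis using y by (simp add: real_sqrt_mult)
    qed
    then have "Q * sqrt l' \<le> Q * y" using Q0 by (intro mult_left_mono) auto
    also have "Q * y < (Q + 1) * y" using y by (simp add: algebra_simps)
    also have "(Q + 1) * y = \<eta>0" using Q0 by (simp add: y_def)
    finally have \<delta>: "Q * sqrt l' < \<eta>0" .
    have "(LBINT z. bx T1 R1 z * \<bar>A (fst z) (snd z) - v l (fst z) (snd z)\<bar>) < e"
    proof (rule comparableD[OF C l(1) _ _ \<delta> v(1)[OF l(1)]])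
      show "l < \<eta>0" using l by (simp add: \<eta>_def)
      show "0 \<le> Q * sqrt l'" using Q0 l' by simp
      show "(\<lambda>z. A (fst z) (snd z)) \<in> borel_measurable borel" unfolding A_def by (rule tr_measurable[OF F(1)])
      show "\<bar>A t x\<bar> \<le> K1" for t x using F(2)[of t T x] KT0[of T] by (auto simp: A_def tr_def K1_def)
      fix k \<phi> N assume k: "\<bar>k\<bar> \<le> K1" and \<phi>: "test_box T Ra N \<phi>"
      have "kruz f g A k \<phi> = kruz f g (v l') k \<phi>" by (rule kruz_cong[OF \<phi>]) (simp add: A_def tr_def)
      moreover have "- (Q * sqrt l' * N) \<le> kruz f g (v l') k \<phi>"
        unfolding Q_def by (rule F(6)[OF k _ _ _ \<phi>]) (use T0 Ra K1_def in auto)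
      ultimately show "- (Q * sqrt l' * N) \<le> kruz f g A k \<phi>" by simp
    qed
    moreover have "(LBINT z. bx T1 R1 z * \<bar>A (fst z) (snd z) - v l (fst z) (snd z)\<bar>)
        = (LBINT z. bx T1 R1 z * \<bar>tp (v l') (fst z) (snd z) - tp (v l) (fst z) (snd z)\<bar>)"
      by (intro Bochner_Integration.integral_cong refl) (use T1 in \<open>auto simp: bx_def indicator_def A_def tr_def tp_def T_def\<close>)
    ultimately show "(LBINT z. bx T1 R1 z * \<bar>tp (v l') (fst z) (snd z) - tp (v l) (fst z) (snd z)\<bar>) < e" by simp
  qed
qed

lemma v_meas [measurable]:
  assumes "0 < l" "l \<le> 1"
  shows "(\<lambda>z. tp (v l) (fst z) (snd z)) \<in> borel_measurable borel"
  by (rule tp_measurable[OF appr_facts(1)[OF assms v(1)[OF assms(1)]]])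

text \<open>From smallness integrated over time to smallness at every time: by the modulus in time
  the distance at \<open>t\<close> exceeds the one at a slightly later \<open>s\<close> by at most
  \<open>e / 2\<close>, and this is averaged over a window of length \<open>h\<close>.\<close>

lemma sup_cauchy:
  assumes T1: "0 < T1" and R1: "0 < R1" and e: "0 < e"
  obtains \<eta> where "0 < \<eta>" "\<eta> \<le> 1" "\<And>l l' t. 0 < l \<Longrightarrow> l < \<eta> \<Longrightarrow> 0 < l' \<Longrightarrow> l' < \<eta> \<Longrightarrow> 0 \<le> t \<Longrightarrow> t \<le> T1 \<Longrightarrow>
     (LBINT x:{-R1..R1}. \<bar>v l' t x - v l t x\<bar>) < e"
proof -
  define T where "T = T1 + 1"
  \<comment> \<open>Passing from \<open>t\<close> to \<open>s\<close> costs four terms, two of size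
    \<open>Tm T * h\<close> and one of order \<open>l\<close> for each solution; each is kept below
    \<open>e / 8\<close>.\<close>
  define h where "h = min 1 (e / (8 * (Tm T + 1)))"
  have h: "0 < h" "h \<le> 1" using e Tm0[of T] by (auto simp: h_def)
  have Tmh: "Tm T * h \<le> e / 8"
  proof -
    have "Tm T * h \<le> (Tm T + 1) * (e / (8 * (Tm T + 1)))" using h Tm0[of T] by (intro mult_mono) (auto simp: h_def)
    also have "\<dots> = e / 8" using Tm0[of T] by (simp add: field_simps)
    finally show ?thesis .
  qed
  have "0 < e * h / 4" using e h by simp
  then obtain \<eta>0 where \<eta>0: "0 < \<eta>0" "\<eta>0 \<le> 1" and C: "\<And>l l'. 0 < l \<Longrightarrow> l < \<eta>0 \<Longrightarrow> 0 < l' \<Longrightarrow> l' < \<eta>0 \<Longrightarrow>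
     (LBINT z. bx T R1 z * \<bar>tp (v l') (fst z) (snd z) - tp (v l) (fst z) (snd z)\<bar>) < e * h / 4"
    using L1_cauchy[of T R1 "e * h / 4"] T1 R1 by (auto simp: T_def)
  define \<eta> where "\<eta> = min \<eta>0 (e / (8 * (Tl T + 1)))"
  have \<eta>: "0 < \<eta>" "\<eta> \<le> 1" "\<eta> \<le> \<eta>0" using \<eta>0 e Tl0[of T] by (auto simp: \<eta>_def)
  have Tlh: "Tl T * l \<le> e / 8" if "0 < l" "l < \<eta>" for l
  proof -
    have "Tl T * l \<le> (Tl T + 1) * (e / (8 * (Tl T + 1)))" using that Tl0[of T] by (intro mult_mono) (auto simp: \<eta>_def)
    also have "\<dots> = e / 8" using Tl0[of T] by (simp add: field_simps)
    finally show ?thesis .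
  qed
  show ?thesis
  proof (rule that[OF \<eta>(1,2)])
    fix l l' t assume l: "0 < l" "l < \<eta>" and l': "0 < l'" "l' < \<eta>" and t: "0 \<le> t" "t \<le> T1"
    have l1: "l \<le> 1" "l' \<le> 1" using l l' \<eta> by auto
    note F = appr_facts[OF l(1) l1(1) v(1)[OF l(1)]] and F' = appr_facts[OF l'(1) l1(2) v(1)[OF l'(1)]]
    define D where "D s = (LBINT x:{-R1..R1}. \<bar>v l' s x - v l s x\<bar>)" for s
    have Dts: "D t \<le> D s + e / 2" if s: "t < s" "s \<le> t + h" for s
    proof -
      have s0: "0 \<le> s" "s \<le> T" using s t h by (auto simp: T_def)
      have i: "set_integrable lborel {-R1..R1} (\<lambda>x. \<bar>v p r x - v q w x\<bar>)" if "p \<in> {l, l'}" "q \<in> {l, l'}" "r \<in> {s, t}" "w \<in> {s, t}" for p q r w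
      proof -
        have "isCont (v p r) x" "isCont (v q w) x" for x using that F(7) F'(7) s0 t by auto
        then show ?thesis by (intro set_integrable_cont continuous_rabs continuous_diff) auto
      qed
      have "D t \<le> (LBINT x:{-R1..R1}. \<bar>v l' s x - v l s x\<bar> + (\<bar>v l' s x - v l' t x\<bar> + \<bar>v l s x - v l t x\<bar>))"
        unfolding D_def by (intro set_integral_mono set_integral_add i) auto
      also have "\<dots> = D s + ((LBINT x:{-R1..R1}. \<bar>v l' s x - v l' t x\<bar>) + (LBINT x:{-R1..R1}. \<bar>v l s x - v l t x\<bar>))"
        unfolding D_def by (subst set_integral_add(2); (intro i set_integral_add)?) (auto intro!: set_integral_add(2) i)
      finally have "D t \<le> D s + ((LBINT x:{-R1..R1}. \<bar>v l' s x - v l' t x\<bar>) + (LBINT x:{-R1..R1}. \<bar>v l s x - v l t x\<bar>))" .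
      moreover have "(LBINT x:{-R1..R1}. \<bar>v l s x - v l t x\<bar>) \<le> Tm T * (s - t) + Tl T * l"
        by (rule F(4)) (use s t s0 R1 in auto)
      moreover have "(LBINT x:{-R1..R1}. \<bar>v l' s x - v l' t x\<bar>) \<le> Tm T * (s - t) + Tl T * l'"
        by (rule F'(4)) (use s t s0 R1 in auto)
      moreover have "Tm T * (s - t) \<le> Tm T * h" using s Tm0 by (intro mult_left_mono) auto
      ultimately show ?thesis using Tmh Tlh[OF l] Tlh[OF l'] by linarith
    qed
    note [measurable] = v_meas[OF l(1) l1(1)] v_meas[OF l'(1) l1(2)]
    have bi: "integrable lborel (\<lambda>z. bx T R1 z * \<bar>tp (v l') (fst z) (snd z) - tp (v l) (fst z) (snd z)\<bar>)"
    proof (rule bx_integrable[where B = "2 * KT T"])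
      fix z assume "bx T R1 z \<noteq> 0"
      then have z: "0 \<le> fst z" "fst z \<le> T" by (auto simp: bx_def indicator_def split: if_splits)
      show "\<bar>\<bar>tp (v l') (fst z) (snd z) - tp (v l) (fst z) (snd z)\<bar>\<bar> \<le> 2 * KT T"
        using F(2)[OF z, of "snd z"] F'(2)[OF z, of "snd z"] z by (simp add: tp_def)
    qed measurable
    have eD: "indicator {0<..T} s * (LBINT x:{-R1..R1}. \<bar>tp (v l') (fst (s, x)) (snd (s, x)) - tp (v l) (fst (s, x)) (snd (s, x))\<bar>) = indicator {0<..T} s * D s" for s
      by (auto simp: D_def tp_def indicator_def)
    note I = bx_integral[OF bi, unfolded eD]
    \<comment> \<open>The average over the window: its total mass is below \<open>e * h / 4\<close>,
      which forces the distance at \<open>t\<close> below \<open>3 e / 4\<close>.\<close>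
    have "(LBINT s. indicator {t<..t + h} s * (D t - e / 2)) \<le> (LBINT s. indicator {0<..T} s * D s)"
    proof (rule integral_mono[OF _ I(2)])
      show "integrable lborel (\<lambda>s. indicator {t<..t + h} s * (D t - e / 2))"
        using h by (intro integrable_mult_left) (simp add: integrable_indicator_iff)
      fix s
      have "0 \<le> D s" unfolding D_def set_lebesgue_integral_def by (intro integral_nonneg_AE AE_I2) auto
      then show "indicator {t<..t + h} s * (D t - e / 2) \<le> indicator {0<..T} s * D s"
        using Dts[of s] t h by (auto simp: indicator_def T_def)
    qed
    moreover have "(LBINT s. indicator {t<..t + h} s * (D t - e / 2)) = h * (D t - e / 2)" using h by simp
    moreover have "(LBINT s. indicator {0<..T} s * D s) < e * h / 4" using C[OF l(1) _ l'(1)] l l' \<eta> I(1) by auto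
    moreover have "h * (e / 4) = e * h / 4" by simp
    ultimately have "h * (D t - e / 2) < h * (e / 4)" by linarith
    then have "D t < e" using h e by simp
    then show "(LBINT x:{-R1..R1}. \<bar>v l' t x - v l t x\<bar>) < e" by (simp add: D_def)
  qed
qed

end

section \<open>Construction of the limit function and its maximum principle\<close>

lemma AE_pos_time:
  assumes "\<And>n::nat. AE z in lborel. bx (real (Suc n)) (real (Suc n)) z \<noteq> 0 \<longrightarrow> P z"
  shows "AE z in lborel. 0 < fst z \<longrightarrow> P z"
proof -
  have "AE z in lborel. \<forall>n. bx (real (Suc n)) (real (Suc n)) z \<noteq> 0 \<longrightarrow> P z" unfolding AE_all_countable using assms by blast
  then show ?thesis
  proof eventually_elim
    case (elim z)
    obtain n where n: "fst z + \<bar>snd z\<bar> < real n" using reals_Archimedean2 by blast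
    have "bx (real (Suc n)) (real (Suc n)) z \<noteq> 0" if "0 < fst z"
      using that n by (auto simp: bx_def indicator_def abs_if split: if_splits)
    then show ?case using elim by blast
  qed
qed

text \<open>Sum and integral are interchanged; a finite integral of the sum makes the sum finite
  almost everywhere.\<close>

lemma AE_summable_boxes:
  fixes d :: "nat \<Rightarrow> real \<times> real \<Rightarrow> real"
  assumes i: "\<And>n. integrable lborel (d n)" and p: "\<And>n z. 0 \<le> d n z" and b: "\<And>n. (LBINT z. d n z) \<le> (1 / 2) ^ n"
  shows "AE z in lborel. summable (\<lambda>n. d n z)"
proof -
  have m [measurable]: "d n \<in> borel_measurable lborel" for n using i by (simp add: integrable_iff_bounded)
  have "(\<integral>\<^sup>+z. (\<Sum>n. ennreal (d n z)) \<partial>lborel) = (\<Sum>n. \<integral>\<^sup>+z. ennreal (d n z) \<partial>lborel)"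
    by (intro nn_integral_suminf) measurable
  also have "\<dots> \<le> (\<Sum>n. ennreal ((1 / 2) ^ n))"
  proof (intro suminf_le)
    show "(\<integral>\<^sup>+z. ennreal (d n z) \<partial>lborel) \<le> ennreal ((1 / 2) ^ n)" for n
      using nn_integral_eq_integral[OF i, of n] p b by (simp add: ennreal_leI)
  qed auto
  also have "\<dots> = ennreal (\<Sum>n. (1 / 2) ^ n)" by (intro suminf_ennreal2 summable_geometric) auto
  also have "\<dots> < \<infinity>" by simp
  finally have "(\<integral>\<^sup>+z. (\<Sum>n. ennreal (d n z)) \<partial>lborel) \<noteq> \<infinity>" by simp
  then have "AE z in lborel. (\<Sum>n. ennreal (d n z)) \<noteq> \<infinity>" by (intro nn_integral_noteq_infinite) measurable
  then show ?thesis by eventually_elim (rule summable_suminf_not_top, use p in auto)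
qed

lemma convergent_of_summable_increments:
  fixes s :: "nat \<Rightarrow> real"
  assumes "summable (\<lambda>n. \<bar>s (Suc n) - s n\<bar>)"
  shows "convergent s"
proof -
  have "summable (\<lambda>n. s (Suc n) - s n)" using assms by (rule summable_rabs_cancel)
  then have "convergent (\<lambda>n. \<Sum>i<n. s (Suc i) - s i)" by (simp add: summable_iff_convergent)
  then have "convergent (\<lambda>n. s n - s 0)" by (simp add: sum_lessThan_telescope)
  then obtain L where "(\<lambda>n. s n - s 0) \<longlonglongrightarrow> L" unfolding convergent_def by blast
  from tendsto_add[OF this tendsto_const[of "s 0"]] show ?thesis by (auto simp: convergent_def)
qed

context rb_family begin

text \<open>A rapidly Cauchy sequence: on the \<open>n\<close>-th box consecutive members differ by
  less than \<open>(1 / 2) ^ n\<close> in L1, so their increments are summable almost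
  everywhere.\<close>

lemma limit_sequence:
  obtains ls :: "nat \<Rightarrow> real" and W :: "real \<times> real \<Rightarrow> real" where "\<forall>n. 0 < ls n" "\<forall>n. ls n \<le> 1" "ls \<longlonglongrightarrow> 0" "W \<in> borel_measurable borel"
    "AE z in lborel. 0 < fst z \<longrightarrow> (\<lambda>n. tp (v (ls n)) (fst z) (snd z)) \<longlonglongrightarrow> W z"
proof -
  let ?r = "\<lambda>n. real (Suc n)"
  define P where "P n \<eta> \<longleftrightarrow> 0 < \<eta> \<and> \<eta> \<le> 1 \<and> (\<forall>l l'. 0 < l \<longrightarrow> l < \<eta> \<longrightarrow> 0 < l' \<longrightarrow> l' < \<eta> \<longrightarrow>
     (LBINT z. bx (?r n) (?r n) z * \<bar>tp (v l') (fst z) (snd z) - tp (v l) (fst z) (snd z)\<bar>) < (1 / 2) ^ n)" for n \<eta>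
  have "\<exists>\<eta>. P n \<eta>" for n
  proof -
    obtain \<eta> where "0 < \<eta>" "\<eta> \<le> 1" "\<And>l l'. 0 < l \<Longrightarrow> l < \<eta> \<Longrightarrow> 0 < l' \<Longrightarrow> l' < \<eta> \<Longrightarrow>
       (LBINT z. bx (?r n) (?r n) z * \<bar>tp (v l') (fst z) (snd z) - tp (v l) (fst z) (snd z)\<bar>) < (1 / 2) ^ n"
      using L1_cauchy[of "?r n" "?r n" "(1 / 2) ^ n"] by auto
    then have "P n \<eta>" unfolding P_def by blast
    then show ?thesis by blast
  qed
  then obtain \<eta> where P: "\<And>n. P n (\<eta> n)" by metis
  then have \<eta>: "\<And>n. 0 < \<eta> n" "\<And>n. \<eta> n \<le> 1" and C: "\<And>n l l'. 0 < l \<Longrightarrow> l < \<eta> n \<Longrightarrow> 0 < l' \<Longrightarrow> l' < \<eta> n \<Longrightarrow>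
     (LBINT z. bx (?r n) (?r n) z * \<bar>tp (v l') (fst z) (snd z) - tp (v l) (fst z) (snd z)\<bar>) < (1 / 2) ^ n"
    unfolding P_def by blast+
  \<comment> \<open>The minimum over all earlier thresholds puts both \<open>ls n\<close> and
    \<open>ls (Suc n)\<close> below \<open>\<eta> n\<close>. Division by \<open>real n + 2\<close>
    makes this strict and sends \<open>ls\<close> to 0.\<close>
  define m where "m n = Min (\<eta> ` {..n})" for n
  define ls where "ls n = m n / (real n + 2)" for n
  have m0: "0 < m n" for n unfolding m_def using \<eta>(1) by simp
  have m\<eta>: "m n \<le> \<eta> i" if "i \<le> n" for i n unfolding m_def using that by (intro Min_le) auto
  have l0: "0 < ls n" for n unfolding ls_def using m0[of n] by simp
  have lm: "ls n < m n" for n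
    unfolding ls_def using m0[of n] by (simp add: field_simps) (smt (verit) of_nat_0_le_iff mult_nonneg_nonneg m0)
  have l\<eta>: "ls n < \<eta> i" if "i \<le> n" for i n using lm[of n] m\<eta>[OF that] by linarith
  have l1: "ls n \<le> 1" for n using l\<eta>[of n n] \<eta>(2)[of n] by simp
  have lim: "ls \<longlonglongrightarrow> 0"
  proof (rule tendsto_sandwich[where f = "\<lambda>_. 0" and h = "\<lambda>n. inverse (real (Suc n))"])
    have "ls n \<le> inverse (real (Suc n))" for n
    proof -
      have "m n \<le> 1" using m\<eta>[of n n] \<eta>(2)[of n] by linarith
      then have "ls n \<le> 1 / (real n + 2)" unfolding ls_def by (intro divide_right_mono) auto
      also have "\<dots> \<le> inverse (real (Suc n))" by (simp add: field_simps)
      finally show ?thesis .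
    qed
    then show "\<forall>\<^sub>F n in sequentially. ls n \<le> inverse (real (Suc n))" by simp
    show "\<forall>\<^sub>F n in sequentially. 0 \<le> ls n" by (intro always_eventually allI less_imp_le l0)
  qed (rule tendsto_const, rule LIMSEQ_inverse_real_of_nat)
  define S where "S n z = tp (v (ls n)) (fst z) (snd z)" for n and z :: "real \<times> real"
  have Sm [measurable]: "S n \<in> borel_measurable borel" for n unfolding S_def[abs_def] by (rule v_meas[OF l0 l1])
  \<comment> \<open>\<open>lim\<close> is total, hence \<open>W\<close> is measurable before it is
    known where the sequence converges.\<close>
  define W where "W z = lim (\<lambda>n. S n z)" for z
  have Wm: "W \<in> borel_measurable borel" unfolding W_def by (rule borel_measurable_lim_metric[OF Sm])
  have i: "integrable lborel (\<lambda>z. bx (?r n) (?r n) z * \<bar>S (Suc n) z - S n z\<bar>)" for n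
  proof (rule bx_integrable[where B = "2 * KT (?r n)"])
    fix z assume "bx (?r n) (?r n) z \<noteq> 0"
    then have z: "0 \<le> fst z" "fst z \<le> ?r n" by (auto simp: bx_def indicator_def split: if_splits)
    show "\<bar>\<bar>S (Suc n) z - S n z\<bar>\<bar> \<le> 2 * KT (?r n)"
      using appr_facts(2)[OF l0 l1 v(1)[OF l0] z, of n "snd z"] appr_facts(2)[OF l0 l1 v(1)[OF l0] z, of "Suc n" "snd z"] z by (simp add: tp_def S_def)
  qed measurable
  have b: "(LBINT z. bx (?r n) (?r n) z * \<bar>S (Suc n) z - S n z\<bar>) \<le> (1 / 2) ^ n" for n
    unfolding S_def by (rule less_imp_le[OF C]) (use l0 l\<eta> in auto)
  have "AE z in lborel. summable (\<lambda>n. bx (?r n) (?r n) z * \<bar>S (Suc n) z - S n z\<bar>)"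
    by (rule AE_summable_boxes[OF i _ b]) (simp add: bx_bounds)
  then have ae: "AE z in lborel. 0 < fst z \<longrightarrow> (\<lambda>n. tp (v (ls n)) (fst z) (snd z)) \<longlonglongrightarrow> W z"
  proof eventually_elim
    case (elim z)
    show ?case
    proof
      assume z: "0 < fst z"
      obtain n0 :: nat where n0: "fst z + \<bar>snd z\<bar> < real n0" using reals_Archimedean2 by blast
      have "summable (\<lambda>n. \<bar>S (Suc n) z - S n z\<bar>)"
      proof (rule summable_comparison_test[OF _ elim], intro exI allI impI)
        fix n assume "n0 \<le> n"
        then have "bx (?r n) (?r n) z = 1" using z n0 by (auto simp: bx_def indicator_def abs_if split: if_splits)
        then show "norm \<bar>S (Suc n) z - S n z\<bar> \<le> bx (?r n) (?r n) z * \<bar>S (Suc n) z - S n z\<bar>" by simp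
      qed
      then have "convergent (\<lambda>n. S n z)" by (rule convergent_of_summable_increments)
      then show "(\<lambda>n. tp (v (ls n)) (fst z) (snd z)) \<longlonglongrightarrow> W z"
        unfolding convergent_LIMSEQ_iff W_def S_def .
    qed
  qed
  show ?thesis using l0 l1 by (intro that[OF _ _ lim Wm ae]) auto
qed

text \<open>The defects are of order \<open>sqrt (ls n)\<close>. The range \<open>K\<close> has to
  contain the solutions as well as the given constant \<open>k\<close>.\<close>

lemma kruz_limit:
  assumes ls: "\<And>n. 0 < ls n" "\<And>n. ls n \<le> 1" "ls \<longlonglongrightarrow> 0" and m: "(\<lambda>z. w (fst z) (snd z)) \<in> borel_measurable borel"
    and lim: "AE z in lborel. 0 < fst z \<longrightarrow> (\<lambda>n. tp (v (ls n)) (fst z) (snd z)) \<longlonglongrightarrow> w (fst z) (snd z)"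
    and \<phi>: "test_box T R N \<phi>" and TR: "0 \<le> T" "0 \<le> R"
  shows "0 \<le> kruz f g w k \<phi>"
proof -
  define K where "K = max (KT T) \<bar>k\<bar>"
  note F = appr_facts[OF ls(1,2) v(1)[OF ls(1)]]
  have "compact (f ` {-KT T..KT T})" using f_isCont by (intro compact_continuous_image continuous_at_imp_continuous_on) auto
  then obtain L where L: "\<And>x. x \<in> {-KT T..KT T} \<Longrightarrow> \<bar>f x\<bar> \<le> L" by (meson compact_imp_bounded bounded_real imageI)
  have "(\<lambda>n. kruz f g (tp (v (ls n))) k \<phi>) \<longlonglongrightarrow> kruz f g w k \<phi>"
  proof (rule kruz_tendsto[where K = "KT T" and L = L, OF f_isCont _ v_meas[OF ls(1,2)] m _ lim \<phi>])
    show "\<bar>f y\<bar> \<le> L" if "\<bar>y\<bar> \<le> KT T" for y using that by (intro L) (auto simp: abs_le_iff)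
    show "\<bar>tp (v (ls n)) t x\<bar> \<le> KT T" if "0 < t" "t \<le> T" for n t x using F(2)[of t T n x] that by (simp add: tp_def)
  qed
  moreover have "(\<lambda>n. - (Kr T R K * sqrt (ls n) * N)) \<longlonglongrightarrow> - (Kr T R K * sqrt 0 * N)" using ls(3) by (intro tendsto_intros)
  moreover have "- (Kr T R K * sqrt (ls n) * N) \<le> kruz f g (tp (v (ls n))) k \<phi>" for n
  proof -
    have "kruz f g (tp (v (ls n))) k \<phi> = kruz f g (v (ls n)) k \<phi>" by (rule kruz_cong[OF \<phi>]) (simp add: tp_def)
    then show ?thesis using F(6)[of k K T R N \<phi> n] TR \<phi> by (simp add: K_def)
  qed
  ultimately show ?thesis by (intro LIMSEQ_le[where X = "\<lambda>n. - (Kr T R K * sqrt (ls n) * N)"]) auto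
qed

text \<open>The available bound \<open>KT t\<close> grows with \<open>t\<close>, while an entropy
  solution needs one bound for all times. Two Kruzhkov inequalities, one of them with an entropy
  that is affine on the range, add up to an inequality for the excess over \<open>KT 0\<close>. Its
  initial value is zero, and the cone weight forces the excess to vanish.\<close>

lemma max_principle:
  assumes m: "(\<lambda>z. w (fst z) (snd z)) \<in> borel_measurable borel" and wK: "\<And>t x. \<bar>w t x\<bar> \<le> KT t"
    and kr: "\<And>T R N \<phi> k. test_box T R N \<phi> \<Longrightarrow> 0 < T \<Longrightarrow> 0 < R \<Longrightarrow> 0 \<le> kruz f g w k \<phi>"
    and \<sigma>: "\<bar>\<sigma>\<bar> = (1::real)"
  shows "AE z in lborel. 0 < fst z \<longrightarrow> \<sigma> * w (fst z) (snd z) \<le> KT 0"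
proof (rule AE_pos_time)
  fix n :: nat
  define T1 where "T1 = real (Suc n)"
  define T where "T = 2 * T1"
  define K1 where "K1 = KT T"
  define L where "L = Lf K1"
  have T1: "0 < T1" by (simp add: T1_def)
  have T0: "0 < T" using T1 by (simp add: T_def)
  have L0: "0 \<le> L" unfolding L_def by (rule Lf(1))
  have K10: "0 \<le> KT 0" "KT 0 \<le> K1" using KT0 KT_mono[of 0 T] T0 by (auto simp: K1_def)
  obtain R N \<Phi> where R0: "0 < R" and \<Phi>: "test_box T R N \<Phi>"
    and cone: "\<forall>D F K. D \<in> borel_measurable borel \<longrightarrow> F \<in> borel_measurable borel \<longrightarrow> (\<forall>z. 0 \<le> D z) \<longrightarrow> (\<forall>z. D z \<le> K) \<longrightarrow>
       (\<forall>z. \<bar>F z\<bar> \<le> L * D z) \<longrightarrow>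
       (LBINT z. half z * (D z * pt \<Phi> z + F z * px \<Phi> z)) \<le> - (T ^ 4 * (LBINT z. bx T1 T1 z * D z))"
    unfolding T_def by (rule cone_estimate[OF T1 T1 L0])
  note [measurable] = test_boxD(10,11)[OF \<Phi>]
  note [measurable] = m isCont_borel[OF f_isCont]
  have LL: "\<bar>deriv f y\<bar> \<le> L" if "\<bar>y\<bar> \<le> K1" for y unfolding L_def by (rule Lf(2)[OF that])
  define A where "A z = (if fst z \<le> T then w (fst z) (snd z) else 0)" for z
  have Am [measurable]: "A \<in> borel_measurable borel" unfolding A_def[abs_def] by measurable
  have AK: "\<bar>A z\<bar> \<le> K1" for z
    using wK[of "fst z" "snd z"] KT_mono[of "fst z" T] K10 unfolding A_def K1_def by (cases "fst z \<le> T") auto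
  \<comment> \<open>\<open>k\<close> is the level to be shown, and \<open>k'\<close> lies at the
    opposite end of the range of \<open>A\<close>, so that the entropy centred at \<open>k'\<close>
    is affine there.\<close>
  define k where "k = \<sigma> * KT 0"
  define k' where "k' = - \<sigma> * K1"
  have \<sigma>': "\<sigma> = 1 \<or> \<sigma> = -1" using \<sigma> by (auto simp: abs_if split: if_splits)
  have kK: "\<bar>k\<bar> \<le> K1" "\<bar>k'\<bar> \<le> K1" using K10 \<sigma>' by (auto simp: k_def k'_def)
  note hi = test2_half_integrals[OF \<Phi> T0]
  define I where "I k z = half z * (\<bar>A z - k\<bar> * pt \<Phi> z + kfl f (A z) k * px \<Phi> z)" for k z
  have kr': "0 \<le> (LBINT z. I \<kappa> z) + (LBINT x. \<bar>g x - \<kappa>\<bar> * \<Phi> (0, x))" for \<kappa>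
  proof -
    have "0 \<le> kruz f g w \<kappa> \<Phi>" by (rule kr[OF \<Phi> T0 R0])
    also have "kruz f g w \<kappa> \<Phi> = kruz f g (\<lambda>t x. A (t, x)) \<kappa> \<Phi>" by (rule kruz_cong[OF \<Phi>]) (simp add: A_def)
    finally show ?thesis unfolding kruz_half I_def by simp
  qed
  have Iint: "integrable lborel (I \<kappa>)" if \<kappa>: "\<bar>\<kappa>\<bar> \<le> K1" for \<kappa>
  proof -
    have "\<bar>A z - \<kappa>\<bar> \<le> 2 * K1" for z using AK[of z] \<kappa> by linarith
    moreover have "\<bar>kfl f (A z) \<kappa>\<bar> \<le> L * (2 * K1)" for z
    proof -
      have "\<bar>kfl f (A z) \<kappa>\<bar> \<le> L * \<bar>A z - \<kappa>\<bar>" unfolding kfl_def by (rule kruzhkov_flux_lipschitz(2)[OF fd(1) LL AK \<kappa> \<kappa>])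
      also have "\<dots> \<le> L * (2 * K1)" using AK[of z] \<kappa> L0 by (intro mult_left_mono) auto
      finally show ?thesis .
    qed
    moreover have "(\<lambda>z. kfl f (A z) \<kappa>) \<in> borel_measurable lborel" unfolding kfl_def by measurable
    ultimately have "integrable lborel (\<lambda>z. \<bar>A z - \<kappa>\<bar> * (half z * pt \<Phi> z) + kfl f (A z) \<kappa> * (half z * px \<Phi> z))"
      by (intro Bochner_Integration.integrable_add integrable_bounded_mult[OF hi(3), where K = "2 * K1"] integrable_bounded_mult[OF hi(4), where K = "L * (2 * K1)"]) simp_all
    then show ?thesis unfolding I_def by (simp add: algebra_simps)
  qed
  \<comment> \<open>\<open>D\<close> is twice the positive part of
    \<open>\<sigma> * A z - KT 0\<close>, and \<open>F\<close> is the flux that belongs to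
    it.\<close>
  define D where "D z = \<bar>A z - k\<bar> + \<sigma> * (A z - k)" for z
  define F where "F z = kfl f (A z) k + \<sigma> * (f (A z) - f k)" for z
  define b where "b = \<sigma> * (f k - f k')"
  have Dz: "0 \<le> D z" "D z \<le> 4 * K1" for z using \<sigma>' AK[of z] kK by (auto simp: D_def)
  have FL: "\<bar>F z\<bar> \<le> L * D z" for z
  proof -
    have "\<bar>kfl f (A z) k\<bar> \<le> L * \<bar>A z - k\<bar>" unfolding kfl_def by (rule kruzhkov_flux_lipschitz(2)[OF fd(1) LL AK kK(1) kK(1)])
    moreover have "F z = 2 * kfl f (A z) k \<and> D z = 2 * \<bar>A z - k\<bar> \<or> F z = 0 \<and> D z = 0"
      using \<sigma>' by (auto simp: F_def D_def kfl_def sgn_if)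
    ultimately show ?thesis by (auto simp: abs_mult)
  qed
  have Isum: "I k z + I k' z = half z * (D z * pt \<Phi> z + F z * px \<Phi> z) + ((KT 0 + K1) * (half z * pt \<Phi> z) + b * (half z * px \<Phi> z))" for z
  proof -
    have 1: "\<bar>A z - k'\<bar> = \<sigma> * (A z - k) + (KT 0 + K1)" using \<sigma>' AK[of z] by (auto simp: k_def k'_def)
    have 2: "kfl f (A z) k' = \<sigma> * (f (A z) - f k) + b"
    proof -
      have "sgn (A z - k') = \<sigma> \<or> A z = k'" using \<sigma>' AK[of z] by (auto simp: k'_def sgn_if)
      then show ?thesis by (auto simp: kfl_def b_def algebra_simps)
    qed
    have "h * (x * p + y * q) + h * ((s + K) * p + (s' + b) * q) = h * ((x + s) * p + (y + s') * q) + (K * (h * p) + b * (h * q))" for h x y p q s s' K b :: real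
      by (simp add: algebra_simps)
    then show ?thesis unfolding I_def 1 2 D_def F_def .
  qed
  \<comment> \<open>The datum lies between the two levels, so the two distances add up to a
    constant. This is exactly what the affine part contributes with the opposite sign.\<close>
  have Gsum: "\<bar>g x - k\<bar> * \<Phi> (0, x) + \<bar>g x - k'\<bar> * \<Phi> (0, x) = (KT 0 + K1) * \<Phi> (0, x)" for x
  proof -
    have "\<bar>g x - k\<bar> + \<bar>g x - k'\<bar> = KT 0 + K1" using \<sigma>' g_bound[of x] K10 by (auto simp: k_def k'_def)
    then show ?thesis by (metis distrib_right)
  qed
  have gi: "integrable lborel (\<lambda>x. \<bar>g x - \<kappa>\<bar> * \<Phi> (0, x))" if \<kappa>: "\<bar>\<kappa>\<bar> \<le> K1" for \<kappa>
  proof (rule integrable_bounded_mult[OF hi(5)])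
    show "\<bar>\<bar>g x - \<kappa>\<bar>\<bar> \<le> 2 * K1" for x using g_bound[of x] \<kappa> K10 by linarith
  qed measurable
  have G: "(LBINT x. \<bar>g x - k\<bar> * \<Phi> (0, x)) + (LBINT x. \<bar>g x - k'\<bar> * \<Phi> (0, x)) = (KT 0 + K1) * (LBINT x. \<Phi> (0, x))"
    using Bochner_Integration.integral_add[OF gi[OF kK(1)] gi[OF kK(2)]] unfolding Gsum by simp
  have c: "integrable lborel (\<lambda>z. (KT 0 + K1) * (half z * pt \<Phi> z) + b * (half z * px \<Phi> z))"
    by (intro Bochner_Integration.integrable_add integrable_mult_right hi)
  have ci: "(LBINT z. (KT 0 + K1) * (half z * pt \<Phi> z) + b * (half z * px \<Phi> z)) = - ((KT 0 + K1) * (LBINT x. \<Phi> (0, x)))"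
    by (subst Bochner_Integration.integral_add) (auto intro: hi integrable_mult_right simp: hi(1,2))
  have "integrable lborel (\<lambda>z. I k z + I k' z - ((KT 0 + K1) * (half z * pt \<Phi> z) + b * (half z * px \<Phi> z)))"
    by (intro Bochner_Integration.integrable_diff Bochner_Integration.integrable_add Iint kK c)
  then have i0: "integrable lborel (\<lambda>z. half z * (D z * pt \<Phi> z + F z * px \<Phi> z))" unfolding Isum by simp
  have II: "(LBINT z. I k z) + (LBINT z. I k' z) = (LBINT z. half z * (D z * pt \<Phi> z + F z * px \<Phi> z)) - (KT 0 + K1) * (LBINT x. \<Phi> (0, x))"
    using Bochner_Integration.integral_add[OF Iint[OF kK(1)] Iint[OF kK(2)]] Bochner_Integration.integral_add[OF i0 c] unfolding Isum ci by simp
  have Dm [measurable]: "D \<in> borel_measurable borel" unfolding D_def[abs_def] by measurable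
  have Fm: "F \<in> borel_measurable borel" unfolding F_def[abs_def] kfl_def by measurable
  have "(LBINT z. half z * (D z * pt \<Phi> z + F z * px \<Phi> z)) \<le> - (T ^ 4 * (LBINT z. bx T1 T1 z * D z))"
    by (rule cone[rule_format, where K = "4 * K1", OF Dm Fm]) (rule Dz FL)+
  then have "T ^ 4 * (LBINT z. bx T1 T1 z * D z) \<le> 0" using kr'[of k] kr'[of k'] II G by linarith
  then have le: "(LBINT z. bx T1 T1 z * D z) \<le> 0" using T0 by (simp add: mult_le_0_iff)
  have Di: "integrable lborel (\<lambda>z. bx T1 T1 z * D z)" by (rule bx_integrable[where B = "4 * K1"]) (use Dz in \<open>auto simp: abs_of_nonneg\<close>)
  have D0: "AE z in lborel. 0 \<le> bx T1 T1 z * D z" using Dz bx_bounds by auto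
  have "(LBINT z. bx T1 T1 z * D z) = 0" using le integral_nonneg_AE[OF D0] by linarith
  then have "AE z in lborel. bx T1 T1 z * D z = 0" using integral_nonneg_eq_0_iff_AE[OF Di D0] by blast
  then show "AE z in lborel. bx (real (Suc n)) (real (Suc n)) z \<noteq> 0 \<longrightarrow> \<sigma> * w (fst z) (snd z) \<le> KT 0"
    unfolding T1_def[symmetric]
  proof eventually_elim
    case (elim z)
    show ?case
    proof
      assume "bx T1 T1 z \<noteq> 0"
      then have "D z = 0" "fst z \<le> T" using elim by (auto simp: bx_def indicator_def T_def split: if_splits)
      then show "\<sigma> * w (fst z) (snd z) \<le> KT 0" using \<sigma>' by (auto simp: D_def A_def k_def)
    qed
  qed
qed

end

lemma bx_L1_tendsto:
  assumes m [measurable]: "\<And>n. S n \<in> borel_measurable borel" "w \<in> borel_measurable borel"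
    and b: "\<And>n z. bx T R z \<noteq> 0 \<Longrightarrow> \<bar>S n z\<bar> \<le> K" "\<And>z. bx T R z \<noteq> 0 \<Longrightarrow> \<bar>w z\<bar> \<le> K"
    and lim: "AE z in lborel. 0 < fst z \<longrightarrow> (\<lambda>n. S n z) \<longlonglongrightarrow> w z"
  shows "(\<lambda>n. LBINT z. bx T R z * \<bar>S n z - w z\<bar>) \<longlonglongrightarrow> 0"
proof -
  have "(\<lambda>n. LBINT z. bx T R z * \<bar>S n z - w z\<bar>) \<longlonglongrightarrow> (LBINT z. (0::real) * w z)"
  proof (rule integral_dominated_convergence[where w = "\<lambda>z. bx T R z * (2 * K)"])
    show "integrable lborel (\<lambda>z. bx T R z * (2 * K))" by (rule bx_integrable[where B = "\<bar>2 * K\<bar>"]) auto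
    show "AE z in lborel. (\<lambda>n. bx T R z * \<bar>S n z - w z\<bar>) \<longlonglongrightarrow> 0 * w z"
      using lim
    proof eventually_elim
      case (elim z)
      show ?case
      proof (cases "0 < fst z")
        case True
        with elim have "(\<lambda>n. S n z) \<longlonglongrightarrow> w z" by blast
        then have "(\<lambda>n. bx T R z * \<bar>S n z - w z\<bar>) \<longlonglongrightarrow> bx T R z * \<bar>w z - w z\<bar>" by (intro tendsto_intros)
        then show ?thesis by simp
      qed (simp add: bx_def)
    qed
    show "AE z in lborel. norm (bx T R z * \<bar>S n z - w z\<bar>) \<le> bx T R z * (2 * K)" for n
    proof (rule AE_I2)
      fix z
      have "\<bar>S n z - w z\<bar> \<le> 2 * K" if "bx T R z \<noteq> 0" using b(1)[OF that, of n] b(2)[OF that] by linarith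
      then show "norm (bx T R z * \<bar>S n z - w z\<bar>) \<le> bx T R z * (2 * K)"
        using bx_bounds(1)[of T R z] by (cases "bx T R z = 0") (auto simp: abs_mult intro: mult_left_mono)
    qed
  qed measurable
  then show ?thesis by simp
qed

text \<open>For bounded functions L1 convergence implies convergence in every other
  exponent.\<close>

lemma powr_le_linear:
  fixes y K p :: real
  assumes "0 \<le> y" "y \<le> K" "1 \<le> p"
  shows "y powr p \<le> K powr (p - 1) * y"
proof (cases "y = 0")
  case False
  then have "y powr p = y powr (p - 1) * y" using assms powr_add[of y "p - 1" 1] by simp
  also have "\<dots> \<le> K powr (p - 1) * y" using assms by (intro mult_right_mono powr_mono2) auto
  finally show ?thesis .
qed simp

lemma kruz_cong_AE:
  assumes f_isCont: "\<And>x. isCont f x" and \<phi>: "test_box T R N \<phi>"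
    and m [measurable]: "(\<lambda>z. w (fst z) (snd z)) \<in> borel_measurable borel" "(\<lambda>z. w' (fst z) (snd z)) \<in> borel_measurable borel"
      "u \<in> borel_measurable borel" "u' \<in> borel_measurable borel"
    and w: "AE z in lborel. 0 < fst z \<longrightarrow> w (fst z) (snd z) = w' (fst z) (snd z)" and u: "AE x in lborel. u x = u' x"
  shows "kruz f u w k \<phi> = kruz f u' w' k \<phi>"
proof -
  note t2 = test_boxD(1)[OF \<phi>] and [measurable] = test_boxD(10,11)[OF \<phi>]
  have "isCont (\<lambda>y. \<phi> (0, y)) x" for x using test2_DERIV(2)[OF t2] DERIV_isCont by blast
  then have [measurable]: "(\<lambda>x. \<phi> (0, x)) \<in> borel_measurable borel" by (rule isCont_borel)
  note [measurable] = isCont_borel[OF f_isCont]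
  let ?I = "\<lambda>w z. half z * (\<bar>w (fst z) (snd z) - k\<bar> * pt \<phi> z + kfl f (w (fst z) (snd z)) k * px \<phi> z)"
  have "(LBINT z. ?I w z)
     = (LBINT z. ?I w' z)"
  proof (rule integral_cong_AE)
    show "AE z in lborel. ?I w z
      = ?I w' z"
      using w
    proof eventually_elim
      case (elim z)
      then show ?case using half_cases[of z] by auto
    qed
  qed (unfold kfl_def measurable_lborel2, measurable)
  moreover have "(LBINT x. \<bar>u x - k\<bar> * \<phi> (0, x)) = (LBINT x. \<bar>u' x - k\<bar> * \<phi> (0, x))"
  proof (rule integral_cong_AE)
    show "AE x in lborel. \<bar>u x - k\<bar> * \<phi> (0, x) = \<bar>u' x - k\<bar> * \<phi> (0, x)" using u by eventually_elim simp
  qed measurable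
  ultimately show ?thesis by (simp add: kruz_half)
qed

lemma test2_test_box:
  assumes "test2 \<phi>" "\<forall>z. 0 \<le> \<phi> z"
  obtains R N where "0 < R" "test_box R R N \<phi>"
proof -
  obtain R where R: "0 < R" "\<And>t x. R \<le> \<bar>t\<bar> \<or> R \<le> \<bar>x\<bar> \<Longrightarrow> \<phi> (t, x) = 0" using test2_support[OF assms(1)] by metis
  obtain N where N: "\<And>z. \<bar>\<phi> z\<bar> \<le> N" "\<And>z. \<bar>pt \<phi> z\<bar> \<le> N" "\<And>z. \<bar>px \<phi> z\<bar> \<le> N" using test2_bounded[OF assms(1)] by metis
  have z: "\<phi> (t, x) = 0" if "R \<le> t \<or> R \<le> \<bar>x\<bar>" for t x using that abs_ge_self[of t] by (intro R(2)) linarith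
  have n: "\<phi> z \<le> N" for z using N(1)[of z] by linarith
  have "test_box R R N \<phi>" unfolding test_box_def using assms n N z by blast
  then show ?thesis using that R(1) by blast
qed

section \<open>Entropy solution, uniqueness and convergence\<close>

context rb_family begin

text \<open>The almost everywhere limit is truncated twice: at \<open>KT t\<close>, to have bounds
  at every point before the maximum principle is applied, and then at \<open>KT 0\<close>, which
  that principle shows to change only a null set of positive times.\<close>

lemma limit_exists:
  obtains ls w where "\<forall>n::nat. 0 < ls n" "\<forall>n. ls n \<le> 1" "ls \<longlonglongrightarrow> 0"
    "(\<lambda>z. w (fst z) (snd z)) \<in> borel_measurable borel" "\<forall>t x. \<bar>w t x\<bar> \<le> KT 0"
    "AE z in lborel. 0 < fst z \<longrightarrow> (\<lambda>n. tp (v (ls n)) (fst z) (snd z)) \<longlonglongrightarrow> w (fst z) (snd z)"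
proof -
  obtain ls :: "nat \<Rightarrow> real" and W where ls': "\<forall>n. 0 < ls n" "\<forall>n. ls n \<le> 1" and ls0: "ls \<longlonglongrightarrow> 0" and Wm [measurable]: "W \<in> borel_measurable borel"
    and lim: "AE z in lborel. 0 < fst z \<longrightarrow> (\<lambda>n. tp (v (ls n)) (fst z) (snd z)) \<longlonglongrightarrow> W z"
    by (rule limit_sequence)
  have ls: "\<And>n. 0 < ls n" "\<And>n. ls n \<le> 1" "ls \<longlonglongrightarrow> 0" using ls' ls0 by auto
  \<comment> \<open>The approximate solutions already obey this bound, so the truncation commutes
    with the limit.\<close>
  define w0 where "w0 t x = max (- KT t) (min (KT t) (W (t, x)))" for t x
  have [measurable]: "KT \<in> borel_measurable borel" unfolding KT_def[abs_def] by measurable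
  have w0m [measurable]: "(\<lambda>z. w0 (fst z) (snd z)) \<in> borel_measurable borel" unfolding w0_def by measurable
  have w0K: "\<bar>w0 t x\<bar> \<le> KT t" for t x using KT0[of t] by (auto simp: w0_def)
  have lim0: "AE z in lborel. 0 < fst z \<longrightarrow> (\<lambda>n. tp (v (ls n)) (fst z) (snd z)) \<longlonglongrightarrow> w0 (fst z) (snd z)"
    using lim
  proof eventually_elim
    case (elim z)
    show ?case
    proof
      assume z: "0 < fst z"
      let ?K = "KT (fst z)"
      have "(\<lambda>n. max (- ?K) (min ?K (tp (v (ls n)) (fst z) (snd z)))) \<longlonglongrightarrow> max (- ?K) (min ?K (W z))"
        using elim z by (intro tendsto_max tendsto_min tendsto_const) auto
      moreover have "max (- ?K) (min ?K (tp (v (ls n)) (fst z) (snd z))) = tp (v (ls n)) (fst z) (snd z)" for n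
        using appr_facts(2)[OF ls(1,2) v(1)[OF ls(1)], of "fst z" "fst z" n "snd z"] z by (simp add: tp_def abs_le_iff)
      ultimately show "(\<lambda>n. tp (v (ls n)) (fst z) (snd z)) \<longlonglongrightarrow> w0 (fst z) (snd z)" by (simp add: w0_def)
    qed
  qed
  have kr: "0 \<le> kruz f g w0 k \<phi>" if "test_box T R N \<phi>" "0 < T" "0 < R" for T R N \<phi> k
    by (rule kruz_limit[OF ls w0m lim0 that(1)]) (use that(2,3) in auto)
  \<comment> \<open>The bound now holds at every point, including times that are not
    positive.\<close>
  define w where "w t x = max (- KT 0) (min (KT 0) (w0 t x))" for t x
  have wm: "(\<lambda>z. w (fst z) (snd z)) \<in> borel_measurable borel" unfolding w_def by measurable
  have wK: "\<bar>w t x\<bar> \<le> KT 0" for t x using KT0[of 0] by (auto simp: w_def)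
  have "AE z in lborel. 0 < fst z \<longrightarrow> 1 * w0 (fst z) (snd z) \<le> KT 0" by (rule max_principle[OF w0m w0K]) (rule kr, assumption+, simp)
  moreover have "AE z in lborel. 0 < fst z \<longrightarrow> (-1) * w0 (fst z) (snd z) \<le> KT 0" by (rule max_principle[OF w0m w0K]) (rule kr, assumption+, simp)
  ultimately have "AE z in lborel. 0 < fst z \<longrightarrow> (\<lambda>n. tp (v (ls n)) (fst z) (snd z)) \<longlonglongrightarrow> w (fst z) (snd z)"
    using lim0
  proof eventually_elim
    case (elim z)
    then have "w (fst z) (snd z) = w0 (fst z) (snd z)" if "0 < fst z" using that by (simp add: w_def)
    then show ?case using elim by simp
  qed
  then show ?thesis using wK by (intro that[OF ls' ls0 wm]) auto
qed

context
  fixes ls :: "nat \<Rightarrow> real" and w :: "real \<Rightarrow> real \<Rightarrow> real"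
  assumes ls: "\<And>n. 0 < ls n" "\<And>n. ls n \<le> 1" "ls \<longlonglongrightarrow> 0"
    and wm [measurable]: "(\<lambda>z. w (fst z) (snd z)) \<in> borel_measurable borel" and wK: "\<And>t x. \<bar>w t x\<bar> \<le> KT 0"
    and lim: "AE z in lborel. 0 < fst z \<longrightarrow> (\<lambda>n. tp (v (ls n)) (fst z) (snd z)) \<longlonglongrightarrow> w (fst z) (snd z)"
begin

lemma u0_borel [measurable]: "u0 \<in> borel_measurable borel" using u0m by simp

lemma slice_borel [measurable]: "w t \<in> borel_measurable borel"
proof -
  have "(\<lambda>x. (\<lambda>z. w (fst z) (snd z)) (t, x)) \<in> borel_measurable borel" by measurable
  then show ?thesis by simp
qed

lemma limit_entropy_solution: "entropy_solution f u0 w"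
  unfolding entropy_solution_def
proof (intro conjI allI impI)
  show "(\<lambda>z. w (fst z) (snd z)) \<in> borel_measurable lborel" by simp
  show "\<exists>B. AE z in lborel. 0 < fst z \<longrightarrow> \<bar>w (fst z) (snd z)\<bar> \<le> B" using wK by (intro exI[of _ "KT 0"]) simp
  fix k \<phi> assume "test2 \<phi> \<and> (\<forall>z. 0 \<le> \<phi> z)"
  then obtain R N where R: "0 < R" and \<phi>: "test_box R R N \<phi>" by (metis test2_test_box)
  have "0 \<le> kruz f g w k \<phi>" by (rule kruz_limit[OF ls wm lim \<phi>]) (use R in auto)
  also have "kruz f g w k \<phi> = kruz f u0 w k \<phi>"
  proof (rule kruz_cong_AE[OF f_isCont \<phi> wm wm gm u0_borel])
    show "AE x in lborel. g x = u0 x" using gu by eventually_elim simp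
  qed simp
  finally show "0 \<le> set_lebesgue_integral lborel ({0<..} \<times> UNIV)
     (\<lambda>z. \<bar>w (fst z) (snd z) - k\<bar> * pt \<phi> z + sgn (w (fst z) (snd z) - k) * (f (w (fst z) (snd z)) - f k) * px \<phi> z)
   + (LBINT x. \<bar>u0 x - k\<bar> * \<phi> (0, x))" by (simp only: kruz_def)
qed

lemma limit_Linf_loc_L1_loc: "Linf_loc_L1_loc w"
  unfolding Linf_loc_L1_loc_def
proof (intro conjI allI)
  show "(\<lambda>z. w (fst z) (snd z)) \<in> borel_measurable lborel" by simp
  fix T a b :: real
  have i: "integrable lborel (\<lambda>x. indicator {a..b} x * w t x)" for t
    by (rule integrable_bounded_box[where B = "KT 0" and a = a and b = b]) (use wK KT0 in \<open>auto simp: indicator_def\<close>)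
  have ic: "integrable lborel (\<lambda>x. indicator {a..b} x * KT 0)"
    by (rule integrable_bounded_box[where B = "KT 0" and a = a and b = b]) (use KT0 in \<open>auto simp: indicator_def\<close>)
  have "(LBINT x:{a..b}. \<bar>w t x\<bar>) \<le> (LBINT x. indicator {a..b} x * KT 0)" for t
    unfolding set_lebesgue_integral_def
  proof (rule integral_mono[OF _ ic])
    show "integrable lborel (\<lambda>x. indicator {a..b} x *\<^sub>R \<bar>w t x\<bar>)" using integrable_abs[OF i[of t]] by (simp add: abs_mult)
    show "indicator {a..b} x *\<^sub>R \<bar>w t x\<bar> \<le> indicator {a..b} x * KT 0" for x using wK by (auto simp: indicator_def)
  qed
  then show "\<exists>B. AE t in lborel. 0 \<le> t \<and> t \<le> T \<longrightarrow> set_integrable lborel {a..b} (w t) \<and> set_lebesgue_integral lborel {a..b} (\<lambda>x. \<bar>w t x\<bar>) \<le> B"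
    using i by (intro exI AE_I2) (auto simp: set_integrable_def)
qed

text \<open>An entropy solution has defect 0, so \<open>compare\<close> places it near
  \<open>v (ls m)\<close> for large \<open>m\<close>, and these converge to \<open>w\<close> in L1
  of every box.\<close>

lemma limit_unique:
  assumes w': "entropy_solution f u0 w'"
  shows "AE z in lborel. 0 < fst z \<longrightarrow> w' (fst z) (snd z) = w (fst z) (snd z)"
proof -
  have w'm [measurable]: "(\<lambda>z. w' (fst z) (snd z)) \<in> borel_measurable borel"
    and kr': "\<And>k \<phi>. test2 \<phi> \<Longrightarrow> (\<forall>z. 0 \<le> \<phi> z) \<Longrightarrow> 0 \<le> kruz f u0 w' k \<phi>"
    using w' unfolding entropy_solution_def kruz_def by auto
  obtain B where B: "AE z in lborel. 0 < fst z \<longrightarrow> \<bar>w' (fst z) (snd z)\<bar> \<le> B" using w' unfolding entropy_solution_def by blast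
  \<comment> \<open>Boundedness almost everywhere becomes boundedness at every point by a change on
    a null set of positive times.\<close>
  define A where "A t x = (if \<bar>w' t x\<bar> \<le> B then w' t x else 0)" for t x
  have Am [measurable]: "(\<lambda>z. A (fst z) (snd z)) \<in> borel_measurable borel" unfolding A_def by measurable
  have AB: "\<bar>A t x\<bar> \<le> \<bar>B\<bar>" for t x by (auto simp: A_def)
  have Aw': "AE z in lborel. 0 < fst z \<longrightarrow> A (fst z) (snd z) = w' (fst z) (snd z)" using B by eventually_elim (simp add: A_def)
  have gu': "AE x in lborel. g x = u0 x" using gu by eventually_elim simp
  have krA: "0 \<le> kruz f g A k \<phi>" if \<phi>: "test_box T R N \<phi>" for T R N k \<phi>
  proof -
    have "kruz f g A k \<phi> = kruz f u0 w' k \<phi>" by (rule kruz_cong_AE[OF f_isCont \<phi> Am w'm gm u0_borel Aw' gu'])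
    then show ?thesis using kr'[of \<phi> k] \<phi> by (simp add: test_box_def)
  qed
  have "AE z in lborel. 0 < fst z \<longrightarrow> A (fst z) (snd z) = w (fst z) (snd z)"
  proof (rule AE_pos_time)
    fix n :: nat
    define T1 where "T1 = real (Suc n)"
    have T1: "0 < T1" by (simp add: T1_def)
    define K1 where "K1 = max (KT (2 * T1 + 1)) \<bar>B\<bar>"
    have K1: "KT (2 * T1 + 1) \<le> K1" by (simp add: K1_def)
    have gK: "\<bar>g x\<bar> \<le> K1" for x using g_bound[of x] KT_mono[of 0 "2 * T1 + 1"] T1 K1 by linarith
    obtain Ra where cmp: "\<forall>e>0. \<exists>\<eta>>0. \<eta> \<le> 1 \<and> comparable T1 T1 (2 * T1 + 1) Ra K1 \<eta> e"
      by (rule compare[OF T1 T1 K1 gK])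
    define S where "S m z = tp (v (ls m)) (fst z) (snd z)" for m and z :: "real \<times> real"
    have Sm [measurable]: "S m \<in> borel_measurable borel" for m unfolding S_def[abs_def] by (rule v_meas[OF ls(1,2)])
    have SK: "\<bar>S m z\<bar> \<le> K1" if "bx T1 T1 z \<noteq> 0" for m z
    proof -
      have "0 \<le> fst z" "fst z \<le> 2 * T1 + 1" using that T1 by (auto simp: bx_def indicator_def split: if_splits)
      then show ?thesis using appr_facts(2)[OF ls(1,2) v(1)[OF ls(1)], of "fst z" "2 * T1 + 1" m "snd z"] K1 by (simp add: S_def tp_def)
    qed
    have wK1: "\<bar>w t x\<bar> \<le> K1" for t x using wK[of t x] KT_mono[of 0 "2 * T1 + 1"] T1 K1 by linarith
    have S0: "(\<lambda>m. LBINT z. bx T1 T1 z * \<bar>S m z - w (fst z) (snd z)\<bar>) \<longlonglongrightarrow> 0"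
      by (rule bx_L1_tendsto[OF Sm wm SK wK1]) (use lim in \<open>simp_all add: S_def\<close>)
    have AK: "\<bar>A t x\<bar> \<le> K1" for t x using AB[of t x] by (simp add: K1_def)
    have iSw: "integrable lborel (\<lambda>z. bx T1 T1 z * \<bar>S m z - w (fst z) (snd z)\<bar>)" for m
    proof (rule bx_integrable[where B = "2 * K1"])
      show "\<bar>\<bar>S m z - w (fst z) (snd z)\<bar>\<bar> \<le> 2 * K1" if "bx T1 T1 z \<noteq> 0" for z using SK[OF that, of m] wK1[of "fst z" "snd z"] by linarith
    qed measurable
    have iAS: "integrable lborel (\<lambda>z. bx T1 T1 z * \<bar>A (fst z) (snd z) - S m z\<bar>)" for m
    proof (rule bx_integrable[where B = "2 * K1"])
      show "\<bar>\<bar>A (fst z) (snd z) - S m z\<bar>\<bar> \<le> 2 * K1" if "bx T1 T1 z \<noteq> 0" for z using SK[OF that, of m] AK[of "fst z" "snd z"] by linarith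
    qed measurable
    have iAw: "integrable lborel (\<lambda>z. bx T1 T1 z * \<bar>A (fst z) (snd z) - w (fst z) (snd z)\<bar>)"
    proof (rule bx_integrable[where B = "2 * K1"])
      show "\<bar>\<bar>A (fst z) (snd z) - w (fst z) (snd z)\<bar>\<bar> \<le> 2 * K1" for z using wK1[of "fst z" "snd z"] AK[of "fst z" "snd z"] by linarith
    qed measurable
    have "(LBINT z. bx T1 T1 z * \<bar>A (fst z) (snd z) - w (fst z) (snd z)\<bar>) \<le> 0"
    proof (rule field_le_epsilon)
      fix e :: real assume "0 < e"
      then have e2: "0 < e / 2" by simp
      obtain \<eta> where \<eta>: "0 < \<eta>" and C: "comparable T1 T1 (2 * T1 + 1) Ra K1 \<eta> (e / 2)"
        using cmp[rule_format, OF e2] by blast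
      have "\<forall>\<^sub>F m in sequentially. ls m < \<eta> \<and> (LBINT z. bx T1 T1 z * \<bar>S m z - w (fst z) (snd z)\<bar>) < e / 2"
        using order_tendstoD(2)[OF ls(3) \<eta>] order_tendstoD(2)[OF S0 e2] by (rule eventually_conj)
      then obtain m where m: "ls m < \<eta>" "(LBINT z. bx T1 T1 z * \<bar>S m z - w (fst z) (snd z)\<bar>) < e / 2"
        using eventually_happens trivial_limit_sequentially by blast
      have "(LBINT z. bx T1 T1 z * \<bar>A (fst z) (snd z) - v (ls m) (fst z) (snd z)\<bar>) < e / 2"
        by (rule comparableD[OF C ls(1) m(1) order_refl \<eta> v(1)[OF ls(1)] Am AK]) (use krA in simp)
      moreover have "(LBINT z. bx T1 T1 z * \<bar>A (fst z) (snd z) - v (ls m) (fst z) (snd z)\<bar>) = (LBINT z. bx T1 T1 z * \<bar>A (fst z) (snd z) - S m z\<bar>)"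
        by (intro Bochner_Integration.integral_cong refl) (auto simp: bx_def indicator_def S_def tp_def)
      moreover have "(LBINT z. bx T1 T1 z * \<bar>A (fst z) (snd z) - w (fst z) (snd z)\<bar>)
          \<le> (LBINT z. bx T1 T1 z * \<bar>A (fst z) (snd z) - S m z\<bar> + bx T1 T1 z * \<bar>S m z - w (fst z) (snd z)\<bar>)"
      proof (rule integral_mono[OF iAw Bochner_Integration.integrable_add[OF iAS iSw]])
        fix z
        have "\<bar>A (fst z) (snd z) - w (fst z) (snd z)\<bar> \<le> \<bar>A (fst z) (snd z) - S m z\<bar> + \<bar>S m z - w (fst z) (snd z)\<bar>" by linarith
        from mult_left_mono[OF this bx_bounds(1)]
        show "bx T1 T1 z * \<bar>A (fst z) (snd z) - w (fst z) (snd z)\<bar> \<le> bx T1 T1 z * \<bar>A (fst z) (snd z) - S m z\<bar> + bx T1 T1 z * \<bar>S m z - w (fst z) (snd z)\<bar>"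
          by (simp only: distrib_left)
      qed
      ultimately show "(LBINT z. bx T1 T1 z * \<bar>A (fst z) (snd z) - w (fst z) (snd z)\<bar>) \<le> 0 + e"
        using m(2) Bochner_Integration.integral_add[OF iAS[of m] iSw[of m]] by linarith
    qed
    moreover have nn: "AE z in lborel. 0 \<le> bx T1 T1 z * \<bar>A (fst z) (snd z) - w (fst z) (snd z)\<bar>" using bx_bounds by auto
    ultimately have "(LBINT z. bx T1 T1 z * \<bar>A (fst z) (snd z) - w (fst z) (snd z)\<bar>) = 0" using integral_nonneg_AE[OF nn] by linarith
    then have "AE z in lborel. bx T1 T1 z * \<bar>A (fst z) (snd z) - w (fst z) (snd z)\<bar> = 0" using integral_nonneg_eq_0_iff_AE[OF iAw nn] by blast
    then show "AE z in lborel. bx (real (Suc n)) (real (Suc n)) z \<noteq> 0 \<longrightarrow> A (fst z) (snd z) = w (fst z) (snd z)"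
      unfolding T1_def[symmetric] by eventually_elim auto
  qed
  with Aw' show ?thesis by eventually_elim simp
qed

text \<open>In the Cauchy estimate at a fixed time the second parameter runs along
  \<open>ls\<close>. The exceptional times are those at which the chosen sequence fails to converge
  almost everywhere in space; this set does not depend on \<open>l\<close>, hence the quantifier
  over \<open>l\<close> inside.\<close>

lemma v_limit:
  assumes T1: "0 < T1" and R1: "0 < R1" and e: "0 < e"
  obtains \<eta> where "0 < \<eta>" "\<eta> \<le> 1" "AE t in lborel. \<forall>l. 0 < l \<longrightarrow> l < \<eta> \<longrightarrow> 0 < t \<longrightarrow> t \<le> T1 \<longrightarrow> (LBINT x:{-R1..R1}. \<bar>v l t x - w t x\<bar>) \<le> e"
proof -
  obtain \<eta> where \<eta>: "0 < \<eta>" "\<eta> \<le> 1" and C: "\<And>l l' t. 0 < l \<Longrightarrow> l < \<eta> \<Longrightarrow> 0 < l' \<Longrightarrow> l' < \<eta> \<Longrightarrow> 0 \<le> t \<Longrightarrow> t \<le> T1 \<Longrightarrow>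
     (LBINT x:{-R1..R1}. \<bar>v l' t x - v l t x\<bar>) < e"
    using sup_cauchy[OF T1 R1 e] by blast
  have "AE t in lborel. AE x in lborel. 0 < t \<longrightarrow> (\<lambda>n. tp (v (ls n)) t x) \<longlonglongrightarrow> w t x"
    using lborel_pair.AE_pair[OF lim[unfolded lborel_prod[symmetric]]] by simp
  then have "AE t in lborel. \<forall>l. 0 < l \<longrightarrow> l < \<eta> \<longrightarrow> 0 < t \<longrightarrow> t \<le> T1 \<longrightarrow> (LBINT x:{-R1..R1}. \<bar>v l t x - w t x\<bar>) \<le> e"
  proof eventually_elim
    case (elim t)
    show ?case
    proof (intro allI impI)
      fix l assume l: "0 < l" "l < \<eta>" and t: "0 < t" "t \<le> T1"
      have l1: "l \<le> 1" using l \<eta> by linarith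
      note F = appr_facts[OF l(1) l1 v(1)[OF l(1)]] and Fn = appr_facts[OF ls(1,2) v(1)[OF ls(1)]]
      have t0: "0 \<le> t" using t by simp
      have [measurable]: "v l t \<in> borel_measurable borel" by (rule isCont_borel[OF F(7)[OF t0]])
      have [measurable]: "v (ls n) t \<in> borel_measurable borel" for n by (rule isCont_borel[OF Fn(7)[OF t0]])
      have cv: "(\<lambda>n. LBINT x:{-R1..R1}. \<bar>v l t x - v (ls n) t x\<bar>) \<longlonglongrightarrow> (LBINT x:{-R1..R1}. \<bar>v l t x - w t x\<bar>)"
        unfolding set_lebesgue_integral_def
      proof (rule integral_dominated_convergence[where w = "\<lambda>x. indicator {-R1..R1} x * (2 * KT T1)"])
        show "integrable lborel (\<lambda>x. indicator {-R1..R1} x * (2 * KT T1))"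
          by (rule integrable_bounded_box[where B = "2 * KT T1" and a = "-R1" and b = R1]) (use KT0 in \<open>auto simp: indicator_def\<close>)
        show "AE x in lborel. (\<lambda>n. indicat_real {-R1..R1} x *\<^sub>R \<bar>v l t x - v (ls n) t x\<bar>) \<longlonglongrightarrow> indicat_real {-R1..R1} x *\<^sub>R \<bar>v l t x - w t x\<bar>"
          using elim
        proof eventually_elim
          case (elim x)
          then have "(\<lambda>n. v (ls n) t x) \<longlonglongrightarrow> w t x" using t by (simp add: tp_def)
          then show ?case by (intro tendsto_intros)
        qed
        show "AE x in lborel. norm (indicat_real {-R1..R1} x *\<^sub>R \<bar>v l t x - v (ls n) t x\<bar>) \<le> indicat_real {-R1..R1} x * (2 * KT T1)" for n
        proof (rule AE_I2)
          fix x
          have "\<bar>v l t x - v (ls n) t x\<bar> \<le> 2 * KT T1" using F(2)[OF t0 t(2), of x] Fn(2)[OF t0 t(2), of n x] by linarith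
          then show "norm (indicat_real {-R1..R1} x *\<^sub>R \<bar>v l t x - v (ls n) t x\<bar>) \<le> indicat_real {-R1..R1} x * (2 * KT T1)" by (auto simp: indicator_def)
        qed
      qed measurable
      have "\<forall>\<^sub>F n in sequentially. (LBINT x:{-R1..R1}. \<bar>v l t x - v (ls n) t x\<bar>) \<le> e"
        using order_tendstoD(2)[OF ls(3) \<eta>(1)] by (rule eventually_mono) (use C[OF ls(1) _ l t0 t(2)] less_imp_le in blast)
      with cv show "(LBINT x:{-R1..R1}. \<bar>v l t x - w t x\<bar>) \<le> e" by (rule tendsto_upperbound) simp
    qed
  qed
  then show ?thesis by (rule that[OF \<eta>])
qed

text \<open>\<open>u l\<close> is within \<open>l\<close> of \<open>v l\<close>, and
  \<open>v l\<close> tends to \<open>w\<close> in L1 uniformly in time; a common bound of the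
  differences raises the exponent from 1 to \<open>p\<close>.\<close>

lemma limit_conv:
  assumes p: "1 \<le> p"
  shows "conv_Linf_loc_Lp_loc p u w"
  unfolding conv_Linf_loc_Lp_loc_def
proof (intro allI impI)
  fix T a b e :: real assume e: "0 < e"
  define T1 where "T1 = max T 0 + 1"
  define R1 where "R1 = \<bar>a\<bar> + \<bar>b\<bar> + 1"
  have T1: "0 < T1" "T \<le> T1" and R1: "0 < R1" by (auto simp: T1_def R1_def)
  \<comment> \<open>Bounds \<open>\<bar>u l t x - w t x\<bar>\<close> on the box:
    \<open>KT T1\<close> for \<open>v l\<close>, \<open>KT 0\<close> for \<open>w\<close>, and 1 for
    the distance between \<open>u l\<close> and \<open>v l\<close>.\<close>
  define Kb where "Kb = KT T1 + KT 0 + 1"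
  define Kp where "Kp = Kb powr (p - 1)"
  have Kb: "1 \<le> Kb" using KT0 by (simp add: Kb_def)
  have Kp: "0 < Kp" using Kb by (simp add: Kp_def)
  have e4: "0 < e / (4 * Kp)" using e Kp by simp
  obtain \<eta>0 where \<eta>0: "0 < \<eta>0" "\<eta>0 \<le> 1"
    and C: "AE t in lborel. \<forall>l. 0 < l \<longrightarrow> l < \<eta>0 \<longrightarrow> 0 < t \<longrightarrow> t \<le> T1 \<longrightarrow> (LBINT x:{-R1..R1}. \<bar>v l t x - w t x\<bar>) \<le> e / (4 * Kp)"
    by (rule v_limit[OF T1(1) R1 e4])
  \<comment> \<open>Besides the Cauchy threshold: the box of size \<open>1 / l\<close> must contain
    the region considered, and the distance \<open>l\<close>, integrated over an interval of length
    \<open>2 * R1\<close>, may contribute at most \<open>e / 4\<close>.\<close>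
  define \<eta> where "\<eta> = min \<eta>0 (min (min (1 / T1) (1 / R1)) (e / (8 * R1 * Kp)))"
  have \<eta>: "0 < \<eta>" using \<eta>0 T1 R1 e Kp by (simp add: \<eta>_def)
  show "\<forall>\<^sub>F l in at_right 0. AE t in lborel. 0 \<le> t \<and> t \<le> T \<longrightarrow>
        set_integrable lborel {a..b} (\<lambda>x. \<bar>u l t x - w t x\<bar> powr p) \<and>
        set_lebesgue_integral lborel {a..b} (\<lambda>x. \<bar>u l t x - w t x\<bar> powr p) < e"
  proof (rule eventually_at_rightI[OF _ \<eta>])
    fix l assume "l \<in> {0<..<\<eta>}"
    then have l: "0 < l" "l < \<eta>" by auto
    then have l1: "l < \<eta>0" "l \<le> 1" using \<eta>0 by (auto simp: \<eta>_def)
    have lT: "T1 \<le> 1 / l" "R1 \<le> 1 / l"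
    proof -
      have "l < 1 / T1" "l < 1 / R1" using l by (auto simp: \<eta>_def)
      then show "T1 \<le> 1 / l" "R1 \<le> 1 / l" using l T1 R1 by (simp_all add: field_simps)
    qed
    have le: "l * (8 * R1 * Kp) < e"
    proof -
      have "l < e / (8 * R1 * Kp)" using l by (simp add: \<eta>_def)
      then show ?thesis using R1 Kp by (simp add: pos_less_divide_eq)
    qed
    note F = appr_facts[OF l(1) l1(2) v(1)[OF l(1)]]
    \<comment> \<open>The estimate for \<open>v l\<close> concerns positive times; time 0 is a null
      set.\<close>
    have "AE t in lborel. t \<noteq> (0::real)" by (rule AE_lborel_singleton)
    with C show "AE t in lborel. 0 \<le> t \<and> t \<le> T \<longrightarrow>
        set_integrable lborel {a..b} (\<lambda>x. \<bar>u l t x - w t x\<bar> powr p) \<and>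
        set_lebesgue_integral lborel {a..b} (\<lambda>x. \<bar>u l t x - w t x\<bar> powr p) < e"
    proof eventually_elim
      case (elim t)
      show ?case
      proof
        assume "0 \<le> t \<and> t \<le> T"
        then have t: "0 < t" "0 \<le> t" "t \<le> T1" using elim(2) T1 by auto
        have D: "(LBINT x:{-R1..R1}. \<bar>v l t x - w t x\<bar>) \<le> e / (4 * Kp)" using elim(1) l l1 t by blast
        have [measurable]: "v l t \<in> borel_measurable borel" by (rule isCont_borel[OF F(7)[OF t(2)]])
        \<comment> \<open>Continuity of \<open>u l t\<close> is at hand on bounded intervals, so
          measurability is obtained after a cut-off.\<close>
        have um [measurable]: "(\<lambda>x. indicator {a..b} x *\<^sub>R u l t x) \<in> borel_measurable borel"
          by (rule borel_measurable_continuous_on_indicator[OF _ u_cont[OF l(1) l1(2) t(2)]]) simp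
        have ab: "x \<in> {-R1..R1}" if "x \<in> {a..b}" for x using that by (auto simp: R1_def)
        have uv: "\<bar>v l t x - u l t x\<bar> < l" if "x \<in> {-R1..R1}" for x
          by (rule v(2)[OF l(1) t(2)]) (use t lT that in auto)
        have uw: "\<bar>u l t x - w t x\<bar> \<le> l + \<bar>v l t x - w t x\<bar>" if "x \<in> {-R1..R1}" for x using uv[OF that] by linarith
        have vw: "\<bar>v l t x - w t x\<bar> \<le> KT T1 + KT 0" for x using F(2)[OF t(2,3), of x] wK[of t x] by linarith
        have uK: "\<bar>u l t x - w t x\<bar> \<le> Kb" if "x \<in> {-R1..R1}" for x using uw[OF that] vw[of x] l1 by (simp add: Kb_def)
        have pw: "\<bar>u l t x - w t x\<bar> powr p \<le> Kp * (l + \<bar>v l t x - w t x\<bar>)" if "x \<in> {-R1..R1}" for x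
        proof -
          have "\<bar>u l t x - w t x\<bar> powr p \<le> Kp * \<bar>u l t x - w t x\<bar>" unfolding Kp_def by (rule powr_le_linear[OF _ uK[OF that] p]) simp
          also have "\<dots> \<le> Kp * (l + \<bar>v l t x - w t x\<bar>)" using uw[OF that] Kp by (intro mult_left_mono) auto
          finally show ?thesis .
        qed
        have i: "integrable lborel (\<lambda>x. indicat_real {a..b} x *\<^sub>R \<bar>u l t x - w t x\<bar> powr p)"
        proof (rule integrable_bounded_box[where B = "Kp * (1 + (KT T1 + KT 0))" and a = a and b = b])
          have "(\<lambda>x. indicat_real {a..b} x * \<bar>indicator {a..b} x *\<^sub>R u l t x - w t x\<bar> powr p) \<in> borel_measurable borel" by measurable
          also have "(\<lambda>x. indicat_real {a..b} x * \<bar>indicator {a..b} x *\<^sub>R u l t x - w t x\<bar> powr p) = (\<lambda>x. indicat_real {a..b} x *\<^sub>R \<bar>u l t x - w t x\<bar> powr p)"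
            by (auto simp: indicator_def)
          finally show "(\<lambda>x. indicat_real {a..b} x *\<^sub>R \<bar>u l t x - w t x\<bar> powr p) \<in> borel_measurable borel" .
          fix x
          have K0: "0 \<le> Kp * (1 + (KT T1 + KT 0))" using Kp KT0[of T1] KT0[of 0] by simp
          show "\<bar>indicat_real {a..b} x *\<^sub>R \<bar>u l t x - w t x\<bar> powr p\<bar> \<le> Kp * (1 + (KT T1 + KT 0))"
          proof (cases "x \<in> {a..b}")
            case True
            have "Kp * (l + \<bar>v l t x - w t x\<bar>) \<le> Kp * (1 + (KT T1 + KT 0))" using Kp l1 vw[of x] by (intro mult_left_mono add_mono) auto
            then show ?thesis using True pw[OF ab[OF True]] by simp
          qed (use K0 in simp)
          show "indicat_real {a..b} x *\<^sub>R \<bar>u l t x - w t x\<bar> powr p = 0" if "x \<notin> cbox a b" using that by simp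
        qed
        have ivw: "set_integrable lborel {-R1..R1} (\<lambda>x. \<bar>v l t x - w t x\<bar>)" unfolding set_integrable_def
        proof (rule integrable_bounded_box[where B = "KT T1 + KT 0" and a = "-R1" and b = R1])
          show "\<bar>indicat_real {-R1..R1} x *\<^sub>R \<bar>v l t x - w t x\<bar>\<bar> \<le> KT T1 + KT 0" for x
            using vw[of x] KT0[of T1] KT0[of 0] by (auto simp: indicator_def)
        qed auto
        have il: "set_integrable lborel {-R1..R1} (\<lambda>x. l)" by (rule set_integrable_cont) simp
        have i2: "set_integrable lborel {-R1..R1} (\<lambda>x. Kp * (l + \<bar>v l t x - w t x\<bar>))"
          by (intro set_integrable_mult_right set_integral_add il ivw)
        have "(LBINT x:{a..b}. \<bar>u l t x - w t x\<bar> powr p) \<le> (LBINT x:{-R1..R1}. Kp * (l + \<bar>v l t x - w t x\<bar>))"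
          unfolding set_lebesgue_integral_def
        proof (rule integral_mono[OF i i2[unfolded set_integrable_def]])
          fix x
          show "indicat_real {a..b} x *\<^sub>R \<bar>u l t x - w t x\<bar> powr p \<le> indicat_real {-R1..R1} x *\<^sub>R (Kp * (l + \<bar>v l t x - w t x\<bar>))"
          proof (cases "x \<in> {a..b}")
            case True
            then show ?thesis using pw[OF ab[OF True]] ab[OF True] by simp
          next
            case False
            moreover have "0 \<le> indicat_real {-R1..R1} x *\<^sub>R (Kp * (l + \<bar>v l t x - w t x\<bar>))"
              using Kp l by (intro scaleR_nonneg_nonneg mult_nonneg_nonneg add_nonneg_nonneg) auto
            ultimately show ?thesis by simp
          qed
        qed
        also have "\<dots> = Kp * ((LBINT x:{-R1..R1}. l) + (LBINT x:{-R1..R1}. \<bar>v l t x - w t x\<bar>))"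
          using set_integral_add(2)[OF il ivw] by simp
        also have "(LBINT x:{-R1..R1}. l) = 2 * R1 * l" using R1 by (simp add: set_lebesgue_integral_def)
        also have "Kp * (2 * R1 * l + (LBINT x:{-R1..R1}. \<bar>v l t x - w t x\<bar>)) \<le> Kp * (2 * R1 * l + e / (4 * Kp))"
          using D Kp by (intro mult_left_mono add_left_mono) auto
        also have "\<dots> = l * (8 * R1 * Kp) / 4 + e / 4" using Kp by (simp add: field_simps)
        also have "\<dots> < e" using le e by linarith
        finally have "(LBINT x:{a..b}. \<bar>u l t x - w t x\<bar> powr p) < e" .
        then show "set_integrable lborel {a..b} (\<lambda>x. \<bar>u l t x - w t x\<bar> powr p) \<and> (LBINT x:{a..b}. \<bar>u l t x - w t x\<bar> powr p) < e"
          using i by (simp add: set_integrable_def)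
      qed
    qed
  qed
qed

end

end

theorem theorem3p2:
  fixes f u0 u0' :: "real \<Rightarrow> real" and c C M :: real
    and u :: "real \<Rightarrow> real \<Rightarrow> real \<Rightarrow> real"
  assumes "C4 f" and "0 < c" and "c \<le> C"
    and "\<forall>v. c \<le> (deriv ^^ 2) f v \<and> (deriv ^^ 2) f v \<le> C"
    and "L2 u0" and "weak_deriv u0 u0'" and "L2 u0'"
    and "integrable lborel u0'"
    and "AE x in lborel. u0' x \<le> M"
    and "\<forall>l>0. constructed_dissipative_solution f u0 l (u l)"
  shows "\<exists>w. Linf_loc_L1_loc w \<and>
           (\<forall>p. 1 \<le> p \<longrightarrow> conv_Linf_loc_Lp_loc p u w) \<and>
           entropy_solution f u0 w \<and>
           (\<forall>w'. entropy_solution f u0 w' \<longrightarrow>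
              (AE z in lborel. 0 < fst z \<longrightarrow> w' (fst z) (snd z) = w (fst z) (snd z)))"
proof -
  \<comment> \<open>Any one of the constructed solutions supplies a Friedrichs kernel, the bump
    required for the lemma of du Bois-Reymond.\<close>
  have "constructed_dissipative_solution f u0 1 (u 1)" using assms(10) by simp
  then obtain j where j: "friedrichs j" unfolding constructed_dissipative_solution_def by blast
  obtain c0 where c0: "AE x in lborel. u0 x = c0 + prim u0' x" by (rule weak_deriv_prim[OF j assms(6)])
  note wi = weak_deriv_loc_int(2)[OF assms(6)]
  \<comment> \<open>The continuous representative of \<open>u0\<close> is a primitive of
    \<open>u0'\<close>. The one-sided bound has to be nonnegative for the Oleinik estimate, hence
    \<open>max M 0\<close>.\<close>
  interpret rb_family u0 u0' "\<lambda>x. c0 + prim u0' x" "max M 0" f c C u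
  proof
    show "u0 \<in> borel_measurable lborel" using assms(5) by (simp add: L2_def)
    show "isCont (\<lambda>x. c0 + prim u0' x) x" for x by (intro continuous_intros prim_cont wi)
    show "c0 + prim u0' b - (c0 + prim u0' a) = (LBINT x:{a..b}. u0' x)" if "a \<le> b" for a b
      using prim_diff[OF wi that] by simp
    show "integrable lborel (\<lambda>x. (u0' x)\<^sup>2)" using assms(7) by (simp add: L2_def)
    show "AE x in lborel. u0' x \<le> max M 0" using assms(9) by eventually_elim simp
  qed (use assms c0 in auto)
  obtain ls w where ls: "\<forall>n::nat. 0 < ls n" "\<forall>n. ls n \<le> 1" "ls \<longlonglongrightarrow> 0"
    "(\<lambda>z. w (fst z) (snd z)) \<in> borel_measurable borel" "\<forall>t x. \<bar>w t x\<bar> \<le> KT 0"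
    "AE z in lborel. 0 < fst z \<longrightarrow> (\<lambda>n. tp (v (ls n)) (fst z) (snd z)) \<longlonglongrightarrow> w (fst z) (snd z)"
    by (rule limit_exists)
  note w = spec[OF ls(1)] spec[OF ls(2)] ls(3,4) spec[OF spec[OF ls(5)]] ls(6)
  show ?thesis
  proof (intro exI conjI allI impI)
    show "Linf_loc_L1_loc w" by (rule limit_Linf_loc_L1_loc[OF w])
    show "conv_Linf_loc_Lp_loc p u w" if "1 \<le> p" for p by (rule limit_conv[OF w that])
    show "entropy_solution f u0 w" by (rule limit_entropy_solution[OF w])
    show "AE z in lborel. 0 < fst z \<longrightarrow> w' (fst z) (snd z) = w (fst z) (snd z)" if "entropy_solution f u0 w'" for w'
      by (rule limit_unique[OF w that])
  qed
qed

end
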